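(* Assume that either $\mu=\alpha_1\alpha_2<1/4$, or $\alpha_1=\alpha_2\in[1/2,1)$. Then, as $c\to\infty$ (through positive integers), $\sigma_c/c^2$ converges in distribution to $$\tau_{\alpha_1,\alpha_2}:=\inf\{t>0:|V_t|\ge2\}.$$
   Context: Model (two interacting elephant random walks). Let $p_1,p_2\in[0,1]$, $\alpha_i=2p_i-1\in[-1,1]$, $\mu=\alpha_1\alpha_2$. For $i=1,2$ let $\{\xi^{(i)}_n\}_{n\ge2}$ be i.i.d. with $\mathbb{P}(\xi_n^{(i)}=1)=p_i=1-\mathbb{P}(\xi_n^{(i)}=-1)$, and let $U_n^{(i)}$, $n\ge1$, be uniform on $\{1,\dots,n\}$; all the variables $\xi^{(i)}_n,U^{(i)}_n$ are mutually independent. Let $(X_1^{(1)},X_1^{(2)})$ be an arbitrary $\{-1,1\}^2$-valued random vector independent of all these variables. For $n\ge1$ set $$X_{n+1}^{(1)}=\xi_{n+1}^{(1)}X^{(2)}_{U_n^{(2)}},\qquad X_{n+1}^{(2)}=\xi_{n+1}^{(2)}X^{(1)}_{U_n^{(1)}}.$$ Put $S_0^{(i)}=0$, $S_n^{(i)}=\sum_{k=1}^nX_k^{(i)}$, and $\mathcal D_n=S_n^{(1)}-S_n^{(2)}$. For each positive integer $c$, $\sigma_c:=\inf\{n\ge1:|\mathcal D_n|\ge 2c\}$, with $\inf\emptyset=\infty$. Limiting process. Let $A=\begin{pmatrix}0&\alpha_1\\ \alpha_2&0\end{pmatrix}$, $x^A:=e^{(\log x)A}$ for $x>0$, $\mathbf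 e=(1,-1)^\top$. $V=\{V_t\}_{t\ge0}$ is the centered continuous real Gaussian process with $V_0=0$ given for $t>0$ by (a) $V_t=\int_0^t\mathbf e^\top(t/s)^A\,dB_s$ with $B$ a two-dimensional standard Brownian motion, if $\mu<1/4$; (b) $V_t=\sqrt2\int_0^t(t/s)^{-\alpha_1}\,dW_s$ with $W$ a standard Brownian motion, if $\alpha_1=\alpha_2\in[1/2,1)$. (Continuous modifications are taken.) *)

theory Defs
  imports "HOL-Probability.Probability"
begin

section \<open>Two interacting elephant random walks\<close>

datatype source = Init | Sign1 nat | Sign2 nat | Pick1 nat | Pick2 nat

locale interacting_erw = prob_space M
  for M :: "'a measure"
  and p1 p2 :: real
  and \<xi>1 \<xi>2 :: "nat \<Rightarrow> 'a \<Rightarrow> int"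
  and U1 U2 :: "nat \<Rightarrow> 'a \<Rightarrow> nat"
  and X1 X2 :: "nat \<Rightarrow> 'a \<Rightarrow> int" +
  assumes p1: "p1 \<in> {0..1}" and p2: "p2 \<in> {0..1}"
    and \<xi>1_measurable: "n \<ge> 2 \<Longrightarrow> \<xi>1 n \<in> measurable M (count_space {-1, 1})"
    and \<xi>2_measurable: "n \<ge> 2 \<Longrightarrow> \<xi>2 n \<in> measurable M (count_space {-1, 1})"
    and \<xi>1_law: "n \<ge> 2 \<Longrightarrow> prob {\<omega> \<in> space M. \<xi>1 n \<omega> = 1} = p1"
                "n \<ge> 2 \<Longrightarrow> prob {\<omega> \<in> space M. \<xi>1 n \<omega> = -1} = 1 - p1"
    and \<xi>2_law: "n \<ge> 2 \<Longrightarrow> prob {\<omega> \<in> space M. \<xi>2 n \<omega> = 1} = p2"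
                "n \<ge> 2 \<Longrightarrow> prob {\<omega> \<in> space M. \<xi>2 n \<omega> = -1} = 1 - p2"
    and U1_measurable: "n \<ge> 1 \<Longrightarrow> U1 n \<in> measurable M (count_space {1..n})"
    and U2_measurable: "n \<ge> 1 \<Longrightarrow> U2 n \<in> measurable M (count_space {1..n})"
    and U1_law: "n \<ge> 1 \<Longrightarrow> distr M (count_space {1..n}) (U1 n) = uniform_count_measure {1..n}"
    and U2_law: "n \<ge> 1 \<Longrightarrow> distr M (count_space {1..n}) (U2 n) = uniform_count_measure {1..n}"
    and init_measurable:
      "(\<lambda>\<omega>. (X1 1 \<omega>, X2 1 \<omega>)) \<in> measurable M (count_space ({-1, 1} \<times> {-1, 1}))"
    and indep: \<comment> \<open>joint independence, stated for the generated \<open>\<sigma>\<close>-algebras because the variables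
                  have different value types\<close>
      "indep_sets
        (\<lambda>i. case i of
           Init \<Rightarrow> sets (vimage_algebra (space M) (\<lambda>\<omega>. (X1 1 \<omega>, X2 1 \<omega>))
                           (count_space ({-1, 1} \<times> {-1, 1})))
         | Sign1 n \<Rightarrow> sets (vimage_algebra (space M) (\<xi>1 n) (count_space {-1, 1}))
         | Sign2 n \<Rightarrow> sets (vimage_algebra (space M) (\<xi>2 n) (count_space {-1, 1}))
         | Pick1 n \<Rightarrow> sets (vimage_algebra (space M) (U1 n) (count_space {1..n}))
         | Pick2 n \<Rightarrow> sets (vimage_algebra (space M) (U2 n) (count_space {1..n})))
        ({Init} \<union> Sign1 ` {2..} \<union> Sign2 ` {2..} \<union> Pick1 ` {1..} \<union> Pick2 ` {1..})"
    and X1_Suc: "n \<ge> 1 \<Longrightarrow> \<omega> \<in> space M \<Longrightarrow> X1 (Suc n) \<omega> = \<xi>1 (Suc n) \<omega> * X2 (U2 n \<omega>) \<omega>"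
    and X2_Suc: "n \<ge> 1 \<Longrightarrow> \<omega> \<in> space M \<Longrightarrow> X2 (Suc n) \<omega> = \<xi>2 (Suc n) \<omega> * X1 (U1 n \<omega>) \<omega>"

definition walk :: "(nat \<Rightarrow> 'a \<Rightarrow> int) \<Rightarrow> nat \<Rightarrow> 'a \<Rightarrow> int" where
  "walk X n \<omega> = (\<Sum>k=1..n. X k \<omega>)"

definition walk_diff :: "(nat \<Rightarrow> 'a \<Rightarrow> int) \<Rightarrow> (nat \<Rightarrow> 'a \<Rightarrow> int) \<Rightarrow> nat \<Rightarrow> 'a \<Rightarrow> int" where
  "walk_diff X1 X2 n \<omega> = walk X1 n \<omega> - walk X2 n \<omega>"

text \<open>First passage times take values in \<open>[0,\<infinity>]\<close>; in \<^typ>\<open>ennreal\<close> the infimum of the empty set is \<open>\<infinity>\<close>.\<close>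

definition exit_index :: "(nat \<Rightarrow> 'a \<Rightarrow> int) \<Rightarrow> (nat \<Rightarrow> 'a \<Rightarrow> int) \<Rightarrow> nat \<Rightarrow> 'a \<Rightarrow> ennreal" where
  "exit_index X1 X2 c \<omega> = Inf {of_nat n | n. n \<ge> 1 \<and> \<bar>walk_diff X1 X2 n \<omega>\<bar> \<ge> 2 * int c}"


section \<open>Brownian motion and the Wiener integral\<close>

definition real_brownian_motion :: "'b measure \<Rightarrow> (real \<Rightarrow> 'b \<Rightarrow> real) \<Rightarrow> bool" where
  "real_brownian_motion N W \<longleftrightarrow>
     prob_space N \<and>
     (\<forall>t\<ge>0. W t \<in> borel_measurable N) \<and>
     (AE \<omega> in N. W 0 \<omega> = 0) \<and>
     (\<forall>s t. 0 \<le> s \<and> s < t \<longrightarrow>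
        distributed N lborel (\<lambda>\<omega>. W t \<omega> - W s \<omega>) (normal_density 0 (sqrt (t - s)))) \<and>
     (\<forall>n (t :: nat \<Rightarrow> real). 0 \<le> t 0 \<and> (\<forall>i<n. t i \<le> t (Suc i)) \<longrightarrow>
        prob_space.indep_vars N (\<lambda>_. borel) (\<lambda>i \<omega>. W (t (Suc i)) \<omega> - W (t i) \<omega>) {..<n}) \<and>
     (AE \<omega> in N. continuous_on {0..} (\<lambda>t. W t \<omega>))"

definition standard_brownian_motion ::
    "'b measure \<Rightarrow> (real \<Rightarrow> 'b \<Rightarrow> 'v::euclidean_space) \<Rightarrow> bool" where
  "standard_brownian_motion N B \<longleftrightarrow>
     (\<forall>b\<in>Basis. real_brownian_motion N (\<lambda>t \<omega>. B t \<omega> \<bullet> b)) \<and>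
     prob_space.indep_vars N (\<lambda>_. Pi\<^sub>M {0..} (\<lambda>_. borel))
       (\<lambda>b \<omega>. \<lambda>t\<in>{0..}. B t \<omega> \<bullet> b) Basis"

text \<open>A list of triples \<open>(a, l, r)\<close> encodes the step function that is the sum of the functions
  \<open>a 1_(l,r]\<close>.\<close>

definition step_fun :: "('v \<times> real \<times> real) list \<Rightarrow> real \<Rightarrow> 'v::euclidean_space" where
  "step_fun xs s = (\<Sum>(a, l, r)\<leftarrow>xs. indicator {l<..r} s *\<^sub>R a)"

definition step_integral ::
    "(real \<Rightarrow> 'b \<Rightarrow> 'v::euclidean_space) \<Rightarrow> ('v \<times> real \<times> real) list \<Rightarrow> 'b \<Rightarrow> real" where
  "step_integral B xs \<omega> = (\<Sum>(a, l, r)\<leftarrow>xs. a \<bullet> (B r \<omega> - B l \<omega>))"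

text \<open>\<open>I\<close> is (a version of) the integral of the deterministic function \<open>g\<close> over \<open>[0,T]\<close> against
  \<open>B\<close>, that is, the mean-square limit of the integrals of step functions converging to \<open>g\<close> in
  \<open>L\<^sup>2[0,T]\<close>.  The integrand is a row vector, paired with the vector \<open>dB\<close> by the inner product.\<close>

definition has_wiener_integral ::
    "'b measure \<Rightarrow> (real \<Rightarrow> 'b \<Rightarrow> 'v::euclidean_space) \<Rightarrow> real \<Rightarrow> (real \<Rightarrow> 'v) \<Rightarrow> ('b \<Rightarrow> real) \<Rightarrow> bool" where
  "has_wiener_integral N B T g I \<longleftrightarrow>
     I \<in> borel_measurable N \<and>
     g \<in> borel_measurable lborel \<and>
     (\<exists>xs :: nat \<Rightarrow> ('v \<times> real \<times> real) list.
        (\<forall>m. \<forall>(a, l, r)\<in>set (xs m). 0 \<le> l \<and> l \<le> r \<and> r \<le> T) \<and>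
        (\<lambda>m. \<integral>\<^sup>+s\<in>{0..T}. ennreal ((norm (step_fun (xs m) s - g s))\<^sup>2) \<partial>lborel) \<longlonglongrightarrow> 0 \<and>
        (\<lambda>m. \<integral>\<^sup>+\<omega>. ennreal ((step_integral B (xs m) \<omega> - I \<omega>)\<^sup>2) \<partial>N) \<longlonglongrightarrow> 0)"


section \<open>The limiting process\<close>

text \<open>The type class multiplication on \<^typ>\<open>real^'n^'n\<close> is componentwise, so the exponential
  series is spelled out with the matrix product.\<close>

definition mat_exp :: "real^'n^'n \<Rightarrow> real^'n^'n" where
  "mat_exp A = (\<Sum>k. (1 / fact k) *\<^sub>R (((\<lambda>P. A ** P) ^^ k) (mat 1)))"

definition mat_powr :: "real \<Rightarrow> real^'n^'n \<Rightarrow> real^'n^'n" where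
  "mat_powr x A = mat_exp (ln x *\<^sub>R A)"

definition memory_matrix :: "real \<Rightarrow> real \<Rightarrow> real^2^2" where
  "memory_matrix \<alpha>1 \<alpha>2 = vector [vector [0, \<alpha>1], vector [\<alpha>2, 0]]"

definition diff_vec :: "real^2" where
  "diff_vec = vector [1, -1]"

text \<open>The values of the integrands at \<open>s = 0\<close> are junk and irrelevant.  That \<open>V\<close> is centered
  Gaussian follows from the integral representation.\<close>

definition limit_process :: "'b measure \<Rightarrow> real \<Rightarrow> real \<Rightarrow> (real \<Rightarrow> 'b \<Rightarrow> real) \<Rightarrow> bool" where
  "limit_process N \<alpha>1 \<alpha>2 V \<longleftrightarrow>
     prob_space N \<and>
     (\<forall>t\<ge>0. V t \<in> borel_measurable N) \<and>
     (\<forall>\<omega>\<in>space N. V 0 \<omega> = 0 \<and> continuous_on {0..} (\<lambda>t. V t \<omega>)) \<and>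
     (\<alpha>1 * \<alpha>2 < 1/4 \<longrightarrow>
        (\<exists>B :: real \<Rightarrow> 'b \<Rightarrow> real^2. standard_brownian_motion N B \<and>
           (\<forall>t>0. has_wiener_integral N B t
                    (\<lambda>s. diff_vec v* mat_powr (t / s) (memory_matrix \<alpha>1 \<alpha>2)) (V t)))) \<and>
     (\<alpha>1 = \<alpha>2 \<and> \<alpha>1 \<in> {1/2..<1} \<longrightarrow>
        (\<exists>W :: real \<Rightarrow> 'b \<Rightarrow> real. standard_brownian_motion N W \<and>
           (\<forall>t>0. \<exists>I. has_wiener_integral N W t (\<lambda>s. (t / s) powr (-\<alpha>1)) I \<and>
                    (AE \<omega> in N. V t \<omega> = sqrt 2 * I \<omega>))))"

definition exit_time :: "(real \<Rightarrow> 'b \<Rightarrow> real) \<Rightarrow> 'b \<Rightarrow> ennreal" where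
  "exit_time V \<omega> = Inf {ennreal t | t. t > 0 \<and> \<bar>V t \<omega>\<bar> \<ge> 2}"


section \<open>Convergence in distribution\<close>

text \<open>The library's \<^const>\<open>weak_conv_m\<close> covers real random variables only; here the values are in
  \<open>[0,\<infinity>]\<close>, and the limit may live on another probability space.\<close>

definition converges_in_distribution ::
    "'a measure \<Rightarrow> (nat \<Rightarrow> 'a \<Rightarrow> 'c::topological_space) \<Rightarrow> 'b measure \<Rightarrow> ('b \<Rightarrow> 'c) \<Rightarrow> bool" where
  "converges_in_distribution M Y N Z \<longleftrightarrow>
     (\<forall>n. Y n \<in> borel_measurable M) \<and> Z \<in> borel_measurable N \<and>
     (\<forall>f :: 'c \<Rightarrow> real. continuous_on UNIV f \<and> bounded (range f) \<longrightarrow>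
        (\<lambda>n. \<integral>\<omega>. f (Y n \<omega>) \<partial>M) \<longlonglongrightarrow> (\<integral>\<omega>. f (Z \<omega>) \<partial>N))"

end

theory Submission
  imports Defs
begin

text \<open>
  The steps depend on the past only through the averages of the walks: given the first \<open>k\<close> steps,
  \<open>X\<^sub>k\<^sub>+\<^sub>1\<close> has mean \<open>A S\<^sub>k / k\<close>.  The innovations \<open>\<epsilon>\<^sub>k\<^sub>+\<^sub>1 = X\<^sub>k\<^sub>+\<^sub>1 - A S\<^sub>k / k\<close> are therefore bounded
  martingale differences, their two coordinates are conditionally uncorrelated, and their conditional
  variances tend to \<open>1\<close> because \<open>S\<^sub>k / k \<rightarrow> 0\<close> in mean square (\<open>second_moment_decay\<close>).

  The walks are recovered from the innovations by a discrete variation of constants.  Let the row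
  vector \<open>\<psi> = (\<psi>1, \<psi>2)\<close> solve \<open>x \<psi>'(x) = \<psi>(x) A\<close>, so that \<open>\<psi>(x) = \<psi>(1) x\<^sup>A\<close>.  The sequence
  \<open>\<psi>(m/k) S\<^sub>k\<close>, \<open>k \<le> m\<close>, has increments \<open>\<psi>(m/k) \<epsilon>\<^sub>k\<close> up to a summable error, whence
  \<open>\<psi>(1) S\<^sub>m = \<Sum>\<^sub>k \<psi>(m/k) \<epsilon>\<^sub>k + O(m\<^sup>\<rho>)\<close> as soon as \<open>\<psi>\<close> grows at most like \<open>x\<^sup>\<rho>\<close> (\<open>abel_summation\<close>).
  The difference of the walks is the case \<open>\<psi>(1) = (1, -1)\<close>.  Both parameter regimes amount to the
  existence of such a \<open>\<psi>\<close> with \<open>\<rho> < 1/2\<close>: if \<open>\<mu> < 1/4\<close> because \<open>x\<^sup>A\<close> itself grows no faster, and if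
  \<open>\<alpha>1 = \<alpha>2 = \<alpha> \<ge> 1/2\<close> because \<open>(1, -1)\<close> is the eigenvector for the eigenvalue \<open>-\<alpha>\<close>, so that
  \<open>\<psi>(x) = x\<^sup>-\<^sup>\<alpha> (1, -1)\<close> decays.  From here on the two regimes have the same proof.

  A martingale central limit theorem, done by replacing one conditional characteristic function at a
  time (\<open>innov_sum_char\<close>), gives the limiting characteristic function of finitely many values
  \<open>D\<^bsub>\<lfloor>r\<^sup>2 t\<rfloor>\<^esub> / r\<close>, \<open>t \<in> J\<close>.  The variances are Riemann sums of \<open>\<integral> |\<Sum>\<^sub>t \<theta>\<^sub>t \<psi>(t/s) 1\<^bsub>s \<le> t\<^esub>|\<^sup>2 ds\<close>, which is
  the variance of \<open>\<Sum>\<^sub>t \<theta>\<^sub>t V\<^sub>t\<close> by the Wiener integral representation of \<open>V\<close>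
  (\<open>lin_stat_char_converges\<close>, \<open>limit_process_char\<close>).  Here \<open>r\<close> is any real sequence tending to
  infinity, which is used below.

  No convergence of paths is needed, since the event \<open>\<sigma>\<^sub>c \<le> c\<^sup>2 t\<close> only says that some \<open>|D\<^sub>k|\<close> with
  \<open>k \<le> c\<^sup>2 t\<close> is at least \<open>2 c\<close>.  For a lower bound of its probability it suffices to look at a finite
  set of times, chosen so that \<open>V\<close>, which is continuous, exceeds a level slightly below \<open>2\<close> at one of
  them with almost the right probability (\<open>passage_lower\<close>).  For an upper bound one waits, after the
  first passage, for the next point of a grid of mesh \<open>h c\<^sup>2\<close>: conditionally on the past, the
  martingale part moves by less than a small multiple of \<open>c\<close> during this time with high probability,
  and so does the drift part (\<open>grid_detects_passage\<close>, \<open>passage_upper\<close>).  Both bounds lose a little in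
  the level.  The loss is turned into a loss in time by the choice \<open>r = \<kappa> c\<close> with \<open>\<kappa>\<close> close to \<open>1\<close>,
  because \<open>r\<close> and not \<open>c\<close> is the scale of the limit theorem: level \<open>2 c\<close> at time \<open>c\<^sup>2 t\<close> is level
  \<open>(2/\<kappa>) r\<close> at time \<open>r\<^sup>2 t/\<kappa>\<^sup>2\<close>.  So nothing has to be known about the law of \<open>V\<close> near its exit time,
  and the two bounds compare the distribution function of \<open>\<sigma>\<^sub>c / c\<^sup>2\<close> with that of \<open>\<tau>\<close> at neighbouring
  times, which is convergence in distribution (\<open>ennreal_convergence_from_cdf\<close>).
\<close>

section \<open>Weights that absorb the memory\<close>

text \<open>Row vectors \<open>\<psi>\<close> with \<open>x \<psi>'(x) = \<psi>(x) A\<close>, \<open>A\<close> the memory matrix: pairing the walks at time \<open>k\<close> with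
\<open>\<psi>(m/k)\<close> cancels the drift to first order.  A growth exponent \<open>\<rho> < 1/2\<close> makes
\<open>\<psi>(t/s)\<close> square integrable at \<open>s = 0\<close>, which is the condition for a diffusive limit.\<close>

definition memory_weight :: "real \<Rightarrow> real \<Rightarrow> real \<Rightarrow> (real \<Rightarrow> real) \<Rightarrow> (real \<Rightarrow> real) \<Rightarrow> bool" where
  "memory_weight \<alpha>1 \<alpha>2 \<rho> \<psi>1 \<psi>2 \<longleftrightarrow>
     (\<forall>x>0. (\<psi>1 has_real_derivative \<alpha>2 * \<psi>2 x / x) (at x) \<and> (\<psi>2 has_real_derivative \<alpha>1 * \<psi>1 x / x) (at x)) \<and>
     (\<exists>C\<ge>0. \<forall>x\<ge>1. \<bar>\<psi>1 x\<bar> \<le> C * x powr \<rho> \<and> \<bar>\<psi>2 x\<bar> \<le> C * x powr \<rho>)"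

text \<open>The power series of \<open>e\<^sup>L\<^sup>A\<close> splits into even and odd powers, which by \<open>A\<^sup>2 = \<mu> I\<close> sum to
\<open>\<Sum>\<^sub>k \<mu>\<^sup>k L\<^sup>2\<^sup>k / (2k)!\<close> times \<open>I\<close> and \<open>\<Sum>\<^sub>k \<mu>\<^sup>k L\<^sup>2\<^sup>k\<^sup>+\<^sup>1 / (2k+1)!\<close> times \<open>A\<close>.  The closed forms of these two
series, rather than the series, give the growth bound for negative \<open>\<mu>\<close>.\<close>

definition even_part :: "real \<Rightarrow> real \<Rightarrow> real" where
  "even_part \<mu> L = (if \<mu> > 0 then cosh (sqrt \<mu> * L) else cos (sqrt (- \<mu>) * L))"

definition odd_part :: "real \<Rightarrow> real \<Rightarrow> real" where
  "odd_part \<mu> L = (if \<mu> > 0 then sinh (sqrt \<mu> * L) / sqrt \<mu> else if \<mu> = 0 then L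
     else sin (sqrt (- \<mu>) * L) / sqrt (- \<mu>))"

lemma even_part_0 [simp]: "even_part \<mu> 0 = 1" and odd_part_0 [simp]: "odd_part \<mu> 0 = 0"
  by (auto simp: even_part_def odd_part_def)

lemma even_part_deriv: "(even_part \<mu> has_real_derivative \<mu> * odd_part \<mu> L) (at L)"
proof -
  consider "\<mu> > 0" | "\<mu> = 0" | "\<mu> < 0" by linarith
  then show ?thesis
  proof cases
    case 1
    then have "sqrt \<mu> * sqrt \<mu> = \<mu>" by simp
    with 1 show ?thesis unfolding even_part_def[abs_def] odd_part_def
      by (auto intro!: derivative_eq_intros simp: field_simps real_div_sqrt)
  next
    case 2
    then show ?thesis by (simp add: even_part_def[abs_def] odd_part_def)
  next
    case 3
    define s where "s = sqrt (-\<mu>)"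
    have s: "s > 0" "\<mu> = - (s * s)" using 3 by (auto simp: s_def)
    with 3 show ?thesis unfolding even_part_def[abs_def] odd_part_def s_def[symmetric]
      by (auto intro!: derivative_eq_intros)
  qed
qed

lemma odd_part_deriv: "(odd_part \<mu> has_real_derivative even_part \<mu> L) (at L)"
proof -
  consider "\<mu> > 0" | "\<mu> = 0" | "\<mu> < 0" by linarith
  then show ?thesis
  proof cases
    case 1
    then show ?thesis unfolding even_part_def odd_part_def[abs_def]
      by (auto intro!: derivative_eq_intros simp: field_simps)
  next
    case 2
    then show ?thesis by (simp add: even_part_def odd_part_def[abs_def])
  next
    case 3
    define s where "s = sqrt (-\<mu>)"
    have s: "s > 0" "\<mu> = - (s * s)" using 3 by (auto simp: s_def)
    with 3 show ?thesis unfolding even_part_def odd_part_def[abs_def] s_def[symmetric]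
      by (auto intro!: derivative_eq_intros)
  qed
qed

text \<open>The eigenvalues of \<open>A\<close> are \<open>\<plusminus>\<surd>\<mu>\<close>, real or imaginary.  Any strictly larger rate works; at \<open>\<mu> = 0\<close> the
strict inequality pays for the factor \<open>L\<close> of the nilpotent part.\<close>

lemma even_odd_part_growth:
  assumes r: "r > 0" "\<mu> < r^2"
  shows "\<exists>C\<ge>0. \<forall>L\<ge>0. \<bar>even_part \<mu> L\<bar> \<le> C * exp (r * L) \<and> \<bar>odd_part \<mu> L\<bar> \<le> C * exp (r * L)"
proof -
  consider "\<mu> > 0" | "\<mu> = 0" | "\<mu> < 0" by linarith
  then show ?thesis
  proof cases
    case 1
    have sr: "sqrt \<mu> \<le> r" using r by (simp add: real_le_lsqrt)
    have le: "exp (sqrt \<mu> * L) \<le> exp (r * L)" "exp (- (sqrt \<mu> * L)) \<le> exp (r * L)" if "L \<ge> 0" for L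
    proof -
      have "0 \<le> r * L" "0 \<le> sqrt \<mu> * L" using that 1 r by simp_all
      with mult_right_mono[OF sr that] show "exp (sqrt \<mu> * L) \<le> exp (r * L)" "exp (- (sqrt \<mu> * L)) \<le> exp (r * L)"
        unfolding exp_le_cancel_iff by linarith+
    qed
    have a: "\<bar>cosh (sqrt \<mu> * L)\<bar> \<le> exp (r * L)" "\<bar>sinh (sqrt \<mu> * L)\<bar> \<le> exp (r * L)" if "L \<ge> 0" for L
    proof -
      have "\<bar>(A + B) / 2\<bar> \<le> C \<and> \<bar>(A - B) / 2\<bar> \<le> C" if "A \<le> C" "B \<le> C" "0 < A" "0 < B" for A B C :: real
        using that by (auto simp: abs_le_iff field_simps)
      from this[OF le[OF that] exp_gt_zero exp_gt_zero]
      show "\<bar>cosh (sqrt \<mu> * L)\<bar> \<le> exp (r * L)" "\<bar>sinh (sqrt \<mu> * L)\<bar> \<le> exp (r * L)"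
        by (simp_all add: cosh_field_def sinh_field_def)
    qed
    show ?thesis
    proof (intro exI[of _ "1 + 1 / sqrt \<mu>"] conjI allI impI)
      fix L :: real assume L: "0 \<le> L"
      have "\<bar>even_part \<mu> L\<bar> \<le> 1 * exp (r * L)"
        using a(1)[OF L] 1 by (simp add: even_part_def)
      also have "\<dots> \<le> (1 + 1 / sqrt \<mu>) * exp (r * L)"
        using 1 by (intro mult_right_mono) auto
      finally show "\<bar>even_part \<mu> L\<bar> \<le> (1 + 1 / sqrt \<mu>) * exp (r * L)" .
      have "\<bar>odd_part \<mu> L\<bar> \<le> exp (r * L) / sqrt \<mu>"
        using 1 a(2)[OF L] by (simp add: odd_part_def abs_divide divide_right_mono)
      also have "\<dots> = 1 / sqrt \<mu> * exp (r * L)" by simp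
      also have "\<dots> \<le> (1 + 1 / sqrt \<mu>) * exp (r * L)" by (intro mult_right_mono) auto
      finally show "\<bar>odd_part \<mu> L\<bar> \<le> (1 + 1 / sqrt \<mu>) * exp (r * L)" .
    qed (use 1 in simp)
  next
    case 2
    show ?thesis
    proof (intro exI[of _ "1 + 1 / r"] conjI allI impI)
      fix L :: real assume L: "0 \<le> L"
      have e: "1 + r * L \<le> exp (r * L)" by (rule exp_ge_add_one_self)
      have rl: "0 \<le> r * L" using r L by simp
      have "\<bar>even_part \<mu> L\<bar> \<le> 1 * exp (r * L)"
        using 2 rl by (simp add: even_part_def)
      also have "\<dots> \<le> (1 + 1 / r) * exp (r * L)" using r by (intro mult_right_mono) auto
      finally show "\<bar>even_part \<mu> L\<bar> \<le> (1 + 1 / r) * exp (r * L)" .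
      have "\<bar>odd_part \<mu> L\<bar> \<le> 1 / r * exp (r * L)"
      proof -
        have "r * L \<le> exp (r * L)" using e by linarith
        then show ?thesis using 2 L r by (simp add: odd_part_def field_simps)
      qed
      also have "\<dots> \<le> (1 + 1 / r) * exp (r * L)" by (intro mult_right_mono) auto
      finally show "\<bar>odd_part \<mu> L\<bar> \<le> (1 + 1 / r) * exp (r * L)" .
    qed (use r in simp)
  next
    case 3
    show ?thesis
    proof (intro exI[of _ "1 + 1 / sqrt (-\<mu>)"] conjI allI impI)
      fix L :: real assume L: "0 \<le> L"
      have rl: "1 \<le> exp (r * L)" using r L by simp
      have "\<bar>even_part \<mu> L\<bar> \<le> 1" using 3 by (simp add: even_part_def)
      also have "1 \<le> (1 + 1 / sqrt (-\<mu>)) * exp (r * L)"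
        using mult_mono[of 1 "1 + 1 / sqrt (-\<mu>)" 1 "exp (r * L)"] rl 3 by simp
      finally show "\<bar>even_part \<mu> L\<bar> \<le> (1 + 1 / sqrt (-\<mu>)) * exp (r * L)" .
      have "\<bar>odd_part \<mu> L\<bar> \<le> 1 / sqrt (-\<mu>)"
        using 3 by (simp add: odd_part_def abs_divide divide_right_mono)
      also have "\<dots> \<le> (1 + 1 / sqrt (-\<mu>)) * exp (r * L)"
        using mult_mono[of "1 / sqrt (-\<mu>)" "1 + 1 / sqrt (-\<mu>)" 1 "exp (r * L)"] rl 3 by simp
      finally show "\<bar>odd_part \<mu> L\<bar> \<le> (1 + 1 / sqrt (-\<mu>)) * exp (r * L)" .
    qed (use 3 in simp)
  qed
qed

text \<open>The weight with \<open>\<psi>(1) = (c1, c2)\<close>, read off from \<open>\<psi>(x) = \<psi>(1) x\<^sup>A\<close>.\<close>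

lemma memory_weight_exists:
  assumes r: "\<rho> > 0" "\<alpha>1 * \<alpha>2 < \<rho>^2"
  defines "\<mu> \<equiv> \<alpha>1 * \<alpha>2"
  shows "memory_weight \<alpha>1 \<alpha>2 \<rho> (\<lambda>x. c1 * even_part \<mu> (ln x) + c2 * \<alpha>2 * odd_part \<mu> (ln x))
      (\<lambda>x. c2 * even_part \<mu> (ln x) + c1 * \<alpha>1 * odd_part \<mu> (ln x))"
  unfolding memory_weight_def
proof (intro conjI allI impI)
  fix x :: real assume x: "0 < x"
  have d: "((\<lambda>x. even_part \<mu> (ln x)) has_real_derivative (\<mu> * odd_part \<mu> (ln x)) * (1 / x)) (at x)"
    "((\<lambda>x. odd_part \<mu> (ln x)) has_real_derivative even_part \<mu> (ln x) * (1 / x)) (at x)"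
    by (rule DERIV_chain2[OF even_part_deriv DERIV_ln_divide[OF x]])
       (rule DERIV_chain2[OF odd_part_deriv DERIV_ln_divide[OF x]])
  show "((\<lambda>x. c1 * even_part \<mu> (ln x) + c2 * \<alpha>2 * odd_part \<mu> (ln x)) has_real_derivative
         \<alpha>2 * (c2 * even_part \<mu> (ln x) + c1 * \<alpha>1 * odd_part \<mu> (ln x)) / x) (at x)"
    by (rule derivative_eq_intros d refl)+ (use x in \<open>simp add: \<mu>_def field_simps\<close>)
  show "((\<lambda>x. c2 * even_part \<mu> (ln x) + c1 * \<alpha>1 * odd_part \<mu> (ln x)) has_real_derivative
         \<alpha>1 * (c1 * even_part \<mu> (ln x) + c2 * \<alpha>2 * odd_part \<mu> (ln x)) / x) (at x)"
    by (rule derivative_eq_intros d refl)+ (use x in \<open>simp add: \<mu>_def field_simps\<close>)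
next
  obtain C where C: "C \<ge> 0" "\<And>L. L \<ge> 0 \<Longrightarrow> \<bar>even_part \<mu> L\<bar> \<le> C * exp (\<rho> * L)" "\<And>L. L \<ge> 0 \<Longrightarrow> \<bar>odd_part \<mu> L\<bar> \<le> C * exp (\<rho> * L)"
    using even_odd_part_growth[of \<rho> \<mu>] r unfolding \<mu>_def by blast
  have b: "\<bar>c * even_part \<mu> (ln x) + d * odd_part \<mu> (ln x)\<bar> \<le> ((\<bar>c1\<bar> + \<bar>c2 * \<alpha>2\<bar> + \<bar>c2\<bar> + \<bar>c1 * \<alpha>1\<bar>) * C) * x powr \<rho>"
    if x: "1 \<le> x" and cd: "\<bar>c\<bar> + \<bar>d\<bar> \<le> \<bar>c1\<bar> + \<bar>c2 * \<alpha>2\<bar> + \<bar>c2\<bar> + \<bar>c1 * \<alpha>1\<bar>" for x c d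
  proof -
    have e: "exp (\<rho> * ln x) = x powr \<rho>" using x by (simp add: powr_def)
    have "\<bar>c * even_part \<mu> (ln x) + d * odd_part \<mu> (ln x)\<bar> \<le> \<bar>c\<bar> * \<bar>even_part \<mu> (ln x)\<bar> + \<bar>d\<bar> * \<bar>odd_part \<mu> (ln x)\<bar>"
      by (rule order_trans[OF abs_triangle_ineq]) (simp add: abs_mult)
    also have "\<dots> \<le> \<bar>c\<bar> * (C * x powr \<rho>) + \<bar>d\<bar> * (C * x powr \<rho>)"
      using C(2,3)[of "ln x"] x unfolding e by (intro add_mono mult_left_mono) auto
    also have "\<dots> = (\<bar>c\<bar> + \<bar>d\<bar>) * (C * x powr \<rho>)" by (simp add: algebra_simps)
    also have "\<dots> \<le> (\<bar>c1\<bar> + \<bar>c2 * \<alpha>2\<bar> + \<bar>c2\<bar> + \<bar>c1 * \<alpha>1\<bar>) * (C * x powr \<rho>)"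
      using C(1) by (intro mult_right_mono cd) auto
    finally show ?thesis by (simp add: mult.assoc)
  qed
  show "\<exists>C\<ge>0. \<forall>x\<ge>1. \<bar>c1 * even_part \<mu> (ln x) + c2 * \<alpha>2 * odd_part \<mu> (ln x)\<bar> \<le> C * x powr \<rho> \<and>
        \<bar>c2 * even_part \<mu> (ln x) + c1 * \<alpha>1 * odd_part \<mu> (ln x)\<bar> \<le> C * x powr \<rho>"
    by (rule exI[of _ "(\<bar>c1\<bar> + \<bar>c2 * \<alpha>2\<bar> + \<bar>c2\<bar> + \<bar>c1 * \<alpha>1\<bar>) * C"])
       (use C(1) b in \<open>auto simp: add_nonneg_nonneg\<close>)
qed

text \<open>For equal memory parameters \<open>(1, -1)\<close> is a left eigenvector of \<open>A\<close> with eigenvalue \<open>-\<alpha>\<close>, so this weight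
is bounded however large \<open>\<alpha>\<close> is, although \<open>x\<^sup>A\<close> grows like \<open>x\<^sup>\<alpha>\<close> in other directions.\<close>

lemma memory_weight_power:
  assumes "\<alpha> \<ge> 0" "\<rho> > 0"
  shows "memory_weight \<alpha> \<alpha> \<rho> (\<lambda>x. x powr (- \<alpha>)) (\<lambda>x. - (x powr (- \<alpha>)))"
  unfolding memory_weight_def
proof (intro conjI allI impI)
  fix x :: real assume x: "0 < x"
  have "((\<lambda>x. x powr (- \<alpha>)) has_real_derivative - \<alpha> * x powr (- \<alpha> - 1)) (at x)"
    using x by (rule has_real_derivative_powr)
  also have "- \<alpha> * x powr (- \<alpha> - 1) = \<alpha> * - (x powr (- \<alpha>)) / x"
    using x by (simp add: powr_diff)
  finally show d: "((\<lambda>x. x powr (- \<alpha>)) has_real_derivative \<alpha> * - (x powr (- \<alpha>)) / x) (at x)" .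
  show "((\<lambda>x. - (x powr (- \<alpha>))) has_real_derivative \<alpha> * (x powr (- \<alpha>)) / x) (at x)"
    using DERIV_minus[OF d] by simp
next
  have "x powr (- \<alpha>) \<le> 1 * x powr \<rho>" if "x \<ge> 1" for x
    using powr_mono[of "-\<alpha>" \<rho> x] assms that by simp
  then show "\<exists>C\<ge>0. \<forall>x\<ge>1. \<bar>x powr (- \<alpha>)\<bar> \<le> C * x powr \<rho> \<and> \<bar>- (x powr (- \<alpha>))\<bar> \<le> C * x powr \<rho>"
    by (intro exI[of _ 1]) auto
qed

text \<open>If \<open>\<psi>\<close> is a weight then so is \<open>\<psi> A\<close>.  Its value at \<open>1\<close> applied to \<open>S\<^sub>k\<close> is \<open>k\<close> times the drift of
\<open>\<psi>(1) S\<^sub>k\<close>, so bounds for weighted walks are also bounds for drifts.\<close>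

lemma memory_weight_drift:
  assumes w: "memory_weight \<alpha>1 \<alpha>2 \<rho> \<psi>1 \<psi>2"
  shows "memory_weight \<alpha>1 \<alpha>2 \<rho> (\<lambda>x. \<alpha>2 * \<psi>2 x) (\<lambda>x. \<alpha>1 * \<psi>1 x)"
proof -
  have d: "(\<psi>1 has_real_derivative \<alpha>2 * \<psi>2 x / x) (at x)" "(\<psi>2 has_real_derivative \<alpha>1 * \<psi>1 x / x) (at x)" if "x > 0" for x
    using w that by (auto simp: memory_weight_def)
  obtain C where C: "C \<ge> 0" "\<And>x. x \<ge> 1 \<Longrightarrow> \<bar>\<psi>1 x\<bar> \<le> C * x powr \<rho>" "\<And>x. x \<ge> 1 \<Longrightarrow> \<bar>\<psi>2 x\<bar> \<le> C * x powr \<rho>"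
    using w by (auto simp: memory_weight_def)
  show ?thesis unfolding memory_weight_def
  proof (intro conjI allI impI)
    fix x :: real assume x: "0 < x"
    show "((\<lambda>x. \<alpha>2 * \<psi>2 x) has_real_derivative \<alpha>2 * (\<alpha>1 * \<psi>1 x) / x) (at x)"
      by (rule derivative_eq_intros d refl x)+ simp
    show "((\<lambda>x. \<alpha>1 * \<psi>1 x) has_real_derivative \<alpha>1 * (\<alpha>2 * \<psi>2 x) / x) (at x)"
      by (rule derivative_eq_intros d refl x)+ simp
  next
    have "\<bar>\<alpha>2 * \<psi>2 x\<bar> \<le> (\<bar>\<alpha>1\<bar> + \<bar>\<alpha>2\<bar>) * C * x powr \<rho>" "\<bar>\<alpha>1 * \<psi>1 x\<bar> \<le> (\<bar>\<alpha>1\<bar> + \<bar>\<alpha>2\<bar>) * C * x powr \<rho>" if "x \<ge> 1" for x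
      using mult_mono[of "\<bar>\<alpha>2\<bar>" "\<bar>\<alpha>1\<bar> + \<bar>\<alpha>2\<bar>", OF _ C(3)[OF that]] mult_mono[of "\<bar>\<alpha>1\<bar>" "\<bar>\<alpha>1\<bar> + \<bar>\<alpha>2\<bar>", OF _ C(2)[OF that]]
      by (auto simp: abs_mult mult.assoc)
    then show "\<exists>C\<ge>0. \<forall>x\<ge>1. \<bar>\<alpha>2 * \<psi>2 x\<bar> \<le> C * x powr \<rho> \<and> \<bar>\<alpha>1 * \<psi>1 x\<bar> \<le> C * x powr \<rho>"
      using C(1) by (intro exI[of _ "(\<bar>\<alpha>1\<bar> + \<bar>\<alpha>2\<bar>) * C"]) auto
  qed
qed

section \<open>Powers of the memory matrix\<close>

lemma memory_matrix_square: "memory_matrix \<alpha>1 \<alpha>2 ** memory_matrix \<alpha>1 \<alpha>2 = (\<alpha>1 * \<alpha>2) *\<^sub>R mat 1"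
  by (simp add: memory_matrix_def vec_eq_iff matrix_matrix_mult_def sum_2 forall_2 mat_def)

lemma matrix_power_square_scalar:
  fixes A :: "real^'n^'n"
  assumes "A ** A = \<mu> *\<^sub>R mat 1"
  shows "((\<lambda>P. (L *\<^sub>R A) ** P) ^^ k) (mat 1) =
     (if even k then (\<mu> ^ (k div 2) * L ^ k) *\<^sub>R mat 1 else (\<mu> ^ (k div 2) * L ^ k) *\<^sub>R A)"
proof (induction k)
  case (Suc k)
  have *: "(c *\<^sub>R P) ** (d *\<^sub>R Q) = (c * d) *\<^sub>R (P ** Q)" for c d and P Q :: "real^'n^'n"
    by (simp add: vec_eq_iff matrix_matrix_mult_def sum_distrib_left mult_ac)
  show ?case using assms Suc
    by (auto simp: * elim!: evenE oddE)
qed simp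

lemma even_part_sums: "(\<lambda>k. if even k then \<mu> ^ (k div 2) * L ^ k / fact k else 0) sums even_part \<mu> L"
proof (cases "\<mu> > 0")
  case True
  have "(\<lambda>k. if even k then (sqrt \<mu> * L) ^ k /\<^sub>R fact k else 0) sums cosh (sqrt \<mu> * L)" by (rule cosh_converges)
  moreover have "(if even k then (sqrt \<mu> * L) ^ k /\<^sub>R fact k else 0) = (if even k then \<mu> ^ (k div 2) * L ^ k / fact k else 0)" for k
    using True by (auto elim!: evenE simp: power_mult_distrib power_mult divide_inverse)
  ultimately show ?thesis using True by (simp add: even_part_def)
next
  case False
  have "(\<lambda>k. cos_coeff k *\<^sub>R (sqrt (-\<mu>) * L) ^ k) sums cos (sqrt (-\<mu>) * L)" by (rule cos_converges)
  moreover have "cos_coeff k *\<^sub>R (sqrt (-\<mu>) * L) ^ k = (if even k then \<mu> ^ (k div 2) * L ^ k / fact k else 0)" for k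
  proof -
    define s where "s = sqrt (-\<mu>)"
    have s: "\<mu> = - (s^2)" using False by (auto simp: s_def)
    show ?thesis unfolding s_def[symmetric] s
      by (auto elim!: evenE simp: cos_coeff_def power_mult_distrib power_mult power_minus[of "s^2"])
  qed
  ultimately show ?thesis using False by (simp add: even_part_def)
qed

lemma odd_part_sums: "(\<lambda>k. if odd k then \<mu> ^ (k div 2) * L ^ k / fact k else 0) sums odd_part \<mu> L"
proof -
  consider "\<mu> > 0" | "\<mu> = 0" | "\<mu> < 0" by linarith
  then show ?thesis
  proof cases
    case 1
    have "(\<lambda>k. (if even k then 0 else (sqrt \<mu> * L) ^ k /\<^sub>R fact k) / sqrt \<mu>) sums (sinh (sqrt \<mu> * L) / sqrt \<mu>)"
      by (intro sums_divide sinh_converges)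
    moreover have "(if even k then 0 else (sqrt \<mu> * L) ^ k /\<^sub>R fact k) / sqrt \<mu> = (if odd k then \<mu> ^ (k div 2) * L ^ k / fact k else 0)" for k
      using 1 by (auto elim!: oddE simp: power_mult_distrib power_mult divide_inverse)
    ultimately show ?thesis using 1 by (simp add: odd_part_def)
  next
    case 2
    have "(\<lambda>k. if k = 1 then L else 0) sums L" by (rule sums_single)
    moreover have "(if odd k then \<mu> ^ (k div 2) * L ^ k / fact k else 0) = (if k = 1 then L else 0)" for k
      using 2 by (auto elim!: oddE simp: power_0_left)
    ultimately show ?thesis using 2 by (simp add: odd_part_def)
  next
    case 3
    have "(\<lambda>k. (sin_coeff k *\<^sub>R (sqrt (-\<mu>) * L) ^ k) / sqrt (-\<mu>)) sums (sin (sqrt (-\<mu>) * L) / sqrt (-\<mu>))"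
      by (intro sums_divide sin_converges)
    moreover have "(sin_coeff k *\<^sub>R (sqrt (-\<mu>) * L) ^ k) / sqrt (-\<mu>) = (if odd k then \<mu> ^ (k div 2) * L ^ k / fact k else 0)" for k
    proof -
      define s where "s = sqrt (-\<mu>)"
      have s: "s > 0" "\<mu> = - (s^2)" using 3 by (auto simp: s_def)
      show ?thesis unfolding s_def[symmetric] s(2) using s(1)
        by (auto elim!: oddE simp: sin_coeff_def power_mult_distrib power_mult power_minus[of "s^2"])
    qed
    ultimately show ?thesis using 3 by (simp add: odd_part_def)
  qed
qed

lemma mat_exp_square_scalar:
  fixes A :: "real^'n^'n"
  assumes "A ** A = \<mu> *\<^sub>R mat 1"
  shows "mat_exp (L *\<^sub>R A) = even_part \<mu> L *\<^sub>R mat 1 + odd_part \<mu> L *\<^sub>R A"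
proof -
  have "(\<lambda>k. (if even k then \<mu> ^ (k div 2) * L ^ k / fact k else 0) *\<^sub>R (mat 1 :: real^'n^'n)
       + (if odd k then \<mu> ^ (k div 2) * L ^ k / fact k else 0) *\<^sub>R A)
     sums (even_part \<mu> L *\<^sub>R mat 1 + odd_part \<mu> L *\<^sub>R A)"
    by (intro sums_add bounded_linear.sums[OF bounded_linear_scaleR_left] even_part_sums odd_part_sums)
  moreover have "(if even k then \<mu> ^ (k div 2) * L ^ k / fact k else 0) *\<^sub>R (mat 1 :: real^'n^'n)
       + (if odd k then \<mu> ^ (k div 2) * L ^ k / fact k else 0) *\<^sub>R A
     = (1 / fact k) *\<^sub>R (((\<lambda>P. (L *\<^sub>R A) ** P) ^^ k) (mat 1))" for k
    unfolding matrix_power_square_scalar[OF assms] by simp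
  ultimately show ?thesis unfolding mat_exp_def by (simp add: sums_iff)
qed

text \<open>The entries are written in the form of the weights of \<open>memory_weight_exists\<close> with \<open>c1 = 1\<close> and
\<open>c2 = -1\<close>: the integrand of the limiting process is a memory weight.\<close>

lemma diff_vec_mat_powr:
  "diff_vec v* mat_powr x (memory_matrix \<alpha>1 \<alpha>2) =
     vector [1 * even_part (\<alpha>1 * \<alpha>2) (ln x) + -1 * \<alpha>2 * odd_part (\<alpha>1 * \<alpha>2) (ln x),
       -1 * even_part (\<alpha>1 * \<alpha>2) (ln x) + 1 * \<alpha>1 * odd_part (\<alpha>1 * \<alpha>2) (ln x)]"
  unfolding mat_powr_def mat_exp_square_scalar[OF memory_matrix_square]
  by (simp add: vec_eq_iff vector_matrix_mult_def sum_2 forall_2 diff_vec_def memory_matrix_def mat_def)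

section \<open>Discrete variation of constants\<close>

lemma sum_powr_le:
  assumes s: "0 \<le> s" "s < 1"
  shows "(\<Sum>k=1..n. real k powr (-s)) \<le> real n powr (1 - s) / (1 - s)"
proof (induction n)
  case (Suc n)
  have step: "(1 - s) * real (Suc n) powr (-s) \<le> real (Suc n) powr (1 - s) - real n powr (1 - s)"
  proof (cases "n = 0")
    case True
    then show ?thesis using s by simp
  next
    case False
    have "\<exists>z. real n < z \<and> z < real (Suc n) \<and>
        real (Suc n) powr (1 - s) - real n powr (1 - s) = (real (Suc n) - real n) * ((1 - s) * z powr (1 - s - 1))"
      by (rule MVT2, simp, rule has_real_derivative_powr) (use False in auto)
    then obtain z where z: "real n < z" "z < real (Suc n)"
      "real (Suc n) powr (1 - s) - real n powr (1 - s) = (1 - s) * z powr (-s)" by auto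
    have "real (Suc n) powr (-s) \<le> z powr (-s)"
      using z False s by (intro powr_mono2') auto
    then show ?thesis unfolding z(3) using s by (intro mult_left_mono) auto
  qed
  have "(\<Sum>k=1..Suc n. real k powr (-s)) \<le> real n powr (1 - s) / (1 - s) + real (Suc n) powr (-s)"
    using Suc.IH by simp
  also have "\<dots> \<le> real (Suc n) powr (1 - s) / (1 - s)"
  proof -
    have "real (Suc n) powr (-s) \<le> (real (Suc n) powr (1 - s) - real n powr (1 - s)) / (1 - s)"
      using step s by (subst pos_le_divide_eq) (simp_all add: mult.commute)
    then show ?thesis by (simp add: diff_divide_distrib)
  qed
  finally show ?case .
qed simp

text \<open>One step of the cancellation: the drift contributes \<open>g (m/(k+1)) a / k\<close>, the change of the weight
contributes \<open>f (m/k) - f (m/(k+1))\<close>, and the differential equation makes the two agree up to second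
order.  Two applications of the mean value theorem suffice because the derivative of \<open>g\<close> is again
controlled by \<open>f\<close>.\<close>

lemma memory_weight_increment:
  fixes f g :: "real \<Rightarrow> real"
  assumes f: "\<And>x. x > 0 \<Longrightarrow> (f has_real_derivative a * g x / x) (at x)"
    and g: "\<And>x. x > 0 \<Longrightarrow> (g has_real_derivative b * f x / x) (at x)"
    and ab: "\<bar>a\<bar> \<le> 1" "\<bar>b\<bar> \<le> 1"
    and k: "k \<ge> 1" and m: "m > 0"
    and B: "\<And>x. m / (k + 1) \<le> x \<Longrightarrow> x \<le> m / k \<Longrightarrow> \<bar>f x\<bar> \<le> B \<and> \<bar>g x\<bar> \<le> B"
  shows "\<bar>g (m / (k + 1)) * a / k - (f (m / k) - f (m / (k + 1)))\<bar> \<le> 2 * B / k^2"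
proof -
  let ?y = "m / (k + 1)" and ?z = "m / k"
  have y: "0 < ?y" "?y < ?z" using k m by (auto simp: field_simps)
  obtain z where z: "?y < z" "z < ?z" "f ?z - f ?y = (?z - ?y) * (a * g z / z)"
    using MVT2[OF y(2), of f "\<lambda>x. a * g x / x"] f y by force
  have z0: "z > 0" using y z by linarith
  obtain w where w: "?y < w" "w < z" "g z - g ?y = (z - ?y) * (b * f w / w)"
    using MVT2[OF z(1), of g "\<lambda>x. b * f x / x"] g y by force
  have w0: "w > 0" using y w by linarith
  have B0: "0 \<le> B" using B[of z] z by auto
  have d: "?z - ?y = ?y / k" using k by (simp add: field_simps)
  have eq: "g ?y * a / k - (f ?z - f ?y) = a / k * ((g ?y - g z) + g z * (1 - ?y / z))"
  proof -
    have "gy * a / k - y / k * (a * gz / z) = a / k * (gy - gz + gz * (1 - y / z))" for y gy gz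
      using k z0 by (simp add: field_simps)
    then show ?thesis unfolding z(3) d .
  qed
  have zy: "z - ?y \<le> ?y / k" using z d by linarith
  have "\<bar>g ?y - g z\<bar> = (z - ?y) * (\<bar>b\<bar> * \<bar>f w\<bar> / w)"
    using w z w0 by (subst abs_minus_commute) (simp add: abs_mult)
  also have "\<dots> \<le> (?y / k) * (1 * B / ?y)"
    using zy z w w0 y B[of w] ab B0 k by (intro mult_mono frac_le) auto
  also have "\<dots> = B / k"
  proof -
    have "y / k * (1 * B / y) = B / k" if "y \<noteq> 0" for y using that by simp
    from this[OF less_imp_neq[OF y(1), symmetric]] show ?thesis .
  qed
  finally have 1: "\<bar>g ?y - g z\<bar> \<le> B / k" .
  have "1 - ?y / z = (z - ?y) / z" using z0 by (simp add: diff_divide_distrib)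
  also have "\<dots> \<le> (?y / k) / ?y" using zy z y k by (intro frac_le) auto
  also have "\<dots> = 1 / k"
  proof -
    have "y / k / y = 1 / k" if "y \<noteq> 0" for y using that by simp
    from this[OF less_imp_neq[OF y(1), symmetric]] show ?thesis .
  qed
  finally have 2: "1 - ?y / z \<le> 1 / k" .
  have 3: "0 \<le> 1 - ?y / z" using z(1) z0 by (simp del: divide_divide_eq_left)
  have "\<bar>g z * (1 - ?y / z)\<bar> \<le> B * (1 / k)"
    unfolding abs_mult using B[of z] z 2 3 B0 by (intro mult_mono) auto
  then have 4: "\<bar>(g ?y - g z) + g z * (1 - ?y / z)\<bar> \<le> 2 * B / k"
    by (rule order_trans[OF order_trans[OF abs_triangle_ineq add_mono[OF 1]]]) simp
  have "\<bar>a / k\<bar> \<le> 1 / k" using ab k by (simp add: abs_divide divide_right_mono)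
  then have "\<bar>g ?y * a / k - (f ?z - f ?y)\<bar> \<le> 1 / k * (2 * B / k)"
    unfolding eq abs_mult by (intro mult_mono 4) (use k in auto)
  then show ?thesis by (simp add: power2_eq_square)
qed

lemma telescope_from_1:
  fixes f :: "nat \<Rightarrow> real"
  assumes "1 \<le> m"
  shows "(\<Sum>k\<in>{1<..m}. f k - f (k - 1)) = f m - f 1"
  using assms
proof (induction m rule: dec_induct)
  case (step n)
  then have "{1<..Suc n} = insert (Suc n) {1<..n}" by auto
  with step show ?case by simp
qed simp

text \<open>Discrete variation of constants.  Telescoping \<open>\<psi>(m/k) S\<^sub>k\<close> over \<open>k\<close> leaves the weighted innovations
and errors of size \<open>k\<cdot>(m/k)\<^sup>\<rho>/k\<^sup>2\<close>, which sum to \<open>O(m\<^sup>\<rho>)\<close> since \<open>\<Sum>\<^sub>k k\<^sup>-\<^sup>1\<^sup>-\<^sup>\<rho>\<close> converges.  The statement is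
deterministic: any sequences with \<open>|S\<^sub>k| \<le> k\<close> will do.\<close>

lemma abel_summation:
  assumes w: "memory_weight \<alpha>1 \<alpha>2 \<rho> \<psi>1 \<psi>2" and \<rho>: "\<rho> > 0" and ab: "\<bar>\<alpha>1\<bar> \<le> 1" "\<bar>\<alpha>2\<bar> \<le> 1"
  obtains K where "K \<ge> 0"
    "\<And>(S1 :: nat \<Rightarrow> real) S2 m. (\<And>k. \<bar>S1 k\<bar> \<le> k) \<Longrightarrow> (\<And>k. \<bar>S2 k\<bar> \<le> k) \<Longrightarrow> 1 \<le> m \<Longrightarrow>
      \<bar>\<psi>1 1 * S1 m + \<psi>2 1 * S2 m - (\<Sum>k\<in>{1<..m}. \<psi>1 (m / k) * (S1 k - S1 (k - 1) - \<alpha>1 * S2 (k - 1) / real (k - 1))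
          + \<psi>2 (m / k) * (S2 k - S2 (k - 1) - \<alpha>2 * S1 (k - 1) / real (k - 1)))\<bar> \<le> K * m powr \<rho>"
proof -
  have d: "(\<psi>1 has_real_derivative \<alpha>2 * \<psi>2 x / x) (at x)" "(\<psi>2 has_real_derivative \<alpha>1 * \<psi>1 x / x) (at x)" if "x > 0" for x
    using w that by (auto simp: memory_weight_def)
  obtain C where C: "C \<ge> 0" "\<And>x. x \<ge> 1 \<Longrightarrow> \<bar>\<psi>1 x\<bar> \<le> C * x powr \<rho>" "\<And>x. x \<ge> 1 \<Longrightarrow> \<bar>\<psi>2 x\<bar> \<le> C * x powr \<rho>"
    using w by (auto simp: memory_weight_def)
  have sm: "summable (\<lambda>n. real n powr (-1 - \<rho>))" using \<rho> by (subst summable_real_powr_iff) auto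
  define Z where "Z = (\<Sum>n. real n powr (-1 - \<rho>))"
  have Z0: "0 \<le> Z" unfolding Z_def by (intro suminf_nonneg sm) auto
  show ?thesis
  proof (rule that[of "2 * C + 4 * C * Z"])
    show "2 * C + 4 * C * Z \<ge> 0" using C(1) Z0 by simp
    fix S1 S2 :: "nat \<Rightarrow> real" and m :: nat
    assume S: "\<And>k. \<bar>S1 k\<bar> \<le> k" "\<And>k. \<bar>S2 k\<bar> \<le> k" and m: "1 \<le> m"
    define e1 where "e1 k = S1 k - S1 (k - 1) - \<alpha>1 * S2 (k - 1) / real (k - 1)" for k
    define e2 where "e2 k = S2 k - S2 (k - 1) - \<alpha>2 * S1 (k - 1) / real (k - 1)" for k
    define f where "f k = \<psi>1 (m / real k) * S1 k + \<psi>2 (m / real k) * S2 k" for k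
    \<comment> \<open>What is left of the drift after the change of the weight is subtracted.\<close>
    define R where "R k = S1 (k - 1) * (\<psi>2 (m / real k) * \<alpha>2 / real (k - 1) - (\<psi>1 (m / real (k - 1)) - \<psi>1 (m / real k)))
        + S2 (k - 1) * (\<psi>1 (m / real k) * \<alpha>1 / real (k - 1) - (\<psi>2 (m / real (k - 1)) - \<psi>2 (m / real k)))" for k
    have fR: "f k - f (k - 1) = \<psi>1 (m / real k) * e1 k + \<psi>2 (m / real k) * e2 k + R k" for k
      unfolding f_def e1_def e2_def R_def by (simp add: algebra_simps)
    have "f m - f 1 = (\<Sum>k\<in>{1<..m}. f k - f (k - 1))" using telescope_from_1[OF m] by simp
    also have "\<dots> = (\<Sum>k\<in>{1<..m}. \<psi>1 (m / real k) * e1 k + \<psi>2 (m / real k) * e2 k) + (\<Sum>k\<in>{1<..m}. R k)"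
      unfolding fR by (simp add: sum.distrib)
    finally have main: "f m - (\<Sum>k\<in>{1<..m}. \<psi>1 (m / real k) * e1 k + \<psi>2 (m / real k) * e2 k) = f 1 + (\<Sum>k\<in>{1<..m}. R k)"
      by simp
    have fm: "f m = \<psi>1 1 * S1 m + \<psi>2 1 * S2 m" using m by (simp add: f_def)
    have Rk: "\<bar>R k\<bar> \<le> 4 * C * m powr \<rho> * real (k - 1) powr (-1 - \<rho>)" if k: "k \<in> {1<..m}" for k
    proof -
      define j where "j = real (k - 1)"
      have j: "j \<ge> 1" "real k = j + 1" "j \<le> m" using k by (auto simp: j_def of_nat_diff)
      define B where "B = C * (m / j) powr \<rho>"
      have B: "\<bar>\<psi>1 x\<bar> \<le> B \<and> \<bar>\<psi>2 x\<bar> \<le> B" if x: "m / (j + 1) \<le> x" "x \<le> m / j" for x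
      proof -
        have "1 \<le> m / (j + 1)" using k j by (auto simp: field_simps)
        then have x1: "1 \<le> x" using x by linarith
        have "x powr \<rho> \<le> (m / j) powr \<rho>" using x x1 \<rho> by (intro powr_mono2) auto
        then have "C * x powr \<rho> \<le> B" unfolding B_def using C(1) by (intro mult_left_mono)
        then show ?thesis using C(2,3)[OF x1] by auto
      qed
      have m0: "real m > 0" using m by simp
      have "\<bar>\<psi>2 (m / (j + 1)) * \<alpha>2 / j - (\<psi>1 (m / j) - \<psi>1 (m / (j + 1)))\<bar> \<le> 2 * B / j^2"
        by (rule memory_weight_increment[OF d(1) d(2) ab(2,1) j(1) m0]) (use B in auto)
      moreover have "\<bar>\<psi>1 (m / (j + 1)) * \<alpha>1 / j - (\<psi>2 (m / j) - \<psi>2 (m / (j + 1)))\<bar> \<le> 2 * B / j^2"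
        by (rule memory_weight_increment[OF d(2) d(1) ab(1,2) j(1) m0]) (use B in auto)
      ultimately have "\<bar>R k\<bar> \<le> j * (2 * B / j^2) + j * (2 * B / j^2)"
        unfolding R_def j_def[symmetric] j(2) using S[of "k - 1"] j(1) unfolding j_def[symmetric]
        by (intro order_trans[OF abs_triangle_ineq] add_mono) (auto simp only: abs_mult intro!: mult_mono)
      also have "\<dots> = 4 * C * ((m / j) powr \<rho> / j)"
        using j(1) by (simp add: B_def power2_eq_square)
      also have "(m / j) powr \<rho> / j = m powr \<rho> * j powr (-1 - \<rho>)"
      proof -
        have "(m / j) powr \<rho> = m powr \<rho> / j powr \<rho>" using j(1) by (simp add: powr_divide)
        moreover have "j powr (-1 - \<rho>) = 1 / (j * j powr \<rho>)"
          using j(1) by (simp add: powr_diff powr_minus divide_inverse)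
        ultimately show ?thesis by simp
      qed
      finally show ?thesis by (simp add: j_def)
    qed
    have "\<bar>\<Sum>k\<in>{1<..m}. R k\<bar> \<le> (\<Sum>k\<in>{1<..m}. 4 * C * m powr \<rho> * real (k - 1) powr (-1 - \<rho>))"
      by (rule order_trans[OF sum_abs sum_mono]) (rule Rk)
    also have "\<dots> = 4 * C * m powr \<rho> * (\<Sum>k\<in>{1<..m}. real (k - 1) powr (-1 - \<rho>))"
      by (simp only: sum_distrib_left)
    also have "(\<Sum>k\<in>{1<..m}. real (k - 1) powr (-1 - \<rho>)) = (\<Sum>i\<in>(\<lambda>k. k - 1) ` {1<..m}. real i powr (-1 - \<rho>))"
      by (subst sum.reindex) (auto simp: inj_on_def)
    also have "\<dots> \<le> Z" unfolding Z_def by (intro sum_le_suminf sm) auto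
    finally have sR: "\<bar>\<Sum>k\<in>{1<..m}. R k\<bar> \<le> 4 * C * m powr \<rho> * Z" using C(1) by (simp add: mult_left_mono)
    have "\<bar>\<psi>1 m * S1 1\<bar> \<le> (C * m powr \<rho>) * 1" "\<bar>\<psi>2 m * S2 1\<bar> \<le> (C * m powr \<rho>) * 1"
      unfolding abs_mult using C(2,3)[of m] m S[of 1] C(1) by (intro mult_mono; auto)+
    then have f1: "\<bar>f 1\<bar> \<le> 2 * C * m powr \<rho>"
      unfolding f_def by (intro order_trans[OF abs_triangle_ineq]) simp
    have "\<bar>f m - (\<Sum>k\<in>{1<..m}. \<psi>1 (m / real k) * e1 k + \<psi>2 (m / real k) * e2 k)\<bar> \<le> \<bar>f 1\<bar> + \<bar>\<Sum>k\<in>{1<..m}. R k\<bar>"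
      unfolding main by (rule abs_triangle_ineq)
    also have "\<dots> \<le> (2 * C + 4 * C * Z) * m powr \<rho>" using f1 sR by (simp add: algebra_simps)
    finally show "\<bar>\<psi>1 1 * S1 m + \<psi>2 1 * S2 m - (\<Sum>k\<in>{1<..m}. \<psi>1 (m / k) * (S1 k - S1 (k - 1) - \<alpha>1 * S2 (k - 1) / real (k - 1))
          + \<psi>2 (m / k) * (S2 k - S2 (k - 1) - \<alpha>2 * S1 (k - 1) / real (k - 1)))\<bar> \<le> (2 * C + 4 * C * Z) * m powr \<rho>"
      unfolding fm e1_def e2_def .
  qed
qed

section \<open>Riemann sums near an integrable singularity\<close>

text \<open>The integrable majorant \<open>s\<^sup>-\<^sup>\<kappa>\<close> on \<open>(0, T]\<close>; with \<open>\<kappa> = 2 \<rho> < 1\<close> it dominates squared weights.\<close>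

definition power_envelope :: "real \<Rightarrow> real \<Rightarrow> real \<Rightarrow> real" where
  "power_envelope \<kappa> T s = (if 0 < s \<and> s \<le> T then s powr (-\<kappa>) else 0)"

lemma power_envelope_measurable [measurable]: "power_envelope \<kappa> T \<in> borel_measurable borel"
  unfolding power_envelope_def[abs_def] by measurable

lemma integrable_power_envelope:
  assumes "\<kappa> < 1" "0 \<le> T"
  shows "integrable lborel (power_envelope \<kappa> T)"
proof -
  have "(\<lambda>x. x powr (-\<kappa>)) integrable_on {0<..T}"
    by (rule integrable_on_powr_from_0') (use assms in auto)
  then have "(\<lambda>x. if x \<in> {0<..T} then x powr (-\<kappa>) else 0) integrable_on UNIV"
    by (simp only: integrable_restrict_UNIV)
  moreover have "(\<lambda>x. if x \<in> {0<..T} then x powr (-\<kappa>) else 0) = power_envelope \<kappa> T"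
    by (auto simp: power_envelope_def)
  ultimately obtain I where I: "(power_envelope \<kappa> T has_integral I) UNIV"
    by (auto simp: integrable_on_def)
  have nn: "0 \<le> power_envelope \<kappa> T x" for x by (simp add: power_envelope_def)
  have "(\<integral>\<^sup>+x. ennreal (power_envelope \<kappa> T x) \<partial>lborel) = ennreal I"
    by (rule nn_integral_has_integral_lborel[OF _ _ I]) (auto simp: nn)
  then show ?thesis
    by (intro integrableI_nonneg) (auto simp: nn)
qed

text \<open>The sums are integrals of step functions with cells of length \<open>1/r\<^sup>2\<close>, so the claim is dominated
convergence.  The first cell is left out because the innovations start at index \<open>2\<close>.  The limit \<open>g\<close>
may fail to be the pointwise limit at the finitely many points of \<open>J\<close>, where the kernels below jump.\<close>

lemma riemann_sum_converges:
  fixes c :: "nat \<Rightarrow> nat \<Rightarrow> real"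
  assumes r: "\<And>n. r n > 0" "filterlim r at_top sequentially"
    and \<kappa>: "0 \<le> \<kappa>" "\<kappa> < 1" and T: "0 \<le> T" and B: "0 \<le> B"
    and bound: "\<And>n k. 1 \<le> k \<Longrightarrow> \<bar>c n k\<bar> \<le> B * ((r n)^2 / real k) powr \<kappa>"
    and zero: "\<And>n k. real k > (r n)^2 * T \<Longrightarrow> c n k = 0"
    and K: "\<And>n. real (K n) \<ge> (r n)^2 * T"
    and lim: "\<And>s. 0 < s \<Longrightarrow> s \<notin> J \<Longrightarrow> (\<lambda>n. c n (nat \<lceil>(r n)^2 * s\<rceil>)) \<longlonglongrightarrow> g s"
    and J: "finite J"
    and g: "(\<lambda>s. indicator {0<..} s * g s) \<in> borel_measurable borel"
  shows "(\<lambda>n. \<Sum>k\<in>{1<..K n}. c n k / (r n)^2) \<longlonglongrightarrow> (\<integral>s. indicator {0<..} s * g s \<partial>lborel)"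
proof -
  define f where "f n s = (\<Sum>k\<in>{1<..K n}. c n k * indicator {(real k - 1) / (r n)^2<..real k / (r n)^2} s)" for n s
  have r2: "(r n)^2 > 0" for n using r(1)[of n] by simp
  have [measurable]: "f n \<in> borel_measurable borel" for n unfolding f_def[abs_def] by measurable
  have int_f: "(\<integral>s. f n s \<partial>lborel) = (\<Sum>k\<in>{1<..K n}. c n k / (r n)^2)" for n
  proof -
    have "(real k - 1) / (r n)^2 \<le> real k / (r n)^2" for k using r2[of n] by (intro divide_right_mono) auto
    then have i: "integrable lborel (\<lambda>s. c n k * indicator {(real k - 1) / (r n)^2<..real k / (r n)^2} s)"
      and e: "(\<integral>s. c n k * indicator {(real k - 1) / (r n)^2<..real k / (r n)^2} s \<partial>lborel) = c n k / (r n)^2" for k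
      by (simp_all add: diff_divide_distrib)
    show ?thesis unfolding f_def by (subst Bochner_Integration.integral_sum) (rule i, simp only: e)
  qed
  have cell: "indicator {(real k - 1) / (r n)^2<..real k / (r n)^2} s = (if k = nat \<lceil>(r n)^2 * s\<rceil> then 1 else (0::real))"
    if k: "1 \<le> k" for n k s
  proof -
    have "s \<in> {(real k - 1) / (r n)^2<..real k / (r n)^2} \<longleftrightarrow> real k - 1 < (r n)^2 * s \<and> (r n)^2 * s \<le> real k"
      using r2[of n] by (simp add: pos_divide_less_eq pos_le_divide_eq mult.commute)
    also have "\<dots> \<longleftrightarrow> \<lceil>(r n)^2 * s\<rceil> = int k" by (auto simp: ceiling_eq_iff)
    also have "\<dots> \<longleftrightarrow> k = nat \<lceil>(r n)^2 * s\<rceil>" using k by auto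
    finally show ?thesis by (simp add: indicator_def)
  qed
  have f_eq: "f n s = (if nat \<lceil>(r n)^2 * s\<rceil> \<in> {1<..K n} then c n (nat \<lceil>(r n)^2 * s\<rceil>) else 0)" for n s
  proof -
    have "f n s = (\<Sum>k\<in>{1<..K n}. if nat \<lceil>(r n)^2 * s\<rceil> = k then c n k else 0)"
      unfolding f_def by (intro sum.cong refl) (auto simp: cell)
    then show ?thesis by simp
  qed
  have dom: "norm (f n s) \<le> B * power_envelope \<kappa> T s" for n s
  \<comment> \<open>For indices beyond the time horizon the coefficient vanishes, so only cells inside \<open>(0, T]\<close> count.\<close>
  proof (cases "nat \<lceil>(r n)^2 * s\<rceil> \<in> {1<..K n} \<and> c n (nat \<lceil>(r n)^2 * s\<rceil>) \<noteq> 0")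
    case False
    then show ?thesis unfolding f_eq using B by (auto simp: power_envelope_def)
  next
    case True
    define k where "k = nat \<lceil>(r n)^2 * s\<rceil>"
    have k: "k > 1" "c n k \<noteq> 0" "k \<le> K n" using True by (auto simp: k_def)
    have "0 < \<lceil>(r n)^2 * s\<rceil>" using k(1) by (simp add: k_def)
    then have sk: "(r n)^2 * s \<le> real k" "(r n)^2 * s > 0"
      by (simp_all add: k_def real_nat_ceiling_ge zero_less_ceiling)
    then have s0: "s > 0" using r2[of n] by (simp add: zero_less_mult_iff)
    have kT: "real k \<le> (r n)^2 * T" using zero[of n k] k by force
    with sk(1) have "(r n)^2 * s \<le> (r n)^2 * T" by linarith
    then have sT: "s \<le> T" using r2[of n] by simp
    have "\<bar>c n k\<bar> \<le> B * ((r n)^2 / real k) powr \<kappa>" using bound k by simp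
    also have "\<dots> \<le> B * (1 / s) powr \<kappa>"
      using sk s0 \<kappa> B r2[of n] k by (intro mult_left_mono powr_mono2) (auto simp: field_simps)
    also have "(1 / s) powr \<kappa> = s powr (-\<kappa>)" using s0 by (simp add: powr_divide powr_minus_divide)
    finally show ?thesis unfolding f_eq k_def[symmetric] using k s0 sT by (simp add: power_envelope_def)
  qed
  have "(\<lambda>n. \<integral>s. f n s \<partial>lborel) \<longlonglongrightarrow> (\<integral>s. indicator {0<..} s * g s \<partial>lborel)"
  proof (rule integral_dominated_convergence[where w="\<lambda>s. B * power_envelope \<kappa> T s"])
    show "integrable lborel (\<lambda>s. B * power_envelope \<kappa> T s)"
      by (intro integrable_mult_right integrable_power_envelope \<kappa> T)
    have "AE s in lborel. s \<notin> J" by (rule AE_not_in[OF finite_imp_null_set_lborel[OF J]])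
    moreover have r2inf: "filterlim (\<lambda>n. (r n)^2) at_top sequentially"
      using r(2) by (intro filterlim_pow_at_top) auto
    have "(\<lambda>n. f n s) \<longlonglongrightarrow> indicator {0<..} s * g s" if "s \<notin> J" for s
    proof (cases "s > 0")
      case False
      then have "(r n)^2 * s \<le> 0" for n using r2[of n] by (simp add: mult_le_0_iff)
      then have "nat \<lceil>(r n)^2 * s\<rceil> = 0" for n by (simp add: ceiling_le_iff)
      then have "f n s = 0" for n unfolding f_eq by simp
      with False show ?thesis by simp
    next
      case True
      have "eventually (\<lambda>n. (r n)^2 * s > 1) sequentially"
        using filterlim_at_top_mult_tendsto_pos[OF tendsto_const True r2inf] by (simp add: filterlim_at_top_dense mult.commute)
      then have "eventually (\<lambda>n. c n (nat \<lceil>(r n)^2 * s\<rceil>) = f n s) sequentially"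
      proof (eventually_elim)
        case (elim n)
        let ?k = "nat \<lceil>(r n)^2 * s\<rceil>"
        have k1: "?k > 1" using elim by (simp add: less_ceiling_iff zless_nat_eq_int_zless)
        show ?case
        proof (cases "?k \<le> K n")
          case True
          then show ?thesis unfolding f_eq using k1 by auto
        next
          case False
          then have "real ?k > (r n)^2 * T" using K[of n] by linarith
          then show ?thesis unfolding f_eq using zero False by simp
        qed
      qed
      with lim[OF True that] True show ?thesis by (simp add: tendsto_cong)
    qed
    ultimately show "AE s in lborel. (\<lambda>n. f n s) \<longlonglongrightarrow> indicator {0<..} s * g s" by auto
    show "AE s in lborel. norm (f n s) \<le> B * power_envelope \<kappa> T s" for n using dom by simp
  qed (use g in simp_all)
  then show ?thesis unfolding int_f .
qed

section \<open>The law of the next step given the past\<close>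

lemma level_set_in_vimage_algebra:
  assumes "f \<in> measurable M (count_space A)"
  shows "{\<omega>\<in>space M. f \<omega> = a} \<in> sets (vimage_algebra (space M) f (count_space A))"
proof -
  have "f -` ({a} \<inter> A) \<inter> space M \<in> sets (vimage_algebra (space M) f (count_space A))"
    by (rule in_vimage_algebra) simp
  also have "f -` ({a} \<inter> A) \<inter> space M = {\<omega>\<in>space M. f \<omega> = a}"
    using measurable_space[OF assms] by auto
  finally show ?thesis .
qed

lemma integral_sum4:
  fixes f :: "'i \<Rightarrow> 'j \<Rightarrow> 'k \<Rightarrow> 'l \<Rightarrow> 'a \<Rightarrow> 'c::{banach, second_countable_topology}"
  assumes int: "\<And>a b c d. c \<in> C \<Longrightarrow> d \<in> D \<Longrightarrow> a \<in> A \<Longrightarrow> b \<in> B \<Longrightarrow> integrable M (f a b c d)"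
  shows "(\<integral>x. (\<Sum>a\<in>A. \<Sum>b\<in>B. \<Sum>c\<in>C. \<Sum>d\<in>D. f a b c d x) \<partial>M) =
    (\<Sum>a\<in>A. \<Sum>b\<in>B. \<Sum>c\<in>C. \<Sum>d\<in>D. \<integral>x. f a b c d x \<partial>M)"
proof -
  have "(\<integral>x. (\<Sum>d\<in>D. f a b c d x) \<partial>M) = (\<Sum>d\<in>D. \<integral>x. f a b c d x \<partial>M)"
    if "a \<in> A" "b \<in> B" "c \<in> C" for a b c
    by (rule Bochner_Integration.integral_sum) (rule int[OF that(3) _ that(1,2)])
  moreover have "(\<integral>x. (\<Sum>c\<in>C. \<Sum>d\<in>D. f a b c d x) \<partial>M) = (\<Sum>c\<in>C. \<integral>x. (\<Sum>d\<in>D. f a b c d x) \<partial>M)"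
    if "a \<in> A" "b \<in> B" for a b
    by (rule Bochner_Integration.integral_sum) (intro Bochner_Integration.integrable_sum int that)
  moreover have "(\<integral>x. (\<Sum>b\<in>B. \<Sum>c\<in>C. \<Sum>d\<in>D. f a b c d x) \<partial>M) = (\<Sum>b\<in>B. \<integral>x. (\<Sum>c\<in>C. \<Sum>d\<in>D. f a b c d x) \<partial>M)"
    if "a \<in> A" for a
    by (rule Bochner_Integration.integral_sum) (intro Bochner_Integration.integrable_sum int that)
  moreover have "(\<integral>x. (\<Sum>a\<in>A. \<Sum>b\<in>B. \<Sum>c\<in>C. \<Sum>d\<in>D. f a b c d x) \<partial>M) = (\<Sum>a\<in>A. \<integral>x. (\<Sum>b\<in>B. \<Sum>c\<in>C. \<Sum>d\<in>D. f a b c d x) \<partial>M)"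
    by (rule Bochner_Integration.integral_sum) (intro Bochner_Integration.integrable_sum int)
  ultimately show ?thesis by (simp cong: sum.cong)
qed

lemma sum_product4:
  fixes F :: "'i \<Rightarrow> 'l \<Rightarrow> 'c::comm_ring_1"
  shows "(\<Sum>a\<in>A. \<Sum>d\<in>D. F a d) * (\<Sum>b\<in>B. \<Sum>c\<in>C. G b c) =
    (\<Sum>a\<in>A. \<Sum>b\<in>B. \<Sum>c\<in>C. \<Sum>d\<in>D. F a d * G b c)"
proof -
  have "(\<Sum>d\<in>D. F a d) * (\<Sum>c\<in>C. G b c) = (\<Sum>c\<in>C. \<Sum>d\<in>D. F a d * G b c)" for a b
    unfolding sum_product by (rule sum.swap)
  then show ?thesis unfolding sum_product[of "\<lambda>a. sum (F a) D"] by simp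
qed

context interacting_erw
begin

text \<open>The \<open>\<sigma>\<close>-algebra generated by a single source of randomness; the family of these is independent by
assumption.\<close>

definition gen :: "source \<Rightarrow> 'a set set" where
  "gen i = (case i of
           Init \<Rightarrow> sets (vimage_algebra (space M) (\<lambda>\<omega>. (X1 1 \<omega>, X2 1 \<omega>))
                           (count_space ({-1, 1} \<times> {-1, 1})))
         | Sign1 n \<Rightarrow> sets (vimage_algebra (space M) (\<xi>1 n) (count_space {-1, 1}))
         | Sign2 n \<Rightarrow> sets (vimage_algebra (space M) (\<xi>2 n) (count_space {-1, 1}))
         | Pick1 n \<Rightarrow> sets (vimage_algebra (space M) (U1 n) (count_space {1..n}))
         | Pick2 n \<Rightarrow> sets (vimage_algebra (space M) (U2 n) (count_space {1..n})))"

definition past_sources :: "nat \<Rightarrow> source set" where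
  "past_sources k = {Init} \<union> Sign1 ` {2..k} \<union> Sign2 ` {2..k} \<union> Pick1 ` {1..<k} \<union> Pick2 ` {1..<k}"

definition next_sources :: "nat \<Rightarrow> source set" where
  "next_sources k = {Sign1 (Suc k), Sign2 (Suc k), Pick1 k, Pick2 k}"

text \<open>The history up to time \<open>k\<close> is generated by the sources, not by the walks, because independence of the
next step is an assumption about sources.\<close>

definition hist :: "nat \<Rightarrow> 'a measure" where
  "hist k = sigma (space M) (\<Union>i\<in>past_sources k. gen i)"

lemma indep_gen:
  "indep_sets gen ({Init} \<union> Sign1 ` {2..} \<union> Sign2 ` {2..} \<union> Pick1 ` {1..} \<union> Pick2 ` {1..})"
  using indep unfolding gen_def[abs_def] .

lemma gen_events:
  "i \<in> {Init} \<union> Sign1 ` {2..} \<union> Sign2 ` {2..} \<union> Pick1 ` {1..} \<union> Pick2 ` {1..} \<Longrightarrow> gen i \<subseteq> events"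
  using indep_gen unfolding indep_sets_def by blast

lemma past_sources_subset:
  "past_sources k \<subseteq> {Init} \<union> Sign1 ` {2..} \<union> Sign2 ` {2..} \<union> Pick1 ` {1..} \<union> Pick2 ` {1..}"
  by (auto simp: past_sources_def)

lemma past_gen_Pow: "(\<Union>i\<in>past_sources k. gen i) \<subseteq> Pow (space M)"
proof (rule UN_least)
  fix i assume "i \<in> past_sources k"
  then have "gen i \<subseteq> events" by (intro gen_events subsetD[OF past_sources_subset])
  then show "gen i \<subseteq> Pow (space M)" using sets.space_closed[of M] by (rule order_trans)
qed

lemma space_hist [simp]: "space (hist k) = space M"
  unfolding hist_def by (rule space_measure_of[OF past_gen_Pow])

lemma sets_hist: "sets (hist k) = sigma_sets (space M) (\<Union>i\<in>past_sources k. gen i)"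
  unfolding hist_def by (rule sets_measure_of[OF past_gen_Pow])

lemma hist_events: "sets (hist k) \<subseteq> events"
  unfolding sets_hist
proof (intro sets.sigma_sets_subset UN_least)
  fix i assume "i \<in> past_sources k"
  then show "gen i \<subseteq> events" by (intro gen_events subsetD[OF past_sources_subset])
qed

lemma hist_mono: "j \<le> k \<Longrightarrow> sets (hist j) \<subseteq> sets (hist k)"
  unfolding sets_hist
  by (rule sigma_sets_mono', rule UN_mono) (auto simp: past_sources_def)

lemma hist_measurable_mono:
  "f \<in> measurable (hist j) L \<Longrightarrow> j \<le> k \<Longrightarrow> f \<in> measurable (hist k) L"
  using hist_mono[of j k] by (auto simp: measurable_def)

lemma hist_measurable_M: "f \<in> measurable (hist j) L \<Longrightarrow> f \<in> measurable M L"
  using hist_events[of j] by (auto simp: measurable_def)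

lemma gen_in_hist: "i \<in> past_sources k \<Longrightarrow> gen i \<subseteq> sets (hist k)"
  unfolding sets_hist by auto

lemma measurable_hist_vimage:
  assumes "gen i = sets (vimage_algebra (space M) f L)" "i \<in> past_sources k" "f \<in> measurable M L"
  shows "f \<in> measurable (hist k) L"
proof (rule measurableI)
  fix x assume "x \<in> space (hist k)"
  then show "f x \<in> space L" using assms(3) by (auto simp: measurable_def)
next
  fix A assume "A \<in> sets L"
  then have "f -` A \<inter> space M \<in> gen i"
    unfolding assms(1) by (rule in_vimage_algebra)
  then show "f -` A \<inter> space (hist k) \<in> sets (hist k)"
    using gen_in_hist[OF assms(2)] by auto
qed

lemma measurable_sources:
  shows "2 \<le> j \<Longrightarrow> j \<le> k \<Longrightarrow> \<xi>1 j \<in> measurable (hist k) (count_space {-1,1})"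
    and "2 \<le> j \<Longrightarrow> j \<le> k \<Longrightarrow> \<xi>2 j \<in> measurable (hist k) (count_space {-1,1})"
    and "1 \<le> j \<Longrightarrow> j < k \<Longrightarrow> U1 j \<in> measurable (hist k) (count_space {1..j})"
    and "1 \<le> j \<Longrightarrow> j < k \<Longrightarrow> U2 j \<in> measurable (hist k) (count_space {1..j})"
    and "(\<lambda>\<omega>. (X1 1 \<omega>, X2 1 \<omega>)) \<in> measurable (hist k) (count_space ({-1, 1} \<times> {-1, 1}))"
  subgoal by (rule measurable_hist_vimage[of "Sign1 j"]) (auto simp: gen_def past_sources_def \<xi>1_measurable)
  subgoal by (rule measurable_hist_vimage[of "Sign2 j"]) (auto simp: gen_def past_sources_def \<xi>2_measurable)
  subgoal by (rule measurable_hist_vimage[of "Pick1 j"]) (auto simp: gen_def past_sources_def U1_measurable[simplified])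
  subgoal by (rule measurable_hist_vimage[of "Pick2 j"]) (auto simp: gen_def past_sources_def U2_measurable[simplified])
  subgoal by (rule measurable_hist_vimage[of "Init"]) (auto simp: gen_def past_sources_def init_measurable[simplified])
  done

text \<open>A step looks up an earlier step of the other walk at a random index, so measurability and the values
\<open>\<plusminus>1\<close> have to be established for both walks simultaneously, by induction over all earlier times.\<close>

lemma steps_measurable_and_values:
  assumes "1 \<le> j"
  shows "X1 j \<in> measurable (hist j) (count_space UNIV) \<and> X2 j \<in> measurable (hist j) (count_space UNIV)
      \<and> (\<forall>\<omega>\<in>space M. X1 j \<omega> \<in> {-1,1} \<and> X2 j \<omega> \<in> {-1,1})"
  using assms
proof (induction j rule: less_induct)
  case (less j)
  show ?case
  proof (cases "j = 1")
    case True
    note m = measurable_sources(5)[of 1]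
    have "(\<lambda>\<omega>. fst (X1 1 \<omega>, X2 1 \<omega>)) \<in> measurable (hist 1) (count_space UNIV)"
         "(\<lambda>\<omega>. snd (X1 1 \<omega>, X2 1 \<omega>)) \<in> measurable (hist 1) (count_space UNIV)"
      by (rule measurable_compose[OF m], simp)+
    moreover have "(X1 1 \<omega>, X2 1 \<omega>) \<in> {-1,1} \<times> {-1,1}" if "\<omega> \<in> space M" for \<omega>
      using measurable_space[OF init_measurable that] by simp
    ultimately show ?thesis using True by auto
  next
    case False
    with less.prems obtain n where n: "j = Suc n" "n \<ge> 1" by (cases j) auto
    have IH: "X1 i \<in> measurable (hist j) (count_space UNIV)"
      "X2 i \<in> measurable (hist j) (count_space UNIV)"
      "\<And>\<omega>. \<omega>\<in>space M \<Longrightarrow> X1 i \<omega> \<in> {-1,1} \<and> X2 i \<omega> \<in> {-1,1}" if "i \<in> {1..n}" for i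
      using less.IH[of i] that n by (auto intro: hist_measurable_mono)
    have u1: "U1 n \<in> measurable (hist j) (count_space {1..n})"
      and u2: "U2 n \<in> measurable (hist j) (count_space {1..n})"
      and x1: "\<xi>1 j \<in> measurable (hist j) (count_space {-1,1})"
      and x2: "\<xi>2 j \<in> measurable (hist j) (count_space {-1,1})"
      using n measurable_sources(1,2)[of j j] measurable_sources(3,4)[of n j] by auto
    have a1: "(\<lambda>\<omega>. X2 (U2 n \<omega>) \<omega>) \<in> measurable (hist j) (count_space UNIV)"
      by (rule measurable_compose_countable'[OF _ u2]) (auto intro: IH)
    have a2: "(\<lambda>\<omega>. X1 (U1 n \<omega>) \<omega>) \<in> measurable (hist j) (count_space UNIV)"
      by (rule measurable_compose_countable'[OF _ u1]) (auto intro: IH)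
    have x1': "\<xi>1 j \<in> measurable (hist j) (count_space UNIV)"
      using measurable_compose[OF x1, of "\<lambda>x. x" "count_space UNIV"] by simp
    have x2': "\<xi>2 j \<in> measurable (hist j) (count_space UNIV)"
      using measurable_compose[OF x2, of "\<lambda>x. x" "count_space UNIV"] by simp
    have "X1 j \<in> measurable (hist j) (count_space UNIV) \<longleftrightarrow>
        (\<lambda>\<omega>. \<xi>1 j \<omega> * X2 (U2 n \<omega>) \<omega>) \<in> measurable (hist j) (count_space UNIV)"
      by (rule measurable_cong) (use n X1_Suc in simp)
    moreover have "X2 j \<in> measurable (hist j) (count_space UNIV) \<longleftrightarrow>
        (\<lambda>\<omega>. \<xi>2 j \<omega> * X1 (U1 n \<omega>) \<omega>) \<in> measurable (hist j) (count_space UNIV)"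
      by (rule measurable_cong) (use n X2_Suc in simp)
    ultimately have m: "X1 j \<in> measurable (hist j) (count_space UNIV)"
      "X2 j \<in> measurable (hist j) (count_space UNIV)"
      using x1' a1 x2' a2 by simp_all
    have "X1 j \<omega> \<in> {-1,1} \<and> X2 j \<omega> \<in> {-1,1}" if w: "\<omega> \<in> space M" for \<omega>
    proof -
      have "U1 n \<omega> \<in> {1..n}" "U2 n \<omega> \<in> {1..n}" "\<xi>1 j \<omega> \<in> {-1,1}" "\<xi>2 j \<omega> \<in> {-1,1}"
        using measurable_space[OF u1] measurable_space[OF u2] measurable_space[OF x1] measurable_space[OF x2] w by auto
      then show ?thesis using IH(3)[of "U1 n \<omega>" \<omega>] IH(3)[of "U2 n \<omega>" \<omega>] w n X1_Suc X2_Suc by auto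
    qed
    with m show ?thesis by blast
  qed
qed

definition x1 :: "nat \<Rightarrow> 'a \<Rightarrow> real" where "x1 k \<omega> = real_of_int (X1 k \<omega>)"
definition x2 :: "nat \<Rightarrow> 'a \<Rightarrow> real" where "x2 k \<omega> = real_of_int (X2 k \<omega>)"
definition s1 :: "nat \<Rightarrow> 'a \<Rightarrow> real" where "s1 k \<omega> = real_of_int (walk X1 k \<omega>)"
definition s2 :: "nat \<Rightarrow> 'a \<Rightarrow> real" where "s2 k \<omega> = real_of_int (walk X2 k \<omega>)"

lemma X_measurable_hist [measurable (raw)]:
  assumes "1 \<le> j" "j \<le> k"
  shows "X1 j \<in> measurable (hist k) (count_space UNIV)" "X2 j \<in> measurable (hist k) (count_space UNIV)"
  using steps_measurable_and_values[OF assms(1)] assms(2) by (auto intro: hist_measurable_mono)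

lemma X_measurable: 
  assumes "1 \<le> j"
  shows "X1 j \<in> measurable M (count_space UNIV)" "X2 j \<in> measurable M (count_space UNIV)"
  using X_measurable_hist[OF assms order_refl] by (auto intro: hist_measurable_M)

lemma X_values: "1 \<le> j \<Longrightarrow> \<omega> \<in> space M \<Longrightarrow> X1 j \<omega> = -1 \<or> X1 j \<omega> = 1"
  "1 \<le> j \<Longrightarrow> \<omega> \<in> space M \<Longrightarrow> X2 j \<omega> = -1 \<or> X2 j \<omega> = 1"
  using steps_measurable_and_values[of j] by auto

lemma s_measurable_hist [measurable]:
  shows "s1 k \<in> borel_measurable (hist k)" "s2 k \<in> borel_measurable (hist k)"
proof -
  have "(\<lambda>\<omega>. \<Sum>j=1..k. real_of_int (X1 j \<omega>)) \<in> borel_measurable (hist k)"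
    by (intro borel_measurable_sum measurable_compose[OF X_measurable_hist(1)]) auto
  moreover have "(\<lambda>\<omega>. \<Sum>j=1..k. real_of_int (X2 j \<omega>)) \<in> borel_measurable (hist k)"
    by (intro borel_measurable_sum measurable_compose[OF X_measurable_hist(2)]) auto
  ultimately show "s1 k \<in> borel_measurable (hist k)" "s2 k \<in> borel_measurable (hist k)"
    by (simp_all add: s1_def[abs_def] s2_def[abs_def] walk_def)
qed

lemma s_measurable [measurable]:
  shows "s1 k \<in> borel_measurable M" "s2 k \<in> borel_measurable M"
  using s_measurable_hist hist_measurable_M by blast+

lemma x_measurable: 
  assumes "1 \<le> j"
  shows "x1 j \<in> borel_measurable M" "x2 j \<in> borel_measurable M"
  unfolding x1_def[abs_def] x2_def[abs_def]
  by (rule measurable_compose[OF X_measurable(1)[OF assms]], simp)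
     (rule measurable_compose[OF X_measurable(2)[OF assms]], simp)

lemma s_Suc: "s1 (Suc k) \<omega> = s1 k \<omega> + x1 (Suc k) \<omega>" "s2 (Suc k) \<omega> = s2 k \<omega> + x2 (Suc k) \<omega>"
  by (simp_all add: s1_def s2_def walk_def x1_def x2_def)

lemma abs_s_le: 
  assumes "\<omega> \<in> space M"
  shows "\<bar>s1 k \<omega>\<bar> \<le> k" "\<bar>s2 k \<omega>\<bar> \<le> k"
proof -
  have "\<bar>real_of_int (X1 j \<omega>)\<bar> \<le> 1" "\<bar>real_of_int (X2 j \<omega>)\<bar> \<le> 1" if "j \<in> {1..k}" for j
    using X_values[of j \<omega>] that assms by auto
  then have "(\<Sum>j=1..k. \<bar>real_of_int (X1 j \<omega>)\<bar>) \<le> real (card {1..k}) * 1"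
    "(\<Sum>j=1..k. \<bar>real_of_int (X2 j \<omega>)\<bar>) \<le> real (card {1..k}) * 1"
    by (intro sum_bounded_above; simp)+
  then show "\<bar>s1 k \<omega>\<bar> \<le> k" "\<bar>s2 k \<omega>\<bar> \<le> k"
    unfolding s1_def s2_def walk_def of_int_sum
    by (simp_all add: order_trans[OF sum_abs])
qed

text \<open>Given the past, the next step is determined by two signs and two picks.  On an atom of these four choices
each coordinate of it is, up to sign, a fixed earlier step of the other walk.\<close>

definition atom :: "nat \<Rightarrow> int \<Rightarrow> int \<Rightarrow> nat \<Rightarrow> nat \<Rightarrow> 'a set" where
  "atom k a b i j = {\<omega>\<in>space M. \<xi>1 (Suc k) \<omega> = a \<and> \<xi>2 (Suc k) \<omega> = b \<and> U1 k \<omega> = i \<and> U2 k \<omega> = j}"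

lemma next_sources_disjoint: "k \<ge> 1 \<Longrightarrow> past_sources k \<inter> next_sources k = {}"
  by (auto simp: past_sources_def next_sources_def)

lemma gen_Int_stable: "Int_stable (gen i)"
  by (cases i) (auto simp: gen_def Int_stable_def)

lemma hist_indep_next:
  assumes "k \<ge> 1"
  shows "indep_set (sets (hist k)) (sigma_sets (space M) (\<Union>i\<in>next_sources k. gen i))"
proof -
  have sub: "(\<Union>j\<in>UNIV. case_bool (past_sources k) (next_sources k) j)
     \<subseteq> {Init} \<union> Sign1 ` {2..} \<union> Sign2 ` {2..} \<union> Pick1 ` {1..} \<union> Pick2 ` {1..}"
    using assms by (auto simp: UNIV_bool past_sources_def next_sources_def)
  have "indep_sets (\<lambda>j. sigma_sets (space M) (\<Union>i\<in>case_bool (past_sources k) (next_sources k) j. gen i)) UNIV"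
    by (rule indep_sets_collect_sigma[OF indep_sets_mono_index[OF sub indep_gen]])
       (use next_sources_disjoint[OF assms] in \<open>auto simp: gen_Int_stable disjoint_family_on_def split: bool.splits\<close>)
  then have "indep_sets (\<lambda>j. case_bool (sigma_sets (space M) (\<Union>i\<in>past_sources k. gen i)) (sigma_sets (space M) (\<Union>i\<in>next_sources k. gen i)) j) UNIV"
    by (rule indep_sets_cong[THEN iffD1, rotated -1]) (auto split: bool.split)
  then show ?thesis unfolding indep_set_def sets_hist by simp
qed

lemma atom_gen:
  assumes "k \<ge> 1" 
  shows "{\<omega>\<in>space M. \<xi>1 (Suc k) \<omega> = a} \<in> gen (Sign1 (Suc k))" 
    "{\<omega>\<in>space M. \<xi>2 (Suc k) \<omega> = b} \<in> gen (Sign2 (Suc k))"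
    "{\<omega>\<in>space M. U1 k \<omega> = i} \<in> gen (Pick1 k)"
    "{\<omega>\<in>space M. U2 k \<omega> = j} \<in> gen (Pick2 k)"
  using level_set_in_vimage_algebra[OF \<xi>1_measurable[of "Suc k"]]
    level_set_in_vimage_algebra[OF \<xi>2_measurable[of "Suc k"]]
    level_set_in_vimage_algebra[OF U1_measurable[OF assms]]
    level_set_in_vimage_algebra[OF U2_measurable[OF assms]] assms
  by (auto simp: gen_def)

lemma prob_pick:
  assumes "k \<ge> 1" "i \<in> {1..k}"
  shows "prob {\<omega>\<in>space M. U1 k \<omega> = i} = 1 / k" "prob {\<omega>\<in>space M. U2 k \<omega> = i} = 1 / k"
proof -
  have "measure (distr M (count_space {1..k}) (U1 k)) {i} = 1/k"
    unfolding U1_law[OF assms(1)] using assms by (simp add: measure_uniform_count_measure)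
  then show "prob {\<omega>\<in>space M. U1 k \<omega> = i} = 1 / k"
    using assms by (subst (asm) measure_distr[OF U1_measurable]) (auto simp: vimage_def Int_def conj_commute)
  have "measure (distr M (count_space {1..k}) (U2 k)) {i} = 1/k"
    unfolding U2_law[OF assms(1)] using assms by (simp add: measure_uniform_count_measure)
  then show "prob {\<omega>\<in>space M. U2 k \<omega> = i} = 1 / k"
    using assms by (subst (asm) measure_distr[OF U2_measurable]) (auto simp: vimage_def Int_def conj_commute)
qed

definition sign_prob :: "real \<Rightarrow> int \<Rightarrow> real" where
  "sign_prob p a = (if a = 1 then p else 1 - p)"

lemma prob_atom:
  assumes k: "k \<ge> 1" and a: "a \<in> {-1,1}" "b \<in> {-1,1}" and i: "i \<in> {1..k}" "j \<in> {1..k}"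
  shows "prob (atom k a b i j) = sign_prob p1 a * sign_prob p2 b / (real k)^2"
proof -
  define E where "E s = (case s of Sign1 _ \<Rightarrow> {\<omega>\<in>space M. \<xi>1 (Suc k) \<omega> = a}
     | Sign2 _ \<Rightarrow> {\<omega>\<in>space M. \<xi>2 (Suc k) \<omega> = b} | Pick1 _ \<Rightarrow> {\<omega>\<in>space M. U1 k \<omega> = i}
     | Pick2 _ \<Rightarrow> {\<omega>\<in>space M. U2 k \<omega> = j} | Init \<Rightarrow> {})" for s
  have "prob (\<Inter>s\<in>next_sources k. E s) = (\<Prod>s\<in>next_sources k. prob (E s))"
    by (rule indep_setsD[OF indep_gen])
       (use k atom_gen[OF k] in \<open>auto simp: next_sources_def E_def\<close>)
  moreover have "(\<Inter>s\<in>next_sources k. E s) = atom k a b i j"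
    by (auto simp: next_sources_def E_def atom_def)
  moreover have "(\<Prod>s\<in>next_sources k. prob (E s)) = sign_prob p1 a * sign_prob p2 b / (real k)^2"
    using k a i by (auto simp: next_sources_def E_def prob_pick \<xi>1_law \<xi>2_law sign_prob_def power2_eq_square)
  ultimately show ?thesis by simp
qed

lemma atom_next: 
  assumes "k \<ge> 1"
  shows "atom k a b i j \<in> sigma_sets (space M) (\<Union>i\<in>next_sources k. gen i)"
proof -
  have sub: "(\<Union>i\<in>next_sources k. gen i) \<subseteq> Pow (space M)"
    using gen_events[of "Sign1 (Suc k)"] gen_events[of "Sign2 (Suc k)"] gen_events[of "Pick1 k"] gen_events[of "Pick2 k"] sets.space_closed[of M] assms
    unfolding next_sources_def by auto
  interpret S: sigma_algebra "space M" "sigma_sets (space M) (\<Union>i\<in>next_sources k. gen i)"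
    by (rule sigma_algebra_sigma_sets[OF sub])
  have "atom k a b i j = {\<omega>\<in>space M. \<xi>1 (Suc k) \<omega> = a} \<inter> {\<omega>\<in>space M. \<xi>2 (Suc k) \<omega> = b} \<inter>
     {\<omega>\<in>space M. U1 k \<omega> = i} \<inter> {\<omega>\<in>space M. U2 k \<omega> = j}"
    by (auto simp: atom_def)
  also have "\<dots> \<in> sigma_sets (space M) (\<Union>i\<in>next_sources k. gen i)"
    by (intro S.Int sigma_sets.Basic)
       (use atom_gen(1)[OF assms, of a] atom_gen(2)[OF assms, of b] atom_gen(3)[OF assms, of i] atom_gen(4)[OF assms, of j]
         in \<open>auto simp: next_sources_def\<close>)
  finally show ?thesis .
qed

lemma expectation_past_times_atom:
  fixes Z :: "'a \<Rightarrow> 'c::{real_normed_field, banach, second_countable_topology}"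
  assumes k: "k \<ge> 1" and Z: "Z \<in> borel_measurable (hist k)" and int: "integrable M Z"
  shows "(\<integral>\<omega>. Z \<omega> * indicator (atom k a b i j) \<omega> \<partial>M) = (\<integral>\<omega>. Z \<omega> \<partial>M) * of_real (prob (atom k a b i j))"
    and "integrable M (\<lambda>\<omega>. Z \<omega> * indicator (atom k a b i j) \<omega>)"
proof -
  let ?C = "atom k a b i j" and ?S = "sigma_sets (space M) (\<Union>i\<in>next_sources k. gen i)"
  have C: "?C \<in> ?S" by (rule atom_next[OF k])
  have Cev: "?C \<in> events" using indep_setD_ev2[OF hist_indep_next[OF k]] C by auto
  have sub: "(\<Union>i\<in>next_sources k. gen i) \<subseteq> Pow (space M)"
    using gen_events[of "Sign1 (Suc k)"] gen_events[of "Sign2 (Suc k)"] gen_events[of "Pick1 k"] gen_events[of "Pick2 k"] sets.space_closed[of M] k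
    unfolding next_sources_def by auto
  interpret S: sigma_algebra "space M" ?S
    by (rule sigma_algebra_sigma_sets[OF sub])
  have "indep_var borel Z borel (indicator ?C :: 'a \<Rightarrow> 'c)"
    unfolding indep_var_eq
  proof (intro conjI)
    show "random_variable borel Z" by (rule hist_measurable_M[OF Z])
    show "random_variable borel (indicator ?C :: 'a \<Rightarrow> 'c)" using Cev by simp
    have 1: "sigma_sets (space M) {Z -` A \<inter> space M | A. A \<in> sets borel} \<subseteq> sets (hist k)"
      using measurable_sets[OF Z] sets.sigma_sets_subset[of "{Z -` A \<inter> space M | A. A \<in> sets borel}" "hist k"] by auto
    have 2: "sigma_sets (space M) {(indicator ?C :: 'a \<Rightarrow> 'c) -` A \<inter> space M | A. A \<in> sets borel} \<subseteq> ?S"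
    proof (rule S.sigma_sets_subset, safe)
      fix A :: "'c set" assume "A \<in> sets borel"
      have "(indicator ?C :: 'a \<Rightarrow> 'c) -` A \<inter> space M = (if 1 \<in> A then ?C else {}) \<union> (if 0 \<in> A then space M - ?C else {})"
        by (cases "1 \<in> A"; cases "0 \<in> A") (auto simp: atom_def split: split_indicator split_indicator_asm)
      also have "\<dots> \<in> ?S" using C by auto
      finally show "(indicator ?C :: 'a \<Rightarrow> 'c) -` A \<inter> space M \<in> ?S" .
    qed
    show "indep_set (sigma_sets (space M) {Z -` A \<inter> space M | A. A \<in> sets borel})
       (sigma_sets (space M) {(indicator ?C :: 'a \<Rightarrow> 'c) -` A \<inter> space M | A. A \<in> sets borel})"
      by (intro indep_setI order_trans[OF 1 hist_events] order_trans[OF 2 indep_setD_ev2[OF hist_indep_next[OF k]]]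
            indep_setD[OF hist_indep_next[OF k]] subsetD[OF 1] subsetD[OF 2])
  qed
  moreover have "has_bochner_integral M (indicator ?C) (of_real (prob ?C) :: 'c)"
  proof -
    have "has_bochner_integral M (\<lambda>\<omega>. indicator ?C \<omega> *\<^sub>R (1::'c)) (prob ?C *\<^sub>R 1)"
      by (rule has_bochner_integral_indicator) (use Cev in \<open>auto simp: less_top[symmetric]\<close>)
    moreover have "(\<lambda>\<omega>. indicator ?C \<omega> *\<^sub>R (1::'c)) = indicator ?C"
      by (auto split: split_indicator)
    ultimately show ?thesis by (simp add: scaleR_conv_of_real)
  qed
  then have "integrable M (indicator ?C :: 'a \<Rightarrow> 'c)" "(\<integral>\<omega>. (indicator ?C \<omega> :: 'c) \<partial>M) = of_real (prob ?C)"
    by (auto simp: has_bochner_integral_iff)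
  ultimately show "(\<integral>\<omega>. Z \<omega> * indicator ?C \<omega> \<partial>M) = (\<integral>\<omega>. Z \<omega> \<partial>M) * of_real (prob ?C)"
    "integrable M (\<lambda>\<omega>. Z \<omega> * indicator ?C \<omega>)"
    using indep_var_lebesgue_integral[of Z "indicator ?C"] indep_var_integrable[of Z "indicator ?C"] int by auto
qed


lemma sign_average:
  fixes u :: "int \<Rightarrow> 'c::{real_normed_field, banach, second_countable_topology}"
  assumes "x = -1 \<or> x = 1"
  shows "(\<Sum>a\<in>{-1,1}. of_real (sign_prob p a) * u (a * x)) =
     (u 1 + u (-1)) / 2 + (u 1 - u (-1)) / 2 * of_real ((2 * p - 1) * real_of_int x)"
  using assms by (auto simp: sign_prob_def field_simps)

text \<open>The conditional law of \<open>(X\<^sub>k\<^sub>+\<^sub>1\<^sup>1, X\<^sub>k\<^sub>+\<^sub>1\<^sup>2)\<close> given the past, in the form in which it is used: conditionally the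
two steps are independent signs whose means are the memory parameters times the averages of the other
walk.  A function of a sign is affine, \<open>u(x) = (u(1) + u(-1))/2 + x (u(1) - u(-1))/2\<close>, so the mean
determines its expectation.  Both the moments and the characteristic functions of the innovations are
instances, which is why \<open>Z\<close>, \<open>u\<close> and \<open>v\<close> may be real or complex.\<close>

lemma expectation_next_step:
  fixes Z :: "'a \<Rightarrow> 'c::{real_normed_field, banach, second_countable_topology}"
  assumes k: "k \<ge> 1" and Z: "Z \<in> borel_measurable (hist k)" and bd: "\<And>\<omega>. \<omega> \<in> space M \<Longrightarrow> norm (Z \<omega>) \<le> K"
  shows "(\<integral>\<omega>. Z \<omega> * u (X1 (Suc k) \<omega>) * v (X2 (Suc k) \<omega>) \<partial>M) =
    (\<integral>\<omega>. Z \<omega> * ((u 1 + u (-1)) / 2 + (u 1 - u (-1)) / 2 * of_real ((2 * p1 - 1) * s2 k \<omega> / k))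
          * ((v 1 + v (-1)) / 2 + (v 1 - v (-1)) / 2 * of_real ((2 * p2 - 1) * s1 k \<omega> / k)) \<partial>M)"
proof -
  let ?S = "{-1,1::int}" and ?I = "{1..k}"
  define Y where "Y a b i j \<omega> = Z \<omega> * u (a * X2 j \<omega>) * v (b * X1 i \<omega>)" for a b i j \<omega>
  have [measurable]: "Z \<in> borel_measurable (hist k)" by fact
  have Ym: "Y a b i j \<in> borel_measurable (hist k)" if "i \<in> ?I" "j \<in> ?I" for a b i j
  proof -
    have "(\<lambda>\<omega>. u (a * X2 j \<omega>)) \<in> borel_measurable (hist k)" "(\<lambda>\<omega>. v (b * X1 i \<omega>)) \<in> borel_measurable (hist k)"
      using that by (auto intro: measurable_compose[OF X_measurable_hist(2)] measurable_compose[OF X_measurable_hist(1)])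
    then show ?thesis unfolding Y_def[abs_def] by measurable
  qed
  define C where "C = norm (u 1) + norm (u (-1))"
  define C' where "C' = norm (v 1) + norm (v (-1))"
  have ub: "norm (u (a * x)) \<le> C" "norm (v (a * x)) \<le> C'" if "a \<in> ?S" "x = -1 \<or> x = 1" for a x
    using that by (auto simp: C_def C'_def)
  have Yb: "norm (Y a b i j \<omega>) \<le> K * C * C'" if "i \<in> ?I" "j \<in> ?I" "a \<in> ?S" "b \<in> ?S" "\<omega> \<in> space M" for a b i j \<omega>
    unfolding Y_def norm_mult
    by (intro mult_mono bd ub X_values mult_nonneg_nonneg order_trans[OF norm_ge_zero bd]) (use that in \<open>auto simp: C_def C'_def\<close>)
  have Yi: "integrable M (Y a b i j)" if "i \<in> ?I" "j \<in> ?I" "a \<in> ?S" "b \<in> ?S" for a b i j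
    by (rule integrable_const_bound[where B="K * C * C'"])
       (use Yb[OF that] hist_measurable_M[OF Ym[OF that(1,2)]] in auto)
  \<comment> \<open>Partition according to the choices made at step \<open>k + 1\<close>.\<close>
  have split: "Z \<omega> * u (X1 (Suc k) \<omega>) * v (X2 (Suc k) \<omega>) =
      (\<Sum>a\<in>?S. \<Sum>b\<in>?S. \<Sum>i\<in>?I. \<Sum>j\<in>?I. Y a b i j \<omega> * indicator (atom k a b i j) \<omega>)"
    if w: "\<omega> \<in> space M" for \<omega>
  proof -
    have m: "\<xi>1 (Suc k) \<omega> \<in> ?S" "\<xi>2 (Suc k) \<omega> \<in> ?S" "U1 k \<omega> \<in> ?I" "U2 k \<omega> \<in> ?I"
      using measurable_space[OF \<xi>1_measurable[of "Suc k"] w] measurable_space[OF \<xi>2_measurable[of "Suc k"] w]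
         measurable_space[OF U1_measurable[OF k] w] measurable_space[OF U2_measurable[OF k] w] k by auto
    have ind: "Y a b i j \<omega> * indicator (atom k a b i j) \<omega> =
       (if U2 k \<omega> = j then if U1 k \<omega> = i then if \<xi>2 (Suc k) \<omega> = b then if \<xi>1 (Suc k) \<omega> = a then
           Y a b i j \<omega> else 0 else 0 else 0 else 0)" for a b i j
      using w by (auto simp: atom_def)
    have "(\<Sum>a\<in>?S. \<Sum>b\<in>?S. \<Sum>i\<in>?I. \<Sum>j\<in>?I. Y a b i j \<omega> * indicator (atom k a b i j) \<omega>)
       = Y (\<xi>1 (Suc k) \<omega>) (\<xi>2 (Suc k) \<omega>) (U1 k \<omega>) (U2 k \<omega>) \<omega>"
      unfolding ind using m by (simp only: sum.delta' finite_atLeastAtMost finite_insert finite.emptyI if_True)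
    also have "\<dots> = Z \<omega> * u (X1 (Suc k) \<omega>) * v (X2 (Suc k) \<omega>)"
      unfolding Y_def using X1_Suc[OF k w] X2_Suc[OF k w] by simp
    finally show ?thesis ..
  qed
  have "(\<integral>\<omega>. Z \<omega> * u (X1 (Suc k) \<omega>) * v (X2 (Suc k) \<omega>) \<partial>M)
     = (\<integral>\<omega>. (\<Sum>a\<in>?S. \<Sum>b\<in>?S. \<Sum>i\<in>?I. \<Sum>j\<in>?I. Y a b i j \<omega> * indicator (atom k a b i j) \<omega>) \<partial>M)"
    by (rule Bochner_Integration.integral_cong[OF refl split])
  also have "\<dots> = (\<Sum>a\<in>?S. \<Sum>b\<in>?S. \<Sum>i\<in>?I. \<Sum>j\<in>?I. \<integral>\<omega>. Y a b i j \<omega> * indicator (atom k a b i j) \<omega> \<partial>M)"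
    by (rule integral_sum4) (rule expectation_past_times_atom(2)[OF k Ym Yi])
  also have "\<dots> = (\<Sum>a\<in>?S. \<Sum>b\<in>?S. \<Sum>i\<in>?I. \<Sum>j\<in>?I.
      \<integral>\<omega>. of_real (sign_prob p1 a * sign_prob p2 b / (real k)^2) * Y a b i j \<omega> \<partial>M)"
    by (intro sum.cong refl) (simp add: expectation_past_times_atom(1)[OF k Ym Yi] prob_atom[OF k] mult.commute del: of_real_mult of_real_divide)
  also have "\<dots> = (\<integral>\<omega>. (\<Sum>a\<in>?S. \<Sum>b\<in>?S. \<Sum>i\<in>?I. \<Sum>j\<in>?I.
       of_real (sign_prob p1 a * sign_prob p2 b / (real k)^2) * Y a b i j \<omega>) \<partial>M)"
    by (rule integral_sum4[symmetric]) (intro integrable_mult_right Yi)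
  also have "\<dots> = (\<integral>\<omega>. Z \<omega> * ((u 1 + u (-1)) / 2 + (u 1 - u (-1)) / 2 * of_real ((2 * p1 - 1) * s2 k \<omega> / k))
          * ((v 1 + v (-1)) / 2 + (v 1 - v (-1)) / 2 * of_real ((2 * p2 - 1) * s1 k \<omega> / k)) \<partial>M)"
  proof (rule Bochner_Integration.integral_cong[OF refl])
    fix \<omega> assume w: "\<omega> \<in> space M"
    \<comment> \<open>Averaging over the sign and the uniform index turns the past steps into the average of the walk.\<close>
    have avg: "(\<Sum>a\<in>?S. \<Sum>j\<in>?I. of_real (sign_prob p a) * f (a * X j \<omega>)) / of_nat k
       = (f 1 + f (-1)) / 2 + (f 1 - f (-1)) / 2 * of_real ((2 * p - 1) * (\<Sum>j\<in>?I. real_of_int (X j \<omega>)) / k)"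
      if X: "\<And>j. j \<in> ?I \<Longrightarrow> X j \<omega> = -1 \<or> X j \<omega> = 1" for X :: "nat \<Rightarrow> 'a \<Rightarrow> int" and p and f :: "int \<Rightarrow> 'c"
    proof -
      have affine: "(\<Sum>j\<in>?I. g + h * of_real (c * r j)) = of_nat k * g + h * of_real (c * (\<Sum>j\<in>?I. r j))"
        for g h :: 'c and c :: real and r :: "nat \<Rightarrow> real"
        by (simp add: sum.distrib sum_distrib_left)
      have "(\<Sum>a\<in>?S. \<Sum>j\<in>?I. of_real (sign_prob p a) * f (a * X j \<omega>)) =
         (\<Sum>j\<in>?I. (f 1 + f (-1)) / 2 + (f 1 - f (-1)) / 2 * of_real ((2 * p - 1) * real_of_int (X j \<omega>)))"
        by (subst sum.swap) (intro sum.cong refl sign_average X)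
      also have "\<dots> = of_nat k * ((f 1 + f (-1)) / 2) + (f 1 - f (-1)) / 2 * of_real ((2 * p - 1) * (\<Sum>j\<in>?I. real_of_int (X j \<omega>)))"
        by (rule affine)
      finally have *: "(\<Sum>a\<in>?S. \<Sum>j\<in>?I. of_real (sign_prob p a) * f (a * X j \<omega>)) = \<dots>" .
      have "L / of_nat k = g + h * of_real (x / k)" if "L = of_nat k * g + h * of_real x" for L g h :: 'c and x :: real
        using k that by (simp add: field_simps)
      from this[OF *] show ?thesis .
    qed
    have "(\<Sum>a\<in>?S. \<Sum>b\<in>?S. \<Sum>i\<in>?I. \<Sum>j\<in>?I. of_real (sign_prob p1 a * sign_prob p2 b / (real k)^2) * Y a b i j \<omega>)
      = Z \<omega> * ((\<Sum>a\<in>?S. \<Sum>j\<in>?I. of_real (sign_prob p1 a) * u (a * X2 j \<omega>)) / of_nat k)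
         * ((\<Sum>b\<in>?S. \<Sum>i\<in>?I. of_real (sign_prob p2 b) * v (b * X1 i \<omega>)) / of_nat k)"
      (is "?L = ?R")
    proof -
      have "?R = (Z \<omega> / (of_nat k)^2) * ((\<Sum>a\<in>?S. \<Sum>j\<in>?I. of_real (sign_prob p1 a) * u (a * X2 j \<omega>))
         * (\<Sum>b\<in>?S. \<Sum>i\<in>?I. of_real (sign_prob p2 b) * v (b * X1 i \<omega>)))"
        by (simp add: power2_eq_square)
      also have "\<dots> = ?L"
        by (subst sum_product4, simp only: sum_distrib_left, intro sum.cong refl) (simp add: Y_def)
      finally show ?thesis ..
    qed
    also have "\<dots> = Z \<omega> * ((u 1 + u (-1)) / 2 + (u 1 - u (-1)) / 2 * of_real ((2 * p1 - 1) * s2 k \<omega> / k))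
          * ((v 1 + v (-1)) / 2 + (v 1 - v (-1)) / 2 * of_real ((2 * p2 - 1) * s1 k \<omega> / k))"
      using X_values(1)[OF _ w] X_values(2)[OF _ w]
      by (subst avg, simp)+ (simp add: s1_def s2_def walk_def)
    finally show "(\<Sum>a\<in>?S. \<Sum>b\<in>?S. \<Sum>i\<in>?I. \<Sum>j\<in>?I. of_real (sign_prob p1 a * sign_prob p2 b / (real k)^2) * Y a b i j \<omega>)
      = Z \<omega> * ((u 1 + u (-1)) / 2 + (u 1 - u (-1)) / 2 * of_real ((2 * p1 - 1) * s2 k \<omega> / k))
          * ((v 1 + v (-1)) / 2 + (v 1 - v (-1)) / 2 * of_real ((2 * p2 - 1) * s1 k \<omega> / k))" .
  qed
  finally show ?thesis .
qed

end

section \<open>Innovations\<close>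

lemma norm_integral_le:
  fixes f :: "'a \<Rightarrow> 'b::{banach, second_countable_topology}"
  assumes g: "integrable M g" and le: "\<And>x. x \<in> space M \<Longrightarrow> norm (f x) \<le> g x"
  shows "norm (\<integral>x. f x \<partial>M) \<le> (\<integral>x. g x \<partial>M)"
  by (rule order_trans[OF integral_norm_bound integral_mono'[OF g]])
     (auto intro: le order_trans[OF norm_ge_zero le])

text \<open>The characteristic function of \<open>\<zeta> - \<beta>\<close> for a random sign \<open>\<zeta>\<close> of mean \<open>\<beta>\<close>: the conditional
characteristic function of an innovation.\<close>

definition centred_sign_char :: "real \<Rightarrow> real \<Rightarrow> complex" where
  "centred_sign_char \<beta> u = iexp (- (u * \<beta>)) * (of_real (cos u) + \<i> * of_real (sin u) * of_real \<beta>)"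

lemma centred_sign_char_alt:
  "centred_sign_char \<beta> u = of_real ((1 + \<beta>) / 2) * iexp (u * (1 - \<beta>)) + of_real ((1 - \<beta>) / 2) * iexp (- (u * (1 + \<beta>)))"
proof -
  have e: "iexp (u * (1 - \<beta>)) = iexp (- (u * \<beta>)) * iexp u" "iexp (- (u * (1 + \<beta>))) = iexp (- (u * \<beta>)) * iexp (- u)"
    by (simp_all add: exp_add[symmetric] algebra_simps)
  have c: "iexp u = of_real (cos u) + \<i> * of_real (sin u)" "iexp (-u) = of_real (cos u) - \<i> * of_real (sin u)"
    using cis_conv_exp[of u, symmetric] cis_conv_exp[of "-u", symmetric] by (simp_all add: complex_eq_iff)
  show ?thesis unfolding e centred_sign_char_def c by (simp add: field_simps)
qed

lemma iexp_taylor2: "cmod (iexp x - (1 + \<i> * of_real x - (of_real x)^2 / 2)) \<le> \<bar>x\<bar>^3 / 6"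
proof -
  have "(\<Sum>k\<le>2. (\<i> * complex_of_real x)^k / fact k) = 1 + \<i> * of_real x - (of_real x)^2 / 2"
    by (simp add: numeral_2_eq_2 power_mult_distrib)
  then show ?thesis using iexp_approx1[of x 2] by (simp add: numeral_3_eq_3 fact_numeral numeral_2_eq_2)
qed

lemma exp_neg_quadratic: "0 \<le> x \<Longrightarrow> \<bar>exp (- x) - (1 - x)\<bar> \<le> x^2 / (2::real)"
proof -
  assume x: "0 \<le> x"
  have 1: "1 - x \<le> exp (- x)" using exp_ge_add_one_self[of "-x"] by simp
  have "exp x \<ge> 1 + x + x^2/2" using exp_lower_Taylor_quadratic[OF x] by simp
  moreover have "(1 + x + x^2/2) * (1 - x + x^2/2) = 1 + (x^2)^2/4"
    by (simp add: power2_eq_square algebra_simps)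
  then have "(1 + x + x^2/2) * (1 - x + x^2/2) \<ge> 1" by simp
  moreover have p: "1 - x + x^2/2 > 0" 
    using sum_power2_gt_zero_iff[of "1-x" 1] by (simp add: power2_eq_square algebra_simps)
  ultimately have "exp x * (1 - x + x^2/2) \<ge> 1" 
    by (smt (verit) mult_right_mono)
  then have "exp (- x) \<le> 1 - x + x^2/2" by (simp add: exp_minus field_simps)
  with 1 show ?thesis by simp
qed

text \<open>The variance is \<open>1 - \<beta>\<^sup>2\<close>.  Comparing with the Gaussian of variance \<open>1\<close> instead costs the term \<open>u\<^sup>2 \<beta>\<^sup>2\<close>,
which will be small on average because \<open>\<beta>\<close> is a multiple of an average of a walk.\<close>

lemma centred_sign_char_approx:
  assumes b: "\<bar>\<beta>\<bar> \<le> 1" and u: "\<bar>u\<bar> \<le> 1"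
  shows "cmod (centred_sign_char \<beta> u - of_real (exp (- (u^2 / 2)))) \<le> 2 * \<bar>u\<bar>^3 + u^2 * \<beta>^2"
proof -
  let ?x = "u * (1 - \<beta>)" and ?y = "- (u * (1 + \<beta>))"
  \<comment> \<open>Second order Taylor polynomials of the two exponentials; their linear terms cancel in the mixture.\<close>
  let ?T = "\<lambda>x::real. 1 + \<i> * of_real x - (of_real x)^2 / 2 :: complex"
  have ab: "0 \<le> (1 + \<beta>) / 2" "0 \<le> (1 - \<beta>) / 2" using b by (auto simp: abs_le_iff)
  have T: "of_real ((1 + \<beta>) / 2) * ?T ?x + of_real ((1 - \<beta>) / 2) * ?T ?y = of_real (1 - u^2 * (1 - \<beta>^2) / 2)"
    by (simp add: field_simps power2_eq_square)
  have c: "\<bar>?x\<bar>^3 / 6 \<le> 8 * \<bar>u\<bar>^3 / 6" "\<bar>?y\<bar>^3 / 6 \<le> 8 * \<bar>u\<bar>^3 / 6"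
  proof -
    have "\<bar>?x\<bar> \<le> \<bar>u\<bar> * 2" "\<bar>?y\<bar> \<le> \<bar>u\<bar> * 2"
      unfolding abs_mult abs_minus_cancel by (intro mult_left_mono; use b in auto)+
    then have "\<bar>?x\<bar>^3 \<le> (\<bar>u\<bar> * 2)^3" "\<bar>?y\<bar>^3 \<le> (\<bar>u\<bar> * 2)^3"
      by (intro power_mono; simp)+
    then show "\<bar>?x\<bar>^3 / 6 \<le> 8 * \<bar>u\<bar>^3 / 6" "\<bar>?y\<bar>^3 / 6 \<le> 8 * \<bar>u\<bar>^3 / 6" by (simp_all add: power_mult_distrib)
  qed
  have xx: "cmod (iexp ?x - ?T ?x) \<le> 8 * \<bar>u\<bar>^3 / 6" by (rule order_trans[OF iexp_taylor2 c(1)])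
  have yy: "cmod (iexp ?y - ?T ?y) \<le> 8 * \<bar>u\<bar>^3 / 6" by (rule order_trans[OF iexp_taylor2 c(2)])
  have "cmod (centred_sign_char \<beta> u - of_real (1 - u^2 * (1 - \<beta>^2) / 2))
     = cmod (of_real ((1 + \<beta>) / 2) * (iexp ?x - ?T ?x) + of_real ((1 - \<beta>) / 2) * (iexp ?y - ?T ?y))"
    unfolding T[symmetric] centred_sign_char_alt by (simp only: algebra_simps)
  also have "\<dots> \<le> (1 + \<beta>) / 2 * cmod (iexp ?x - ?T ?x) + (1 - \<beta>) / 2 * cmod (iexp ?y - ?T ?y)"
    by (rule order_trans[OF norm_triangle_ineq]) (use ab in \<open>simp only: norm_mult norm_of_real abs_of_nonneg order_refl\<close>)
  also have "\<dots> \<le> (1 + \<beta>) / 2 * (8 * \<bar>u\<bar>^3 / 6) + (1 - \<beta>) / 2 * (8 * \<bar>u\<bar>^3 / 6)"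
    by (intro add_mono mult_left_mono ab xx yy)
  also have "\<dots> = 4/3 * \<bar>u\<bar>^3" by (simp add: field_simps)
  finally have 1: "cmod (centred_sign_char \<beta> u - of_real (1 - u^2 * (1 - \<beta>^2) / 2)) \<le> 4/3 * \<bar>u\<bar>^3" .
  have "\<bar>exp (- (u^2/2)) - (1 - u^2/2)\<bar> \<le> (u^2/2)^2/2" by (rule exp_neg_quadratic) simp
  also have "\<dots> = \<bar>u\<bar>^3 * \<bar>u\<bar> / 8" by (simp add: power2_eq_square power3_eq_cube)
  also have "\<dots> \<le> \<bar>u\<bar>^3 * 1 / 8" by (intro divide_right_mono mult_left_mono u) auto
  finally have 2: "\<bar>exp (- (u^2/2)) - (1 - u^2/2)\<bar> \<le> \<bar>u\<bar>^3 / 8" by simp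
  have "cmod (of_real (1 - u^2 * (1 - \<beta>^2) / 2) - of_real (exp (- (u^2/2)))) \<le> \<bar>u\<bar>^3 / 8 + u^2 * \<beta>^2 / 2"
  proof -
    have "1 - u^2 * (1 - \<beta>^2) / 2 - exp (- (u^2/2)) = u^2 * \<beta>^2 / 2 - (exp (- (u^2/2)) - (1 - u^2/2))"
      by (simp add: field_simps)
    then show ?thesis
      unfolding of_real_diff[symmetric] norm_of_real
      using order_trans[OF abs_triangle_ineq4 add_left_mono[OF 2], of "u^2 * \<beta>^2 / 2"]
      by (simp only: abs_mult abs_divide abs_power2 abs_numeral add.commute)
  qed
  with 1 have "cmod (centred_sign_char \<beta> u - of_real (exp (- (u^2/2)))) \<le> 4/3 * \<bar>u\<bar>^3 + (\<bar>u\<bar>^3 / 8 + u^2 * \<beta>^2 / 2)"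
    by (rule norm_diff_triangle_le)
  also have "\<dots> \<le> 2 * \<bar>u\<bar>^3 + u^2 * \<beta>^2" 
    by (simp add: field_simps)
  finally show ?thesis .
qed

lemma norm_mult_diff_le_1:
  fixes a b c d :: complex
  assumes "cmod b \<le> 1" "cmod c \<le> 1"
  shows "cmod (a * b - c * d) \<le> cmod (a - c) + cmod (b - d)"
proof -
  have "a * b - c * d = (a - c) * b + c * (b - d)" by (simp add: algebra_simps)
  then have "cmod (a * b - c * d) \<le> cmod (a - c) * cmod b + cmod c * cmod (b - d)"
    by (metis norm_mult norm_triangle_ineq)
  also have "\<dots> \<le> cmod (a - c) * 1 + 1 * cmod (b - d)"
    by (intro add_mono mult_left_mono mult_right_mono assms) auto
  finally show ?thesis by simp
qed

lemma centred_sign_char_le_1: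
  assumes b: "\<bar>\<beta>\<bar> \<le> 1"
  shows "cmod (centred_sign_char \<beta> u) \<le> 1"
proof -
  have ab: "0 \<le> (1 + \<beta>) / 2" "0 \<le> (1 - \<beta>) / 2" using b by (auto simp: abs_le_iff)
  have "cmod (centred_sign_char \<beta> u) \<le> (1 + \<beta>) / 2 + (1 - \<beta>) / 2"
    unfolding centred_sign_char_alt
    by (rule order_trans[OF norm_triangle_ineq]) (use ab in \<open>simp only: norm_mult norm_of_real abs_of_nonneg norm_exp_i_times mult_1_right order_refl\<close>)
  then show ?thesis by (simp add: field_simps)
qed

context interacting_erw
begin

definition mem1 :: real where "mem1 = 2 * p1 - 1"
definition mem2 :: real where "mem2 = 2 * p2 - 1"

lemma abs_mem: "\<bar>mem1\<bar> \<le> 1" "\<bar>mem2\<bar> \<le> 1"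
  using p1 p2 by (auto simp: mem1_def mem2_def abs_le_iff)

definition drift1 :: "nat \<Rightarrow> 'a \<Rightarrow> real" where "drift1 k \<omega> = mem1 * s2 k \<omega> / k"
definition drift2 :: "nat \<Rightarrow> 'a \<Rightarrow> real" where "drift2 k \<omega> = mem2 * s1 k \<omega> / k"

definition innov1 :: "nat \<Rightarrow> 'a \<Rightarrow> real" where "innov1 k \<omega> = x1 k \<omega> - drift1 (k - 1) \<omega>"
definition innov2 :: "nat \<Rightarrow> 'a \<Rightarrow> real" where "innov2 k \<omega> = x2 k \<omega> - drift2 (k - 1) \<omega>"

lemma drift_measurable_hist [measurable]: "drift1 k \<in> borel_measurable (hist k)" "drift2 k \<in> borel_measurable (hist k)"
  unfolding drift1_def[abs_def] drift2_def[abs_def] by measurable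

lemma drift_measurable [measurable]: "drift1 k \<in> borel_measurable M" "drift2 k \<in> borel_measurable M"
  unfolding drift1_def[abs_def] drift2_def[abs_def] by measurable

lemma abs_drift_le: "\<omega> \<in> space M \<Longrightarrow> \<bar>drift1 k \<omega>\<bar> \<le> 1" "\<omega> \<in> space M \<Longrightarrow> \<bar>drift2 k \<omega>\<bar> \<le> 1"
proof -
  assume w: "\<omega> \<in> space M"
  have "\<bar>mem1 * s2 k \<omega>\<bar> \<le> 1 * real k" "\<bar>mem2 * s1 k \<omega>\<bar> \<le> 1 * real k"
    unfolding abs_mult by (intro mult_mono abs_mem abs_s_le w; simp)+
  then show "\<bar>drift1 k \<omega>\<bar> \<le> 1" "\<bar>drift2 k \<omega>\<bar> \<le> 1"
    by (auto simp: drift1_def drift2_def divide_le_eq)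
qed

lemma abs_x: "1 \<le> k \<Longrightarrow> \<omega> \<in> space M \<Longrightarrow> \<bar>x1 k \<omega>\<bar> = 1" "1 \<le> k \<Longrightarrow> \<omega> \<in> space M \<Longrightarrow> \<bar>x2 k \<omega>\<bar> = 1"
  using X_values[of k \<omega>] by (auto simp: x1_def x2_def)

lemma abs_innov_le: "1 \<le> k \<Longrightarrow> \<omega> \<in> space M \<Longrightarrow> \<bar>innov1 k \<omega>\<bar> \<le> 2" "1 \<le> k \<Longrightarrow> \<omega> \<in> space M \<Longrightarrow> \<bar>innov2 k \<omega>\<bar> \<le> 2"
  using abs_x[of k \<omega>] abs_drift_le[of \<omega> "k - 1"] unfolding innov1_def innov2_def by linarith+

lemma x_measurable_hist:
  assumes "1 \<le> j" "j \<le> k"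
  shows "x1 j \<in> borel_measurable (hist k)" "x2 j \<in> borel_measurable (hist k)"
  unfolding x1_def[abs_def] x2_def[abs_def]
  by (rule measurable_compose[OF X_measurable_hist(1)[OF assms]], simp)
     (rule measurable_compose[OF X_measurable_hist(2)[OF assms]], simp)

lemma innov_measurable_hist:
  assumes "1 \<le> j" "j \<le> k"
  shows "innov1 j \<in> borel_measurable (hist k)" "innov2 j \<in> borel_measurable (hist k)"
  unfolding innov1_def[abs_def] innov2_def[abs_def]
  by (intro borel_measurable_diff x_measurable_hist assms hist_measurable_mono[OF drift_measurable_hist(1), of "j - 1" k]
         hist_measurable_mono[OF drift_measurable_hist(2), of "j - 1" k]; use assms in simp)+

definition innov_sum :: "(nat \<Rightarrow> real) \<Rightarrow> (nat \<Rightarrow> real) \<Rightarrow> nat \<Rightarrow> nat \<Rightarrow> 'a \<Rightarrow> real" where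
  "innov_sum u v j K \<omega> = (\<Sum>k\<in>{j<..K}. u k * innov1 k \<omega> + v k * innov2 k \<omega>)"

lemma innov_sum_measurable_hist: "innov_sum u v j K \<in> borel_measurable (hist K)"
  unfolding innov_sum_def[abs_def]
  by (intro borel_measurable_sum borel_measurable_add borel_measurable_times borel_measurable_const innov_measurable_hist) auto

lemma innov_sum_measurable [measurable]: "innov_sum u v j K \<in> borel_measurable M"
  by (rule hist_measurable_M[OF innov_sum_measurable_hist])

lemma innov_sum_Suc: "j \<le> K \<Longrightarrow> innov_sum u v j (Suc K) \<omega> = innov_sum u v j K \<omega> + (u (Suc K) * innov1 (Suc K) \<omega> + v (Suc K) * innov2 (Suc K) \<omega>)"
proof -
  assume "j \<le> K"
  then have "{j<..Suc K} = insert (Suc K) {j<..K}" by auto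
  then show ?thesis unfolding innov_sum_def by simp
qed

lemma abs_innov_sum_le:
  assumes "\<omega> \<in> space M"
  shows "\<bar>innov_sum u v j K \<omega>\<bar> \<le> (\<Sum>k\<in>{j<..K}. 2 * (\<bar>u k\<bar> + \<bar>v k\<bar>))"
  unfolding innov_sum_def
proof (rule order_trans[OF sum_abs sum_mono])
  fix k assume "k \<in> {j<..K}"
  then have "\<bar>innov1 k \<omega>\<bar> \<le> 2" "\<bar>innov2 k \<omega>\<bar> \<le> 2" using abs_innov_le[OF _ assms] by auto
  then have "\<bar>u k * innov1 k \<omega>\<bar> \<le> \<bar>u k\<bar> * 2" "\<bar>v k * innov2 k \<omega>\<bar> \<le> \<bar>v k\<bar> * 2"
    unfolding abs_mult by (intro mult_left_mono; simp)+
  then show "\<bar>u k * innov1 k \<omega> + v k * innov2 k \<omega>\<bar> \<le> 2 * (\<bar>u k\<bar> + \<bar>v k\<bar>)"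
    using order_trans[OF abs_triangle_ineq add_mono, of "u k * innov1 k \<omega>" "\<bar>u k\<bar> * 2" "v k * innov2 k \<omega>" "\<bar>v k\<bar> * 2"]
    by (simp add: algebra_simps)
qed

text \<open>Conditional first and second moments, tested against bounded random variables of the past.\<close>

lemma innov_moments:
  fixes Z :: "'a \<Rightarrow> real"
  assumes k: "k \<ge> 1" and Z: "Z \<in> borel_measurable (hist k)" and bd: "\<And>\<omega>. \<omega> \<in> space M \<Longrightarrow> \<bar>Z \<omega>\<bar> \<le> B"
  shows "(\<integral>\<omega>. Z \<omega> * innov1 (Suc k) \<omega> \<partial>M) = 0"
    and "(\<integral>\<omega>. Z \<omega> * innov2 (Suc k) \<omega> \<partial>M) = 0"
    and "(\<integral>\<omega>. Z \<omega> * (innov1 (Suc k) \<omega> * innov2 (Suc k) \<omega>) \<partial>M) = 0"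
    and "(\<integral>\<omega>. Z \<omega> * (innov1 (Suc k) \<omega>)^2 \<partial>M) = (\<integral>\<omega>. Z \<omega> * (1 - (drift1 k \<omega>)^2) \<partial>M)"
    and "(\<integral>\<omega>. Z \<omega> * (innov2 (Suc k) \<omega>)^2 \<partial>M) = (\<integral>\<omega>. Z \<omega> * (1 - (drift2 k \<omega>)^2) \<partial>M)"
proof -
  have [measurable]: "Z \<in> borel_measurable (hist k)" "Z \<in> borel_measurable M"
    using Z hist_measurable_M by blast+
  have [measurable]: "x1 (Suc k) \<in> borel_measurable M" "x2 (Suc k) \<in> borel_measurable M"
    by (auto intro: x_measurable)
  have int: "integrable M f" if "f \<in> borel_measurable M" "\<And>\<omega>. \<omega> \<in> space M \<Longrightarrow> \<bar>f \<omega>\<bar> \<le> C" for f :: "'a \<Rightarrow> real" and C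
    by (rule integrable_const_bound[where B=C]) (use that in auto)
  have le: "\<bar>a * b\<bar> \<le> A" if "\<bar>a\<bar> \<le> A" "\<bar>b\<bar> \<le> 1" for a b A :: real
    using mult_mono[of "\<bar>a\<bar>" A "\<bar>b\<bar>" 1] that by (simp add: abs_mult)
  define Q where "Q Y \<longleftrightarrow> Y \<in> borel_measurable (hist k) \<and> (\<forall>\<omega>\<in>space M. \<bar>Y \<omega>\<bar> \<le> B)" for Y :: "'a \<Rightarrow> real"
  have QZ: "Q Z" using bd by (auto simp: Q_def)
  have Qd: "Q (\<lambda>\<omega>. Y \<omega> * drift1 k \<omega>)" "Q (\<lambda>\<omega>. Y \<omega> * drift2 k \<omega>)" if "Q Y" for Y
    using that abs_drift_le by (auto simp: Q_def intro!: le)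
  have QM: "Y \<in> borel_measurable M" if "Q Y" for Y using that hist_measurable_M unfolding Q_def by blast
  have i0: "integrable M Y" if "Q Y" for Y
    by (rule int[of _ B]) (use that QM[OF that] in \<open>auto simp: Q_def\<close>)
  have i1: "integrable M (\<lambda>\<omega>. Y \<omega> * x1 (Suc k) \<omega>)" "integrable M (\<lambda>\<omega>. Y \<omega> * x2 (Suc k) \<omega>)" 
     "integrable M (\<lambda>\<omega>. Y \<omega> * x1 (Suc k) \<omega> * x2 (Suc k) \<omega>)" if "Q Y" for Y
    by (rule int[of _ B]; use that QM[OF that] abs_x[of "Suc k"] in \<open>auto simp: Q_def intro!: le\<close>)+
  have e1: "(\<integral>\<omega>. Y \<omega> * x1 (Suc k) \<omega> \<partial>M) = (\<integral>\<omega>. Y \<omega> * drift1 k \<omega> \<partial>M)" if "Q Y" for Y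
    using expectation_next_step[OF k, of Y B real_of_int "\<lambda>_. 1"] that
    by (simp add: Q_def x1_def drift1_def mem1_def)
  have e2: "(\<integral>\<omega>. Y \<omega> * x2 (Suc k) \<omega> \<partial>M) = (\<integral>\<omega>. Y \<omega> * drift2 k \<omega> \<partial>M)" if "Q Y" for Y
    using expectation_next_step[OF k, of Y B "\<lambda>_. 1" real_of_int] that
    by (simp add: Q_def x2_def drift2_def mem2_def)
  have e12: "(\<integral>\<omega>. Y \<omega> * x1 (Suc k) \<omega> * x2 (Suc k) \<omega> \<partial>M) = (\<integral>\<omega>. Y \<omega> * drift1 k \<omega> * drift2 k \<omega> \<partial>M)" if "Q Y" for Y
    using expectation_next_step[OF k, of Y B real_of_int real_of_int] that
    by (simp add: Q_def x1_def x2_def drift1_def drift2_def mem1_def mem2_def)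
  show "(\<integral>\<omega>. Z \<omega> * innov1 (Suc k) \<omega> \<partial>M) = 0"
    using e1[OF QZ] i1[OF QZ] i0[OF Qd(1)[OF QZ]] by (simp add: innov1_def algebra_simps)
  show "(\<integral>\<omega>. Z \<omega> * innov2 (Suc k) \<omega> \<partial>M) = 0"
    using e2[OF QZ] i1[OF QZ] i0[OF Qd(2)[OF QZ]] by (simp add: innov2_def algebra_simps)
  have "(\<integral>\<omega>. Z \<omega> * (innov1 (Suc k) \<omega> * innov2 (Suc k) \<omega>) \<partial>M)
    = (\<integral>\<omega>. Z \<omega> * x1 (Suc k) \<omega> * x2 (Suc k) \<omega> - (Z \<omega> * drift2 k \<omega>) * x1 (Suc k) \<omega>
        - (Z \<omega> * drift1 k \<omega>) * x2 (Suc k) \<omega> + (Z \<omega> * drift1 k \<omega>) * drift2 k \<omega> \<partial>M)"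
    by (rule Bochner_Integration.integral_cong) (simp_all add: innov1_def innov2_def algebra_simps)
  also have "\<dots> = 0"
    using e12[OF QZ] e1[OF Qd(2)[OF QZ]] e2[OF Qd(1)[OF QZ]] i1[OF QZ] i1[OF Qd(1)[OF QZ]] i1[OF Qd(2)[OF QZ]] i0[OF Qd(2)[OF Qd(1)[OF QZ]]]
    by (simp add: algebra_simps)
  finally show "(\<integral>\<omega>. Z \<omega> * (innov1 (Suc k) \<omega> * innov2 (Suc k) \<omega>) \<partial>M) = 0" .
  have sq: "(x1 (Suc k) \<omega>)^2 = 1" "(x2 (Suc k) \<omega>)^2 = 1" if "\<omega> \<in> space M" for \<omega>
    using abs_x[of "Suc k" \<omega>] that by (auto simp: power2_eq_1_iff abs_eq_iff)
  have "(\<integral>\<omega>. Z \<omega> * (innov1 (Suc k) \<omega>)^2 \<partial>M) = (\<integral>\<omega>. Z \<omega> - 2 * ((Z \<omega> * drift1 k \<omega>) * x1 (Suc k) \<omega>) + (Z \<omega> * drift1 k \<omega>) * drift1 k \<omega> \<partial>M)"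
    by (rule Bochner_Integration.integral_cong) (simp_all add: innov1_def power2_diff sq, simp add: algebra_simps power2_eq_square)
  also have "\<dots> = (\<integral>\<omega>. Z \<omega> * (1 - (drift1 k \<omega>)^2) \<partial>M)"
    using e1[OF Qd(1)[OF QZ]] i0[OF QZ] i1[OF Qd(1)[OF QZ]] i0[OF Qd(1)[OF Qd(1)[OF QZ]]]
    by (simp add: right_diff_distrib power2_eq_square mult.assoc)
  finally show "(\<integral>\<omega>. Z \<omega> * (innov1 (Suc k) \<omega>)^2 \<partial>M) = (\<integral>\<omega>. Z \<omega> * (1 - (drift1 k \<omega>)^2) \<partial>M)" .
  have "(\<integral>\<omega>. Z \<omega> * (innov2 (Suc k) \<omega>)^2 \<partial>M) = (\<integral>\<omega>. Z \<omega> - 2 * ((Z \<omega> * drift2 k \<omega>) * x2 (Suc k) \<omega>) + (Z \<omega> * drift2 k \<omega>) * drift2 k \<omega> \<partial>M)"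
    by (rule Bochner_Integration.integral_cong) (simp_all add: innov2_def power2_diff sq, simp add: algebra_simps power2_eq_square)
  also have "\<dots> = (\<integral>\<omega>. Z \<omega> * (1 - (drift2 k \<omega>)^2) \<partial>M)"
    using e2[OF Qd(2)[OF QZ]] i0[OF QZ] i1[OF Qd(2)[OF QZ]] i0[OF Qd(2)[OF Qd(2)[OF QZ]]]
    by (simp add: right_diff_distrib power2_eq_square mult.assoc)
  finally show "(\<integral>\<omega>. Z \<omega> * (innov2 (Suc k) \<omega>)^2 \<partial>M) = (\<integral>\<omega>. Z \<omega> * (1 - (drift2 k \<omega>)^2) \<partial>M)" .
qed

text \<open>Orthogonality of martingale differences, localised to an event \<open>A\<close> of the past.  The localisation is
what the first passage argument needs: \<open>A\<close> will be the event that the first passage happens at time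
\<open>j\<close>.\<close>

lemma innov_sum_second_moment:
  assumes j: "1 \<le> j" "j \<le> K" and A: "A \<in> sets (hist j)"
  shows "(\<integral>\<omega>. indicator A \<omega> * (innov_sum u v j K \<omega>)^2 \<partial>M) \<le> prob A * (\<Sum>k\<in>{j<..K}. (u k)^2 + (v k)^2)"
  using j(2)
proof (induction K rule: dec_induct)
  case base
  show ?case by (simp add: innov_sum_def)
next
  case (step K)
  let ?Y = "innov_sum u v j K" and ?k = "Suc K"
  have A': "A \<in> sets (hist K)" using hist_mono[OF step.hyps(1)] A by auto
  have AM: "A \<in> events" using A hist_events by auto
  define B where "B = (\<Sum>k\<in>{j<..K}. 2 * (\<bar>u k\<bar> + \<bar>v k\<bar>))"
  have B0: "0 \<le> B" unfolding B_def by (intro sum_nonneg) auto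
  have Yb: "\<bar>?Y \<omega>\<bar> \<le> B" if "\<omega> \<in> space M" for \<omega>
    unfolding B_def by (rule abs_innov_sum_le[OF that])
  have [measurable]: "(indicator A :: 'a \<Rightarrow> real) \<in> borel_measurable (hist K)" "?Y \<in> borel_measurable (hist K)"
    using A' innov_sum_measurable_hist by auto
  have [measurable]: "(indicator A :: 'a \<Rightarrow> real) \<in> borel_measurable M" using AM by simp
  have im[measurable]: "innov1 ?k \<in> borel_measurable M" "innov2 ?k \<in> borel_measurable M"
    using innov_measurable_hist[of ?k ?k] hist_measurable_M by auto
  have k1: "1 \<le> K" using j step.hyps by simp
  have Z1: "(\<lambda>\<omega>. indicator A \<omega> * ?Y \<omega>) \<in> borel_measurable (hist K)" by measurable
  have Z1b: "\<bar>indicator A \<omega> * ?Y \<omega>\<bar> \<le> B" if "\<omega> \<in> space M" for \<omega>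
    using Yb[OF that] B0 by (auto split: split_indicator)
  have Z2: "(indicator A :: 'a \<Rightarrow> real) \<in> borel_measurable (hist K)" by measurable
  note m1 = innov_moments[OF k1 Z1 Z1b] and m2 = innov_moments[OF k1 Z2, of 1]
  have int: "integrable M f" if "f \<in> borel_measurable M" "\<And>\<omega>. \<omega> \<in> space M \<Longrightarrow> \<bar>f \<omega>\<bar> \<le> C" for f :: "'a \<Rightarrow> real" and C
    by (rule integrable_const_bound[where B=C]) (use that in auto)
  have ib: "\<bar>innov1 ?k \<omega>\<bar> \<le> 2" "\<bar>innov2 ?k \<omega>\<bar> \<le> 2" if "\<omega> \<in> space M" for \<omega>
    using abs_innov_le[OF _ that, of ?k] by auto
  have sq: "x^2 \<le> 4" if "\<bar>x\<bar> \<le> 2" for x :: real using power_mono[OF that, of 2] by simp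
  have i1: "integrable M (\<lambda>\<omega>. indicator A \<omega> * (?Y \<omega>)^2)"
  proof (rule int[of _ "B^2"])
    fix \<omega> assume "\<omega> \<in> space M"
    from power_mono[OF Yb[OF this], of 2] show "\<bar>indicator A \<omega> * (?Y \<omega>)^2\<bar> \<le> B^2"
      by (auto split: split_indicator)
  qed measurable
  have i2: "integrable M (\<lambda>\<omega>. (indicator A \<omega> * ?Y \<omega>) * innov1 ?k \<omega>)" "integrable M (\<lambda>\<omega>. (indicator A \<omega> * ?Y \<omega>) * innov2 ?k \<omega>)"
    by (rule int[of _ "B * 2"]; (unfold abs_mult[of "indicator A _ * _"])?; (intro mult_mono Z1b ib B0)?; simp?)+
  have i3: "integrable M (\<lambda>\<omega>. indicator A \<omega> * (innov1 ?k \<omega>)^2)" "integrable M (\<lambda>\<omega>. indicator A \<omega> * (innov2 ?k \<omega>)^2)"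
    by (rule int[of _ 4]; use sq[OF ib(1)] sq[OF ib(2)] in \<open>auto split: split_indicator\<close>)+
  have i4: "integrable M (\<lambda>\<omega>. indicator A \<omega> * (innov1 ?k \<omega> * innov2 ?k \<omega>))"
  proof (rule int[of _ "2 * 2"])
    fix \<omega> assume "\<omega> \<in> space M"
    then show "\<bar>indicator A \<omega> * (innov1 ?k \<omega> * innov2 ?k \<omega>)\<bar> \<le> 2 * 2"
      using mult_mono[OF ib, of \<omega> \<omega>] by (auto split: split_indicator simp: abs_mult)
  qed measurable
  have i5: "integrable M (\<lambda>\<omega>. indicator A \<omega> * (1 - (drift1 K \<omega>)^2))" "integrable M (\<lambda>\<omega>. indicator A \<omega> * (1 - (drift2 K \<omega>)^2))"
    by (rule int[of _ 1]; use abs_drift_le[of _ K] in \<open>auto split: split_indicator simp: abs_square_le_1 abs_le_iff\<close>)+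
  have le: "(\<integral>\<omega>. indicator A \<omega> * (1 - (drift1 K \<omega>)^2) \<partial>M) \<le> prob A" "(\<integral>\<omega>. indicator A \<omega> * (1 - (drift2 K \<omega>)^2) \<partial>M) \<le> prob A"
  proof -
    have "(\<integral>\<omega>. indicator A \<omega> * (1 - (drift1 K \<omega>)^2) \<partial>M) \<le> (\<integral>\<omega>. indicator A \<omega> \<partial>M)"
      "(\<integral>\<omega>. indicator A \<omega> * (1 - (drift2 K \<omega>)^2) \<partial>M) \<le> (\<integral>\<omega>. indicator A \<omega> \<partial>M)"
      by (intro integral_mono i5; use AM in \<open>auto split: split_indicator simp: less_top[symmetric]\<close>)+
    then show "(\<integral>\<omega>. indicator A \<omega> * (1 - (drift1 K \<omega>)^2) \<partial>M) \<le> prob A" "(\<integral>\<omega>. indicator A \<omega> * (1 - (drift2 K \<omega>)^2) \<partial>M) \<le> prob A"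
      using AM by simp_all
  qed
  have "(\<integral>\<omega>. indicator A \<omega> * (innov_sum u v j ?k \<omega>)^2 \<partial>M) =
     (\<integral>\<omega>. indicator A \<omega> * (?Y \<omega>)^2 + 2 * u ?k * ((indicator A \<omega> * ?Y \<omega>) * innov1 ?k \<omega>)
        + 2 * v ?k * ((indicator A \<omega> * ?Y \<omega>) * innov2 ?k \<omega>) + (u ?k)^2 * (indicator A \<omega> * (innov1 ?k \<omega>)^2)
        + (v ?k)^2 * (indicator A \<omega> * (innov2 ?k \<omega>)^2) + 2 * u ?k * v ?k * (indicator A \<omega> * (innov1 ?k \<omega> * innov2 ?k \<omega>)) \<partial>M)"
    by (rule Bochner_Integration.integral_cong) (simp_all add: innov_sum_Suc[OF step.hyps(1)] power2_eq_square algebra_simps)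
  also have "\<dots> = (\<integral>\<omega>. indicator A \<omega> * (?Y \<omega>)^2 \<partial>M) + (u ?k)^2 * (\<integral>\<omega>. indicator A \<omega> * (1 - (drift1 K \<omega>)^2) \<partial>M)
      + (v ?k)^2 * (\<integral>\<omega>. indicator A \<omega> * (1 - (drift2 K \<omega>)^2) \<partial>M)"
    using i1 i2 i3 i4 m1(1,2) m2(3-5) by simp
  also have "\<dots> \<le> prob A * (\<Sum>k\<in>{j<..K}. (u k)^2 + (v k)^2) + (u ?k)^2 * prob A + (v ?k)^2 * prob A"
    by (intro add_mono step.IH mult_left_mono le) auto
  also have "\<dots> = prob A * (\<Sum>k\<in>{j<..?k}. (u k)^2 + (v k)^2)"
  proof -
    have "{j<..?k} = insert ?k {j<..K}" using step.hyps by auto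
    then show ?thesis by (simp add: algebra_simps)
  qed
  finally show ?case .
qed

text \<open>Martingale central limit theorem with an explicit error.  Conditioning on the past replaces the last
factor of the characteristic function by its conditional expectation, which is a constant Gaussian
factor up to a small random error; this is iterated.  The random part of the error is a squared
average of the walks, so its expectation is all that matters.\<close>

lemma innov_sum_char:
  assumes K: "1 \<le> K" and small: "\<And>k. k \<in> {1<..K} \<Longrightarrow> \<bar>u k\<bar> \<le> 1 \<and> \<bar>v k\<bar> \<le> 1"
  shows "cmod ((\<integral>\<omega>. iexp (innov_sum u v 1 K \<omega>) \<partial>M) - of_real (exp (- ((\<Sum>k\<in>{1<..K}. (u k)^2 + (v k)^2) / 2))))
     \<le> (\<Sum>k\<in>{1<..K}. 2 * (\<bar>u k\<bar>^3 + \<bar>v k\<bar>^3)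
           + ((u k)^2 + (v k)^2) * (\<integral>\<omega>. (s1 (k-1) \<omega> / real (k-1))^2 + (s2 (k-1) \<omega> / real (k-1))^2 \<partial>M))"
  using assms
proof (induction K rule: dec_induct)
  case base
  show ?case by (simp add: innov_sum_def prob_space)
next
  case (step K)
  let ?Y = "innov_sum u v 1 K" and ?k = "Suc K"
  let ?u = "u ?k" and ?v = "v ?k"
  have k1: "1 \<le> K" using step.hyps by simp
  have small': "\<bar>?u\<bar> \<le> 1" "\<bar>?v\<bar> \<le> 1" using step.prems[of ?k] k1 by auto
  define S where "S = (\<Sum>k\<in>{1<..K}. (u k)^2 + (v k)^2)"
  define q where "q = ?u^2 + ?v^2"
  have q0: "0 \<le> q" by (simp add: q_def)
  have ins: "{1<..?k} = insert ?k {1<..K}" using k1 by auto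
  let ?\<beta> = "\<lambda>\<omega>. drift1 K \<omega>" and ?\<gamma> = "\<lambda>\<omega>. drift2 K \<omega>"
  \<comment> \<open>The part of the exponential that is known at time \<open>K\<close>: earlier innovations and the current drift.\<close>
  define Z where "Z \<omega> = iexp (?Y \<omega>) * iexp (- (?u * ?\<beta> \<omega>)) * iexp (- (?v * ?\<gamma> \<omega>))" for \<omega>
  have [measurable]: "?Y \<in> borel_measurable (hist K)" by (rule innov_sum_measurable_hist)
  have Zm: "Z \<in> borel_measurable (hist K)" unfolding Z_def[abs_def] by measurable
  have Z1: "cmod (Z \<omega>) = 1" for \<omega> by (simp add: Z_def norm_mult)
  have Y1: "iexp (innov_sum u v 1 ?k \<omega>) = Z \<omega> * iexp (?u * of_int (X1 ?k \<omega>)) * iexp (?v * of_int (X2 ?k \<omega>))" for \<omega>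
    unfolding Z_def innov_sum_Suc[OF k1] innov1_def innov2_def x1_def x2_def
    by (simp add: exp_add[symmetric] algebra_simps)
  have "(\<integral>\<omega>. iexp (innov_sum u v 1 ?k \<omega>) \<partial>M) =
     (\<integral>\<omega>. Z \<omega> * (of_real (cos ?u) + \<i> * of_real (sin ?u) * of_real (?\<beta> \<omega>)) * (of_real (cos ?v) + \<i> * of_real (sin ?v) * of_real (?\<gamma> \<omega>)) \<partial>M)"
  proof -
    have c: "(iexp (x * of_int 1) + iexp (x * of_int (-1))) / 2 = of_real (cos x)"
      "(iexp (x * of_int 1) - iexp (x * of_int (-1))) / 2 = \<i> * of_real (sin x)" for x
      using cis_conv_exp[of x, symmetric] cis_conv_exp[of "-x", symmetric] by (simp_all add: complex_eq_iff)
    show ?thesis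
      unfolding Y1
      using expectation_next_step[OF k1 Zm, of 1 "\<lambda>x. iexp (?u * of_int x)" "\<lambda>x. iexp (?v * of_int x)"]
      unfolding c drift1_def drift2_def mem1_def mem2_def by (simp only: Z1 order_refl)
  qed
  also have "\<dots> = (\<integral>\<omega>. iexp (?Y \<omega>) * (centred_sign_char (?\<beta> \<omega>) ?u * centred_sign_char (?\<gamma> \<omega>) ?v) \<partial>M)"
    unfolding Z_def centred_sign_char_def by (intro Bochner_Integration.integral_cong refl) (simp only: mult_ac)
  finally have E: "(\<integral>\<omega>. iexp (innov_sum u v 1 ?k \<omega>) \<partial>M) = \<dots>" .
  let ?g = "\<lambda>\<omega>. centred_sign_char (?\<beta> \<omega>) ?u * centred_sign_char (?\<gamma> \<omega>) ?v"
  let ?D = "\<integral>\<omega>. (s1 K \<omega> / real K)^2 + (s2 K \<omega> / real K)^2 \<partial>M"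
  have gm: "?g \<in> borel_measurable M" unfolding centred_sign_char_def by measurable
  have g1: "cmod (?g \<omega>) \<le> 1" if "\<omega> \<in> space M" for \<omega>
    unfolding norm_mult using centred_sign_char_le_1 abs_drift_le[OF that, of K]
    by (intro mult_le_one) auto
  have gd: "cmod (?g \<omega> - of_real (exp (- (q/2)))) \<le> 2 * (\<bar>?u\<bar>^3 + \<bar>?v\<bar>^3) + q * ((s1 K \<omega> / real K)^2 + (s2 K \<omega> / real K)^2)"
    if w: "\<omega> \<in> space M" for \<omega>
  proof -
    have ex: "of_real (exp (- (q/2))) = complex_of_real (exp (- (?u^2/2))) * of_real (exp (- (?v^2/2)))"
      unfolding of_real_mult[symmetric] exp_add[symmetric] by (simp add: q_def add_divide_distrib)
    have "cmod (?g \<omega> - of_real (exp (- (q/2)))) \<le> cmod (centred_sign_char (?\<beta> \<omega>) ?u - of_real (exp (- (?u^2/2))))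
        + cmod (centred_sign_char (?\<gamma> \<omega>) ?v - of_real (exp (- (?v^2/2))))"
      unfolding ex by (rule norm_mult_diff_le_1) (use centred_sign_char_le_1 abs_drift_le[OF w, of K] in auto)
    also have "\<dots> \<le> (2 * \<bar>?u\<bar>^3 + ?u^2 * (?\<beta> \<omega>)^2) + (2 * \<bar>?v\<bar>^3 + ?v^2 * (?\<gamma> \<omega>)^2)"
      by (intro add_mono centred_sign_char_approx abs_drift_le w small')
    also have "\<dots> \<le> (2 * \<bar>?u\<bar>^3 + ?u^2 * ((s1 K \<omega> / real K)^2 + (s2 K \<omega> / real K)^2)) + (2 * \<bar>?v\<bar>^3 + ?v^2 * ((s1 K \<omega> / real K)^2 + (s2 K \<omega> / real K)^2))"
    proof -
      have "(mem1 * y)^2 \<le> y^2" "(mem2 * y)^2 \<le> y^2" for y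
        using abs_mem mult_right_mono[of "mem1^2" 1 "y^2"] mult_right_mono[of "mem2^2" 1 "y^2"]
        by (auto simp: power_mult_distrib abs_square_le_1)
      from this(1)[of "s2 K \<omega> / K"] this(2)[of "s1 K \<omega> / K"]
      have "(?\<beta> \<omega>)^2 \<le> (s1 K \<omega> / real K)^2 + (s2 K \<omega> / real K)^2" "(?\<gamma> \<omega>)^2 \<le> (s1 K \<omega> / real K)^2 + (s2 K \<omega> / real K)^2"
        unfolding drift1_def drift2_def by (auto simp: add_increasing add_increasing2)
      then show ?thesis by (intro add_mono order_refl mult_left_mono) auto
    qed
    finally show ?thesis by (simp add: q_def algebra_simps)
  qed
  have sm: "(s1 K \<omega> / real K)^2 \<le> 1" "(s2 K \<omega> / real K)^2 \<le> 1" if "\<omega> \<in> space M" for \<omega>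
    using abs_s_le[OF that, of K] k1 by (auto simp: abs_square_le_1 divide_le_eq)
  have iD: "integrable M (\<lambda>\<omega>. (s1 K \<omega> / real K)^2 + (s2 K \<omega> / real K)^2)"
    by (rule integrable_const_bound[where B=2]) (use add_mono[OF sm] in \<open>auto intro!: AE_I2\<close>)
  have iY: "integrable M (\<lambda>\<omega>. iexp (?Y \<omega>))"
    by (rule integrable_const_bound[where B=1]) auto
  have iYg: "integrable M (\<lambda>\<omega>. iexp (?Y \<omega>) * ?g \<omega>)"
    by (rule integrable_const_bound[where B=1]) (use g1 gm in \<open>auto simp: norm_mult\<close>)
  have "cmod ((\<integral>\<omega>. iexp (?Y \<omega>) * ?g \<omega> \<partial>M) - (\<integral>\<omega>. iexp (?Y \<omega>) \<partial>M) * of_real (exp (- (q/2))))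
     = cmod (\<integral>\<omega>. iexp (?Y \<omega>) * (?g \<omega> - of_real (exp (- (q/2)))) \<partial>M)"
    using iY iYg by (subst right_diff_distrib, subst Bochner_Integration.integral_diff) auto
  also have "\<dots> \<le> (\<integral>\<omega>. 2 * (\<bar>?u\<bar>^3 + \<bar>?v\<bar>^3) + q * ((s1 K \<omega> / real K)^2 + (s2 K \<omega> / real K)^2) \<partial>M)"
    by (rule norm_integral_le) (use gd iD in \<open>auto simp: norm_mult\<close>)
  also have "\<dots> = 2 * (\<bar>?u\<bar>^3 + \<bar>?v\<bar>^3) + q * ?D"
    using iD by (subst Bochner_Integration.integral_add) (auto simp: prob_space)
  finally have 1: "cmod ((\<integral>\<omega>. iexp (innov_sum u v 1 ?k \<omega>) \<partial>M) - (\<integral>\<omega>. iexp (?Y \<omega>) \<partial>M) * of_real (exp (- (q/2))))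
     \<le> 2 * (\<bar>?u\<bar>^3 + \<bar>?v\<bar>^3) + q * ?D" unfolding E .
  have "cmod ((\<integral>\<omega>. iexp (?Y \<omega>) \<partial>M) * of_real (exp (- (q/2))) - of_real (exp (- (S/2))) * of_real (exp (- (q/2))))
     \<le> cmod ((\<integral>\<omega>. iexp (?Y \<omega>) \<partial>M) - of_real (exp (- (S/2)))) * 1"
    unfolding left_diff_distrib[symmetric] norm_mult using q0 by (intro mult_left_mono) auto
  also have "\<dots> \<le> (\<Sum>k\<in>{1<..K}. 2 * (\<bar>u k\<bar>^3 + \<bar>v k\<bar>^3)
           + ((u k)^2 + (v k)^2) * (\<integral>\<omega>. (s1 (k-1) \<omega> / real (k-1))^2 + (s2 (k-1) \<omega> / real (k-1))^2 \<partial>M))"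
    unfolding S_def mult_1_right by (rule step.IH) (use step.prems in auto)
  finally have 2: "cmod ((\<integral>\<omega>. iexp (?Y \<omega>) \<partial>M) * of_real (exp (- (q/2))) - of_real (exp (- (S/2))) * of_real (exp (- (q/2)))) \<le> \<dots>" .
  have 3: "of_real (exp (- (S/2))) * of_real (exp (- (q/2))) = complex_of_real (exp (- ((\<Sum>k\<in>{1<..?k}. (u k)^2 + (v k)^2) / 2)))"
    unfolding of_real_mult[symmetric] exp_add[symmetric] ins S_def q_def by (simp add: add_divide_distrib)
  have 4: "(\<Sum>k\<in>{1<..?k}. 2 * (\<bar>u k\<bar>^3 + \<bar>v k\<bar>^3)
           + ((u k)^2 + (v k)^2) * (\<integral>\<omega>. (s1 (k-1) \<omega> / real (k-1))^2 + (s2 (k-1) \<omega> / real (k-1))^2 \<partial>M))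
    = (2 * (\<bar>?u\<bar>^3 + \<bar>?v\<bar>^3) + q * ?D) + (\<Sum>k\<in>{1<..K}. 2 * (\<bar>u k\<bar>^3 + \<bar>v k\<bar>^3)
           + ((u k)^2 + (v k)^2) * (\<integral>\<omega>. (s1 (k-1) \<omega> / real (k-1))^2 + (s2 (k-1) \<omega> / real (k-1))^2 \<partial>M))"
    unfolding ins q_def by simp
  show ?case unfolding 4 3[symmetric] by (rule norm_diff_triangle_le[OF 1 2])
qed

end

section \<open>Second moments of the walks\<close>

lemma sum_weight_squares_le:
  fixes C :: real
  assumes b: "\<And>x. x \<ge> 1 \<Longrightarrow> \<bar>f x\<bar> \<le> C * x powr \<rho>" "\<And>x. x \<ge> 1 \<Longrightarrow> \<bar>g x\<bar> \<le> C * x powr \<rho>"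
  shows "(\<Sum>k\<in>{1<..m}. (f (m / real k))^2 + (g (m / real k))^2) \<le> 2 * C^2 * m powr (2 * \<rho>) * (\<Sum>k=1..m. real k powr (- (2 * \<rho>)))"
proof -
  have "(f (m / real k))^2 + (g (m / real k))^2 \<le> 2 * C^2 * m powr (2 * \<rho>) * real k powr (- (2 * \<rho>))" if k: "k \<in> {1<..m}" for k
  proof -
    have x: "m / real k \<ge> 1" using k by simp
    have e: "((m / real k) powr \<rho>)^2 = m powr (2 * \<rho>) * real k powr (- (2 * \<rho>))"
    proof -
      have "((m / real k) powr \<rho>)^2 = (m / real k) powr (2 * \<rho>)"
        by (simp add: power2_eq_square powr_add[symmetric])
      also have "\<dots> = m powr (2 * \<rho>) / real k powr (2 * \<rho>)" by (simp add: powr_divide)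
      finally show ?thesis by (simp add: powr_minus divide_inverse)
    qed
    have "(f (m / real k))^2 \<le> (C * (m / real k) powr \<rho>)^2" "(g (m / real k))^2 \<le> (C * (m / real k) powr \<rho>)^2"
      using power_mono[OF b(1)[OF x], of 2] power_mono[OF b(2)[OF x], of 2] by simp_all
    then show ?thesis by (simp add: power_mult_distrib e)
  qed
  then have "(\<Sum>k\<in>{1<..m}. (f (m / real k))^2 + (g (m / real k))^2) \<le> (\<Sum>k\<in>{1<..m}. 2 * C^2 * m powr (2 * \<rho>) * real k powr (- (2 * \<rho>)))"
    by (rule sum_mono)
  also have "\<dots> = 2 * C^2 * m powr (2 * \<rho>) * (\<Sum>k\<in>{1<..m}. real k powr (- (2 * \<rho>)))"
    by (simp only: sum_distrib_left)
  also have "\<dots> \<le> 2 * C^2 * m powr (2 * \<rho>) * (\<Sum>k=1..m. real k powr (- (2 * \<rho>)))"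
    by (intro mult_left_mono sum_mono2) auto
  finally show ?thesis .
qed

context interacting_erw
begin

lemma weight_approximation:
  assumes w: "memory_weight mem1 mem2 \<rho> \<psi>1 \<psi>2" and \<rho>: "\<rho> > 0"
  obtains K where "K \<ge> 0" "\<And>m \<omega>. 1 \<le> m \<Longrightarrow> \<omega> \<in> space M \<Longrightarrow>
     \<bar>\<psi>1 1 * s1 m \<omega> + \<psi>2 1 * s2 m \<omega> - innov_sum (\<lambda>k. \<psi>1 (m / k)) (\<lambda>k. \<psi>2 (m / k)) 1 m \<omega>\<bar> \<le> K * m powr \<rho>"
proof -
  obtain K where K: "K \<ge> 0"
    "\<And>(S1 :: nat \<Rightarrow> real) S2 m. (\<And>k. \<bar>S1 k\<bar> \<le> k) \<Longrightarrow> (\<And>k. \<bar>S2 k\<bar> \<le> k) \<Longrightarrow> 1 \<le> m \<Longrightarrow>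
      \<bar>\<psi>1 1 * S1 m + \<psi>2 1 * S2 m - (\<Sum>k\<in>{1<..m}. \<psi>1 (m / k) * (S1 k - S1 (k - 1) - mem1 * S2 (k - 1) / real (k - 1))
          + \<psi>2 (m / k) * (S2 k - S2 (k - 1) - mem2 * S1 (k - 1) / real (k - 1)))\<bar> \<le> K * m powr \<rho>"
    using abel_summation[OF w \<rho> abs_mem] by blast
  show ?thesis
  proof (rule that[OF K(1)])
    fix m :: nat and \<omega> assume m: "1 \<le> m" and om: "\<omega> \<in> space M"
    have i: "innov1 k \<omega> = s1 k \<omega> - s1 (k - 1) \<omega> - mem1 * s2 (k - 1) \<omega> / real (k - 1)"
      "innov2 k \<omega> = s2 k \<omega> - s2 (k - 1) \<omega> - mem2 * s1 (k - 1) \<omega> / real (k - 1)" if "k \<in> {1<..m}" for k :: nat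
      using s_Suc[of "k - 1" \<omega>] that by (auto simp: innov1_def innov2_def drift1_def drift2_def)
    have "innov_sum (\<lambda>k. \<psi>1 (m / k)) (\<lambda>k. \<psi>2 (m / k)) 1 m \<omega> = (\<Sum>k\<in>{1<..m}. \<psi>1 (m / k) * (s1 k \<omega> - s1 (k - 1) \<omega> - mem1 * s2 (k - 1) \<omega> / real (k - 1))
          + \<psi>2 (m / k) * (s2 k \<omega> - s2 (k - 1) \<omega> - mem2 * s1 (k - 1) \<omega> / real (k - 1)))"
      unfolding innov_sum_def by (intro sum.cong refl) (simp add: i)
    then show "\<bar>\<psi>1 1 * s1 m \<omega> + \<psi>2 1 * s2 m \<omega> - innov_sum (\<lambda>k. \<psi>1 (m / k)) (\<lambda>k. \<psi>2 (m / k)) 1 m \<omega>\<bar> \<le> K * m powr \<rho>"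
      using K(2)[of "\<lambda>k. s1 k \<omega>" "\<lambda>k. s2 k \<omega>", OF abs_s_le(1)[OF om] abs_s_le(2)[OF om] m] by simp
  qed
qed

lemma integrable_bounded_rv:
  fixes f :: "'a \<Rightarrow> real"
  assumes "f \<in> borel_measurable M" "\<And>\<omega>. \<omega> \<in> space M \<Longrightarrow> \<bar>f \<omega>\<bar> \<le> C"
  shows "integrable M f"
  by (rule integrable_const_bound[where B=C]) (use assms in auto)

lemma integrable_innov_sum_square: "integrable M (\<lambda>\<omega>. (innov_sum u v j m \<omega>)^2)"
  by (rule integrable_bounded_rv[of _ "(\<Sum>k\<in>{j<..m}. 2 * (\<bar>u k\<bar> + \<bar>v k\<bar>))^2"])
     (use power_mono[OF abs_innov_sum_le, of _ u v j m 2] in auto)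

text \<open>Square the representation of \<open>\<psi>(1) S\<^sub>m\<close> by innovations.  The right-hand side is \<open>O(m)\<close> for
\<open>\<rho> < 1/2\<close> and \<open>O(m\<^sup>2\<^sup>\<rho>)\<close> for \<open>\<rho> > 1/2\<close>; both cases are used.\<close>

lemma weighted_second_moment:
  assumes w: "memory_weight mem1 mem2 \<rho> \<psi>1 \<psi>2" and \<rho>: "\<rho> > 0"
  obtains C where "C \<ge> 0" "\<And>m. 1 \<le> m \<Longrightarrow>
     (\<integral>\<omega>. (\<psi>1 1 * s1 m \<omega> + \<psi>2 1 * s2 m \<omega>)^2 \<partial>M) \<le> C * m powr (2 * \<rho>) * (\<Sum>k=1..m. real k powr (- (2 * \<rho>)))"
proof -
  obtain K where K: "K \<ge> 0" "\<And>m \<omega>. 1 \<le> m \<Longrightarrow> \<omega> \<in> space M \<Longrightarrow>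
     \<bar>\<psi>1 1 * s1 m \<omega> + \<psi>2 1 * s2 m \<omega> - innov_sum (\<lambda>k. \<psi>1 (m / k)) (\<lambda>k. \<psi>2 (m / k)) 1 m \<omega>\<bar> \<le> K * m powr \<rho>"
    using weight_approximation[OF w \<rho>] by blast
  obtain C where C: "C \<ge> 0" "\<And>x. x \<ge> 1 \<Longrightarrow> \<bar>\<psi>1 x\<bar> \<le> C * x powr \<rho>" "\<And>x. x \<ge> 1 \<Longrightarrow> \<bar>\<psi>2 x\<bar> \<le> C * x powr \<rho>"
    using w by (auto simp: memory_weight_def)
  show ?thesis
  proof (rule that[of "2 * K^2 + 4 * C^2"])
    fix m :: nat assume m: "1 \<le> m"
    let ?Y = "innov_sum (\<lambda>k. \<psi>1 (m / k)) (\<lambda>k. \<psi>2 (m / k)) 1 m" and ?S = "\<Sum>k=1..m. real k powr (- (2 * \<rho>))"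
    have S1: "1 \<le> ?S"
      using member_le_sum[of 1 "{1..m}" "\<lambda>k. real k powr (- (2 * \<rho>))"] m by simp
    have pt: "(\<psi>1 1 * s1 m \<omega> + \<psi>2 1 * s2 m \<omega>)^2 \<le> 2 * (K^2 * m powr (2 * \<rho>)) + 2 * (?Y \<omega>)^2" if om: "\<omega> \<in> space M" for \<omega>
    proof -
      let ?X = "\<psi>1 1 * s1 m \<omega> + \<psi>2 1 * s2 m \<omega>"
      have "(?X - ?Y \<omega>)^2 \<le> (K * m powr \<rho>)^2"
        using power_mono[OF K(2)[OF m om], of 2] by simp
      also have "\<dots> = K^2 * m powr (2 * \<rho>)"
        by (simp add: power_mult_distrib power2_eq_square powr_add[symmetric])
      finally have 1: "(?X - ?Y \<omega>)^2 \<le> K^2 * m powr (2 * \<rho>)" .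
      have "?X^2 \<le> 2 * (?X - ?Y \<omega>)^2 + 2 * (?Y \<omega>)^2"
        using zero_le_power2[of "?X - 2 * ?Y \<omega>"] by (simp add: power2_eq_square algebra_simps)
      with 1 show ?thesis by linarith
    qed
    have "(\<integral>\<omega>. (\<psi>1 1 * s1 m \<omega> + \<psi>2 1 * s2 m \<omega>)^2 \<partial>M) \<le> (\<integral>\<omega>. 2 * (K^2 * m powr (2 * \<rho>)) + 2 * (?Y \<omega>)^2 \<partial>M)"
      by (rule integral_mono') (use pt integrable_innov_sum_square in auto)
    also have "\<dots> = 2 * (K^2 * m powr (2 * \<rho>)) + 2 * (\<integral>\<omega>. (?Y \<omega>)^2 \<partial>M)"
      using integrable_innov_sum_square by (simp add: prob_space)
    also have "(\<integral>\<omega>. (?Y \<omega>)^2 \<partial>M) \<le> (\<Sum>k\<in>{1<..m}. (\<psi>1 (m / real k))^2 + (\<psi>2 (m / real k))^2)"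
    proof -
      have "(\<integral>\<omega>. (?Y \<omega>)^2 \<partial>M) = (\<integral>\<omega>. indicator (space M) \<omega> * (?Y \<omega>)^2 \<partial>M)"
        by (rule Bochner_Integration.integral_cong) auto
      also have "\<dots> \<le> prob (space M) * (\<Sum>k\<in>{1<..m}. (\<psi>1 (m / real k))^2 + (\<psi>2 (m / real k))^2)"
        by (rule innov_sum_second_moment) (use m sets.top[of "hist 1"] in auto)
      finally show ?thesis by (simp add: prob_space)
    qed
    also have "\<dots> \<le> 2 * C^2 * m powr (2 * \<rho>) * ?S"
      by (rule sum_weight_squares_le[OF C(2,3)])
    also have "2 * (K^2 * m powr (2 * \<rho>)) \<le> 2 * (K^2 * m powr (2 * \<rho>)) * ?S"
      using S1 mult_left_mono[OF S1, of "2 * (K^2 * m powr (2 * \<rho>))"] by simp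
    finally show "(\<integral>\<omega>. (\<psi>1 1 * s1 m \<omega> + \<psi>2 1 * s2 m \<omega>)^2 \<partial>M) \<le> (2 * K^2 + 4 * C^2) * m powr (2 * \<rho>) * ?S"
      by (simp add: algebra_simps)
  qed auto
qed

text \<open>For \<open>\<rho> < 1/2\<close> the direction \<open>\<psi>(1)\<close> is diffusive.  This gives tightness of the rescaled walks in that direction
and, applied to \<open>\<psi> A\<close>, control of the drift.\<close>

lemma diffusive_second_moment:
  assumes w: "memory_weight mem1 mem2 \<rho> \<psi>1 \<psi>2" and \<rho>: "\<rho> > 0" "\<rho> < 1/2"
  obtains C :: real where "C \<ge> 0" "\<And>m. (\<integral>\<omega>. (\<psi>1 1 * s1 m \<omega> + \<psi>2 1 * s2 m \<omega>)^2 \<partial>M) \<le> C * real m"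
proof -
  obtain C where C: "C \<ge> 0" "\<And>m. 1 \<le> m \<Longrightarrow>
     (\<integral>\<omega>. (\<psi>1 1 * s1 m \<omega> + \<psi>2 1 * s2 m \<omega>)^2 \<partial>M) \<le> C * m powr (2 * \<rho>) * (\<Sum>k=1..m. real k powr (- (2 * \<rho>)))"
    using weighted_second_moment[OF w \<rho>(1)] by blast
  show ?thesis
  proof (rule that[of "C / (1 - 2 * \<rho>)"])
    fix m :: nat
    show "(\<integral>\<omega>. (\<psi>1 1 * s1 m \<omega> + \<psi>2 1 * s2 m \<omega>)^2 \<partial>M) \<le> C / (1 - 2 * \<rho>) * real m"
    proof (cases "m = 0")
      case True
      then show ?thesis by (simp add: s1_def s2_def walk_def)
    next
      case False
      then have m: "1 \<le> m" by simp
      have "C * m powr (2 * \<rho>) * (\<Sum>k=1..m. real k powr (- (2 * \<rho>))) \<le> C * m powr (2 * \<rho>) * (m powr (1 - 2 * \<rho>) / (1 - 2 * \<rho>))"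
        using C(1) \<rho> by (intro mult_left_mono sum_powr_le) auto
      also have "\<dots> = C * (m powr (2 * \<rho>) * m powr (1 - 2 * \<rho>)) / (1 - 2 * \<rho>)" by simp
      also have "m powr (2 * \<rho>) * m powr (1 - 2 * \<rho>) = m" using m by (simp add: powr_add[symmetric])
      finally show ?thesis using C(2)[OF m] by simp
    qed
  qed (use C \<rho> in auto)
qed

text \<open>Law of large numbers in mean square with a rate.  Here arbitrary starting values of the weight are
needed, so the exponent must exceed \<open>\<surd>\<mu>\<close>; an exponent below \<open>1\<close> is enough for the averages, and it is
available for all \<open>\<mu> < 1\<close>, in particular beyond the diffusive regime.\<close>

lemma second_moment_decay:
  assumes mu: "mem1 * mem2 < 1"
  obtains C \<eta> where "C \<ge> 0" "\<eta> > 0" "\<And>m. 1 \<le> m \<Longrightarrow>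
     (\<integral>\<omega>. (s1 m \<omega> / real m)^2 + (s2 m \<omega> / real m)^2 \<partial>M) \<le> C * real m powr (- \<eta>)"
proof -
  \<comment> \<open>Strictly between \<open>\<surd>\<mu>\<close> and \<open>1\<close>, and above \<open>1/2\<close> so that \<open>\<Sum>k powr (-2\<rho>)\<close> converges.\<close>
  define \<rho> where "\<rho> = max (3/4) (sqrt ((1 + max 0 (mem1 * mem2)) / 2))"
  have "(1 + max 0 (mem1 * mem2)) / 2 < 1" using mu by auto
  then have "sqrt ((1 + max 0 (mem1 * mem2)) / 2) < 1" by (simp add: max_def)
  then have \<rho>: "\<rho> > 0" "2 * \<rho> > 1" "\<rho> < 1" by (auto simp: \<rho>_def)
  have "mem1 * mem2 < (1 + max 0 (mem1 * mem2)) / 2" using mu by (auto simp: max_def)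
  also have "\<dots> = (sqrt ((1 + max 0 (mem1 * mem2)) / 2))^2" by (simp add: max_def)
  also have "\<dots> \<le> \<rho>^2" by (intro power_mono) (auto simp: \<rho>_def)
  finally have mr: "mem1 * mem2 < \<rho>^2" .
  note w = memory_weight_exists[OF \<rho>(1) mr]
  obtain C1 where C1: "C1 \<ge> 0" "\<And>m. 1 \<le> m \<Longrightarrow> (\<integral>\<omega>. (s1 m \<omega>)^2 \<partial>M) \<le> C1 * m powr (2 * \<rho>) * (\<Sum>k=1..m. real k powr (- (2 * \<rho>)))"
    using weighted_second_moment[OF w[of 1 0] \<rho>(1)] by auto
  obtain C2 where C2: "C2 \<ge> 0" "\<And>m. 1 \<le> m \<Longrightarrow> (\<integral>\<omega>. (s2 m \<omega>)^2 \<partial>M) \<le> C2 * m powr (2 * \<rho>) * (\<Sum>k=1..m. real k powr (- (2 * \<rho>)))"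
    using weighted_second_moment[OF w[of 0 1] \<rho>(1)] by auto
  have sm: "summable (\<lambda>n. real n powr (- (2 * \<rho>)))" using \<rho> by (subst summable_real_powr_iff) auto
  define Z where "Z = (\<Sum>n. real n powr (- (2 * \<rho>)))"
  have Z: "(\<Sum>k=1..m. real k powr (- (2 * \<rho>))) \<le> Z" for m
    unfolding Z_def by (intro sum_le_suminf sm) auto
  have Z0: "0 \<le> Z" using Z[of 0] by simp
  have int: "integrable M (\<lambda>\<omega>. (s1 m \<omega>)^2)" "integrable M (\<lambda>\<omega>. (s2 m \<omega>)^2)" for m
    by (rule integrable_bounded_rv[of _ "(real m)^2"]; use power_mono[OF abs_s_le(1), of _ m 2] power_mono[OF abs_s_le(2), of _ m 2] in simp)+
  show ?thesis
  proof (rule that[of "(C1 + C2) * Z" "2 - 2 * \<rho>"])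
    fix m :: nat assume m: "1 \<le> m"
    have "(\<integral>\<omega>. (s1 m \<omega> / real m)^2 + (s2 m \<omega> / real m)^2 \<partial>M) = ((\<integral>\<omega>. (s1 m \<omega>)^2 \<partial>M) + (\<integral>\<omega>. (s2 m \<omega>)^2 \<partial>M)) / (real m)^2"
      using int by (simp add: power_divide add_divide_distrib)
    also have "\<dots> \<le> (C1 * m powr (2 * \<rho>) * Z + C2 * m powr (2 * \<rho>) * Z) / (real m)^2"
      by (intro divide_right_mono add_mono order_trans[OF C1(2)[OF m]] order_trans[OF C2(2)[OF m]] mult_left_mono Z)
         (use C1 C2 in auto)
    also have "\<dots> = (C1 + C2) * Z * (m powr (2 * \<rho>) / (real m)^2)" by (simp add: algebra_simps add_divide_distrib)
    also have "m powr (2 * \<rho>) / (real m)^2 = real m powr (- (2 - 2 * \<rho>))"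
      using m by (simp add: powr_diff)
    finally show "(\<integral>\<omega>. (s1 m \<omega> / real m)^2 + (s2 m \<omega> / real m)^2 \<partial>M) \<le> (C1 + C2) * Z * real m powr (- (2 - 2 * \<rho>))" .
  qed (use C1 C2 Z0 \<rho> in auto)
qed

end

section \<open>The central limit theorem for the walks\<close>

lemma cmod_iexp_diff_le: "cmod (iexp x - iexp y) \<le> \<bar>x - y\<bar>"
proof -
  have "iexp x - iexp y = iexp y * (iexp (x - y) - 1)"
    by (simp add: right_diff_distrib exp_add[symmetric] algebra_simps)
  then have "cmod (iexp x - iexp y) = cmod (iexp (x - y) - 1)" by (simp add: norm_mult)
  also have "\<dots> \<le> \<bar>x - y\<bar>" using iexp_approx1[of "x - y" 0] by simp
  finally show ?thesis .
qed

lemma tendsto_floor_scaled: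
  assumes r: "\<And>n. r n > 0" "filterlim r at_top sequentially" and t: "t \<ge> 0"
  shows "(\<lambda>n. real (nat \<lfloor>(r n)^2 * t\<rfloor>) / (r n)^2) \<longlonglongrightarrow> t"
    and "(\<lambda>n. real (nat \<lceil>(r n)^2 * t\<rceil>) / (r n)^2) \<longlonglongrightarrow> t"
proof -
  have r2: "(r n)^2 > 0" for n using r(1)[of n] by simp
  have "filterlim (\<lambda>n. (r n)^2) at_top sequentially"
    using r(2) by (intro filterlim_pow_at_top) auto
  then have inv: "(\<lambda>n. 1 / (r n)^2) \<longlonglongrightarrow> 0"
    by (simp add: divide_inverse tendsto_inverse_0_at_top)
  have f: "t - 1 / (r n)^2 \<le> real (nat \<lfloor>(r n)^2 * t\<rfloor>) / (r n)^2" "real (nat \<lfloor>(r n)^2 * t\<rfloor>) / (r n)^2 \<le> t"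
    and c: "t \<le> real (nat \<lceil>(r n)^2 * t\<rceil>) / (r n)^2" "real (nat \<lceil>(r n)^2 * t\<rceil>) / (r n)^2 \<le> t + 1 / (r n)^2" for n
  proof -
    have x: "0 \<le> (r n)^2 * t" using t by simp
    have e: "real (nat \<lfloor>(r n)^2 * t\<rfloor>) = of_int \<lfloor>(r n)^2 * t\<rfloor>" "real (nat \<lceil>(r n)^2 * t\<rceil>) = of_int \<lceil>(r n)^2 * t\<rceil>"
      using x by (auto simp: of_nat_nat)
    have "(r n)^2 * t - 1 \<le> of_int \<lfloor>(r n)^2 * t\<rfloor>" "of_int \<lfloor>(r n)^2 * t\<rfloor> \<le> (r n)^2 * t"
      "(r n)^2 * t \<le> of_int \<lceil>(r n)^2 * t\<rceil>" "of_int \<lceil>(r n)^2 * t\<rceil> \<le> (r n)^2 * t + 1"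
      by linarith+
    from this[THEN divide_right_mono, of "(r n)^2"] r2[of n]
    show "t - 1 / (r n)^2 \<le> real (nat \<lfloor>(r n)^2 * t\<rfloor>) / (r n)^2" "real (nat \<lfloor>(r n)^2 * t\<rfloor>) / (r n)^2 \<le> t"
      "t \<le> real (nat \<lceil>(r n)^2 * t\<rceil>) / (r n)^2" "real (nat \<lceil>(r n)^2 * t\<rceil>) / (r n)^2 \<le> t + 1 / (r n)^2"
      unfolding e by (simp_all add: diff_divide_distrib add_divide_distrib)
  qed
  have l1: "(\<lambda>n. t - 1 / (r n)^2) \<longlonglongrightarrow> t" and l2: "(\<lambda>n. t + 1 / (r n)^2) \<longlonglongrightarrow> t"
    using tendsto_diff[OF tendsto_const inv, of t] tendsto_add[OF tendsto_const inv, of t] by simp_all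
  show "(\<lambda>n. real (nat \<lfloor>(r n)^2 * t\<rfloor>) / (r n)^2) \<longlonglongrightarrow> t"
    by (rule tendsto_sandwich[OF _ _ l1 tendsto_const]) (use f in auto)
  show "(\<lambda>n. real (nat \<lceil>(r n)^2 * t\<rceil>) / (r n)^2) \<longlonglongrightarrow> t"
    by (rule tendsto_sandwich[OF _ _ tendsto_const l2]) (use c in auto)
qed

text \<open>The integrand at \<open>s\<close> of the Wiener integral representing \<open>\<Sum>\<^sub>t \<theta>\<^sub>t V\<^sub>t\<close>, one coordinate at a time.\<close>

definition kernel_sum :: "real set \<Rightarrow> (real \<Rightarrow> real) \<Rightarrow> (real \<Rightarrow> real) \<Rightarrow> real \<Rightarrow> real" where
  "kernel_sum J \<theta> \<psi> s = (\<Sum>t\<in>J. if s \<le> t then \<theta> t * \<psi> (t / s) else 0)"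

lemma kernel_sum_measurable:
  assumes \<psi>: "\<And>x. x > 0 \<Longrightarrow> isCont \<psi> x" and J: "\<And>t. t \<in> J \<Longrightarrow> t > 0"
  shows "(\<lambda>s. indicator {0<..} s * kernel_sum J \<theta> \<psi> s) \<in> borel_measurable borel"
proof -
  have "(\<lambda>s. indicator {0<..} s *\<^sub>R \<psi> (t / s)) \<in> borel_measurable borel" if "t \<in> J" for t
  proof (rule borel_measurable_continuous_on_indicator)
    show "continuous_on {0<..} (\<lambda>s. \<psi> (t / s))"
    proof (intro continuous_at_imp_continuous_on ballI)
      fix s :: real assume s: "s \<in> {0<..}"
      have "isCont (\<lambda>s. t / s) s" using s by (intro continuous_intros) auto
      moreover have "isCont \<psi> (t / s)" using s J[OF that] by (intro \<psi>) auto
      ultimately show "isCont (\<lambda>s. \<psi> (t / s)) s" by (rule isCont_o2)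
    qed
  qed simp
  then have "(\<lambda>s. \<Sum>t\<in>J. indicator {..t} s * \<theta> t * (indicator {0<..} s *\<^sub>R \<psi> (t / s))) \<in> borel_measurable borel"
    by (intro borel_measurable_sum borel_measurable_times) auto
  also have "(\<lambda>s. \<Sum>t\<in>J. indicator {..t} s * \<theta> t * (indicator {0<..} s *\<^sub>R \<psi> (t / s))) = (\<lambda>s. indicator {0<..} s * kernel_sum J \<theta> \<psi> s)"
    unfolding kernel_sum_def sum_distrib_left by (intro ext sum.cong refl) (auto split: split_indicator)
  finally show ?thesis .
qed

lemma kernel_sum_squares_measurable:
  assumes "\<And>x. x > 0 \<Longrightarrow> isCont \<psi>1 x" "\<And>x. x > 0 \<Longrightarrow> isCont \<psi>2 x" and J: "\<And>t. t \<in> J \<Longrightarrow> t > 0"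
  shows "(\<lambda>s. indicator {0<..} s * ((kernel_sum J \<theta> \<psi>1 s)^2 + (kernel_sum J \<theta> \<psi>2 s)^2)) \<in> borel_measurable borel"
proof -
  have "(\<lambda>s. (indicator {0<..} s * kernel_sum J \<theta> \<psi>1 s)^2 + (indicator {0<..} s * kernel_sum J \<theta> \<psi>2 s)^2) \<in> borel_measurable borel"
    by (intro borel_measurable_add borel_measurable_power; rule kernel_sum_measurable, erule assms, erule J)
  also have "(\<lambda>s. (indicator {0<..} s * kernel_sum J \<theta> \<psi>1 s)^2 + (indicator {0<..} s * kernel_sum J \<theta> \<psi>2 s)^2)
     = (\<lambda>s. indicator {0<..} s * ((kernel_sum J \<theta> \<psi>1 s)^2 + (kernel_sum J \<theta> \<psi>2 s)^2))"
    by (auto split: split_indicator)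
  finally show ?thesis .
qed

text \<open>The coefficient of the \<open>k\<close>-th innovation in the linear combination \<open>\<Sum>\<^sub>t \<theta>\<^sub>t \<psi>(1) S\<^bsub>\<lfloor>r\<^sup>2 t\<rfloor>\<^esub>\<close>, up to the
negligible error of the discrete variation of constants.\<close>

definition discrete_kernel_sum :: "real set \<Rightarrow> (real \<Rightarrow> real) \<Rightarrow> (real \<Rightarrow> real) \<Rightarrow> real \<Rightarrow> nat \<Rightarrow> real" where
  "discrete_kernel_sum J \<theta> \<psi> r k =
     (\<Sum>t\<in>J. if k \<le> nat \<lfloor>r^2 * t\<rfloor> then \<theta> t * \<psi> (real (nat \<lfloor>r^2 * t\<rfloor>) / real k) else 0)"

lemma discrete_kernel_sum_tendsto:
  assumes r: "\<And>n. r n > 0" "filterlim r at_top sequentially" and J: "\<And>t. t \<in> J \<Longrightarrow> t > 0"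
    and \<psi>: "\<And>x. x > 0 \<Longrightarrow> isCont \<psi> x" and s: "s > 0" "s \<notin> J"
  shows "(\<lambda>n. discrete_kernel_sum J \<theta> \<psi> (r n) (nat \<lceil>(r n)^2 * s\<rceil>)) \<longlonglongrightarrow> kernel_sum J \<theta> \<psi> s"
  unfolding discrete_kernel_sum_def kernel_sum_def
proof (rule tendsto_sum)
  fix t assume t: "t \<in> J"
  have t0: "t > 0" using J t by auto
  let ?m = "\<lambda>n. real (nat \<lfloor>(r n)^2 * t\<rfloor>)" and ?k = "\<lambda>n. real (nat \<lceil>(r n)^2 * s\<rceil>)"
  have r2: "(r n)^2 > 0" for n using r(1)[of n] by simp
  have lim: "(\<lambda>n. (?m n / (r n)^2) / (?k n / (r n)^2)) \<longlonglongrightarrow> t / s"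
    by (intro tendsto_divide tendsto_floor_scaled r) (use t0 s in auto)
  have e: "(?m n / (r n)^2) / (?k n / (r n)^2) = ?m n / ?k n" for n using r2[of n] by simp
  have lim': "(\<lambda>n. ?m n / ?k n) \<longlonglongrightarrow> t / s" using lim unfolding e .
  show "(\<lambda>n. if nat \<lceil>(r n)^2 * s\<rceil> \<le> nat \<lfloor>(r n)^2 * t\<rfloor> then \<theta> t * \<psi> (?m n / ?k n) else 0)
     \<longlonglongrightarrow> (if s \<le> t then \<theta> t * \<psi> (t / s) else 0)"
  proof (cases "s < t")
    case True
    then have "1 < t / s" using s by simp
    from order_tendstoD(1)[OF lim' this]
    have ev: "eventually (\<lambda>n. (if nat \<lceil>(r n)^2 * s\<rceil> \<le> nat \<lfloor>(r n)^2 * t\<rfloor> then \<theta> t * \<psi> (?m n / ?k n) else 0) = \<theta> t * \<psi> (?m n / ?k n)) sequentially"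
    proof eventually_elim
      case (elim n)
      have "?k n > 0" using elim by (cases "?k n = 0") auto
      with elim have "?k n \<le> ?m n" by (simp add: less_divide_eq)
      then show ?case by simp
    qed
    have "(\<lambda>n. \<theta> t * \<psi> (?m n / ?k n)) \<longlonglongrightarrow> \<theta> t * \<psi> (t / s)"
      by (intro tendsto_mult tendsto_const isCont_tendsto_compose[OF \<psi> lim']) (use t0 s in simp)
    then show ?thesis using tendsto_cong[OF ev] True by simp
  next
    case False
    with s t have ts: "t < s" by (metis linorder_neqE_linordered_idom)
    have "\<not> nat \<lceil>(r n)^2 * s\<rceil> \<le> nat \<lfloor>(r n)^2 * t\<rfloor>" for n
    proof -
      have "(r n)^2 * t < (r n)^2 * s" using ts r2[of n] by simp
      moreover have "0 \<le> (r n)^2 * t" using t0 by simp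
      ultimately have "?m n < ?k n" using real_nat_ceiling_ge[of "(r n)^2 * s"] of_nat_floor[of "(r n)^2 * t"] by linarith
      then show ?thesis by (simp only: of_nat_less_iff not_le)
    qed
    then show ?thesis using ts by simp
  qed
qed

lemma discrete_kernel_sum_zero:
  assumes J: "finite J" "\<And>t. t \<in> J \<Longrightarrow> t > 0" and k: "real k > r^2 * (\<Sum>t\<in>J. t)"
  shows "discrete_kernel_sum J \<theta> \<psi> r k = 0"
  unfolding discrete_kernel_sum_def
proof (rule sum.neutral, rule ballI)
  fix t assume t: "t \<in> J"
  then have "t \<le> (\<Sum>t\<in>J. t)" using J by (intro member_le_sum) (auto intro: less_imp_le)
  then have "r^2 * t \<le> r^2 * (\<Sum>t\<in>J. t)" by (intro mult_left_mono) auto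
  moreover have "real (nat \<lfloor>r^2 * t\<rfloor>) \<le> r^2 * t" using J(2)[OF t] by (intro of_nat_floor) auto
  ultimately have "\<not> k \<le> nat \<lfloor>r^2 * t\<rfloor>" using k by linarith
  then show "(if k \<le> nat \<lfloor>r^2 * t\<rfloor> then \<theta> t * \<psi> (real (nat \<lfloor>r^2 * t\<rfloor>) / real k) else 0) = 0" by simp
qed

lemma discrete_kernel_sum_bound:
  assumes J: "finite J" "\<And>t. t \<in> J \<Longrightarrow> t > 0" and \<rho>: "\<rho> > 0" and C: "C \<ge> 0" "\<And>x. x \<ge> 1 \<Longrightarrow> \<bar>\<psi> x\<bar> \<le> C * x powr \<rho>"
    and k: "1 \<le> k" and r: "r > 0"
  shows "\<bar>discrete_kernel_sum J \<theta> \<psi> r k\<bar> \<le> ((\<Sum>t\<in>J. \<bar>\<theta> t\<bar>) * C * (\<Sum>t\<in>J. t) powr \<rho>) * (r^2 / real k) powr \<rho>"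
proof -
  let ?T = "\<Sum>t\<in>J. t"
  have "\<bar>if k \<le> nat \<lfloor>r^2 * t\<rfloor> then \<theta> t * \<psi> (real (nat \<lfloor>r^2 * t\<rfloor>) / real k) else 0\<bar> \<le> \<bar>\<theta> t\<bar> * (C * (?T powr \<rho> * (r^2 / real k) powr \<rho>))"
    if t: "t \<in> J" for t
  proof (cases "k \<le> nat \<lfloor>r^2 * t\<rfloor>")
    case True
    have tT: "t \<le> ?T" using J t by (intro member_le_sum) (auto intro: less_imp_le)
    let ?x = "real (nat \<lfloor>r^2 * t\<rfloor>) / real k"
    have "real (nat \<lfloor>r^2 * t\<rfloor>) \<le> r^2 * t" using J(2)[OF t] by (intro of_nat_floor) auto
    also have "\<dots> \<le> ?T * r^2" using mult_right_mono[OF tT, of "r^2"] by (simp add: mult.commute)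
    finally have "?x \<le> ?T * (r^2 / real k)" using k by (simp add: divide_right_mono)
    moreover have x1: "1 \<le> ?x" using True k by simp
    ultimately have "?x powr \<rho> \<le> (?T * (r^2 / real k)) powr \<rho>" using \<rho> by (intro powr_mono2) auto
    also have "\<dots> = ?T powr \<rho> * (r^2 / real k) powr \<rho>" by (rule powr_mult)
    finally have "C * ?x powr \<rho> \<le> C * (?T powr \<rho> * (r^2 / real k) powr \<rho>)" using C(1) by (rule mult_left_mono)
    with C(2)[OF x1] have "\<bar>\<psi> ?x\<bar> \<le> C * (?T powr \<rho> * (r^2 / real k) powr \<rho>)" by linarith
    then show ?thesis using True by (simp add: abs_mult mult_left_mono)
  qed (use C in simp)
  then have "\<bar>discrete_kernel_sum J \<theta> \<psi> r k\<bar> \<le> (\<Sum>t\<in>J. \<bar>\<theta> t\<bar> * (C * (?T powr \<rho> * (r^2 / real k) powr \<rho>)))"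
    unfolding discrete_kernel_sum_def by (rule order_trans[OF sum_abs sum_mono])
  also have "\<dots> = (\<Sum>t\<in>J. \<bar>\<theta> t\<bar>) * (C * (?T powr \<rho> * (r^2 / real k) powr \<rho>))"
    by (rule sum_distrib_right[symmetric])
  finally show ?thesis by (simp add: mult.assoc)
qed

context interacting_erw
begin

text \<open>The rescaled walk in the direction \<open>\<psi>(1)\<close>.  The scale \<open>r\<close> is real: it is not tied to the integer levels
of the exit problem.\<close>

definition lin_stat :: "(real \<Rightarrow> real) \<Rightarrow> (real \<Rightarrow> real) \<Rightarrow> real \<Rightarrow> real \<Rightarrow> 'a \<Rightarrow> real" where
  "lin_stat \<psi>1 \<psi>2 r t \<omega> = (\<psi>1 1 * s1 (nat \<lfloor>r^2 * t\<rfloor>) \<omega> + \<psi>2 1 * s2 (nat \<lfloor>r^2 * t\<rfloor>) \<omega>) / r"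

lemma lin_stat_measurable [measurable]: "lin_stat \<psi>1 \<psi>2 r t \<in> borel_measurable M"
  unfolding lin_stat_def[abs_def] by measurable

lemma innov_sum_kernel:
  assumes J: "finite J" "\<And>t. t \<in> J \<Longrightarrow> nat \<lfloor>r^2 * t\<rfloor> \<le> K"
  shows "innov_sum (\<lambda>k. discrete_kernel_sum J \<theta> \<psi>1 r k / r) (\<lambda>k. discrete_kernel_sum J \<theta> \<psi>2 r k / r) 1 K \<omega> =
    (\<Sum>t\<in>J. \<theta> t / r * innov_sum (\<lambda>k. \<psi>1 (real (nat \<lfloor>r^2 * t\<rfloor>) / k)) (\<lambda>k. \<psi>2 (real (nat \<lfloor>r^2 * t\<rfloor>) / k)) 1 (nat \<lfloor>r^2 * t\<rfloor>) \<omega>)"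
proof -
  let ?m = "\<lambda>t. nat \<lfloor>r^2 * t\<rfloor>"
  have "innov_sum (\<lambda>k. discrete_kernel_sum J \<theta> \<psi>1 r k / r) (\<lambda>k. discrete_kernel_sum J \<theta> \<psi>2 r k / r) 1 K \<omega> =
     (\<Sum>k\<in>{1<..K}. \<Sum>t\<in>J. if k \<le> ?m t then \<theta> t / r * (\<psi>1 (?m t / real k) * innov1 k \<omega> + \<psi>2 (?m t / real k) * innov2 k \<omega>) else 0)"
    unfolding innov_sum_def discrete_kernel_sum_def sum_divide_distrib sum_distrib_right sum.distrib[symmetric]
    by (intro sum.cong refl) (auto simp: algebra_simps add_divide_distrib)
  also have "\<dots> = (\<Sum>t\<in>J. \<Sum>k\<in>{1<..K}. if k \<le> ?m t then \<theta> t / r * (\<psi>1 (?m t / real k) * innov1 k \<omega> + \<psi>2 (?m t / real k) * innov2 k \<omega>) else 0)"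
    by (rule sum.swap)
  also have "\<dots> = (\<Sum>t\<in>J. \<theta> t / r * innov_sum (\<lambda>k. \<psi>1 (?m t / k)) (\<lambda>k. \<psi>2 (?m t / k)) 1 (?m t) \<omega>)"
  proof (rule sum.cong[OF refl])
    fix t assume "t \<in> J"
    then have le: "?m t \<le> K" by (rule J(2))
    have "(\<Sum>k\<in>{1<..K}. if k \<le> ?m t then \<theta> t / r * (\<psi>1 (?m t / real k) * innov1 k \<omega> + \<psi>2 (?m t / real k) * innov2 k \<omega>) else 0)
       = (\<Sum>k\<in>{1<..?m t}. \<theta> t / r * (\<psi>1 (?m t / real k) * innov1 k \<omega> + \<psi>2 (?m t / real k) * innov2 k \<omega>))"
      by (rule sum.mono_neutral_cong_right) (use le in auto)
    then show "(\<Sum>k\<in>{1<..K}. if k \<le> ?m t then \<theta> t / r * (\<psi>1 (?m t / real k) * innov1 k \<omega> + \<psi>2 (?m t / real k) * innov2 k \<omega>) else 0)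
       = \<theta> t / r * innov_sum (\<lambda>k. \<psi>1 (?m t / k)) (\<lambda>k. \<psi>2 (?m t / k)) 1 (?m t) \<omega>"
      unfolding innov_sum_def sum_distrib_left .
  qed
  finally show ?thesis .
qed

text \<open>A linear combination of rescaled walks is one sum of innovations up to \<open>O(r\<^sup>2\<^sup>\<rho>\<^sup>-\<^sup>1)\<close>, to which the martingale
central limit theorem applies.  The sum of squared coefficients and the two error sums are Riemann sums
with the same integrable majorant.  The first tends to the integral of the squared kernel; the other two tend
to \<open>0\<close>, because the cubes carry an additional factor \<open>1/r\<close> and the squared averages of the walks tend to
\<open>0\<close> in mean.\<close>

lemma lin_stat_char_converges:
  assumes w: "memory_weight mem1 mem2 \<rho> \<psi>1 \<psi>2" and \<rho>: "\<rho> > 0" "\<rho> < 1/2"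
    and mu: "mem1 * mem2 < 1"
    and J: "finite J" "\<And>t. t \<in> J \<Longrightarrow> t > 0"
    and r: "\<And>n. r n \<ge> 1" "filterlim r at_top sequentially"
  shows "(\<lambda>n. \<integral>\<omega>. iexp (\<Sum>t\<in>J. \<theta> t * lin_stat \<psi>1 \<psi>2 (r n) t \<omega>) \<partial>M) \<longlonglongrightarrow>
    of_real (exp (- ((\<integral>s. indicator {0<..} s * ((kernel_sum J \<theta> \<psi>1 s)^2 + (kernel_sum J \<theta> \<psi>2 s)^2) \<partial>lborel) / 2)))"
proof -
  have d: "(\<psi>1 has_real_derivative mem2 * \<psi>2 x / x) (at x)" "(\<psi>2 has_real_derivative mem1 * \<psi>1 x / x) (at x)" if "x > 0" for x
    using w that by (auto simp: memory_weight_def)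
  have cont: "isCont \<psi>1 x" "isCont \<psi>2 x" if "x > 0" for x using d[OF that] by (auto intro: DERIV_isCont)
  obtain C where C: "C \<ge> 0" "\<And>x. x \<ge> 1 \<Longrightarrow> \<bar>\<psi>1 x\<bar> \<le> C * x powr \<rho>" "\<And>x. x \<ge> 1 \<Longrightarrow> \<bar>\<psi>2 x\<bar> \<le> C * x powr \<rho>"
    using w by (auto simp: memory_weight_def)
  obtain K0 where K0: "K0 \<ge> 0" "\<And>m \<omega>. 1 \<le> m \<Longrightarrow> \<omega> \<in> space M \<Longrightarrow>
     \<bar>\<psi>1 1 * s1 m \<omega> + \<psi>2 1 * s2 m \<omega> - innov_sum (\<lambda>k. \<psi>1 (m / k)) (\<lambda>k. \<psi>2 (m / k)) 1 m \<omega>\<bar> \<le> K0 * m powr \<rho>"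
    using weight_approximation[OF w \<rho>(1)] by blast
  define T where "T = (\<Sum>t\<in>J. t)"
  define \<Theta> where "\<Theta> = (\<Sum>t\<in>J. \<bar>\<theta> t\<bar>)"
  define A where "A = \<Theta> * C * T powr \<rho>"
  have T0: "T \<ge> 0" unfolding T_def using J by (intro sum_nonneg) (auto intro: less_imp_le)
  have tT: "t \<le> T" if "t \<in> J" for t unfolding T_def using J that by (intro member_le_sum) (auto intro: less_imp_le)
  have \<Theta>0: "\<Theta> \<ge> 0" unfolding \<Theta>_def by (intro sum_nonneg) auto
  have A0: "A \<ge> 0" unfolding A_def using \<Theta>0 C(1) by simp
  have r0: "r n > 0" for n using r(1)[of n] by linarith
  define a where "a n k = discrete_kernel_sum J \<theta> \<psi>1 (r n) k" for n k
  define b where "b n k = discrete_kernel_sum J \<theta> \<psi>2 (r n) k" for n k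
  \<comment> \<open>A common last index for all times in \<open>J\<close>; the successor keeps it positive if \<open>J\<close> is empty.\<close>
  define K where "K n = Suc (nat \<lceil>(r n)^2 * T\<rceil>)" for n
  have K: "real (K n) \<ge> (r n)^2 * T" "1 \<le> K n" for n unfolding K_def using real_nat_ceiling_ge[of "(r n)^2 * T"] by auto
  define m where "m n t = nat \<lfloor>(r n)^2 * t\<rfloor>" for n t
  have m_le: "real (m n t) \<le> (r n)^2 * t" if "t \<in> J" for n t
    unfolding m_def using J(2)[OF that] by (intro of_nat_floor) auto
  have mK: "m n t \<le> K n" if "t \<in> J" for n t
  proof -
    have "real (m n t) \<le> (r n)^2 * T" using m_le[OF that] tT[OF that] r0[of n] by (meson mult_left_mono order_trans zero_le_power2)
    then show ?thesis using K(1)[of n] by linarith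
  qed
  have ab: "\<bar>a n k\<bar> \<le> A * ((r n)^2 / real k) powr \<rho>" "\<bar>b n k\<bar> \<le> A * ((r n)^2 / real k) powr \<rho>" if "1 \<le> k" for n k
    unfolding a_def b_def A_def \<Theta>_def T_def
    by (rule discrete_kernel_sum_bound[OF J \<rho>(1) C(1) C(2) that r0], assumption, assumption)
       (rule discrete_kernel_sum_bound[OF J \<rho>(1) C(1) C(3) that r0], assumption, assumption)
  have abz: "a n k = 0" "b n k = 0" if "real k > (r n)^2 * T" for n k
    using that unfolding a_def b_def T_def by (intro discrete_kernel_sum_zero J; simp)+
  have abl: "(\<lambda>n. a n (nat \<lceil>(r n)^2 * s\<rceil>)) \<longlonglongrightarrow> kernel_sum J \<theta> \<psi>1 s"
    "(\<lambda>n. b n (nat \<lceil>(r n)^2 * s\<rceil>)) \<longlonglongrightarrow> kernel_sum J \<theta> \<psi>2 s" if "0 < s" "s \<notin> J" for s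
    unfolding a_def b_def
    by (rule discrete_kernel_sum_tendsto[OF r0 r(2)], erule J(2), erule cont(1), rule that(1), rule that(2))
       (rule discrete_kernel_sum_tendsto[OF r0 r(2)], erule J(2), erule cont(2), rule that(1), rule that(2))
  have pw2: "((x powr \<rho>)^2 :: real) = x powr (2 * \<rho>)" for x by (simp add: power2_eq_square powr_add[symmetric])
  have ab2: "(a n k)^2 + (b n k)^2 \<le> 2 * A^2 * ((r n)^2 / real k) powr (2 * \<rho>)" if "1 \<le> k" for n k
    using power_mono[OF ab(1)[OF that, of n], of 2] power_mono[OF ab(2)[OF that, of n], of 2] by (simp add: power_mult_distrib pw2)
  have small: "\<bar>a n k\<bar> / r n \<le> A * (r n) powr (2 * \<rho> - 1)" "\<bar>b n k\<bar> / r n \<le> A * (r n) powr (2 * \<rho> - 1)" if "1 \<le> k" for n k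
  proof -
    have "((r n)^2 / real k) powr \<rho> \<le> ((r n)^2) powr \<rho>"
      using that r0[of n] \<rho> by (intro powr_mono2) (auto simp: divide_le_eq mult_le_cancel_left1)
    also have "\<dots> = (r n) powr (2 * \<rho>)" using r0[of n] by (simp add: powr_powr flip: powr_numeral)
    finally have "A * ((r n)^2 / real k) powr \<rho> \<le> A * (r n) powr (2 * \<rho>)" using A0 by (rule mult_left_mono)
    then have "\<bar>a n k\<bar> / r n \<le> A * (r n) powr (2 * \<rho>) / r n" "\<bar>b n k\<bar> / r n \<le> A * (r n) powr (2 * \<rho>) / r n"
      using ab[OF that, of n] r0[of n] by (intro divide_right_mono; linarith)+
    then show "\<bar>a n k\<bar> / r n \<le> A * (r n) powr (2 * \<rho> - 1)" "\<bar>b n k\<bar> / r n \<le> A * (r n) powr (2 * \<rho> - 1)"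
      using r0[of n] by (simp_all add: powr_diff)
  qed
  have rpow: "(\<lambda>n. (r n) powr (2 * \<rho> - 1)) \<longlonglongrightarrow> 0"
    by (rule tendsto_neg_powr) (use \<rho> r in auto)
  have g_meas: "(\<lambda>s. indicator {0<..} s * ((kernel_sum J \<theta> \<psi>1 s)^2 + (kernel_sum J \<theta> \<psi>2 s)^2)) \<in> borel_measurable borel"
    by (rule kernel_sum_squares_measurable[OF cont J(2)])
  define \<delta> where "\<delta> j = (\<integral>\<omega>. (s1 j \<omega> / real j)^2 + (s2 j \<omega> / real j)^2 \<partial>M)" for j
  obtain Cd \<eta> where Cd: "Cd \<ge> 0" "\<eta> > 0" "\<And>m. 1 \<le> m \<Longrightarrow> \<delta> m \<le> Cd * real m powr (- \<eta>)"
    using second_moment_decay[OF mu] unfolding \<delta>_def by blast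
  have \<delta>0: "0 \<le> \<delta> j" for j unfolding \<delta>_def by (intro integral_nonneg_AE) auto
  have \<delta>lim: "\<delta> \<longlonglongrightarrow> 0"
  proof (rule tendsto_sandwich[OF _ _ tendsto_const])
    have "(\<lambda>m. real m powr (- \<eta>)) \<longlonglongrightarrow> 0"
      by (rule tendsto_neg_powr) (use Cd filterlim_real_sequentially in auto)
    then show "(\<lambda>m. Cd * real m powr (- \<eta>)) \<longlonglongrightarrow> 0" by (rule tendsto_mult_right_zero)
    show "eventually (\<lambda>m. \<delta> m \<le> Cd * real m powr (- \<eta>)) sequentially"
      using eventually_ge_at_top[of 1] by eventually_elim (rule Cd(3))
  qed (use \<delta>0 in auto)
  then have "Bseq \<delta>" by (intro convergent_imp_Bseq convergentI)
  then obtain Bd where Bd: "Bd > 0" "\<And>j. \<bar>\<delta> j\<bar> \<le> Bd" unfolding Bseq_def by auto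
  have r2inf: "filterlim (\<lambda>n. (r n)^2) at_top sequentially"
    using r(2) by (intro filterlim_pow_at_top) auto

  let ?I = "\<integral>s. indicator {0<..} s * ((kernel_sum J \<theta> \<psi>1 s)^2 + (kernel_sum J \<theta> \<psi>2 s)^2) \<partial>lborel"
  \<comment> \<open>The variance.\<close>
  have L1: "(\<lambda>n. \<Sum>k\<in>{1<..K n}. ((a n k)^2 + (b n k)^2) / (r n)^2) \<longlonglongrightarrow> ?I"
    by (rule riemann_sum_converges[where T=T and B="2 * A^2" and \<kappa>="2 * \<rho>" and J=J])
       (use r r0 \<rho> T0 K ab2 abz J g_meas in \<open>auto intro!: tendsto_intros abl\<close>)
  \<comment> \<open>The error from conditional variances below \<open>1\<close>.\<close>
  have L2: "(\<lambda>n. \<Sum>k\<in>{1<..K n}. (((a n k)^2 + (b n k)^2) * \<delta> (k - 1)) / (r n)^2) \<longlonglongrightarrow> (\<integral>s. indicator {0::real<..} s * (0::real) \<partial>lborel)"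
  proof (rule riemann_sum_converges[where c="\<lambda>n k. ((a n k)^2 + (b n k)^2) * \<delta> (k - 1)" and r=r and K=K and T=T and g="\<lambda>_. 0" and B="2 * A^2 * Bd" and \<kappa>="2 * \<rho>" and J=J])
    fix n k :: nat assume k: "1 \<le> k"
    have "\<bar>((a n k)^2 + (b n k)^2) * \<delta> (k - 1)\<bar> \<le> (2 * A^2 * ((r n)^2 / real k) powr (2 * \<rho>)) * Bd"
      unfolding abs_mult using ab2[OF k] Bd by (intro mult_mono) auto
    then show "\<bar>((a n k)^2 + (b n k)^2) * \<delta> (k - 1)\<bar> \<le> 2 * A^2 * Bd * ((r n)^2 / real k) powr (2 * \<rho>)"
      by (simp add: mult_ac)
  next
    fix s :: real assume s: "0 < s" "s \<notin> J"
    have "filterlim (\<lambda>n. nat \<lceil>(r n)^2 * s\<rceil> - 1) at_top sequentially"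
      unfolding filterlim_at_top
    proof
      fix Z :: nat
      have "eventually (\<lambda>n. (r n)^2 * s \<ge> real Z + 1) sequentially"
        using filterlim_at_top_mult_tendsto_pos[OF tendsto_const s(1) r2inf] by (simp add: filterlim_at_top mult.commute)
      then show "eventually (\<lambda>n. Z \<le> nat \<lceil>(r n)^2 * s\<rceil> - 1) sequentially"
        by eventually_elim (use real_nat_ceiling_ge in linarith)
    qed
    then have "(\<lambda>n. \<delta> (nat \<lceil>(r n)^2 * s\<rceil> - 1)) \<longlonglongrightarrow> 0" by (rule filterlim_compose[OF \<delta>lim])
    then have "(\<lambda>n. ((a n (nat \<lceil>(r n)^2 * s\<rceil>))^2 + (b n (nat \<lceil>(r n)^2 * s\<rceil>))^2) * \<delta> (nat \<lceil>(r n)^2 * s\<rceil> - 1))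
        \<longlonglongrightarrow> ((kernel_sum J \<theta> \<psi>1 s)^2 + (kernel_sum J \<theta> \<psi>2 s)^2) * 0"
      by (intro tendsto_intros abl s)
    then show "(\<lambda>n. ((a n (nat \<lceil>(r n)^2 * s\<rceil>))^2 + (b n (nat \<lceil>(r n)^2 * s\<rceil>))^2) * \<delta> (nat \<lceil>(r n)^2 * s\<rceil> - 1)) \<longlonglongrightarrow> 0" by simp
  qed (use r r0 \<rho> T0 K abz J Bd in auto)
  \<comment> \<open>The Taylor error: one factor of each cube is absorbed by \<open>a / r \<rightarrow> 0\<close> uniformly in \<open>k\<close>.\<close>
  have L3: "(\<lambda>n. \<Sum>k\<in>{1<..K n}. ((\<bar>a n k\<bar>^3 + \<bar>b n k\<bar>^3) / r n) / (r n)^2) \<longlonglongrightarrow> (\<integral>s. indicator {0::real<..} s * (0::real) \<partial>lborel)"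
  proof (rule riemann_sum_converges[where c="\<lambda>n k. (\<bar>a n k\<bar>^3 + \<bar>b n k\<bar>^3) / r n" and r=r and K=K and T=T and g="\<lambda>_. 0" and B="2 * A^2 * A" and \<kappa>="2 * \<rho>" and J=J])
    fix n k :: nat assume k: "1 \<le> k"
    have "(r n) powr (2 * \<rho> - 1) \<le> 1" using r(1)[of n] \<rho> powr_mono[of "2 * \<rho> - 1" 0 "r n"] by simp
    then have "A * (r n) powr (2 * \<rho> - 1) \<le> A" using A0 mult_left_mono[of _ 1 A] by simp
    then have s: "\<bar>a n k\<bar> / r n \<le> A" "\<bar>b n k\<bar> / r n \<le> A" using small[OF k, of n] by linarith+
    have "(\<bar>a n k\<bar>^3 + \<bar>b n k\<bar>^3) / r n = (a n k)^2 * (\<bar>a n k\<bar> / r n) + (b n k)^2 * (\<bar>b n k\<bar> / r n)"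
      by (simp add: power3_eq_cube power2_eq_square add_divide_distrib abs_mult_self_eq)
    also have "\<dots> \<le> (a n k)^2 * A + (b n k)^2 * A" by (intro add_mono mult_left_mono s) auto
    also have "\<dots> = ((a n k)^2 + (b n k)^2) * A" by (simp add: algebra_simps)
    also have "\<dots> \<le> (2 * A^2 * ((r n)^2 / real k) powr (2 * \<rho>)) * A" by (intro mult_right_mono ab2 k A0)
    finally have "(\<bar>a n k\<bar>^3 + \<bar>b n k\<bar>^3) / r n \<le> 2 * A^2 * A * ((r n)^2 / real k) powr (2 * \<rho>)" by (simp add: mult_ac)
    moreover have "0 \<le> (\<bar>a n k\<bar>^3 + \<bar>b n k\<bar>^3) / r n" using r0[of n] by simp
    ultimately show "\<bar>(\<bar>a n k\<bar>^3 + \<bar>b n k\<bar>^3) / r n\<bar> \<le> 2 * A^2 * A * ((r n)^2 / real k) powr (2 * \<rho>)" by simp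
  next
    fix s :: real assume s: "0 < s" "s \<notin> J"
    have "(\<lambda>n. \<bar>a n (nat \<lceil>(r n)^2 * s\<rceil>)\<bar>^3 + \<bar>b n (nat \<lceil>(r n)^2 * s\<rceil>)\<bar>^3)
        \<longlonglongrightarrow> \<bar>kernel_sum J \<theta> \<psi>1 s\<bar>^3 + \<bar>kernel_sum J \<theta> \<psi>2 s\<bar>^3"
      by (intro tendsto_add tendsto_power tendsto_rabs abl s)
    from real_tendsto_divide_at_top[OF this r(2)]
    show "(\<lambda>n. (\<bar>a n (nat \<lceil>(r n)^2 * s\<rceil>)\<bar>^3 + \<bar>b n (nat \<lceil>(r n)^2 * s\<rceil>)\<bar>^3) / r n) \<longlonglongrightarrow> 0" .
  qed (use r r0 \<rho> T0 K abz J A0 in auto)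

  define u where "u n k = a n k / r n" for n k
  define v where "v n k = b n k / r n" for n k
  have S1: "(\<Sum>k\<in>{1<..K n}. (u n k)^2 + (v n k)^2) = (\<Sum>k\<in>{1<..K n}. ((a n k)^2 + (b n k)^2) / (r n)^2)" for n
    by (intro sum.cong refl) (simp add: u_def v_def power_divide add_divide_distrib)
  have S2: "(\<Sum>k\<in>{1<..K n}. 2 * (\<bar>u n k\<bar>^3 + \<bar>v n k\<bar>^3) + ((u n k)^2 + (v n k)^2) * \<delta> (k - 1)) =
     2 * (\<Sum>k\<in>{1<..K n}. ((\<bar>a n k\<bar>^3 + \<bar>b n k\<bar>^3) / r n) / (r n)^2) + (\<Sum>k\<in>{1<..K n}. (((a n k)^2 + (b n k)^2) * \<delta> (k - 1)) / (r n)^2)" for n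
  proof -
    have "\<bar>u n k\<bar>^3 + \<bar>v n k\<bar>^3 = ((\<bar>a n k\<bar>^3 + \<bar>b n k\<bar>^3) / r n) / (r n)^2" for k
      using r0[of n] by (simp add: u_def v_def abs_divide power_divide add_divide_distrib power3_eq_cube power2_eq_square)
    moreover have "((u n k)^2 + (v n k)^2) * \<delta> (k - 1) = (((a n k)^2 + (b n k)^2) * \<delta> (k - 1)) / (r n)^2" for k
      by (simp add: u_def v_def power_divide add_divide_distrib algebra_simps)
    ultimately show ?thesis by (simp add: sum.distrib sum_distrib_left)
  qed
  define err where "err n = (\<Sum>k\<in>{1<..K n}. 2 * (\<bar>u n k\<bar>^3 + \<bar>v n k\<bar>^3) + ((u n k)^2 + (v n k)^2) * \<delta> (k - 1))" for n
  have err: "err \<longlonglongrightarrow> 0"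
    unfolding err_def S2 using tendsto_add[OF tendsto_mult[OF tendsto_const[of 2] L3] L2] by simp
  have ev_small: "eventually (\<lambda>n. \<forall>k\<ge>1. \<bar>u n k\<bar> \<le> 1 \<and> \<bar>v n k\<bar> \<le> 1) sequentially"
  proof -
    have "(\<lambda>n. A * (r n) powr (2 * \<rho> - 1)) \<longlonglongrightarrow> 0" by (rule tendsto_mult_right_zero[OF rpow])
    then have "eventually (\<lambda>n. A * (r n) powr (2 * \<rho> - 1) < 1) sequentially" by (rule order_tendstoD) simp
    then show ?thesis
    proof eventually_elim
      case (elim n)
      have "\<bar>u n k\<bar> = \<bar>a n k\<bar> / r n" "\<bar>v n k\<bar> = \<bar>b n k\<bar> / r n" for k
        using r0[of n] by (simp_all add: u_def v_def abs_divide)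
      then show ?case using small[of _ n] elim by (metis less_imp_le order_trans)
    qed
  qed
  have char: "(\<lambda>n. \<integral>\<omega>. iexp (innov_sum (u n) (v n) 1 (K n) \<omega>) \<partial>M) \<longlonglongrightarrow> of_real (exp (- (?I / 2)))"
  proof -
    have e: "(\<lambda>n. of_real (exp (- ((\<Sum>k\<in>{1<..K n}. (u n k)^2 + (v n k)^2) / 2))) :: complex) \<longlonglongrightarrow> of_real (exp (- (?I / 2)))"
      unfolding S1 by (intro tendsto_intros L1) simp
    have "(\<lambda>n. (\<integral>\<omega>. iexp (innov_sum (u n) (v n) 1 (K n) \<omega>) \<partial>M) - of_real (exp (- ((\<Sum>k\<in>{1<..K n}. (u n k)^2 + (v n k)^2) / 2)))) \<longlonglongrightarrow> 0"
    proof (rule Lim_null_comparison[OF _ err])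
      show "eventually (\<lambda>n. cmod ((\<integral>\<omega>. iexp (innov_sum (u n) (v n) 1 (K n) \<omega>) \<partial>M) - of_real (exp (- ((\<Sum>k\<in>{1<..K n}. (u n k)^2 + (v n k)^2) / 2)))) \<le> err n) sequentially"
        using ev_small unfolding err_def \<delta>_def by eventually_elim (rule innov_sum_char[OF K(2)], auto)
    qed
    from tendsto_add[OF this e] show ?thesis by simp
  qed
  define \<epsilon> where "\<epsilon> n = \<Theta> * K0 * T powr \<rho> * (r n) powr (2 * \<rho> - 1)" for n
  have \<epsilon>: "\<epsilon> \<longlonglongrightarrow> 0" unfolding \<epsilon>_def by (rule tendsto_mult_right_zero[OF rpow])
  have approx: "\<bar>(\<Sum>t\<in>J. \<theta> t * lin_stat \<psi>1 \<psi>2 (r n) t \<omega>) - innov_sum (u n) (v n) 1 (K n) \<omega>\<bar> \<le> \<epsilon> n" if om: "\<omega> \<in> space M" for n \<omega>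
  proof -
    let ?Y = "\<lambda>t. innov_sum (\<lambda>k. \<psi>1 (real (m n t) / k)) (\<lambda>k. \<psi>2 (real (m n t) / k)) 1 (m n t) \<omega>"
    let ?X = "\<lambda>t. \<psi>1 1 * s1 (m n t) \<omega> + \<psi>2 1 * s2 (m n t) \<omega>"
    have "innov_sum (u n) (v n) 1 (K n) \<omega> = (\<Sum>t\<in>J. \<theta> t / r n * ?Y t)"
      unfolding u_def[abs_def] v_def[abs_def] a_def b_def m_def by (rule innov_sum_kernel[OF J(1) mK[unfolded m_def]])
    then have eq: "(\<Sum>t\<in>J. \<theta> t * lin_stat \<psi>1 \<psi>2 (r n) t \<omega>) - innov_sum (u n) (v n) 1 (K n) \<omega> = (\<Sum>t\<in>J. \<theta> t / r n * (?X t - ?Y t))"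
      by (simp add: lin_stat_def m_def sum_subtractf right_diff_distrib)
    have "\<bar>\<Sum>t\<in>J. \<theta> t / r n * (?X t - ?Y t)\<bar> \<le> (\<Sum>t\<in>J. \<bar>\<theta> t\<bar> * (K0 * T powr \<rho> * (r n) powr (2 * \<rho> - 1)))"
    proof (rule order_trans[OF sum_abs sum_mono])
      fix t assume t: "t \<in> J"
      have "\<bar>?X t - ?Y t\<bar> \<le> K0 * (T powr \<rho> * (r n) powr (2 * \<rho>))"
      proof (cases "m n t = 0")
        case True
        then show ?thesis using K0(1) by (simp add: s1_def s2_def walk_def innov_sum_def)
      next
        case False
        then have "\<bar>?X t - ?Y t\<bar> \<le> K0 * real (m n t) powr \<rho>" using K0(2)[OF _ om, of "m n t"] by simp
        also have "real (m n t) powr \<rho> \<le> (T * (r n)^2) powr \<rho>"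
          using m_le[OF t, of n] mult_right_mono[OF tT[OF t], of "(r n)^2"] \<rho> by (intro powr_mono2) (auto simp: mult.commute)
        also have "\<dots> = T powr \<rho> * (r n) powr (2 * \<rho>)" using r0[of n] T0 by (simp add: powr_mult powr_powr flip: powr_numeral)
        finally show ?thesis using K0(1) by (simp add: mult_left_mono)
      qed
      then have "\<bar>?X t - ?Y t\<bar> / r n \<le> K0 * (T powr \<rho> * (r n) powr (2 * \<rho>)) / r n"
        using r0[of n] by (intro divide_right_mono) auto
      also have "\<dots> = K0 * T powr \<rho> * (r n) powr (2 * \<rho> - 1)" using r0[of n] by (simp add: powr_diff)
      finally have "\<bar>\<theta> t\<bar> * (\<bar>?X t - ?Y t\<bar> / r n) \<le> \<bar>\<theta> t\<bar> * (K0 * T powr \<rho> * (r n) powr (2 * \<rho> - 1))"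
        by (intro mult_left_mono) auto
      then show "\<bar>\<theta> t / r n * (?X t - ?Y t)\<bar> \<le> \<bar>\<theta> t\<bar> * (K0 * T powr \<rho> * (r n) powr (2 * \<rho> - 1))"
        using r0[of n] by (simp add: abs_mult abs_divide)
    qed
    also have "\<dots> = \<Theta> * (K0 * T powr \<rho> * (r n) powr (2 * \<rho> - 1))" unfolding \<Theta>_def by (rule sum_distrib_right[symmetric])
    also have "\<dots> = \<epsilon> n" by (simp only: \<epsilon>_def mult.assoc)
    finally show ?thesis unfolding eq .
  qed
  have "(\<lambda>n. (\<integral>\<omega>. iexp (\<Sum>t\<in>J. \<theta> t * lin_stat \<psi>1 \<psi>2 (r n) t \<omega>) \<partial>M) - (\<integral>\<omega>. iexp (innov_sum (u n) (v n) 1 (K n) \<omega>) \<partial>M)) \<longlonglongrightarrow> 0"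
  proof (rule Lim_null_comparison[OF always_eventually \<epsilon>], rule allI)
    fix n
    have i: "integrable M (\<lambda>\<omega>. iexp (\<Sum>t\<in>J. \<theta> t * lin_stat \<psi>1 \<psi>2 (r n) t \<omega>))" "integrable M (\<lambda>\<omega>. iexp (innov_sum (u n) (v n) 1 (K n) \<omega>))"
      by (rule integrable_const_bound[where B=1]; simp)+
    have "cmod ((\<integral>\<omega>. iexp (\<Sum>t\<in>J. \<theta> t * lin_stat \<psi>1 \<psi>2 (r n) t \<omega>) \<partial>M) - (\<integral>\<omega>. iexp (innov_sum (u n) (v n) 1 (K n) \<omega>) \<partial>M))
      = cmod (\<integral>\<omega>. iexp (\<Sum>t\<in>J. \<theta> t * lin_stat \<psi>1 \<psi>2 (r n) t \<omega>) - iexp (innov_sum (u n) (v n) 1 (K n) \<omega>) \<partial>M)"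
      using i by simp
    also have "\<dots> \<le> (\<integral>\<omega>. \<epsilon> n \<partial>M)"
      by (rule norm_integral_le[OF integrable_const]) (rule order_trans[OF cmod_iexp_diff_le approx])
    finally show "cmod ((\<integral>\<omega>. iexp (\<Sum>t\<in>J. \<theta> t * lin_stat \<psi>1 \<psi>2 (r n) t \<omega>) \<partial>M) - (\<integral>\<omega>. iexp (innov_sum (u n) (v n) 1 (K n) \<omega>) \<partial>M)) \<le> \<epsilon> n"
      by (simp add: prob_space)
  qed
  from tendsto_add[OF this char] show ?thesis by simp
qed

end

section \<open>Wiener integrals of deterministic functions\<close>

lemma normal_iexp_expectation:
  assumes "prob_space N" and X: "distributed N lborel X (normal_density 0 \<sigma>)" and \<sigma>: "\<sigma> > 0"
  shows "(\<integral>\<omega>. iexp (u * X \<omega>) \<partial>N) = of_real (exp (- (u^2 * \<sigma>^2 / 2)))"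
proof -
  interpret prob_space N by fact
  have Z: "distributed N lborel (\<lambda>\<omega>. (X \<omega> - 0) / \<sigma>) std_normal_density"
    using normal_standard_normal_convert[OF \<sigma>, of X 0] X by simp
  have Zm: "(\<lambda>\<omega>. X \<omega> / \<sigma>) \<in> measurable N lborel" using distributed_measurable[OF Z] by simp
  have "(\<integral>\<omega>. iexp (u * X \<omega>) \<partial>N) = (\<integral>\<omega>. iexp ((u * \<sigma>) * (X \<omega> / \<sigma>)) \<partial>N)"
    using \<sigma> by simp
  also have "\<dots> = (\<integral>x. iexp ((u * \<sigma>) * x) \<partial>distr N lborel (\<lambda>\<omega>. X \<omega> / \<sigma>))"
    by (rule integral_distr[OF Zm, symmetric]) simp
  also have "distr N lborel (\<lambda>\<omega>. X \<omega> / \<sigma>) = std_normal_distribution"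
    using distributed_distr_eq_density[OF Z] by simp
  also have "(\<integral>x. iexp ((u * \<sigma>) * x) \<partial>std_normal_distribution) = char std_normal_distribution (u * \<sigma>)"
    by (simp add: char_def)
  also have "\<dots> = of_real (exp (- (u^2 * \<sigma>^2 / 2)))"
    unfolding char_std_normal_distribution by (simp add: power_mult_distrib)
  finally show ?thesis .
qed

lemma real_brownian_increments_char:
  assumes W: "real_brownian_motion N W" and p: "0 \<le> p 0" "\<And>k. k < n \<Longrightarrow> p k \<le> p (Suc k)"
  shows "(\<integral>\<omega>. iexp (\<Sum>k<n. c k * (W (p (Suc k)) \<omega> - W (p k) \<omega>)) \<partial>N) =
     of_real (exp (- ((\<Sum>k<n. (c k)^2 * (p (Suc k) - p k)) / 2)))"
proof -
  interpret prob_space N using W by (simp add: real_brownian_motion_def)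
  have p0: "0 \<le> p k" if "k \<le> n" for k
    using that by (induction k) (use p in \<open>auto intro: order_trans\<close>)
  have Wm: "W t \<in> borel_measurable N" if "t \<ge> 0" for t using W that by (simp add: real_brownian_motion_def)
  have "indep_vars (\<lambda>_. borel) (\<lambda>i \<omega>. W (p (Suc i)) \<omega> - W (p i) \<omega>) {..<n}"
    using W p unfolding real_brownian_motion_def by blast
  then have ind: "indep_vars (\<lambda>_. borel) (\<lambda>i \<omega>. c i * (W (p (Suc i)) \<omega> - W (p i) \<omega>)) {..<n}"
    by (rule indep_vars_compose2) simp
  have m: "(\<lambda>\<omega>. c k * (W (p (Suc k)) \<omega> - W (p k) \<omega>)) \<in> borel_measurable N" if "k < n" for k
    using that by (intro borel_measurable_times borel_measurable_diff Wm p0) auto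
  have one: "char (distr N borel (\<lambda>\<omega>. c k * (W (p (Suc k)) \<omega> - W (p k) \<omega>))) 1 = of_real (exp (- ((c k)^2 * (p (Suc k) - p k) / 2)))"
    if k: "k < n" for k
  proof -
    have "char (distr N borel (\<lambda>\<omega>. c k * (W (p (Suc k)) \<omega> - W (p k) \<omega>))) 1 = (\<integral>\<omega>. iexp (c k * (W (p (Suc k)) \<omega> - W (p k) \<omega>)) \<partial>N)"
      unfolding char_def by (subst integral_distr[OF m[OF k]]) auto
    also have "\<dots> = of_real (exp (- ((c k)^2 * (p (Suc k) - p k) / 2)))"
    proof (cases "p k = p (Suc k)")
      case True
      then show ?thesis by (simp add: prob_space)
    next
      case False
      then have lt: "p k < p (Suc k)" using p(2)[OF k] by simp
      have "distributed N lborel (\<lambda>\<omega>. W (p (Suc k)) \<omega> - W (p k) \<omega>) (normal_density 0 (sqrt (p (Suc k) - p k)))"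
        using W lt p0[of k] k unfolding real_brownian_motion_def by simp
      from normal_iexp_expectation[OF prob_space_axioms this, of "c k"] lt show ?thesis by simp
    qed
    finally show ?thesis .
  qed
  have sm: "(\<lambda>\<omega>. \<Sum>k<n. c k * (W (p (Suc k)) \<omega> - W (p k) \<omega>)) \<in> borel_measurable N"
    by (intro borel_measurable_sum m) auto
  have "(\<integral>\<omega>. iexp (\<Sum>k<n. c k * (W (p (Suc k)) \<omega> - W (p k) \<omega>)) \<partial>N)
     = char (distr N borel (\<lambda>\<omega>. \<Sum>k<n. c k * (W (p (Suc k)) \<omega> - W (p k) \<omega>))) 1"
    unfolding char_def by (subst integral_distr[OF sm]) auto
  also have "\<dots> = (\<Prod>k<n. char (distr N borel (\<lambda>\<omega>. c k * (W (p (Suc k)) \<omega> - W (p k) \<omega>))) 1)"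
    by (rule char_distr_sum[OF ind])
  also have "\<dots> = (\<Prod>k<n. of_real (exp (- ((c k)^2 * (p (Suc k) - p k) / 2))))"
    by (intro prod.cong refl one) auto
  also have "\<dots> = of_real (exp (\<Sum>k<n. - ((c k)^2 * (p (Suc k) - p k) / 2)))"
    by (simp only: exp_sum finite_lessThan of_real_prod)
  also have "(\<Sum>k<n. - ((c k)^2 * (p (Suc k) - p k) / 2)) = - ((\<Sum>k<n. (c k)^2 * (p (Suc k) - p k)) / 2)"
    by (simp only: sum_negf sum_divide_distrib)
  finally show ?thesis .
qed

text \<open>Increments are independent over time within a coordinate, whereas the coordinates are independent as whole
paths.  So the sum is first split into one functional of the path for each coordinate, and each of
these is then handled by the one-dimensional case.\<close>

lemma brownian_increments_char:
  fixes B :: "real \<Rightarrow> 'b \<Rightarrow> 'v::euclidean_space"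
  assumes B: "standard_brownian_motion N B" and p: "0 \<le> p 0" "\<And>k. k < n \<Longrightarrow> p k \<le> p (Suc k)"
  shows "(\<integral>\<omega>. iexp (\<Sum>k<n. c k \<bullet> (B (p (Suc k)) \<omega> - B (p k) \<omega>)) \<partial>N) =
     of_real (exp (- ((\<Sum>k<n. (norm (c k))^2 * (p (Suc k) - p k)) / 2)))"
proof -
  obtain b0 :: 'v where "b0 \<in> Basis" using nonempty_Basis by blast
  then interpret prob_space N using B by (auto simp: standard_brownian_motion_def real_brownian_motion_def)
  have W: "real_brownian_motion N (\<lambda>t \<omega>. B t \<omega> \<bullet> b)" if "b \<in> Basis" for b
    using B that by (simp add: standard_brownian_motion_def)
  have p0: "0 \<le> p k" if "k \<le> n" for k
    using that by (induction k) (use p in \<open>auto intro: order_trans\<close>)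
  define F where "F b w = (\<Sum>k<n. (c k \<bullet> b) * (w (p (Suc k)) - w (p k)))" for b and w :: "real \<Rightarrow> real"
  have Fm: "F b \<in> borel_measurable (Pi\<^sub>M {0..} (\<lambda>_. borel))" for b
    unfolding F_def[abs_def]
    by (intro borel_measurable_sum borel_measurable_times borel_measurable_const borel_measurable_diff measurable_component_singleton)
       (use p0 in auto)
  have "indep_vars (\<lambda>_. Pi\<^sub>M {0..} (\<lambda>_. borel)) (\<lambda>b \<omega>. \<lambda>t\<in>{0..}. B t \<omega> \<bullet> b) Basis"
    using B by (simp add: standard_brownian_motion_def)
  then have "indep_vars (\<lambda>_. borel) (\<lambda>b \<omega>. F b (\<lambda>t\<in>{0..}. B t \<omega> \<bullet> b)) Basis"
    by (rule indep_vars_compose2) (rule Fm)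
  moreover have Fr: "F b (\<lambda>t\<in>{0..}. B t \<omega> \<bullet> b) = F b (\<lambda>t. B t \<omega> \<bullet> b)" for b \<omega>
    unfolding F_def using p0 by (intro sum.cong refl) auto
  ultimately have ind: "indep_vars (\<lambda>_. borel) (\<lambda>b \<omega>. F b (\<lambda>t. B t \<omega> \<bullet> b)) Basis" by simp
  then have m: "(\<lambda>\<omega>. F b (\<lambda>t. B t \<omega> \<bullet> b)) \<in> borel_measurable N" if "b \<in> Basis" for b
    using that by (auto simp: indep_vars_def)
  have sm: "(\<lambda>\<omega>. \<Sum>b\<in>Basis. F b (\<lambda>t. B t \<omega> \<bullet> b)) \<in> borel_measurable N"
    by (intro borel_measurable_sum m)
  have split: "(\<Sum>k<n. c k \<bullet> (B (p (Suc k)) \<omega> - B (p k) \<omega>)) = (\<Sum>b\<in>Basis. F b (\<lambda>t. B t \<omega> \<bullet> b))" for \<omega>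
  proof -
    have "(\<Sum>k<n. c k \<bullet> (B (p (Suc k)) \<omega> - B (p k) \<omega>)) = (\<Sum>k<n. \<Sum>b\<in>Basis. (c k \<bullet> b) * (B (p (Suc k)) \<omega> \<bullet> b - B (p k) \<omega> \<bullet> b))"
      by (subst euclidean_inner) (simp add: inner_diff_left)
    also have "\<dots> = (\<Sum>b\<in>Basis. F b (\<lambda>t. B t \<omega> \<bullet> b))" unfolding F_def by (rule sum.swap)
    finally show ?thesis .
  qed
  have one: "char (distr N borel (\<lambda>\<omega>. F b (\<lambda>t. B t \<omega> \<bullet> b))) 1 = of_real (exp (- ((\<Sum>k<n. (c k \<bullet> b)^2 * (p (Suc k) - p k)) / 2)))"
    if b: "b \<in> Basis" for b
  proof -
    have "char (distr N borel (\<lambda>\<omega>. F b (\<lambda>t. B t \<omega> \<bullet> b))) 1 = (\<integral>\<omega>. iexp (F b (\<lambda>t. B t \<omega> \<bullet> b)) \<partial>N)"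
      unfolding char_def by (subst integral_distr[OF m[OF b]]) auto
    also have "\<dots> = of_real (exp (- ((\<Sum>k<n. (c k \<bullet> b)^2 * (p (Suc k) - p k)) / 2)))"
      unfolding F_def by (rule real_brownian_increments_char[OF W[OF b] p])
    finally show ?thesis .
  qed
  have "(\<integral>\<omega>. iexp (\<Sum>k<n. c k \<bullet> (B (p (Suc k)) \<omega> - B (p k) \<omega>)) \<partial>N) = char (distr N borel (\<lambda>\<omega>. \<Sum>b\<in>Basis. F b (\<lambda>t. B t \<omega> \<bullet> b))) 1"
    unfolding char_def split by (subst integral_distr[OF sm]) auto
  also have "\<dots> = (\<Prod>b\<in>Basis. char (distr N borel (\<lambda>\<omega>. F b (\<lambda>t. B t \<omega> \<bullet> b))) 1)"
    by (rule char_distr_sum[OF ind])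
  also have "\<dots> = (\<Prod>b\<in>Basis. of_real (exp (- ((\<Sum>k<n. (c k \<bullet> b)^2 * (p (Suc k) - p k)) / 2))))"
    by (intro prod.cong refl one)
  also have "\<dots> = of_real (exp (\<Sum>b\<in>Basis. - ((\<Sum>k<n. (c k \<bullet> b)^2 * (p (Suc k) - p k)) / 2)))"
    by (simp only: exp_sum finite_Basis of_real_prod)
  also have "(\<Sum>b\<in>Basis. - ((\<Sum>k<n. (c k \<bullet> b)^2 * (p (Suc k) - p k)) / 2)) = - ((\<Sum>b\<in>Basis. \<Sum>k<n. (c k \<bullet> b)^2 * (p (Suc k) - p k)) / 2)"
    by (simp only: sum_negf sum_divide_distrib)
  also have "(\<Sum>b\<in>Basis. \<Sum>k<n. (c k \<bullet> b)^2 * (p (Suc k) - p k)) = (\<Sum>k<n. (norm (c k))^2 * (p (Suc k) - p k))"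
  proof -
    have "(norm (c k))^2 = (\<Sum>b\<in>Basis. (c k \<bullet> b)^2)" for k
      unfolding power2_norm_eq_inner by (subst euclidean_inner) (simp add: power2_eq_square)
    then show ?thesis by (subst sum.swap) (simp add: sum_distrib_right)
  qed
  finally show ?thesis .
qed

text \<open>The intervals of a step function given as a list may overlap.  On the grid of all their end points the
same step function and the same integral have a representation with disjoint cells, for which
independence of increments can be used.\<close>

lemma step_grid:
  fixes xs :: "('v::euclidean_space \<times> real \<times> real) list"
  assumes xs': "\<forall>(a, l, r)\<in>set xs. 0 \<le> l \<and> l \<le> r"
  shows "\<exists>(n :: nat) (p :: nat \<Rightarrow> real) c. 0 \<le> p 0 \<and> (\<forall>i j. i \<le> j \<longrightarrow> j \<le> n \<longrightarrow> p i \<le> p j) \<and>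
    (\<forall>(B :: real \<Rightarrow> 'b \<Rightarrow> 'v) \<omega>. step_integral B xs \<omega> = (\<Sum>k<n. c k \<bullet> (B (p (Suc k)) \<omega> - B (p k) \<omega>))) \<and>
    (\<forall>s. step_fun xs s = (\<Sum>k<n. indicator {p k<..p (Suc k)} s *\<^sub>R c k))"
proof -
  have xs: "0 \<le> l \<and> l \<le> r" if "(a, l, r) \<in> set xs" for a l r using xs' that by auto
  define P where "P = insert 0 ((\<lambda>(a, l, r). l) ` set xs \<union> (\<lambda>(a, l, r). r) ` set xs)"
  have P: "finite P" "P \<noteq> {}" "\<And>x. x \<in> P \<Longrightarrow> 0 \<le> x"
    using xs by (auto simp: P_def intro: order_trans)
  define ps where "ps = sorted_list_of_set P"
  have ps: "set ps = P" "sorted ps" "ps \<noteq> []" using P by (auto simp: ps_def)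
  define n where "n = length ps - 1"
  define p where "p i = ps ! i" for i
  have len: "length ps = Suc n" using ps(3) by (cases ps) (auto simp: n_def)
  have mono: "p i \<le> p j" if "i \<le> j" "j \<le> n" for i j
    unfolding p_def using ps(2) that len by (intro sorted_nth_mono) auto
  have p0: "0 \<le> p 0" using P(3)[of "p 0"] ps(1) len nth_mem[of 0 ps] by (simp add: p_def)
  have idx: "\<exists>i\<le>n. p i = x" if "x \<in> P" for x
    using that len unfolding ps(1)[symmetric] in_set_conv_nth p_def by (auto simp: less_Suc_eq_le)
  have "\<exists>c. (\<forall>(B :: real \<Rightarrow> 'b \<Rightarrow> 'v) \<omega>. step_integral B ys \<omega> = (\<Sum>k<n. c k \<bullet> (B (p (Suc k)) \<omega> - B (p k) \<omega>))) \<and>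
     (\<forall>s. step_fun ys s = (\<Sum>k<n. indicator {p k<..p (Suc k)} s *\<^sub>R c k))" if "set ys \<subseteq> set xs" for ys
    using that
  proof (induction ys)
    case Nil
    then show ?case by (intro exI[of _ "\<lambda>_. 0"]) (simp add: step_integral_def step_fun_def)
  next
    case (Cons x ys)
    then obtain c where c: "\<And>(B :: real \<Rightarrow> 'b \<Rightarrow> 'v) \<omega>. step_integral B ys \<omega> = (\<Sum>k<n. c k \<bullet> (B (p (Suc k)) \<omega> - B (p k) \<omega>))"
      "\<And>s. step_fun ys s = (\<Sum>k<n. indicator {p k<..p (Suc k)} s *\<^sub>R c k)" by auto
    obtain a l r where x: "x = (a, l, r)" by (cases x) auto
    have lr: "l \<le> r" "l \<in> P" "r \<in> P" using Cons.prems xs[of a l r] by (force simp: x P_def)+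
    obtain i j0 where i: "i \<le> n" "p i = l" "j0 \<le> n" "p j0 = r" using idx lr by metis
    define j where "j = max i j0"
    have j: "i \<le> j" "j \<le> n" "p j = r"
    proof -
      show "i \<le> j" "j \<le> n" using i by (auto simp: j_def)
      show "p j = r"
      proof (cases "i \<le> j0")
        case False
        then have "r \<le> l" using mono[of j0 i] i by auto
        then show ?thesis using False lr i by (simp add: j_def max_def)
      qed (use i in \<open>simp add: j_def max_def\<close>)
    qed
    define d where "d k = (if i \<le> k \<and> k < j then a else 0)" for k
    have d1: "(\<Sum>k<n. d k \<bullet> (B (p (Suc k)) \<omega> - B (p k) \<omega>)) = a \<bullet> (B r \<omega> - B l \<omega>)" for B :: "real \<Rightarrow> 'b \<Rightarrow> 'v" and \<omega>
    proof -
      have "(\<Sum>k<n. d k \<bullet> (B (p (Suc k)) \<omega> - B (p k) \<omega>)) = (\<Sum>k\<in>{i..<j}. a \<bullet> (B (p (Suc k)) \<omega> - B (p k) \<omega>))"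
        by (rule sum.mono_neutral_cong_right) (use j in \<open>auto simp: d_def\<close>)
      also have "\<dots> = a \<bullet> (\<Sum>k\<in>{i..<j}. B (p (Suc k)) \<omega> - B (p k) \<omega>)" by (simp only: inner_sum_right)
      also have "(\<Sum>k\<in>{i..<j}. B (p (Suc k)) \<omega> - B (p k) \<omega>) = B (p j) \<omega> - B (p i) \<omega>"
        by (rule sum_Suc_diff'[OF j(1), of "\<lambda>k. B (p k) \<omega>"])
      finally show ?thesis using i j by simp
    qed
    have d2: "(\<Sum>k<n. indicator {p k<..p (Suc k)} s *\<^sub>R d k) = indicator {l<..r} s *\<^sub>R a" for s
    proof -
      have tel: "indicator {x<..y} s = (indicator {..y} s - indicator {..x} s :: real)" if "x \<le> y" for x y
        using that by (auto split: split_indicator)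
      have "(\<Sum>k<n. indicator {p k<..p (Suc k)} s *\<^sub>R d k) = (\<Sum>k\<in>{i..<j}. indicator {p k<..p (Suc k)} s *\<^sub>R a)"
        by (rule sum.mono_neutral_cong_right) (use j in \<open>auto simp: d_def\<close>)
      also have "\<dots> = (\<Sum>k\<in>{i..<j}. indicator {..p (Suc k)} s - indicator {..p k} s) *\<^sub>R a"
        unfolding scaleR_sum_left by (intro sum.cong refl arg_cong2[where f="(*\<^sub>R)"] tel mono) (use j in auto)
      also have "(\<Sum>k\<in>{i..<j}. indicator {..p (Suc k)} s - indicator {..p k} s) = (indicator {..p j} s - indicator {..p i} s :: real)"
        by (rule sum_Suc_diff'[OF j(1), of "\<lambda>k. indicator {..p k} s"])
      finally show ?thesis using i j lr by (simp add: tel)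
    qed
    show ?case
    proof (intro exI[of _ "\<lambda>k. d k + c k"] conjI allI)
      fix B :: "real \<Rightarrow> 'b \<Rightarrow> 'v" and \<omega>
      have "step_integral B (x # ys) \<omega> = a \<bullet> (B r \<omega> - B l \<omega>) + step_integral B ys \<omega>" by (simp add: step_integral_def x)
      then show "step_integral B (x # ys) \<omega> = (\<Sum>k<n. (d k + c k) \<bullet> (B (p (Suc k)) \<omega> - B (p k) \<omega>))"
        by (simp only: c(1) d1[symmetric] inner_add_left sum.distrib)
    next
      fix s
      have "step_fun (x # ys) s = indicator {l<..r} s *\<^sub>R a + step_fun ys s" by (simp add: step_fun_def x)
      then show "step_fun (x # ys) s = (\<Sum>k<n. indicator {p k<..p (Suc k)} s *\<^sub>R (d k + c k))"
        by (simp only: c(2) d2[symmetric] scaleR_add_right sum.distrib)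
    qed
  qed
  from this[of xs] obtain c where c: "\<And>(B :: real \<Rightarrow> 'b \<Rightarrow> 'v) \<omega>. step_integral B xs \<omega> = (\<Sum>k<n. c k \<bullet> (B (p (Suc k)) \<omega> - B (p k) \<omega>))"
      "\<And>s. step_fun xs s = (\<Sum>k<n. indicator {p k<..p (Suc k)} s *\<^sub>R c k)" by auto
  show ?thesis
    by (rule exI[of _ n], rule exI[of _ p], rule exI[of _ c]) (use p0 mono c in simp)
qed

lemma step_integral_char:
  fixes B :: "real \<Rightarrow> 'b \<Rightarrow> 'v::euclidean_space"
  assumes B: "standard_brownian_motion N B"
    and xs: "\<And>a l r. (a, l, r) \<in> set xs \<Longrightarrow> 0 \<le> l \<and> l \<le> r"
  shows "(\<integral>\<omega>. iexp (step_integral B xs \<omega>) \<partial>N) = of_real (exp (- ((\<integral>s. (norm (step_fun xs s))^2 \<partial>lborel) / 2)))"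
    and "integrable lborel (\<lambda>s. (norm (step_fun xs s))^2)"
proof -
  obtain n :: nat and p :: "nat \<Rightarrow> real" and c :: "nat \<Rightarrow> 'v" where p: "0 \<le> p 0" "\<And>i j. i \<le> j \<Longrightarrow> j \<le> n \<Longrightarrow> p i \<le> p j"
    and I: "\<And>(B :: real \<Rightarrow> 'b \<Rightarrow> 'v) \<omega>. step_integral B xs \<omega> = (\<Sum>k<n. c k \<bullet> (B (p (Suc k)) \<omega> - B (p k) \<omega>))"
    and f: "\<And>s. step_fun xs s = (\<Sum>k<n. indicator {p k<..p (Suc k)} s *\<^sub>R c k)"
    using step_grid[of xs] xs by blast
  have sq: "(norm (step_fun xs s))^2 = (\<Sum>k<n. (norm (c k))^2 * indicator {p k<..p (Suc k)} s)" for s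
  proof (cases "\<exists>k0<n. s \<in> {p k0<..p (Suc k0)}")
    case False
    then have z: "indicator {p k<..p (Suc k)} s = (0::real)" if "k < n" for k using that by (simp add: indicator_def)
    have "(\<Sum>k<n. indicator {p k<..p (Suc k)} s *\<^sub>R c k) = 0" by (rule sum.neutral) (simp add: z)
    moreover have "(\<Sum>k<n. (norm (c k))^2 * indicator {p k<..p (Suc k)} s) = 0" by (rule sum.neutral) (simp add: z)
    ultimately show ?thesis unfolding f by simp
  next
    case True
    then obtain k0 where k0: "k0 < n" "s \<in> {p k0<..p (Suc k0)}" by blast
    have other: "s \<notin> {p k<..p (Suc k)}" if "k < n" "k \<noteq> k0" for k
      using that k0 p(2)[of "Suc k" k0] p(2)[of "Suc k0" k] by (cases k k0 rule: linorder_cases) auto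
    have "(\<Sum>k<n. indicator {p k<..p (Suc k)} s *\<^sub>R c k) = (\<Sum>k<n. if k = k0 then c k else 0)"
      using k0 other by (intro sum.cong refl) (auto simp: indicator_def)
    moreover have "(\<Sum>k<n. (norm (c k))^2 * indicator {p k<..p (Suc k)} s) = (\<Sum>k<n. if k = k0 then (norm (c k))^2 else 0)"
      using k0 other by (intro sum.cong refl) (auto simp: indicator_def)
    ultimately show ?thesis unfolding f using k0 by simp
  qed
  have cell: "has_bochner_integral lborel (\<lambda>s. (norm (c k))^2 * indicator {p k<..p (Suc k)} s) ((norm (c k))^2 * (p (Suc k) - p k))" if "k < n" for k
    using p(2)[of k "Suc k"] that by (simp add: has_bochner_integral_iff)
  have hb: "has_bochner_integral lborel (\<lambda>s. (norm (step_fun xs s))^2) (\<Sum>k<n. (norm (c k))^2 * (p (Suc k) - p k))"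
    unfolding sq by (rule has_bochner_integral_sum) (rule cell, simp)
  then show "integrable lborel (\<lambda>s. (norm (step_fun xs s))^2)" by (simp add: has_bochner_integral_iff)
  have "(\<integral>s. (norm (step_fun xs s))^2 \<partial>lborel) = (\<Sum>k<n. (norm (c k))^2 * (p (Suc k) - p k))"
    using hb by (simp add: has_bochner_integral_iff)
  moreover have "(\<integral>\<omega>. iexp (step_integral B xs \<omega>) \<partial>N) = of_real (exp (- ((\<Sum>k<n. (norm (c k))^2 * (p (Suc k) - p k)) / 2)))"
    unfolding I by (rule brownian_increments_char[OF B, of p, OF p(1)]) (use p(2) in auto)
  ultimately show "(\<integral>\<omega>. iexp (step_integral B xs \<omega>) \<partial>N) = of_real (exp (- ((\<integral>s. (norm (step_fun xs s))^2 \<partial>lborel) / 2)))"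
    by simp
qed

text \<open>Linear combinations of integrals over different horizons are integrals of a single step function; so
joint laws of several Wiener integrals reduce to the law of one.\<close>

lemma step_linear_combination:
  fixes xs :: "'i \<Rightarrow> ('v::euclidean_space \<times> real \<times> real) list"
  assumes "finite J" "\<forall>t\<in>J. \<forall>(a, l, r)\<in>set (xs t). 0 \<le> l \<and> l \<le> r"
  shows "\<exists>zs. (\<forall>(a, l, r) \<in> set zs. 0 \<le> l \<and> l \<le> r) \<and>
    (\<forall>(B :: real \<Rightarrow> 'b \<Rightarrow> 'v) \<omega>. step_integral B zs \<omega> = (\<Sum>t\<in>J. \<theta> t * step_integral B (xs t) \<omega>)) \<and>
    (\<forall>s. step_fun zs s = (\<Sum>t\<in>J. \<theta> t *\<^sub>R step_fun (xs t) s))"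
    using assms
  proof (induction J rule: finite_induct)
    case empty
    then show ?case by (intro exI[of _ "[]"]) (simp add: step_integral_def step_fun_def)
  next
    case (insert t J)
    then have "\<forall>t\<in>J. \<forall>(a, l, r)\<in>set (xs t). 0 \<le> l \<and> l \<le> r" by simp
    from insert.IH[OF this] obtain zs where zs: "\<forall>(a, l, r) \<in> set zs. 0 \<le> l \<and> l \<le> r"
      "\<And>(B :: real \<Rightarrow> 'b \<Rightarrow> 'v) \<omega>. step_integral B zs \<omega> = (\<Sum>t\<in>J. \<theta> t * step_integral B (xs t) \<omega>)"
      "\<And>s. step_fun zs s = (\<Sum>t\<in>J. \<theta> t *\<^sub>R step_fun (xs t) s)" by blast
    let ?ys = "map (\<lambda>(a, l, r). (\<theta> t *\<^sub>R a, l, r)) (xs t)"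
    have i: "step_integral B (map (\<lambda>(a, l, r). (q *\<^sub>R a, l, r)) ys) \<omega> = q * step_integral B ys \<omega>" for q ys and B :: "real \<Rightarrow> 'b \<Rightarrow> 'v" and \<omega>
      by (induction ys) (auto simp: step_integral_def algebra_simps)
    have f: "step_fun (map (\<lambda>(a, l, r). (q *\<^sub>R a, l, r)) ys) s = q *\<^sub>R step_fun ys s" for q and ys :: "('v \<times> real \<times> real) list" and s
      by (induction ys) (auto simp: step_fun_def algebra_simps)
    show ?case
    proof (intro exI[of _ "?ys @ zs"] conjI allI)
      show "\<forall>(a, l, r)\<in>set (?ys @ zs). 0 \<le> l \<and> l \<le> r"
        using zs(1) insert.prems by auto
      fix B :: "real \<Rightarrow> 'b \<Rightarrow> 'v" and \<omega>
      have "step_integral B (?ys @ zs) \<omega> = step_integral B ?ys \<omega> + step_integral B zs \<omega>" by (simp add: step_integral_def)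
      then show "step_integral B (?ys @ zs) \<omega> = (\<Sum>t\<in>insert t J. \<theta> t * step_integral B (xs t) \<omega>)"
        by (simp only: i zs(2) sum.insert[OF insert.hyps(1,2)])
    next
      fix s
      have "step_fun (?ys @ zs) s = step_fun ?ys s + step_fun zs s" by (simp add: step_fun_def)
      then show "step_fun (?ys @ zs) s = (\<Sum>t\<in>insert t J. \<theta> t *\<^sub>R step_fun (xs t) s)"
        by (simp only: f zs(3) sum.insert[OF insert.hyps(1,2)])
    qed
  qed


text \<open>\<open>|exp (i x) - exp (i y)| \<le> |x - y| \<le> e/2 + (x - y)\<^sup>2/e\<close> for every \<open>e > 0\<close>, so mean-square convergence suffices.\<close>

lemma l2_limit_iexp:
  assumes "prob_space N" and X: "\<And>m. X m \<in> borel_measurable N" and Y: "Y \<in> borel_measurable N"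
    and lim: "(\<lambda>m. \<integral>\<^sup>+\<omega>. ennreal ((X m \<omega> - Y \<omega>)^2) \<partial>N) \<longlonglongrightarrow> 0"
  shows "(\<lambda>m. \<integral>\<omega>. iexp (X m \<omega>) \<partial>N) \<longlonglongrightarrow> (\<integral>\<omega>. iexp (Y \<omega>) \<partial>N)"
proof (rule LIMSEQ_I)
  interpret prob_space N by fact
  fix e :: real assume e: "e > 0"
  note [measurable] = X Y
  have "eventually (\<lambda>m. (\<integral>\<^sup>+\<omega>. ennreal ((X m \<omega> - Y \<omega>)^2) \<partial>N) < ennreal (e^2 / 4)) sequentially"
    by (rule order_tendstoD(2)[OF lim]) (use e in simp)
  then obtain m0 where m0: "\<And>m. m \<ge> m0 \<Longrightarrow> (\<integral>\<^sup>+\<omega>. ennreal ((X m \<omega> - Y \<omega>)^2) \<partial>N) < ennreal (e^2 / 4)"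
    by (auto simp: eventually_sequentially)
  show "\<exists>m0. \<forall>m\<ge>m0. norm ((\<integral>\<omega>. iexp (X m \<omega>) \<partial>N) - (\<integral>\<omega>. iexp (Y \<omega>) \<partial>N)) < e"
  proof (intro exI allI impI)
    fix m assume "m0 \<le> m"
    note lt = m0[OF this]
    have int: "integrable N (\<lambda>\<omega>. (X m \<omega> - Y \<omega>)^2)"
      by (rule integrableI_nonneg) (use lt in \<open>auto intro: less_trans\<close>)
    have "ennreal (\<integral>\<omega>. (X m \<omega> - Y \<omega>)^2 \<partial>N) < ennreal (e^2 / 4)"
      using lt by (subst (asm) nn_integral_eq_integral[OF int]) auto
    then have small: "(\<integral>\<omega>. (X m \<omega> - Y \<omega>)^2 \<partial>N) < e^2 / 4" using e by (subst (asm) ennreal_less_iff) auto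
    have i: "integrable N (\<lambda>\<omega>. iexp (X m \<omega>))" "integrable N (\<lambda>\<omega>. iexp (Y \<omega>))"
      by (rule integrable_const_bound[where B=1]; simp)+
    have pt: "cmod (iexp (X m \<omega>) - iexp (Y \<omega>)) \<le> e / 2 + (X m \<omega> - Y \<omega>)^2 / e" for \<omega>
    proof -
      let ?d = "\<bar>X m \<omega> - Y \<omega>\<bar>"
      have "0 \<le> (?d - e)^2" by simp
      also have "\<dots> = (X m \<omega> - Y \<omega>)^2 - 2 * e * ?d + e^2" by (simp add: power2_diff)
      finally have "2 * e * ?d \<le> (X m \<omega> - Y \<omega>)^2 + e^2" by simp
      then have "?d \<le> ((X m \<omega> - Y \<omega>)^2 + e^2) / (2 * e)" using e by (simp add: field_simps)
      also have "\<dots> = e / 2 + (X m \<omega> - Y \<omega>)^2 / (2 * e)" using e by (simp add: add_divide_distrib power2_eq_square)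
      also have "\<dots> \<le> e / 2 + (X m \<omega> - Y \<omega>)^2 / e" using e by (intro add_left_mono frac_le) auto
      finally have "?d \<le> e / 2 + (X m \<omega> - Y \<omega>)^2 / e" .
      then show ?thesis by (rule order_trans[OF cmod_iexp_diff_le])
    qed
    have "norm ((\<integral>\<omega>. iexp (X m \<omega>) \<partial>N) - (\<integral>\<omega>. iexp (Y \<omega>) \<partial>N)) = norm (\<integral>\<omega>. iexp (X m \<omega>) - iexp (Y \<omega>) \<partial>N)"
      using i by simp
    also have "\<dots> \<le> (\<integral>\<omega>. e / 2 + (X m \<omega> - Y \<omega>)^2 / e \<partial>N)"
      by (rule norm_integral_le) (use pt int in auto)
    also have "\<dots> = e / 2 + (\<integral>\<omega>. (X m \<omega> - Y \<omega>)^2 \<partial>N) / e"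
      using int by (simp add: prob_space)
    also have "\<dots> < e / 2 + (e^2 / 4) / e" using small e by (intro add_strict_left_mono divide_strict_right_mono) auto
    also have "\<dots> \<le> e" using e by (simp add: power2_eq_square)
    finally show "norm ((\<integral>\<omega>. iexp (X m \<omega>) \<partial>N) - (\<integral>\<omega>. iexp (Y \<omega>) \<partial>N)) < e" .
  qed
qed

text \<open>Continuity of the \<open>L\<^sup>2\<close> norm, from \<open>| |a|\<^sup>2 - |b|\<^sup>2 | \<le> (1 + 1/\<eta>) |a - b|\<^sup>2 + \<eta> |b|\<^sup>2\<close>.\<close>

lemma l2_limit_norm:
  fixes f :: "nat \<Rightarrow> 'a \<Rightarrow> 'v::euclidean_space"
  assumes f: "\<And>m. f m \<in> borel_measurable L" "\<And>m. integrable L (\<lambda>s. (norm (f m s))^2)"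
    and g: "g \<in> borel_measurable L" "integrable L (\<lambda>s. (norm (g s))^2)"
    and lim: "(\<lambda>m. \<integral>\<^sup>+s. ennreal ((norm (f m s - g s))^2) \<partial>L) \<longlonglongrightarrow> 0"
  shows "(\<lambda>m. \<integral>s. (norm (f m s))^2 \<partial>L) \<longlonglongrightarrow> (\<integral>s. (norm (g s))^2 \<partial>L)"
proof (rule LIMSEQ_I)
  fix e :: real assume e: "e > 0"
  note [measurable] = f(1) g(1)
  define G where "G = (\<integral>s. (norm (g s))^2 \<partial>L)"
  have G0: "0 \<le> G" unfolding G_def by (intro integral_nonneg_AE) auto
  define \<eta> where "\<eta> = e / (2 * (G + 1))"
  have \<eta>: "\<eta> > 0" using e G0 by (simp add: \<eta>_def)
  have \<eta>G: "\<eta> * G \<le> e / 2"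
  proof -
    have "\<eta> * G = e / 2 * (G / (G + 1))" using G0 by (simp add: \<eta>_def field_simps)
    also have "\<dots> \<le> e / 2 * 1" using e G0 by (intro mult_left_mono) auto
    finally show ?thesis by simp
  qed
  define \<kappa> where "\<kappa> = e / (2 * (1 + 1 / \<eta>))"
  have p1: "1 + 1 / \<eta> > 0" using \<eta> by (simp add: add_pos_pos)
  have \<kappa>: "\<kappa> > 0" unfolding \<kappa>_def using e p1 by (intro divide_pos_pos) auto
  have "eventually (\<lambda>m. (\<integral>\<^sup>+s. ennreal ((norm (f m s - g s))^2) \<partial>L) < ennreal \<kappa>) sequentially"
    by (rule order_tendstoD(2)[OF lim]) (use \<kappa> in simp)
  then obtain m0 where m0: "\<And>m. m \<ge> m0 \<Longrightarrow> (\<integral>\<^sup>+s. ennreal ((norm (f m s - g s))^2) \<partial>L) < ennreal \<kappa>"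
    by (auto simp: eventually_sequentially)
  show "\<exists>m0. \<forall>m\<ge>m0. norm ((\<integral>s. (norm (f m s))^2 \<partial>L) - (\<integral>s. (norm (g s))^2 \<partial>L)) < e"
  proof (intro exI allI impI)
    fix m assume "m0 \<le> m"
    note lt = m0[OF this]
    have int: "integrable L (\<lambda>s. (norm (f m s - g s))^2)"
      by (rule integrableI_nonneg) (use lt in \<open>auto intro: less_trans\<close>)
    have "ennreal (\<integral>s. (norm (f m s - g s))^2 \<partial>L) < ennreal \<kappa>"
      using lt by (subst (asm) nn_integral_eq_integral[OF int]) auto
    then have small: "(\<integral>s. (norm (f m s - g s))^2 \<partial>L) < \<kappa>" using \<kappa> by (subst (asm) ennreal_less_iff) auto
    have pt: "\<bar>(norm (f m s))^2 - (norm (g s))^2\<bar> \<le> (1 + 1 / \<eta>) * (norm (f m s - g s))^2 + \<eta> * (norm (g s))^2" for s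
    proof -
      let ?a = "norm (f m s)" and ?b = "norm (g s)" and ?d = "norm (f m s - g s)"
      have d: "\<bar>?a - ?b\<bar> \<le> ?d" by (rule norm_triangle_ineq3)
      have "?a^2 - ?b^2 = (?a - ?b) * ((?a - ?b) + 2 * ?b)"
        by (simp add: power2_eq_square algebra_simps)
      then have "\<bar>?a^2 - ?b^2\<bar> = \<bar>?a - ?b\<bar> * \<bar>(?a - ?b) + 2 * ?b\<bar>"
        by (simp only: abs_mult)
      also have "\<dots> \<le> ?d * (?d + 2 * ?b)" using d by (intro mult_mono) auto
      also have "\<dots> = ?d^2 + 2 * ?d * ?b" by (simp add: power2_eq_square algebra_simps)
      also have "2 * ?d * ?b \<le> ?d^2 / \<eta> + \<eta> * ?b^2"
      proof -
        have "0 \<le> (?d - \<eta> * ?b)^2" by simp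
        then have "\<eta> * (2 * ?d * ?b) \<le> ?d^2 + \<eta>^2 * ?b^2" by (simp add: power2_diff power_mult_distrib algebra_simps)
        then show ?thesis using \<eta> by (simp add: field_simps power2_eq_square)
      qed
      finally show ?thesis by (simp add: algebra_simps)
    qed
    have "norm ((\<integral>s. (norm (f m s))^2 \<partial>L) - (\<integral>s. (norm (g s))^2 \<partial>L)) = norm (\<integral>s. (norm (f m s))^2 - (norm (g s))^2 \<partial>L)"
      using f(2)[of m] g(2) by simp
    also have "\<dots> \<le> (\<integral>s. (1 + 1 / \<eta>) * (norm (f m s - g s))^2 + \<eta> * (norm (g s))^2 \<partial>L)"
      by (rule norm_integral_le) (use pt int g(2) in auto)
    also have "\<dots> = (1 + 1 / \<eta>) * (\<integral>s. (norm (f m s - g s))^2 \<partial>L) + \<eta> * G"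
      using int g(2) by (simp add: G_def)
    also have "\<dots> < (1 + 1 / \<eta>) * \<kappa> + e / 2"
      using small \<eta>G p1 by (intro add_less_le_mono mult_strict_left_mono) auto
    also have "(1 + 1 / \<eta>) * \<kappa> = e / 2"
    proof -
      have "q * (e / (2 * q)) = e / 2" if "q > 0" for q using that by simp
      from this[OF p1] show ?thesis unfolding \<kappa>_def .
    qed
    finally show "norm ((\<integral>s. (norm (f m s))^2 \<partial>L) - (\<integral>s. (norm (g s))^2 \<partial>L)) < e" by simp
  qed
qed

lemma nn_integral_square_sum_tendsto_0:
  fixes D :: "nat \<Rightarrow> 'i \<Rightarrow> 'a \<Rightarrow> 'v::euclidean_space"
  assumes J: "finite J" and D: "\<And>m t. t \<in> J \<Longrightarrow> D m t \<in> borel_measurable L"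
    and lim: "\<And>t. t \<in> J \<Longrightarrow> (\<lambda>m. \<integral>\<^sup>+s. ennreal ((norm (D m t s))^2) \<partial>L) \<longlonglongrightarrow> 0"
  shows "(\<lambda>m. \<integral>\<^sup>+s. ennreal ((norm (\<Sum>t\<in>J. \<theta> t *\<^sub>R D m t s))^2) \<partial>L) \<longlonglongrightarrow> 0"
  using assms
proof (induction J rule: finite_induct)
  case (insert t J)
  let ?E = "\<lambda>m s. \<Sum>t\<in>J. \<theta> t *\<^sub>R D m t s"
  have Dm: "D m t \<in> borel_measurable L" for m using insert.prems(1) by auto
  have Em: "?E m \<in> borel_measurable L" for m
    using insert.prems(1) by (intro borel_measurable_sum borel_measurable_scaleR) auto
  have IH: "(\<lambda>m. \<integral>\<^sup>+s. ennreal ((norm (?E m s))^2) \<partial>L) \<longlonglongrightarrow> 0"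
    by (rule insert.IH) (use insert.prems in auto)
  have Dt: "(\<lambda>m. \<integral>\<^sup>+s. ennreal ((norm (D m t s))^2) \<partial>L) \<longlonglongrightarrow> 0" using insert.prems(2) by simp
  have le: "(\<integral>\<^sup>+s. ennreal ((norm (\<Sum>t\<in>insert t J. \<theta> t *\<^sub>R D m t s))^2) \<partial>L)
    \<le> ennreal (2 * (\<theta> t)^2) * (\<integral>\<^sup>+s. ennreal ((norm (D m t s))^2) \<partial>L) + ennreal 2 * (\<integral>\<^sup>+s. ennreal ((norm (?E m s))^2) \<partial>L)" for m
  proof -
    have pt: "(norm (\<Sum>t\<in>insert t J. \<theta> t *\<^sub>R D m t s))^2 \<le> 2 * (\<theta> t)^2 * (norm (D m t s))^2 + 2 * (norm (?E m s))^2" for s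
    proof -
      have "norm (\<Sum>t\<in>insert t J. \<theta> t *\<^sub>R D m t s) \<le> \<bar>\<theta> t\<bar> * norm (D m t s) + norm (?E m s)"
        using insert.hyps by (simp add: norm_triangle_le)
      then have "(norm (\<Sum>t\<in>insert t J. \<theta> t *\<^sub>R D m t s))^2 \<le> (\<bar>\<theta> t\<bar> * norm (D m t s) + norm (?E m s))^2"
        by (intro power_mono) auto
      also have "\<dots> \<le> 2 * (\<bar>\<theta> t\<bar> * norm (D m t s))^2 + 2 * (norm (?E m s))^2"
        using zero_le_power2[of "\<bar>\<theta> t\<bar> * norm (D m t s) - norm (?E m s)"] by (simp add: power2_eq_square algebra_simps)
      finally show ?thesis by (simp add: power_mult_distrib)
    qed
    have "(\<integral>\<^sup>+s. ennreal ((norm (\<Sum>t\<in>insert t J. \<theta> t *\<^sub>R D m t s))^2) \<partial>L)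
      \<le> (\<integral>\<^sup>+s. ennreal (2 * (\<theta> t)^2) * ennreal ((norm (D m t s))^2) + ennreal 2 * ennreal ((norm (?E m s))^2) \<partial>L)"
      using pt by (intro nn_integral_mono) (simp add: ennreal_mult[symmetric] ennreal_plus[symmetric] del: ennreal_plus ennreal_numeral)
    also have "\<dots> = ennreal (2 * (\<theta> t)^2) * (\<integral>\<^sup>+s. ennreal ((norm (D m t s))^2) \<partial>L) + ennreal 2 * (\<integral>\<^sup>+s. ennreal ((norm (?E m s))^2) \<partial>L)"
      using Dm Em by (subst nn_integral_add) (auto simp: nn_integral_cmult)
    finally show ?thesis .
  qed
  have "(\<lambda>m. ennreal (2 * (\<theta> t)^2) * (\<integral>\<^sup>+s. ennreal ((norm (D m t s))^2) \<partial>L) + ennreal 2 * (\<integral>\<^sup>+s. ennreal ((norm (?E m s))^2) \<partial>L))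
     \<longlonglongrightarrow> ennreal (2 * (\<theta> t)^2) * 0 + ennreal 2 * 0"
    by (intro tendsto_add ennreal_tendsto_cmult Dt IH) auto
  then have lim0: "(\<lambda>m. ennreal (2 * (\<theta> t)^2) * (\<integral>\<^sup>+s. ennreal ((norm (D m t s))^2) \<partial>L) + ennreal 2 * (\<integral>\<^sup>+s. ennreal ((norm (?E m s))^2) \<partial>L)) \<longlonglongrightarrow> 0"
    by simp
  show ?case
  proof (rule tendsto_sandwich[OF _ _ tendsto_const lim0])
    show "\<forall>\<^sub>F m in sequentially. 0 \<le> (\<integral>\<^sup>+s. ennreal ((norm (\<Sum>t\<in>insert t J. \<theta> t *\<^sub>R D m t s))^2) \<partial>L)"
      by (rule always_eventually) (rule allI, rule zero_le)
  qed (rule always_eventually, rule allI, rule le)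
qed simp

lemma step_fun_measurable:
  fixes xs :: "('v::euclidean_space \<times> real \<times> real) list"
  shows "step_fun xs \<in> borel_measurable borel"
proof (induction xs)
  case Nil
  have "step_fun ([] :: ('v \<times> real \<times> real) list) = (\<lambda>s. 0)" by (auto simp: step_fun_def)
  then show ?case by simp
next
  case (Cons x xs)
  obtain a l r where x: "x = (a, l, r)" by (cases x) auto
  have "step_fun (x # xs) = (\<lambda>s. indicator {l<..r} s *\<^sub>R a + step_fun xs s)"
    by (auto simp: step_fun_def x)
  then show ?case using Cons.IH by simp
qed

text \<open>Jointly Gaussian with the covariance of the integrands: both sides are continuous under the
approximation by step functions, for which the formula is independence of Brownian increments.\<close>

lemma wiener_integrals_char:
  fixes B :: "real \<Rightarrow> 'b \<Rightarrow> 'v::euclidean_space"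
  assumes B: "standard_brownian_motion N B" and J: "finite J" "\<And>t. t \<in> J \<Longrightarrow> t > 0"
    and I: "\<And>t. t \<in> J \<Longrightarrow> has_wiener_integral N B t (g t) (I t)"
    and int: "integrable lborel (\<lambda>s. (norm (\<Sum>t\<in>J. \<theta> t *\<^sub>R (indicator {0<..t} s *\<^sub>R g t s)))^2)"
  shows "(\<integral>\<omega>. iexp (\<Sum>t\<in>J. \<theta> t * I t \<omega>) \<partial>N) =
     of_real (exp (- ((\<integral>s. (norm (\<Sum>t\<in>J. \<theta> t *\<^sub>R (indicator {0<..t} s *\<^sub>R g t s)))^2 \<partial>lborel) / 2)))"
proof -
  obtain b0 :: 'v where "b0 \<in> Basis" using nonempty_Basis by blast
  then interpret prob_space N using B by (auto simp: standard_brownian_motion_def real_brownian_motion_def)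
  have "\<forall>t\<in>J. \<exists>xs :: nat \<Rightarrow> ('v \<times> real \<times> real) list.
        (\<forall>m. \<forall>(a, l, r)\<in>set (xs m). 0 \<le> l \<and> l \<le> r \<and> r \<le> t) \<and>
        (\<lambda>m. \<integral>\<^sup>+s\<in>{0..t}. ennreal ((norm (step_fun (xs m) s - g t s))\<^sup>2) \<partial>lborel) \<longlonglongrightarrow> 0 \<and>
        (\<lambda>m. \<integral>\<^sup>+\<omega>. ennreal ((step_integral B (xs m) \<omega> - I t \<omega>)\<^sup>2) \<partial>N) \<longlonglongrightarrow> 0"
    using I unfolding has_wiener_integral_def by blast
  from bchoice[OF this] obtain xs :: "real \<Rightarrow> nat \<Rightarrow> ('v \<times> real \<times> real) list" where
    xs: "\<forall>t\<in>J. (\<forall>m. \<forall>(a, l, r)\<in>set (xs t m). 0 \<le> l \<and> l \<le> r \<and> r \<le> t) \<and>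
        (\<lambda>m. \<integral>\<^sup>+s\<in>{0..t}. ennreal ((norm (step_fun (xs t m) s - g t s))\<^sup>2) \<partial>lborel) \<longlonglongrightarrow> 0 \<and>
        (\<lambda>m. \<integral>\<^sup>+\<omega>. ennreal ((step_integral B (xs t m) \<omega> - I t \<omega>)\<^sup>2) \<partial>N) \<longlonglongrightarrow> 0" by blast
  have lr: "0 \<le> l \<and> l \<le> r \<and> r \<le> t" if "t \<in> J" "(a, l, r) \<in> set (xs t m)" for t m a l r
  proof -
    have "\<forall>(a, l, r)\<in>set (xs t m). 0 \<le> l \<and> l \<le> r \<and> r \<le> t"
      using bspec[OF xs that(1)] by (rule conjunct1[THEN spec])
    from bspec[OF this that(2)] show ?thesis by simp
  qed
  have Im: "I t \<in> borel_measurable N" and gm: "g t \<in> borel_measurable borel" if "t \<in> J" for t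
    using I[OF that] by (auto simp: has_wiener_integral_def)
  have Bm: "B t \<in> borel_measurable N" if "t \<ge> 0" for t
  proof -
    have "(\<lambda>\<omega>. B t \<omega> \<bullet> b) \<in> borel_measurable N" if "b \<in> Basis" for b
      using B that \<open>t \<ge> 0\<close> by (simp add: standard_brownian_motion_def real_brownian_motion_def)
    then show ?thesis by (subst borel_measurable_euclidean_space) auto
  qed
  have stepm: "step_integral B ys \<in> borel_measurable N" if "\<And>a l r. (a, l, r) \<in> set ys \<Longrightarrow> 0 \<le> l \<and> l \<le> r" for ys
    using that
  proof (induction ys)
    case Nil
    then show ?case by (simp add: step_integral_def[abs_def])
  next
    case (Cons x ys)
    obtain a l r where x: "x = (a, l, r)" by (cases x) auto
    have 0: "0 \<le> l" "0 \<le> r" using Cons.prems[of a l r] x by auto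
    have "step_integral B (x # ys) = (\<lambda>\<omega>. a \<bullet> (B r \<omega> - B l \<omega>) + step_integral B ys \<omega>)"
      by (auto simp: step_integral_def x)
    moreover have "step_integral B ys \<in> borel_measurable N" by (rule Cons.IH) (use Cons.prems in auto)
    ultimately show ?case using Bm[OF 0(1)] Bm[OF 0(2)] by simp
  qed
  have "\<exists>zs. (\<forall>a l r. (a, l, r) \<in> set zs \<longrightarrow> 0 \<le> l \<and> l \<le> r) \<and>
    (\<forall>\<omega>. step_integral B zs \<omega> = (\<Sum>t\<in>J. \<theta> t * step_integral B (xs t m) \<omega>)) \<and>
    (\<forall>s. step_fun zs s = (\<Sum>t\<in>J. \<theta> t *\<^sub>R step_fun (xs t m) s))" for m
  proof -
    have "\<forall>t\<in>J. \<forall>(a, l, r)\<in>set (xs t m). 0 \<le> l \<and> l \<le> r" using lr by auto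
    from step_linear_combination[OF J(1) this, where \<theta>=\<theta> and ?'b='b]
    obtain zs where "\<forall>(a, l, r)\<in>set zs. 0 \<le> l \<and> l \<le> r"
      "\<forall>(B :: real \<Rightarrow> 'b \<Rightarrow> 'v) \<omega>. step_integral B zs \<omega> = (\<Sum>t\<in>J. \<theta> t * step_integral B (xs t m) \<omega>)"
      "\<forall>s. step_fun zs s = (\<Sum>t\<in>J. \<theta> t *\<^sub>R step_fun (xs t m) s)" by blast
    then show ?thesis by (intro exI[of _ zs]) auto
  qed
  then have "\<forall>m. \<exists>zs. (\<forall>a l r. (a, l, r) \<in> set zs \<longrightarrow> 0 \<le> l \<and> l \<le> r) \<and>
    (\<forall>\<omega>. step_integral B zs \<omega> = (\<Sum>t\<in>J. \<theta> t * step_integral B (xs t m) \<omega>)) \<and>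
    (\<forall>s. step_fun zs s = (\<Sum>t\<in>J. \<theta> t *\<^sub>R step_fun (xs t m) s))" by blast
  from choice[OF this] obtain zs where zs: "\<And>m a l r. (a, l, r) \<in> set (zs m) \<Longrightarrow> 0 \<le> l \<and> l \<le> r"
    "\<And>m \<omega>. step_integral B (zs m) \<omega> = (\<Sum>t\<in>J. \<theta> t * step_integral B (xs t m) \<omega>)"
    "\<And>m s. step_fun (zs m) s = (\<Sum>t\<in>J. \<theta> t *\<^sub>R step_fun (xs t m) s)" by blast
  let ?G = "\<lambda>s. \<Sum>t\<in>J. \<theta> t *\<^sub>R (indicator {0<..t} s *\<^sub>R g t s)"
  have Gm: "?G \<in> borel_measurable lborel"
    using gm by (intro borel_measurable_sum borel_measurable_scaleR) auto
  have L1: "(\<lambda>m. \<integral>\<omega>. iexp (step_integral B (zs m) \<omega>) \<partial>N) \<longlonglongrightarrow> (\<integral>\<omega>. iexp (\<Sum>t\<in>J. \<theta> t * I t \<omega>) \<partial>N)"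
  proof (rule l2_limit_iexp[OF prob_space_axioms])
    show "step_integral B (zs m) \<in> borel_measurable N" for m by (rule stepm) (rule zs(1))
    show "(\<lambda>\<omega>. \<Sum>t\<in>J. \<theta> t * I t \<omega>) \<in> borel_measurable N"
      using Im by (intro borel_measurable_sum borel_measurable_times) auto
    have "(\<lambda>m. \<integral>\<^sup>+\<omega>. ennreal ((norm (\<Sum>t\<in>J. \<theta> t *\<^sub>R (step_integral B (xs t m) \<omega> - I t \<omega>)))^2) \<partial>N) \<longlonglongrightarrow> 0"
    proof (rule nn_integral_square_sum_tendsto_0[OF J(1)])
      fix m t assume t: "t \<in> J"
      have "step_integral B (xs t m) \<in> borel_measurable N" by (rule stepm) (use lr[OF t] in blast)
      then show "(\<lambda>\<omega>. step_integral B (xs t m) \<omega> - I t \<omega>) \<in> borel_measurable N" using Im[OF t] by simp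
    next
      fix t assume "t \<in> J"
      then show "(\<lambda>m. \<integral>\<^sup>+\<omega>. ennreal ((norm (step_integral B (xs t m) \<omega> - I t \<omega>))^2) \<partial>N) \<longlonglongrightarrow> 0"
        using xs by simp
    qed
    moreover have "(\<Sum>t\<in>J. \<theta> t *\<^sub>R (step_integral B (xs t m) \<omega> - I t \<omega>)) = step_integral B (zs m) \<omega> - (\<Sum>t\<in>J. \<theta> t * I t \<omega>)" for m \<omega>
      unfolding zs(2) by (simp add: sum_subtractf right_diff_distrib)
    ultimately show "(\<lambda>m. \<integral>\<^sup>+\<omega>. ennreal ((step_integral B (zs m) \<omega> - (\<Sum>t\<in>J. \<theta> t * I t \<omega>))^2) \<partial>N) \<longlonglongrightarrow> 0" by simp
  qed
  have L2: "(\<lambda>m. \<integral>s. (norm (step_fun (zs m) s))^2 \<partial>lborel) \<longlonglongrightarrow> (\<integral>s. (norm (?G s))^2 \<partial>lborel)"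
  proof (rule l2_limit_norm[OF _ _ Gm int])
    show "step_fun (zs m) \<in> borel_measurable lborel" for m using step_fun_measurable by simp
    show "integrable lborel (\<lambda>s. (norm (step_fun (zs m) s))^2)" for m by (rule step_integral_char(2)[OF B zs(1)])
    have "(\<lambda>m. \<integral>\<^sup>+s. ennreal ((norm (\<Sum>t\<in>J. \<theta> t *\<^sub>R (step_fun (xs t m) s - indicator {0<..t} s *\<^sub>R g t s)))^2) \<partial>lborel) \<longlonglongrightarrow> 0"
    proof (rule nn_integral_square_sum_tendsto_0[OF J(1)])
      fix m t assume t: "t \<in> J"
      show "(\<lambda>s. step_fun (xs t m) s - indicator {0<..t} s *\<^sub>R g t s) \<in> borel_measurable lborel"
        using step_fun_measurable[of "xs t m"] gm[OF t] by simp
    next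
      fix t assume t: "t \<in> J"
      \<comment> \<open>The approximating step functions vanish outside \<open>(0, t]\<close>, like the truncated integrand.\<close>
      have out: "step_fun (xs t m) s = 0" if "s \<notin> {0<..t}" for m s
      proof -
        have "step_fun ys s = 0" if "\<And>a l r. (a, l, r) \<in> set ys \<Longrightarrow> 0 \<le> l \<and> l \<le> r \<and> r \<le> t" for ys :: "('v \<times> real \<times> real) list"
          using that
        proof (induction ys)
          case (Cons x ys)
          obtain a l r where x: "x = (a, l, r)" by (cases x) auto
          have "s \<notin> {l<..r}" using Cons.prems[of a l r] x \<open>s \<notin> {0<..t}\<close> by auto
          moreover have "step_fun ys s = 0" by (rule Cons.IH) (use Cons.prems in auto)
          ultimately show ?case by (simp add: step_fun_def x)
        qed (simp add: step_fun_def)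
        then show ?thesis using lr[OF t] by blast
      qed
      have "(\<integral>\<^sup>+s. ennreal ((norm (step_fun (xs t m) s - indicator {0<..t} s *\<^sub>R g t s))^2) \<partial>lborel) =
         (\<integral>\<^sup>+s\<in>{0..t}. ennreal ((norm (step_fun (xs t m) s - g t s))\<^sup>2) \<partial>lborel)" for m
      proof (rule nn_integral_cong_AE)
        have "AE s in lborel. s \<noteq> (0::real)" by (rule AE_lborel_singleton)
        then show "AE s in lborel. ennreal ((norm (step_fun (xs t m) s - indicator {0<..t} s *\<^sub>R g t s))^2) =
          ennreal ((norm (step_fun (xs t m) s - g t s))\<^sup>2) * indicator {0..t} s"
          by eventually_elim (auto simp: out split: split_indicator)
      qed
      then show "(\<lambda>m. \<integral>\<^sup>+s. ennreal ((norm (step_fun (xs t m) s - indicator {0<..t} s *\<^sub>R g t s))^2) \<partial>lborel) \<longlonglongrightarrow> 0"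
        using xs t by simp
    qed
    moreover have "(\<Sum>t\<in>J. \<theta> t *\<^sub>R (step_fun (xs t m) s - indicator {0<..t} s *\<^sub>R g t s)) = step_fun (zs m) s - ?G s" for m s
      unfolding zs(3) by (simp add: sum_subtractf scaleR_diff_right)
    ultimately show "(\<lambda>m. \<integral>\<^sup>+s. ennreal ((norm (step_fun (zs m) s - ?G s))^2) \<partial>lborel) \<longlonglongrightarrow> 0" by simp
  qed
  have char: "(\<integral>\<omega>. iexp (step_integral B (zs m) \<omega>) \<partial>N) = of_real (exp (- ((\<integral>s. (norm (step_fun (zs m) s))^2 \<partial>lborel) / 2)))" for m
    by (rule step_integral_char(1)[OF B]) (rule zs(1))
  have "(\<lambda>m. \<integral>\<omega>. iexp (step_integral B (zs m) \<omega>) \<partial>N) \<longlonglongrightarrow> of_real (exp (- ((\<integral>s. (norm (?G s))^2 \<partial>lborel) / 2)))"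
    unfolding char by (intro tendsto_intros L2) simp
  with L1 show ?thesis by (rule LIMSEQ_unique)
qed

section \<open>The limiting process\<close>

lemma kernel_sum_envelope:
  assumes J: "finite J" "\<And>t. t \<in> J \<Longrightarrow> t > 0" and \<rho>: "\<rho> > 0" and C: "C \<ge> 0" "\<And>x. x \<ge> 1 \<Longrightarrow> \<bar>\<psi> x\<bar> \<le> C * x powr \<rho>"
    and s: "s > 0"
  shows "(kernel_sum J \<theta> \<psi> s)^2 \<le> ((\<Sum>t\<in>J. \<bar>\<theta> t\<bar>) * C * (\<Sum>t\<in>J. t) powr \<rho>)^2 * power_envelope (2 * \<rho>) (\<Sum>t\<in>J. t) s"
proof -
  let ?T = "\<Sum>t\<in>J. t"
  have tT: "t \<le> ?T" if "t \<in> J" for t using J that by (intro member_le_sum) (auto intro: less_imp_le)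
  have T0: "?T \<ge> 0" using J by (intro sum_nonneg) (auto intro: less_imp_le)
  show ?thesis
  proof (cases "s \<le> ?T")
    case False
    then have "\<not> s \<le> t" if "t \<in> J" for t using tT[OF that] by linarith
    then have "kernel_sum J \<theta> \<psi> s = 0" unfolding kernel_sum_def by (intro sum.neutral) auto
    then show ?thesis by (simp add: power_envelope_def)
  next
    case True
    have "\<bar>if s \<le> t then \<theta> t * \<psi> (t / s) else 0\<bar> \<le> \<bar>\<theta> t\<bar> * (C * (?T powr \<rho> * s powr (-\<rho>)))" if t: "t \<in> J" for t
    proof (cases "s \<le> t")
      case True
      have x: "t / s \<ge> 1" using True s by simp
      have "(t / s) powr \<rho> \<le> (?T / s) powr \<rho>" using tT[OF t] s x \<rho> J(2)[OF t] by (intro powr_mono2 divide_right_mono) auto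
      also have "\<dots> = ?T powr \<rho> * s powr (-\<rho>)" using T0 s by (simp add: powr_divide powr_minus_divide)
      finally have "C * (t / s) powr \<rho> \<le> C * (?T powr \<rho> * s powr (-\<rho>))" using C(1) by (rule mult_left_mono)
      with C(2)[OF x] have "\<bar>\<psi> (t / s)\<bar> \<le> C * (?T powr \<rho> * s powr (-\<rho>))" by linarith
      then show ?thesis using True by (simp add: abs_mult mult_left_mono)
    qed (use C in simp)
    then have "\<bar>kernel_sum J \<theta> \<psi> s\<bar> \<le> (\<Sum>t\<in>J. \<bar>\<theta> t\<bar> * (C * (?T powr \<rho> * s powr (-\<rho>))))"
      unfolding kernel_sum_def by (rule order_trans[OF sum_abs sum_mono])
    also have "\<dots> = (\<Sum>t\<in>J. \<bar>\<theta> t\<bar>) * (C * (?T powr \<rho> * s powr (-\<rho>)))" by (rule sum_distrib_right[symmetric])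
    finally have "\<bar>kernel_sum J \<theta> \<psi> s\<bar>^2 \<le> ((\<Sum>t\<in>J. \<bar>\<theta> t\<bar>) * (C * (?T powr \<rho> * s powr (-\<rho>))))^2"
      by (intro power_mono) auto
    also have "\<dots> = ((\<Sum>t\<in>J. \<bar>\<theta> t\<bar>) * C * ?T powr \<rho>)^2 * (s powr (-\<rho>))^2" by (simp add: power_mult_distrib mult_ac)
    also have "(s powr (-\<rho>))^2 = power_envelope (2 * \<rho>) ?T s" using True s by (simp add: power_envelope_def power2_eq_square powr_add[symmetric])
    finally show ?thesis by simp
  qed
qed

lemma integrable_kernel_sum_squares:
  assumes w: "memory_weight \<alpha>1 \<alpha>2 \<rho> \<psi>1 \<psi>2" and \<rho>: "\<rho> > 0" "\<rho> < 1/2"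
    and J: "finite J" "\<And>t. t \<in> J \<Longrightarrow> t > 0"
  shows "integrable lborel (\<lambda>s. indicator {0<..} s * ((kernel_sum J \<theta> \<psi>1 s)^2 + (kernel_sum J \<theta> \<psi>2 s)^2))"
proof -
  have cont: "isCont \<psi>1 x" "isCont \<psi>2 x" if "x > 0" for x
    using w that unfolding memory_weight_def by (blast intro: DERIV_isCont)+
  obtain C where C: "C \<ge> 0" "\<And>x. x \<ge> 1 \<Longrightarrow> \<bar>\<psi>1 x\<bar> \<le> C * x powr \<rho>" "\<And>x. x \<ge> 1 \<Longrightarrow> \<bar>\<psi>2 x\<bar> \<le> C * x powr \<rho>"
    using w by (auto simp: memory_weight_def)
  define K where "K = ((\<Sum>t\<in>J. \<bar>\<theta> t\<bar>) * C * (\<Sum>t\<in>J. t) powr \<rho>)^2"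
  have T0: "(\<Sum>t\<in>J. t) \<ge> 0" using J by (intro sum_nonneg) (auto intro: less_imp_le)
  show ?thesis
  proof (rule Bochner_Integration.integrable_bound)
    show "integrable lborel (\<lambda>s. 2 * K * power_envelope (2 * \<rho>) (\<Sum>t\<in>J. t) s)"
      by (intro integrable_mult_right integrable_power_envelope) (use \<rho> T0 in auto)
    show "(\<lambda>s. indicator {0<..} s * ((kernel_sum J \<theta> \<psi>1 s)^2 + (kernel_sum J \<theta> \<psi>2 s)^2)) \<in> borel_measurable lborel"
      using kernel_sum_squares_measurable[OF cont J(2), of J] by simp
    have "norm (indicator {0<..} s * ((kernel_sum J \<theta> \<psi>1 s)^2 + (kernel_sum J \<theta> \<psi>2 s)^2)) \<le> norm (2 * K * power_envelope (2 * \<rho>) (\<Sum>t\<in>J. t) s)" for s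
    proof (cases "s > 0")
      case True
      have p0: "0 \<le> power_envelope (2 * \<rho>) (\<Sum>t\<in>J. t) s" by (simp add: power_envelope_def)
      have "(kernel_sum J \<theta> \<psi>1 s)^2 \<le> K * power_envelope (2 * \<rho>) (\<Sum>t\<in>J. t) s"
        unfolding K_def by (rule kernel_sum_envelope[OF J \<rho>(1) C(1) C(2) True])
      moreover have "(kernel_sum J \<theta> \<psi>2 s)^2 \<le> K * power_envelope (2 * \<rho>) (\<Sum>t\<in>J. t) s"
        unfolding K_def by (rule kernel_sum_envelope[OF J \<rho>(1) C(1) C(3) True])
      moreover have "0 \<le> K" by (simp add: K_def)
      ultimately show ?thesis using True p0 by (simp add: abs_mult)
    qed simp
    then show "AE s in lborel. norm (indicator {0<..} s * ((kernel_sum J \<theta> \<psi>1 s)^2 + (kernel_sum J \<theta> \<psi>2 s)^2)) \<le> norm (2 * K * power_envelope (2 * \<rho>) (\<Sum>t\<in>J. t) s)" by simp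
  qed
qed

text \<open>The two cases in the definition of the limiting process become one: in both there is a weight with
\<open>\<psi>(1) = (1, -1)\<close> and exponent below \<open>1/2\<close> whose kernel gives the covariance.  For equal parameters the
weight \<open>x\<^sup>-\<^sup>\<alpha> (1, -1)\<close> has two coordinates of the same modulus, which accounts for the factor \<open>\<surd>2\<close> in front of
the one-dimensional integral.\<close>

lemma limit_process_char:
  assumes L: "limit_process N \<alpha>1 \<alpha>2 V" and cases: "\<alpha>1 * \<alpha>2 < 1/4 \<or> (\<alpha>1 = \<alpha>2 \<and> \<alpha>1 \<in> {1/2..<1})"
  obtains \<rho> \<psi>1 \<psi>2 where "0 < \<rho>" "\<rho> < 1/2" "memory_weight \<alpha>1 \<alpha>2 \<rho> \<psi>1 \<psi>2" "\<psi>1 1 = 1" "\<psi>2 1 = -1"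
    "\<And>J \<theta>. finite J \<Longrightarrow> J \<subseteq> {0<..} \<Longrightarrow> (\<integral>\<omega>. iexp (\<Sum>t\<in>J. \<theta> t * V t \<omega>) \<partial>N) =
       of_real (exp (- ((\<integral>s. indicator {0<..} s * ((kernel_sum J \<theta> \<psi>1 s)^2 + (kernel_sum J \<theta> \<psi>2 s)^2) \<partial>lborel) / 2)))"
proof (cases "\<alpha>1 * \<alpha>2 < 1/4")
  case True
  define \<mu> where "\<mu> = \<alpha>1 * \<alpha>2"
  \<comment> \<open>Strictly between \<open>\<surd>\<mu>\<close> and \<open>1/2\<close>, and positive also for \<open>\<mu> \<le> 0\<close>.\<close>
  define \<rho> where "\<rho> = max (1/4) (sqrt ((max 0 \<mu> + 1/4) / 2))"
  have m: "(max 0 \<mu> + 1/4) / 2 < 1/4" "(max 0 \<mu> + 1/4) / 2 > \<mu>" "(max 0 \<mu> + 1/4) / 2 \<ge> 0" using True by (auto simp: \<mu>_def max_def)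
  have "sqrt ((max 0 \<mu> + 1/4) / 2) < sqrt (1/4)" using m by (intro real_sqrt_less_mono)
  also have "sqrt (1/4) = (1/2 :: real)" by (simp add: real_sqrt_divide)
  finally have "\<rho> < 1/2" by (simp only: \<rho>_def max_less_iff_conj) simp
  then have \<rho>: "0 < \<rho>" "\<rho> < 1/2" by (simp_all add: \<rho>_def)
  have "\<mu> < (sqrt ((max 0 \<mu> + 1/4) / 2))^2" using m by simp
  also have "\<dots> \<le> \<rho>^2" by (intro power_mono) (use m in \<open>auto simp: \<rho>_def\<close>)
  finally have mr: "\<alpha>1 * \<alpha>2 < \<rho>^2" by (simp add: \<mu>_def)
  define \<psi>1 where "\<psi>1 x = 1 * even_part (\<alpha>1 * \<alpha>2) (ln x) + -1 * \<alpha>2 * odd_part (\<alpha>1 * \<alpha>2) (ln x)" for x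
  define \<psi>2 where "\<psi>2 x = -1 * even_part (\<alpha>1 * \<alpha>2) (ln x) + 1 * \<alpha>1 * odd_part (\<alpha>1 * \<alpha>2) (ln x)" for x
  have w: "memory_weight \<alpha>1 \<alpha>2 \<rho> \<psi>1 \<psi>2"
    unfolding \<psi>1_def[abs_def] \<psi>2_def[abs_def] by (rule memory_weight_exists[OF \<rho>(1) mr])
  have g: "diff_vec v* mat_powr x (memory_matrix \<alpha>1 \<alpha>2) = vector [\<psi>1 x, \<psi>2 x]" for x
    unfolding \<psi>1_def \<psi>2_def by (rule diff_vec_mat_powr)
  obtain B :: "real \<Rightarrow> 'a \<Rightarrow> real^2" where B: "standard_brownian_motion N B"
     "\<And>t. t > 0 \<Longrightarrow> has_wiener_integral N B t (\<lambda>s. diff_vec v* mat_powr (t / s) (memory_matrix \<alpha>1 \<alpha>2)) (V t)"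
    using L True unfolding limit_process_def by blast
  show ?thesis
  proof (rule that[OF \<rho> w])
    show "\<psi>1 1 = 1" "\<psi>2 1 = -1" by (simp_all add: \<psi>1_def \<psi>2_def)
    fix J :: "real set" and \<theta> :: "real \<Rightarrow> real" assume J: "finite J" "J \<subseteq> {0<..}"
    have Jp: "\<And>t. t \<in> J \<Longrightarrow> t > 0" using J by auto
    have eq: "(norm (\<Sum>t\<in>J. \<theta> t *\<^sub>R (indicator {0<..t} s *\<^sub>R (diff_vec v* mat_powr (t / s) (memory_matrix \<alpha>1 \<alpha>2)))))^2
      = indicator {0<..} s * ((kernel_sum J \<theta> \<psi>1 s)^2 + (kernel_sum J \<theta> \<psi>2 s)^2)" for s
    proof -
      let ?v = "\<Sum>t\<in>J. \<theta> t *\<^sub>R (indicator {0<..t} s *\<^sub>R (vector [\<psi>1 (t / s), \<psi>2 (t / s)] :: real^2))"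
      have c: "?v $ 1 = indicator {0<..} s * kernel_sum J \<theta> \<psi>1 s" "?v $ 2 = indicator {0<..} s * kernel_sum J \<theta> \<psi>2 s"
        unfolding kernel_sum_def sum_distrib_left by (auto simp: intro!: sum.cong split: split_indicator)
      have "(norm ?v)^2 = (?v $ 1)^2 + (?v $ 2)^2"
        unfolding power2_norm_eq_inner by (simp add: inner_vec_def sum_2 power2_eq_square)
      then show ?thesis unfolding g c by (auto split: split_indicator)
    qed
    have "integrable lborel (\<lambda>s. (norm (\<Sum>t\<in>J. \<theta> t *\<^sub>R (indicator {0<..t} s *\<^sub>R (diff_vec v* mat_powr (t / s) (memory_matrix \<alpha>1 \<alpha>2)))))^2)"
      unfolding eq by (rule integrable_kernel_sum_squares[OF w \<rho> J(1) Jp])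
    from wiener_integrals_char[OF B(1) J(1) Jp B(2)[OF Jp] this]
    show "(\<integral>\<omega>. iexp (\<Sum>t\<in>J. \<theta> t * V t \<omega>) \<partial>N) =
       of_real (exp (- ((\<integral>s. indicator {0<..} s * ((kernel_sum J \<theta> \<psi>1 s)^2 + (kernel_sum J \<theta> \<psi>2 s)^2) \<partial>lborel) / 2)))"
      unfolding eq .
  qed
next
  case False
  then have a: "\<alpha>1 = \<alpha>2" "\<alpha>1 \<in> {1/2..<1}" using cases by auto
  obtain W :: "real \<Rightarrow> 'a \<Rightarrow> real" where W: "standard_brownian_motion N W"
    "\<And>t. t > 0 \<Longrightarrow> \<exists>I. has_wiener_integral N W t (\<lambda>s. (t / s) powr (-\<alpha>1)) I \<and> (AE \<omega> in N. V t \<omega> = sqrt 2 * I \<omega>)"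
    using L a unfolding limit_process_def by blast
  define \<psi>1 where "\<psi>1 x = x powr (- \<alpha>1)" for x
  define \<psi>2 where "\<psi>2 x = - (x powr (- \<alpha>1))" for x
  \<comment> \<open>The weight is bounded, so every positive exponent will do.\<close>
  have w: "memory_weight \<alpha>1 \<alpha>2 (1/4) \<psi>1 \<psi>2"
    unfolding \<psi>1_def[abs_def] \<psi>2_def[abs_def] a(1)[symmetric] by (rule memory_weight_power) (use a in auto)
  show ?thesis
  proof (rule that[OF _ _ w])
    show "\<psi>1 1 = 1" "\<psi>2 1 = -1" by (simp_all add: \<psi>1_def \<psi>2_def)
    fix J :: "real set" and \<theta> :: "real \<Rightarrow> real" assume J: "finite J" "J \<subseteq> {0<..}"
    have Jp: "\<And>t. t \<in> J \<Longrightarrow> t > 0" using J by auto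
    have "\<forall>t\<in>J. \<exists>I. has_wiener_integral N W t (\<lambda>s. (t / s) powr (-\<alpha>1)) I \<and> (AE \<omega> in N. V t \<omega> = sqrt 2 * I \<omega>)"
      using W(2) Jp by blast
    from bchoice[OF this] obtain I where I: "\<forall>t\<in>J. has_wiener_integral N W t (\<lambda>s. (t / s) powr (-\<alpha>1)) (I t) \<and> (AE \<omega> in N. V t \<omega> = sqrt 2 * I t \<omega>)"
      by blast
    define \<theta>' where "\<theta>' t = sqrt 2 * \<theta> t" for t
    have eq: "(norm (\<Sum>t\<in>J. \<theta>' t *\<^sub>R (indicator {0<..t} s *\<^sub>R ((t / s) powr (-\<alpha>1)))))^2
      = indicator {0<..} s * ((kernel_sum J \<theta> \<psi>1 s)^2 + (kernel_sum J \<theta> \<psi>2 s)^2)" for s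
    proof -
      have "(\<Sum>t\<in>J. \<theta>' t *\<^sub>R (indicator {0<..t} s *\<^sub>R ((t / s) powr (-\<alpha>1)))) = sqrt 2 * (indicator {0<..} s * kernel_sum J \<theta> \<psi>1 s)"
        unfolding kernel_sum_def sum_distrib_left by (auto simp: \<psi>1_def \<theta>'_def intro!: sum.cong split: split_indicator)
      moreover have "kernel_sum J \<theta> \<psi>2 s = - kernel_sum J \<theta> \<psi>1 s"
        unfolding kernel_sum_def sum_negf[symmetric] by (intro sum.cong refl) (simp add: \<psi>1_def \<psi>2_def)
      ultimately show ?thesis by (auto simp: power_mult_distrib split: split_indicator)
    qed
    have "integrable lborel (\<lambda>s. (norm (\<Sum>t\<in>J. \<theta>' t *\<^sub>R (indicator {0<..t} s *\<^sub>R ((t / s) powr (-\<alpha>1)))))^2)"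
      unfolding eq by (rule integrable_kernel_sum_squares[OF w _ _ J(1) Jp]) auto
    from wiener_integrals_char[OF W(1) J(1) Jp _ this, of I] I
    have 1: "(\<integral>\<omega>. iexp (\<Sum>t\<in>J. \<theta>' t * I t \<omega>) \<partial>N) =
       of_real (exp (- ((\<integral>s. indicator {0<..} s * ((kernel_sum J \<theta> \<psi>1 s)^2 + (kernel_sum J \<theta> \<psi>2 s)^2) \<partial>lborel) / 2)))"
      unfolding eq by blast
    have Vm: "V t \<in> borel_measurable N" if "t \<in> J" for t using L Jp[OF that] by (auto simp: limit_process_def)
    have Im: "I t \<in> borel_measurable N" if "t \<in> J" for t using I that by (auto simp: has_wiener_integral_def)
    have "AE \<omega> in N. \<forall>t\<in>J. V t \<omega> = sqrt 2 * I t \<omega>"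
      using I J(1) by (intro AE_finite_allI) auto
    then have "(\<integral>\<omega>. iexp (\<Sum>t\<in>J. \<theta> t * V t \<omega>) \<partial>N) = (\<integral>\<omega>. iexp (\<Sum>t\<in>J. \<theta>' t * I t \<omega>) \<partial>N)"
    proof (intro integral_cong_AE)
      have "(\<lambda>\<omega>. \<Sum>t\<in>J. \<theta> t * V t \<omega>) \<in> borel_measurable N" "(\<lambda>\<omega>. \<Sum>t\<in>J. \<theta>' t * I t \<omega>) \<in> borel_measurable N"
        using Vm Im by (auto intro!: borel_measurable_sum borel_measurable_times)
      then show "(\<lambda>\<omega>. iexp (\<Sum>t\<in>J. \<theta> t * V t \<omega>)) \<in> borel_measurable N" "(\<lambda>\<omega>. iexp (\<Sum>t\<in>J. \<theta>' t * I t \<omega>)) \<in> borel_measurable N"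
        by measurable
      assume "AE \<omega> in N. \<forall>t\<in>J. V t \<omega> = sqrt 2 * I t \<omega>"
      then show "AE \<omega> in N. iexp (\<Sum>t\<in>J. \<theta> t * V t \<omega>) = iexp (\<Sum>t\<in>J. \<theta>' t * I t \<omega>)"
      proof eventually_elim
        case (elim \<omega>)
        then have "(\<Sum>t\<in>J. \<theta> t * V t \<omega>) = (\<Sum>t\<in>J. \<theta>' t * I t \<omega>)" by (intro sum.cong refl) (simp add: \<theta>'_def)
        then show ?case by simp
      qed
    qed
    with 1 show "(\<integral>\<omega>. iexp (\<Sum>t\<in>J. \<theta> t * V t \<omega>) \<partial>N) =
       of_real (exp (- ((\<integral>s. indicator {0<..} s * ((kernel_sum J \<theta> \<psi>1 s)^2 + (kernel_sum J \<theta> \<psi>2 s)^2) \<partial>lborel) / 2)))" by simp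
  qed auto
qed

section \<open>From characteristic functions to level crossings\<close>

text \<open>A continuous substitute for the indicator of \<open>|y| < b\<close> that equals \<open>1\<close> for \<open>|y| \<le> a\<close>.\<close>

definition tent :: "real \<Rightarrow> real \<Rightarrow> real \<Rightarrow> real" where
  "tent a b y = min 1 (max 0 ((b - \<bar>y\<bar>) / (b - a)))"

lemma tent_bounds: "0 \<le> tent a b y" "tent a b y \<le> 1"
  by (auto simp: tent_def)

lemma tent_abs: "tent a b \<bar>y\<bar> = tent a b y" by (simp add: tent_def)

lemma tent_eq_1: "a < b \<Longrightarrow> \<bar>y\<bar> \<le> a \<Longrightarrow> tent a b y = 1"
  by (simp add: tent_def)

lemma tent_eq_0: "a < b \<Longrightarrow> b \<le> \<bar>y\<bar> \<Longrightarrow> tent a b y = 0"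
  by (simp add: tent_def divide_le_0_iff)

lemma continuous_tent: "continuous_on UNIV (tent a b)"
  unfolding tent_def[abs_def] by (cases "a = b") (auto intro!: continuous_intros)

lemma tent_measurable [measurable]: "tent a b \<in> borel_measurable borel"
  by (rule borel_measurable_continuous_onI[OF continuous_tent])

text \<open>On \<open>[-L, L]\<close> an even function is a function of \<open>(1 + cos (\<pi> y / L)) / 2 \<in> [0, 1]\<close>.  Bernstein polynomials
approximate it there and, being averages of its values, stay between \<open>0\<close> and \<open>1\<close>; periodicity extends these
bounds, though not the approximation, to the whole line.  Powers of cosines are combinations of
characters, so convergence of characteristic functions applies to them.\<close>

lemma cosine_polynomial_approx:
  fixes f :: "real \<Rightarrow> real"
  assumes f: "continuous_on UNIV f" "\<And>y. 0 \<le> f y" "\<And>y. f y \<le> 1" "\<And>y. f \<bar>y\<bar> = f y"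
    and L: "L > 0" and e: "e > 0"
  obtains p :: "nat \<Rightarrow> real" and d where
    "\<And>y. 0 \<le> (\<Sum>k\<le>d. p k * cos (pi * y / L) ^ k) \<and> (\<Sum>k\<le>d. p k * cos (pi * y / L) ^ k) \<le> 1"
    "\<And>y. \<bar>y\<bar> \<le> L \<Longrightarrow> \<bar>f y - (\<Sum>k\<le>d. p k * cos (pi * y / L) ^ k)\<bar> \<le> e"
proof -
  define h where "h x = f (L / pi * arccos (2 * x - 1))" for x
  have hc: "continuous_on {0..1} h"
    unfolding h_def
    by (rule continuous_on_compose2[OF f(1)])
       (auto intro!: continuous_intros continuous_on_compose2[OF continuous_on_arccos'])
  obtain N where N: "\<And>n x. N \<le> n \<Longrightarrow> x \<in> {0..1} \<Longrightarrow> \<bar>h x - (\<Sum>k\<le>n. h (real k / real n) * Bernstein n k x)\<bar> < e"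
    using Bernstein_Weierstrass[OF hc e] by auto
  let ?b = "\<lambda>x. \<Sum>k\<le>N. h (real k / real N) * Bernstein N k x"
  have b01: "0 \<le> ?b x \<and> ?b x \<le> 1" if "x \<in> {0..1}" for x
  proof
    show "0 \<le> ?b x" using that f by (intro sum_nonneg mult_nonneg_nonneg) (auto simp: h_def Bernstein_nonneg)
    have "?b x \<le> (\<Sum>k\<le>N. 1 * Bernstein N k x)"
      using that f by (intro sum_mono mult_right_mono) (auto simp: h_def Bernstein_nonneg)
    then show "?b x \<le> 1" by (simp add: sum_Bernstein)
  qed
  \<comment> \<open>The Bernstein polynomial in the variable \<open>c = cos (\<pi> y / L)\<close>.\<close>
  define P :: "real poly" where "P = (\<Sum>k\<le>N. smult (h (real k / real N) * real (N choose k)) ([:1/2, 1/2:] ^ k * [:1/2, -1/2:] ^ (N - k)))"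
  have P: "poly P c = ?b ((1 + c) / 2)" for c
  proof -
    have e: "1 - (1 + c) / 2 = 1/2 - c / 2" "(1 + c) / 2 = 1/2 + c / 2" by (simp_all add: field_simps)
    show ?thesis
      unfolding P_def poly_sum Bernstein_def e by (simp add: mult.assoc)
  qed
  have pc: "(\<Sum>k\<le>degree P. coeff P k * c ^ k) = ?b ((1 + c) / 2)" for c
    unfolding P[symmetric] by (simp add: poly_altdef)
  have r: "(1 + cos z) / 2 \<in> {0..1}" for z :: real
  proof -
    have "0 \<le> 1 + cos z" using cos_ge_minus_one[of z] by linarith
    then show ?thesis using cos_le_one[of z] by simp
  qed
  show ?thesis
  proof (rule that[where d="degree P" and p="coeff P"])
    fix y :: real
    show "0 \<le> (\<Sum>k\<le>degree P. coeff P k * cos (pi * y / L) ^ k) \<and> (\<Sum>k\<le>degree P. coeff P k * cos (pi * y / L) ^ k) \<le> 1"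
      unfolding pc by (rule b01[OF r])
    assume y: "\<bar>y\<bar> \<le> L"
    have "\<bar>pi * y / L\<bar> \<le> pi" using y L by (simp add: abs_mult abs_divide divide_le_eq)
    then have "arccos (cos (pi * y / L)) = \<bar>pi * y / L\<bar>" by (rule arccos_cos_eq_abs)
    then have "h ((1 + cos (pi * y / L)) / 2) = f \<bar>y\<bar>"
      using L by (simp add: h_def abs_mult abs_divide field_simps)
    then have "f y = h ((1 + cos (pi * y / L)) / 2)" using f(4) by simp
    then show "\<bar>f y - (\<Sum>k\<le>degree P. coeff P k * cos (pi * y / L) ^ k)\<bar> \<le> e"
      unfolding pc using N[OF order_refl r, of "pi * y / L"] by simp
  qed
qed

text \<open>Functions that are close on a large interval and have values in \<open>[0, 1]\<close> have products with close
expectations, up to the probability that one of the variables is large.\<close>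

lemma expectation_prod_diff_le:
  fixes f q :: "real \<Rightarrow> real" and \<eta> :: real
  assumes P: "prob_space P" and Y: "\<And>t. t \<in> J \<Longrightarrow> Y t \<in> borel_measurable P"
    and fm: "f \<in> borel_measurable borel" and qm: "q \<in> borel_measurable borel"
    and f: "\<And>y. 0 \<le> f y" "\<And>y. f y \<le> 1" and q: "\<And>y. 0 \<le> q y" "\<And>y. q y \<le> 1"
    and close: "\<And>t y. t \<in> J \<Longrightarrow> \<bar>y\<bar> \<le> L t \<Longrightarrow> \<bar>f y - q y\<bar> \<le> \<eta>"
    and tail: "\<And>t. t \<in> J \<Longrightarrow> measure P {\<omega>\<in>space P. \<bar>Y t \<omega>\<bar> > L t} \<le> \<eta>"
  shows "\<bar>(\<integral>\<omega>. (\<Prod>t\<in>J. f (Y t \<omega>)) \<partial>P) - (\<integral>\<omega>. (\<Prod>t\<in>J. q (Y t \<omega>)) \<partial>P)\<bar> \<le> card J * (2 * \<eta>)"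
proof -
  interpret prob_space P by fact
  have \<eta>: "0 \<le> \<eta>" if "t \<in> J" for t by (rule order_trans[OF measure_nonneg tail[OF that]])
  have pb: "norm (\<Prod>t\<in>J. f (y t)) \<le> 1" "norm (\<Prod>t\<in>J. q (y t)) \<le> 1" for y :: "_ \<Rightarrow> real"
    unfolding real_norm_def abs_prod by (intro prod_le_1; use f q in simp)+
  have diff: "\<bar>(\<Prod>t\<in>J. f (y t)) - (\<Prod>t\<in>J. q (y t))\<bar> \<le> (\<Sum>t\<in>J. \<eta> + indicator {x. \<bar>x\<bar> > L t} (y t))" for y
  proof -
    have "norm ((\<Prod>t\<in>J. f (y t)) - (\<Prod>t\<in>J. q (y t))) \<le> (\<Sum>t\<in>J. norm (f (y t) - q (y t)))"
      by (rule norm_prod_diff) (use f q in auto)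
    also have "\<dots> \<le> (\<Sum>t\<in>J. \<eta> + indicator {x. \<bar>x\<bar> > L t} (y t))"
    proof (rule sum_mono)
      fix t assume t: "t \<in> J"
      show "norm (f (y t) - q (y t)) \<le> \<eta> + indicator {x. \<bar>x\<bar> > L t} (y t)"
      proof (cases "\<bar>y t\<bar> \<le> L t")
        case True
        then show ?thesis using close[OF t] by simp
      next
        case False
        have "\<bar>f (y t) - q (y t)\<bar> \<le> 1" using f[of "y t"] q[of "y t"] unfolding abs_le_iff by linarith
        then show ?thesis using False \<eta>[OF t] by simp
      qed
    qed
    finally show ?thesis by simp
  qed
  have m: "(\<lambda>\<omega>. \<Prod>t\<in>J. f (Y t \<omega>)) \<in> borel_measurable P" "(\<lambda>\<omega>. \<Prod>t\<in>J. q (Y t \<omega>)) \<in> borel_measurable P"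
    by (rule borel_measurable_prod, rule measurable_compose[OF Y fm], assumption)
       (rule borel_measurable_prod, rule measurable_compose[OF Y qm], assumption)
  have i: "integrable P (\<lambda>\<omega>. \<Prod>t\<in>J. f (Y t \<omega>))" "integrable P (\<lambda>\<omega>. \<Prod>t\<in>J. q (Y t \<omega>))"
    using integrable_const_bound[OF AE_I2[OF pb(1)] m(1)] integrable_const_bound[OF AE_I2[OF pb(2)] m(2)] by simp_all
  have s: "{\<omega>\<in>space P. \<bar>Y t \<omega>\<bar> > L t} \<in> sets P" if "t \<in> J" for t using Y[OF that] by measurable
  have i2: "integrable P (\<lambda>\<omega>. indicator {x. \<bar>x\<bar> > L t} (Y t \<omega>) :: real)"
    and e2: "(\<integral>\<omega>. indicator {x. \<bar>x\<bar> > L t} (Y t \<omega>) \<partial>P) = prob {\<omega>\<in>space P. \<bar>Y t \<omega>\<bar> > L t}" if "t \<in> J" for t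
  proof -
    have eq: "indicator {x. \<bar>x\<bar> > L t} (Y t \<omega>) = (indicator {\<omega>\<in>space P. \<bar>Y t \<omega>\<bar> > L t} \<omega> :: real)" if "\<omega> \<in> space P" for \<omega>
      using that by (auto split: split_indicator)
    show "integrable P (\<lambda>\<omega>. indicator {x. \<bar>x\<bar> > L t} (Y t \<omega>) :: real)"
      "(\<integral>\<omega>. indicator {x. \<bar>x\<bar> > L t} (Y t \<omega>) \<partial>P) = prob {\<omega>\<in>space P. \<bar>Y t \<omega>\<bar> > L t}"
      using s[OF that] by (simp_all add: eq less_top[symmetric] cong: Bochner_Integration.integrable_cong Bochner_Integration.integral_cong)
  qed
  have "\<bar>(\<integral>\<omega>. (\<Prod>t\<in>J. f (Y t \<omega>)) \<partial>P) - (\<integral>\<omega>. (\<Prod>t\<in>J. q (Y t \<omega>)) \<partial>P)\<bar> = norm (\<integral>\<omega>. (\<Prod>t\<in>J. f (Y t \<omega>)) - (\<Prod>t\<in>J. q (Y t \<omega>)) \<partial>P)"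
    using i by simp
  also have "\<dots> \<le> (\<integral>\<omega>. (\<Sum>t\<in>J. \<eta> + indicator {x. \<bar>x\<bar> > L t} (Y t \<omega>)) \<partial>P)"
    by (rule norm_integral_le)
       (use diff i2 in \<open>auto intro!: Bochner_Integration.integrable_sum Bochner_Integration.integrable_add\<close>)
  also have "\<dots> = (\<Sum>t\<in>J. \<eta> + prob {\<omega>\<in>space P. \<bar>Y t \<omega>\<bar> > L t})"
    using i2 e2 by (subst Bochner_Integration.integral_sum) (auto simp: prob_space)
  also have "\<dots> \<le> (\<Sum>t\<in>J. \<eta> + \<eta>)" by (intro sum_mono add_mono tail order_refl)
  finally show ?thesis by simp
qed

text \<open>Test functionals \<open>G\<close> whose product with every character has a convergent expectation.  Keeping the
character inside makes the class closed under multiplication by cosines, since a cosine only shifts the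
frequencies.\<close>

definition char_stable ::
  "'a measure \<Rightarrow> (nat \<Rightarrow> real \<Rightarrow> 'a \<Rightarrow> real) \<Rightarrow> 'b measure \<Rightarrow> (real \<Rightarrow> 'b \<Rightarrow> real) \<Rightarrow> real set \<Rightarrow> ((real \<Rightarrow> real) \<Rightarrow> real) \<Rightarrow> bool" where
  "char_stable M Y N V J G \<longleftrightarrow>
     (\<forall>n. (\<lambda>\<omega>. G (\<lambda>t. Y n t \<omega>)) \<in> borel_measurable M) \<and> (\<lambda>\<omega>. G (\<lambda>t. V t \<omega>)) \<in> borel_measurable N \<and>
     (\<exists>B. \<forall>y. \<bar>G y\<bar> \<le> B) \<and>
     (\<forall>\<theta>. (\<lambda>n. \<integral>\<omega>. of_real (G (\<lambda>t. Y n t \<omega>)) * iexp (\<Sum>t\<in>J. \<theta> t * Y n t \<omega>) \<partial>M)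
        \<longlonglongrightarrow> (\<integral>\<omega>. of_real (G (\<lambda>t. V t \<omega>)) * iexp (\<Sum>t\<in>J. \<theta> t * V t \<omega>) \<partial>N))"

locale char_convergence = M: prob_space M + N: prob_space N
  for M :: "'a measure" and N :: "'b measure" +
  fixes Y :: "nat \<Rightarrow> real \<Rightarrow> 'a \<Rightarrow> real" and V :: "real \<Rightarrow> 'b \<Rightarrow> real" and J :: "real set"
  assumes J: "finite J"
    and Ym: "\<And>n t. t \<in> J \<Longrightarrow> Y n t \<in> borel_measurable M"
    and Vm: "\<And>t. t \<in> J \<Longrightarrow> V t \<in> borel_measurable N"
    and chars: "\<And>\<theta>. (\<lambda>n. \<integral>\<omega>. iexp (\<Sum>t\<in>J. \<theta> t * Y n t \<omega>) \<partial>M) \<longlonglongrightarrow> (\<integral>\<omega>. iexp (\<Sum>t\<in>J. \<theta> t * V t \<omega>) \<partial>N)"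
begin

lemma sum_Y_measurable [measurable]: "(\<lambda>\<omega>. \<Sum>t\<in>J. \<theta> t * Y n t \<omega>) \<in> borel_measurable M"
  by (intro borel_measurable_sum borel_measurable_times Ym) auto

lemma sum_V_measurable [measurable]: "(\<lambda>\<omega>. \<Sum>t\<in>J. \<theta> t * V t \<omega>) \<in> borel_measurable N"
  by (intro borel_measurable_sum borel_measurable_times Vm) auto

abbreviation "compatible \<equiv> char_stable M Y N V J"

lemma stable_integrable:
  assumes "compatible G"
  shows "integrable M (\<lambda>\<omega>. of_real (G (\<lambda>t. Y n t \<omega>)) * iexp (\<Sum>t\<in>J. \<theta> t * Y n t \<omega>))"
    and "integrable N (\<lambda>\<omega>. of_real (G (\<lambda>t. V t \<omega>)) * iexp (\<Sum>t\<in>J. \<theta> t * V t \<omega>))"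
proof -
  from assms obtain B where B: "\<And>y. \<bar>G y\<bar> \<le> B" and [measurable]: "(\<lambda>\<omega>. G (\<lambda>t. Y n t \<omega>)) \<in> borel_measurable M" "(\<lambda>\<omega>. G (\<lambda>t. V t \<omega>)) \<in> borel_measurable N"
    by (auto simp: char_stable_def)
  have m: "(\<lambda>\<omega>. of_real (G (\<lambda>t. Y n t \<omega>)) * iexp (\<Sum>t\<in>J. \<theta> t * Y n t \<omega>)) \<in> borel_measurable M"
    "(\<lambda>\<omega>. of_real (G (\<lambda>t. V t \<omega>)) * iexp (\<Sum>t\<in>J. \<theta> t * V t \<omega>)) \<in> borel_measurable N"
    by measurable
  have b: "cmod (of_real (G y) * iexp x) \<le> B" for y x
    unfolding norm_mult norm_exp_i_times norm_of_real mult_1_right by (rule B)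
  show "integrable M (\<lambda>\<omega>. of_real (G (\<lambda>t. Y n t \<omega>)) * iexp (\<Sum>t\<in>J. \<theta> t * Y n t \<omega>))"
    by (rule M.integrable_const_bound[OF AE_I2[OF b] m(1)])
  show "integrable N (\<lambda>\<omega>. of_real (G (\<lambda>t. V t \<omega>)) * iexp (\<Sum>t\<in>J. \<theta> t * V t \<omega>))"
    by (rule N.integrable_const_bound[OF AE_I2[OF b] m(2)])
qed

lemma stable_1: "compatible (\<lambda>_. 1)"
  using chars by (auto simp: char_stable_def)

lemma stable_linear:
  assumes "finite K" "\<And>k. k \<in> K \<Longrightarrow> compatible (G k)"
  shows "compatible (\<lambda>y. \<Sum>k\<in>K. c k * G k y)"
proof -
  have "\<exists>B. \<forall>y. \<bar>\<Sum>k\<in>K. c k * G k y\<bar> \<le> B"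
  proof -
    have "\<forall>k\<in>K. \<exists>B. \<forall>y. \<bar>G k y\<bar> \<le> B" using assms(2) by (auto simp: char_stable_def)
    then obtain B where B: "\<And>k y. k \<in> K \<Longrightarrow> \<bar>G k y\<bar> \<le> B k" by metis
    have "\<bar>\<Sum>k\<in>K. c k * G k y\<bar> \<le> (\<Sum>k\<in>K. \<bar>c k\<bar> * B k)" for y
      by (rule order_trans[OF sum_abs sum_mono]) (simp add: abs_mult mult_left_mono B)
    then show ?thesis by blast
  qed
  moreover have "(\<lambda>n. \<integral>\<omega>. of_real (\<Sum>k\<in>K. c k * G k (\<lambda>t. Y n t \<omega>)) * iexp (\<Sum>t\<in>J. \<theta> t * Y n t \<omega>) \<partial>M)
        \<longlonglongrightarrow> (\<integral>\<omega>. of_real (\<Sum>k\<in>K. c k * G k (\<lambda>t. V t \<omega>)) * iexp (\<Sum>t\<in>J. \<theta> t * V t \<omega>) \<partial>N)" for \<theta>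
  proof -
    have e1: "(\<integral>\<omega>. of_real (\<Sum>k\<in>K. c k * G k (\<lambda>t. Y n t \<omega>)) * iexp (\<Sum>t\<in>J. \<theta> t * Y n t \<omega>) \<partial>M)
      = (\<Sum>k\<in>K. of_real (c k) * (\<integral>\<omega>. of_real (G k (\<lambda>t. Y n t \<omega>)) * iexp (\<Sum>t\<in>J. \<theta> t * Y n t \<omega>) \<partial>M))" for n
    proof -
      have "(\<integral>\<omega>. of_real (\<Sum>k\<in>K. c k * G k (\<lambda>t. Y n t \<omega>)) * iexp (\<Sum>t\<in>J. \<theta> t * Y n t \<omega>) \<partial>M)
        = (\<integral>\<omega>. (\<Sum>k\<in>K. of_real (c k) * (of_real (G k (\<lambda>t. Y n t \<omega>)) * iexp (\<Sum>t\<in>J. \<theta> t * Y n t \<omega>))) \<partial>M)"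
        by (simp only: of_real_sum of_real_mult sum_distrib_right mult.assoc)
      also have "\<dots> = (\<Sum>k\<in>K. \<integral>\<omega>. of_real (c k) * (of_real (G k (\<lambda>t. Y n t \<omega>)) * iexp (\<Sum>t\<in>J. \<theta> t * Y n t \<omega>)) \<partial>M)"
        by (rule Bochner_Integration.integral_sum) (intro integrable_mult_right stable_integrable assms(2))
      finally show ?thesis by simp
    qed
    have e2: "(\<integral>\<omega>. of_real (\<Sum>k\<in>K. c k * G k (\<lambda>t. V t \<omega>)) * iexp (\<Sum>t\<in>J. \<theta> t * V t \<omega>) \<partial>N)
      = (\<Sum>k\<in>K. of_real (c k) * (\<integral>\<omega>. of_real (G k (\<lambda>t. V t \<omega>)) * iexp (\<Sum>t\<in>J. \<theta> t * V t \<omega>) \<partial>N))"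
    proof -
      have "(\<integral>\<omega>. of_real (\<Sum>k\<in>K. c k * G k (\<lambda>t. V t \<omega>)) * iexp (\<Sum>t\<in>J. \<theta> t * V t \<omega>) \<partial>N)
        = (\<integral>\<omega>. (\<Sum>k\<in>K. of_real (c k) * (of_real (G k (\<lambda>t. V t \<omega>)) * iexp (\<Sum>t\<in>J. \<theta> t * V t \<omega>))) \<partial>N)"
        by (simp only: of_real_sum of_real_mult sum_distrib_right mult.assoc)
      also have "\<dots> = (\<Sum>k\<in>K. \<integral>\<omega>. of_real (c k) * (of_real (G k (\<lambda>t. V t \<omega>)) * iexp (\<Sum>t\<in>J. \<theta> t * V t \<omega>)) \<partial>N)"
        by (rule Bochner_Integration.integral_sum) (intro integrable_mult_right stable_integrable assms(2))
      finally show ?thesis by simp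
    qed
    show ?thesis unfolding e1 e2
      by (intro tendsto_sum tendsto_mult tendsto_const) (use assms(2) in \<open>auto simp: char_stable_def\<close>)
  qed
  moreover have "(\<lambda>\<omega>. \<Sum>k\<in>K. c k * G k (\<lambda>t. Y n t \<omega>)) \<in> borel_measurable M" for n
    using assms(2) by (intro borel_measurable_sum borel_measurable_times) (auto simp: char_stable_def)
  moreover have "(\<lambda>\<omega>. \<Sum>k\<in>K. c k * G k (\<lambda>t. V t \<omega>)) \<in> borel_measurable N"
    using assms(2) by (intro borel_measurable_sum borel_measurable_times) (auto simp: char_stable_def)
  ultimately show ?thesis unfolding char_stable_def by blast
qed

lemma stable_cos:
  assumes G: "compatible G" and t0: "t0 \<in> J"
  shows "compatible (\<lambda>y. cos (c * y t0) * G y)"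
proof -
  have cos_iexp: "of_real (cos x) = (iexp x + iexp (-x)) / 2" for x
    using cis_conv_exp[of x, symmetric] cis_conv_exp[of "-x", symmetric] by (simp add: complex_eq_iff)
  have shift: "(\<Sum>t\<in>J. (\<theta>(t0 := \<theta> t0 + d)) t * y t) = d * y t0 + (\<Sum>t\<in>J. \<theta> t * y t)" for \<theta> d and y :: "real \<Rightarrow> real"
  proof -
    have "(\<Sum>t\<in>J. (\<theta>(t0 := \<theta> t0 + d)) t * y t) = (\<Sum>t\<in>J. (if t = t0 then d * y t else 0) + \<theta> t * y t)"
      by (intro sum.cong refl) (auto simp: algebra_simps)
    then show ?thesis using J t0 by (simp add: sum.distrib)
  qed
  have e: "of_real (cos (c * y t0) * G y) * iexp (\<Sum>t\<in>J. \<theta> t * y t) =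
     (of_real (G y) * iexp (\<Sum>t\<in>J. (\<theta>(t0 := \<theta> t0 + c)) t * y t) + of_real (G y) * iexp (\<Sum>t\<in>J. (\<theta>(t0 := \<theta> t0 + - c)) t * y t)) / 2"
    for y :: "real \<Rightarrow> real" and \<theta>
    unfolding shift of_real_mult cos_iexp of_real_add distrib_left exp_add by (simp add: algebra_simps add_divide_distrib)
  note lim = G[unfolded char_stable_def, THEN conjunct2, THEN conjunct2, THEN conjunct2, rule_format]
  have "(\<lambda>n. \<integral>\<omega>. of_real (cos (c * Y n t0 \<omega>) * G (\<lambda>t. Y n t \<omega>)) * iexp (\<Sum>t\<in>J. \<theta> t * Y n t \<omega>) \<partial>M)
        \<longlonglongrightarrow> (\<integral>\<omega>. of_real (cos (c * V t0 \<omega>) * G (\<lambda>t. V t \<omega>)) * iexp (\<Sum>t\<in>J. \<theta> t * V t \<omega>) \<partial>N)" for \<theta>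
  proof -
    have e1: "(\<integral>\<omega>. of_real (cos (c * Y n t0 \<omega>) * G (\<lambda>t. Y n t \<omega>)) * iexp (\<Sum>t\<in>J. \<theta> t * Y n t \<omega>) \<partial>M) =
      ((\<integral>\<omega>. of_real (G (\<lambda>t. Y n t \<omega>)) * iexp (\<Sum>t\<in>J. (\<theta>(t0 := \<theta> t0 + c)) t * Y n t \<omega>) \<partial>M)
       + (\<integral>\<omega>. of_real (G (\<lambda>t. Y n t \<omega>)) * iexp (\<Sum>t\<in>J. (\<theta>(t0 := \<theta> t0 + - c)) t * Y n t \<omega>) \<partial>M)) / 2" for n
      unfolding e[of "\<lambda>t. Y n t _"] using stable_integrable[OF G] by (simp del: fun_upd_apply)
    have e2: "(\<integral>\<omega>. of_real (cos (c * V t0 \<omega>) * G (\<lambda>t. V t \<omega>)) * iexp (\<Sum>t\<in>J. \<theta> t * V t \<omega>) \<partial>N) =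
      ((\<integral>\<omega>. of_real (G (\<lambda>t. V t \<omega>)) * iexp (\<Sum>t\<in>J. (\<theta>(t0 := \<theta> t0 + c)) t * V t \<omega>) \<partial>N)
       + (\<integral>\<omega>. of_real (G (\<lambda>t. V t \<omega>)) * iexp (\<Sum>t\<in>J. (\<theta>(t0 := \<theta> t0 + - c)) t * V t \<omega>) \<partial>N)) / 2"
      unfolding e[of "\<lambda>t. V t _"] using stable_integrable[OF G] by (simp del: fun_upd_apply)
    show ?thesis unfolding e1 e2 by (intro tendsto_divide tendsto_add lim tendsto_const) simp
  qed
  moreover have "(\<lambda>\<omega>. cos (c * Y n t0 \<omega>) * G (\<lambda>t. Y n t \<omega>)) \<in> borel_measurable M" for n
    using G Ym[OF t0] by (auto simp: char_stable_def intro!: borel_measurable_times)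
  moreover have "(\<lambda>\<omega>. cos (c * V t0 \<omega>) * G (\<lambda>t. V t \<omega>)) \<in> borel_measurable N"
    using G Vm[OF t0] by (auto simp: char_stable_def intro!: borel_measurable_times)
  moreover have "\<exists>B. \<forall>y. \<bar>cos (c * y t0) * G y\<bar> \<le> B"
  proof -
    obtain B where B: "\<And>y. \<bar>G y\<bar> \<le> B" using G by (auto simp: char_stable_def)
    have "\<bar>cos (c * y t0) * G y\<bar> \<le> 1 * B" for y
      unfolding abs_mult by (intro mult_mono B) auto
    then show ?thesis by blast
  qed
  ultimately show ?thesis unfolding char_stable_def by blast
qed

lemma stable_cos_power: "compatible G \<Longrightarrow> t0 \<in> J \<Longrightarrow> compatible (\<lambda>y. cos (c * y t0) ^ k * G y)"
proof (induction k)
  case (Suc k)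
  then show ?case using stable_cos[of "\<lambda>y. cos (c * y t0) ^ k * G y" t0 c] by (simp add: mult.assoc)
qed simp

lemma stable_prod_cos_poly:
  assumes "I \<subseteq> J"
  shows "compatible (\<lambda>y. \<Prod>t\<in>I. \<Sum>k\<le>d. p k * cos (c * y t) ^ k)"
  using finite_subset[OF assms J] assms
proof (induction I rule: finite_induct)
  case empty
  then show ?case using stable_1 by simp
next
  case (insert t I)
  then have "compatible (\<lambda>y. \<Sum>k\<le>d. p k * (cos (c * y t) ^ k * (\<Prod>t\<in>I. \<Sum>k\<le>d. p k * cos (c * y t) ^ k)))"
    by (intro stable_linear stable_cos_power) auto
  also have "(\<lambda>y. \<Sum>k\<le>d. p k * (cos (c * y t) ^ k * (\<Prod>t\<in>I. \<Sum>k\<le>d. p k * cos (c * y t) ^ k)))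
     = (\<lambda>y. \<Prod>t\<in>insert t I. \<Sum>k\<le>d. p k * cos (c * y t) ^ k)"
    using insert.hyps by (simp add: sum_distrib_right mult.assoc)
  finally show ?case .
qed

lemma stable_expectation:
  assumes "compatible G"
  shows "(\<lambda>n. \<integral>\<omega>. G (\<lambda>t. Y n t \<omega>) \<partial>M) \<longlonglongrightarrow> (\<integral>\<omega>. G (\<lambda>t. V t \<omega>) \<partial>N)"
proof -
  have "(\<lambda>n. \<integral>\<omega>. of_real (G (\<lambda>t. Y n t \<omega>)) * iexp (\<Sum>t\<in>J. 0 * Y n t \<omega>) \<partial>M)
        \<longlonglongrightarrow> (\<integral>\<omega>. of_real (G (\<lambda>t. V t \<omega>)) * iexp (\<Sum>t\<in>J. 0 * V t \<omega>) \<partial>N)"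
    by (rule assms[unfolded char_stable_def, THEN conjunct2, THEN conjunct2, THEN conjunct2, rule_format])
  then have "(\<lambda>n. complex_of_real (\<integral>\<omega>. G (\<lambda>t. Y n t \<omega>) \<partial>M)) \<longlonglongrightarrow> complex_of_real (\<integral>\<omega>. G (\<lambda>t. V t \<omega>) \<partial>N)"
    by simp
  then show ?thesis by (simp only: tendsto_of_real_iff)
qed

text \<open>The passage from characteristic functions to weak convergence of several coordinates, for the test
functions that the exit problem requires: products of one even function with values in \<open>[0, 1]\<close>.\<close>

lemma prod_even_converges:
  fixes f :: "real \<Rightarrow> real"
  assumes f: "continuous_on UNIV f" "\<And>y. 0 \<le> f y" "\<And>y. f y \<le> 1" "\<And>y. f \<bar>y\<bar> = f y"
    and tight: "\<And>t e. t \<in> J \<Longrightarrow> e > 0 \<Longrightarrow> \<exists>L>0. \<forall>n. M.prob {\<omega>\<in>space M. \<bar>Y n t \<omega>\<bar> > L} \<le> e"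
  shows "(\<lambda>n. \<integral>\<omega>. (\<Prod>t\<in>J. f (Y n t \<omega>)) \<partial>M) \<longlonglongrightarrow> (\<integral>\<omega>. (\<Prod>t\<in>J. f (V t \<omega>)) \<partial>N)"
proof (rule LIMSEQ_I)
  fix e :: real assume e: "e > 0"
  define \<eta> where "\<eta> = e / (6 * (real (card J) + 1))"
  have \<eta>: "\<eta> > 0" using e by (simp add: \<eta>_def)
  have "\<exists>L>0. (\<forall>n. M.prob {\<omega>\<in>space M. \<bar>Y n t \<omega>\<bar> > L} \<le> \<eta>) \<and> N.prob {\<omega>\<in>space N. \<bar>V t \<omega>\<bar> > L} \<le> \<eta>" if t: "t \<in> J" for t
  proof -
    obtain L1 where L1: "L1 > 0" "\<And>n. M.prob {\<omega>\<in>space M. \<bar>Y n t \<omega>\<bar> > L1} \<le> \<eta>" using tight[OF t \<eta>] by blast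
    have [measurable]: "V t \<in> borel_measurable N" "\<And>n. Y n t \<in> borel_measurable M" using t Vm Ym by auto
    have "(\<lambda>i. N.prob {\<omega>\<in>space N. \<bar>V t \<omega>\<bar> > real i}) \<longlonglongrightarrow> N.prob (\<Inter>i. {\<omega>\<in>space N. \<bar>V t \<omega>\<bar> > real i})"
      by (rule N.finite_Lim_measure_decseq) (auto simp: decseq_def)
    also have "(\<Inter>i. {\<omega>\<in>space N. \<bar>V t \<omega>\<bar> > real i}) = {}"
    proof (rule equals0I)
      fix \<omega> assume "\<omega> \<in> (\<Inter>i. {\<omega>\<in>space N. \<bar>V t \<omega>\<bar> > real i})"
      then have "real i < \<bar>V t \<omega>\<bar>" for i by auto
      with reals_Archimedean2[of "\<bar>V t \<omega>\<bar>"] show False by (meson less_asym)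
    qed
    finally have "(\<lambda>i. N.prob {\<omega>\<in>space N. \<bar>V t \<omega>\<bar> > real i}) \<longlonglongrightarrow> 0" by simp
    from order_tendstoD(2)[OF this \<eta>] obtain i where i: "N.prob {\<omega>\<in>space N. \<bar>V t \<omega>\<bar> > real i} < \<eta>"
      by (auto simp: eventually_sequentially)
    show ?thesis
    proof (intro exI[of _ "max L1 (real i)"] conjI allI)
      fix n
      have "M.prob {\<omega>\<in>space M. \<bar>Y n t \<omega>\<bar> > max L1 (real i)} \<le> M.prob {\<omega>\<in>space M. \<bar>Y n t \<omega>\<bar> > L1}"
        by (intro M.finite_measure_mono) auto
      then show "M.prob {\<omega>\<in>space M. \<bar>Y n t \<omega>\<bar> > max L1 (real i)} \<le> \<eta>" using L1(2)[of n] by linarith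
      have "N.prob {\<omega>\<in>space N. \<bar>V t \<omega>\<bar> > max L1 (real i)} \<le> N.prob {\<omega>\<in>space N. \<bar>V t \<omega>\<bar> > real i}"
        by (intro N.finite_measure_mono) auto
      then show "N.prob {\<omega>\<in>space N. \<bar>V t \<omega>\<bar> > max L1 (real i)} \<le> \<eta>" using i by linarith
    qed (use L1 in auto)
  qed
  then have "\<forall>t\<in>J. \<exists>L. L > 0 \<and> (\<forall>n. M.prob {\<omega>\<in>space M. \<bar>Y n t \<omega>\<bar> > L} \<le> \<eta>) \<and> N.prob {\<omega>\<in>space N. \<bar>V t \<omega>\<bar> > L} \<le> \<eta>"
    by blast
  from bchoice[OF this] obtain L where
    L': "\<forall>t\<in>J. L t > 0 \<and> (\<forall>n. M.prob {\<omega>\<in>space M. \<bar>Y n t \<omega>\<bar> > L t} \<le> \<eta>) \<and> N.prob {\<omega>\<in>space N. \<bar>V t \<omega>\<bar> > L t} \<le> \<eta>"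
    by blast
  have L: "\<And>t. t \<in> J \<Longrightarrow> L t > 0" "\<And>t n. t \<in> J \<Longrightarrow> M.prob {\<omega>\<in>space M. \<bar>Y n t \<omega>\<bar> > L t} \<le> \<eta>"
     "\<And>t. t \<in> J \<Longrightarrow> N.prob {\<omega>\<in>space N. \<bar>V t \<omega>\<bar> > L t} \<le> \<eta>"
    using L' by simp_all
  \<comment> \<open>One interval for all coordinates; the summand \<open>1\<close> keeps it nonempty if \<open>J\<close> is empty.\<close>
  define L0 where "L0 = 1 + (\<Sum>t\<in>J. L t)"
  have L0: "L0 > 0" "\<And>t. t \<in> J \<Longrightarrow> L t \<le> L0"
  proof -
    have "0 \<le> (\<Sum>t\<in>J. L t)" by (intro sum_nonneg less_imp_le L(1))
    then show "L0 > 0" by (simp add: L0_def)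
    fix t assume "t \<in> J"
    then have "L t \<le> (\<Sum>t\<in>J. L t)" using J by (intro member_le_sum less_imp_le L(1)) auto
    then show "L t \<le> L0" by (simp add: L0_def)
  qed
  obtain p d where p: "\<And>y. 0 \<le> (\<Sum>k\<le>d. p k * cos (pi * y / L0) ^ k) \<and> (\<Sum>k\<le>d. p k * cos (pi * y / L0) ^ k) \<le> 1"
    "\<And>y. \<bar>y\<bar> \<le> L0 \<Longrightarrow> \<bar>f y - (\<Sum>k\<le>d. p k * cos (pi * y / L0) ^ k)\<bar> \<le> \<eta>"
    using cosine_polynomial_approx[OF f L0(1) \<eta>] by blast
  define q where "q y = (\<Sum>k\<le>d. p k * cos (pi * y / L0) ^ k)" for y
  have q_alt: "q y = (\<Sum>k\<le>d. p k * cos ((pi / L0) * y) ^ k)" for y by (simp add: q_def)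
  have qm [measurable]: "q \<in> borel_measurable borel" unfolding q_def[abs_def] by measurable
  have fm [measurable]: "f \<in> borel_measurable borel" by (rule borel_measurable_continuous_onI[OF f(1)])
  have fq: "0 \<le> f y" "f y \<le> 1" "0 \<le> q y" "q y \<le> 1" for y using f p by (auto simp: q_def)
  have close: "\<bar>f y - q y\<bar> \<le> \<eta>" if "t \<in> J" "\<bar>y\<bar> \<le> L t" for t y
    using p(2)[of y] L0(2)[OF that(1)] that(2) by (simp add: q_def)
  have bM: "\<bar>(\<integral>\<omega>. (\<Prod>t\<in>J. f (Y n t \<omega>)) \<partial>M) - (\<integral>\<omega>. (\<Prod>t\<in>J. q (Y n t \<omega>)) \<partial>M)\<bar> \<le> card J * (2 * \<eta>)" for n
    by (rule expectation_prod_diff_le[OF M.prob_space_axioms Ym fm qm fq close L(2)])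
  have bN: "\<bar>(\<integral>\<omega>. (\<Prod>t\<in>J. f (V t \<omega>)) \<partial>N) - (\<integral>\<omega>. (\<Prod>t\<in>J. q (V t \<omega>)) \<partial>N)\<bar> \<le> card J * (2 * \<eta>)"
    by (rule expectation_prod_diff_le[OF N.prob_space_axioms Vm fm qm fq close L(3)])
  have J\<eta>: "card J * (2 * \<eta>) \<le> e / 3"
  proof -
    have "card J * (2 * \<eta>) = e / 3 * (real (card J) / (real (card J) + 1))" by (simp add: \<eta>_def field_simps)
    also have "\<dots> \<le> e / 3 * 1" using e by (intro mult_left_mono) auto
    finally show ?thesis by simp
  qed
  have "compatible (\<lambda>y. \<Prod>t\<in>J. q (y t))" unfolding q_alt by (rule stable_prod_cos_poly) simp
  from LIMSEQ_D[OF stable_expectation[OF this], of "e / 3"] e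
  obtain n0 where n0: "\<And>n. n \<ge> n0 \<Longrightarrow> \<bar>(\<integral>\<omega>. (\<Prod>t\<in>J. q (Y n t \<omega>)) \<partial>M) - (\<integral>\<omega>. (\<Prod>t\<in>J. q (V t \<omega>)) \<partial>N)\<bar> < e / 3" by auto
  show "\<exists>n0. \<forall>n\<ge>n0. norm ((\<integral>\<omega>. (\<Prod>t\<in>J. f (Y n t \<omega>)) \<partial>M) - (\<integral>\<omega>. (\<Prod>t\<in>J. f (V t \<omega>)) \<partial>N)) < e"
  proof (intro exI allI impI)
    fix n assume "n0 \<le> n"
    from n0[OF this] bM[of n] bN J\<eta> show "norm ((\<integral>\<omega>. (\<Prod>t\<in>J. f (Y n t \<omega>)) \<partial>M) - (\<integral>\<omega>. (\<Prod>t\<in>J. f (V t \<omega>)) \<partial>N)) < e"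
      unfolding real_norm_def by linarith
  qed
qed

end

section \<open>First passage and the next grid point\<close>

lemma sum_inverse_sqrt_shift_le: "(\<Sum>j\<in>{m<..m + l}. real j powr (-1/2)) \<le> 2 * sqrt (real l)"
proof -
  have "(\<Sum>j\<in>{m<..m + l}. real j powr (-1/2)) = (\<Sum>i=1..l. real (m + i) powr (-1/2))"
    by (rule sum.reindex_bij_witness[of _ "\<lambda>i. m + i" "\<lambda>j. j - m"]) auto
  also have "\<dots> \<le> (\<Sum>i=1..l. real i powr (-(1/2)))"
    by (intro sum_mono) (auto intro!: powr_mono2')
  also have "\<dots> \<le> real l powr (1 - 1/2) / (1 - 1/2)" by (rule sum_powr_le) auto
  also have "\<dots> = 2 * sqrt (real l)" by (simp add: powr_half_sqrt)
  finally show ?thesis .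
qed

context interacting_erw
begin

definition gap :: "nat \<Rightarrow> 'a \<Rightarrow> real" where "gap k \<omega> = s1 k \<omega> - s2 k \<omega>"

lemma gap_measurable_hist: "gap k \<in> borel_measurable (hist k)"
  unfolding gap_def[abs_def] using s_measurable_hist by auto

lemma gap_measurable [measurable]: "gap k \<in> borel_measurable M"
  by (rule hist_measurable_M[OF gap_measurable_hist])

lemma gap_increment:
  assumes "1 \<le> k" "k \<le> g"
  shows "gap g \<omega> - gap k \<omega> = innov_sum (\<lambda>_. 1) (\<lambda>_. -1) k g \<omega> + (\<Sum>j\<in>{k<..g}. drift1 (j - 1) \<omega> - drift2 (j - 1) \<omega>)"
  using assms(2)
proof (induction g rule: dec_induct)
  case base
  then show ?case by (simp add: innov_sum_def)
next
  case (step g)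
  have "{k<..Suc g} = insert (Suc g) {k<..g}" using step.hyps by auto
  then show ?case
    using step.IH by (simp add: innov_sum_Suc[OF step.hyps(1)] gap_def s_Suc innov1_def innov2_def)
qed

lemma markov_square:
  fixes f :: "'a \<Rightarrow> real"
  assumes "f \<in> borel_measurable M" "integrable M (\<lambda>\<omega>. (f \<omega>)^2)" "c > 0"
  shows "prob {\<omega>\<in>space M. \<bar>f \<omega>\<bar> \<ge> c} \<le> (\<integral>\<omega>. (f \<omega>)^2 \<partial>M) / c^2"
proof -
  have "prob {\<omega>\<in>space M. (f \<omega>)^2 \<ge> c^2} \<le> (\<integral>\<omega>. (f \<omega>)^2 \<partial>M) / c^2"
    by (rule integral_Markov_inequality_measure[where A="{}"]) (use assms in auto)
  moreover have "{\<omega>\<in>space M. \<bar>f \<omega>\<bar> \<ge> c} = {\<omega>\<in>space M. (f \<omega>)^2 \<ge> c^2}"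
    using assms(3) by (auto simp: abs_le_square_iff[of c, symmetric])
  ultimately show ?thesis by simp
qed

text \<open>A passage of the level \<open>A\<close> before the last grid point \<open>m q\<close> is seen, up to \<open>2 b\<close> in the level, at the next
grid point after it, unless the difference of the walks moves by at least \<open>2 b\<close> within \<open>l\<close> steps of the first passage.
Decompose according to the time \<open>k\<close> of first passage.  The event that it equals \<open>k\<close> belongs to the past of
\<open>k\<close>, so Chebyshev's inequality for the martingale part, conditionally on it, gives \<open>2 l / b\<^sup>2\<close> times its
probability, and these probabilities add up to at most \<open>1\<close>: only one passage time counts, not all
\<open>m q\<close> of them.

The drift part between two grid points is controlled for all grid cells at once.  The \<open>j\<close>-th drift has second
moment \<open>O(1/j)\<close>; by the Cauchy-Schwarz inequality with weights \<open>j\<^sup>1\<^sup>/\<^sup>2\<close> its sum over a cell is at most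
\<open>(2 \<surd>l Q)\<^sup>1\<^sup>/\<^sup>2\<close> with one random variable \<open>Q\<close> of expectation \<open>O(\<surd>(m q))\<close>.\<close>

lemma grid_detects_passage:
  fixes m :: "nat \<Rightarrow> nat"
  assumes Cd: "Cd \<ge> 0" "\<And>n. (\<integral>\<omega>. (mem1 * s2 n \<omega> - mem2 * s1 n \<omega>)^2 \<partial>M) \<le> Cd * real n"
    and m0: "m 0 = 0" and m_mono: "\<And>i. m i \<le> m (Suc i)" and m_gap: "\<And>i. m (Suc i) \<le> m i + l"
    and b: "b > 0"
  shows "prob {\<omega>\<in>space M. \<exists>k\<in>{1..m q}. \<bar>gap k \<omega>\<bar> \<ge> A} \<le>
     prob {\<omega>\<in>space M. \<exists>i\<in>{1..q}. \<bar>gap (m i) \<omega>\<bar> \<ge> A - 2 * b} + 2 * real l / b^2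
       + 4 * Cd * sqrt (real l) * sqrt (real (m q)) / b^2"
proof -
  \<comment> \<open>The drift of the difference of the walks.\<close>
  define d where "d j \<omega> = drift1 j \<omega> - drift2 j \<omega>" for j \<omega>
  have dm [measurable]: "d j \<in> borel_measurable M" for j unfolding d_def[abs_def] by measurable
  have d_bound: "\<bar>d j \<omega>\<bar> \<le> 2" if "\<omega> \<in> space M" for j \<omega>
    using abs_drift_le[OF that, of j] unfolding d_def by linarith
  have mm: "m i \<le> m j" if "i \<le> j" for i j using that m_mono by (rule lift_Suc_mono_le[rotated])
  define Q where "Q \<omega> = (\<Sum>j\<in>{0<..m q}. real j powr (1/2) * (d j \<omega>)^2)" for \<omega>
  have Q0: "0 \<le> Q \<omega>" for \<omega> unfolding Q_def by (intro sum_nonneg) auto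
  define first where "first k = {\<omega>\<in>space M. \<bar>gap k \<omega>\<bar> \<ge> A \<and> (\<forall>j\<in>{1..<k}. \<bar>gap j \<omega>\<bar> < A)}" for k
  define grid where "grid k = m (LEAST i. k \<le> m i)" for k
  have grid: "k \<le> grid k" "grid k \<le> k + l" "\<exists>i\<in>{1..q}. m (i - 1) < k \<and> k \<le> m i \<and> grid k = m i" if k: "k \<in> {1..m q}" for k
  proof -
    define i where "i = (LEAST i. k \<le> m i)"
    have i1: "k \<le> m i" unfolding i_def by (rule LeastI[of _ q]) (use k in simp)
    have iq: "i \<le> q" unfolding i_def by (rule Least_le) (use k in simp)
    have i0: "i \<noteq> 0" using i1 m0 k by (intro notI) simp
    have i2: "m (i - 1) < k"
    proof (rule ccontr)
      assume "\<not> m (i - 1) < k"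
      then have "i \<le> i - 1" unfolding i_def by (intro Least_le) (simp add: i_def[symmetric])
      with i0 show False by simp
    qed
    have g: "grid k = m i" by (simp add: grid_def i_def)
    show "k \<le> grid k" using i1 g by simp
    have "m i \<le> m (i - 1) + l" using m_gap[of "i - 1"] i0 by simp
    then show "grid k \<le> k + l" using i2 g by simp
    show "\<exists>i\<in>{1..q}. m (i - 1) < k \<and> k \<le> m i \<and> grid k = m i" using i0 iq i1 i2 g by (intro bexI[of _ i]) auto
  qed
  have first_hist: "first k \<in> sets (hist k)" for k
  proof -
    have A1: "{\<omega>\<in>space M. \<bar>gap j \<omega>\<bar> \<ge> A} \<in> sets (hist k)" and A2: "{\<omega>\<in>space M. \<bar>gap j \<omega>\<bar> < A} \<in> sets (hist k)"
      if "j \<le> k" for j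
    proof -
      have [measurable]: "gap j \<in> borel_measurable (hist k)"
        by (rule hist_measurable_mono[OF gap_measurable_hist that])
      have "{\<omega>\<in>space (hist k). \<bar>gap j \<omega>\<bar> \<ge> A} \<in> sets (hist k)" "{\<omega>\<in>space (hist k). \<bar>gap j \<omega>\<bar> < A} \<in> sets (hist k)"
        by measurable
      then show "{\<omega>\<in>space M. \<bar>gap j \<omega>\<bar> \<ge> A} \<in> sets (hist k)" "{\<omega>\<in>space M. \<bar>gap j \<omega>\<bar> < A} \<in> sets (hist k)" by simp_all
    qed
    have "{\<omega>\<in>space M. \<bar>gap k \<omega>\<bar> \<ge> A} \<inter> (\<Inter>j\<in>{1..<k}. {\<omega>\<in>space M. \<bar>gap j \<omega>\<bar> < A}) \<in> sets (hist k)" if "{1..<k} \<noteq> {}"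
      using that by (intro sets.Int sets.finite_INT A1 A2) auto
    moreover have "{\<omega>\<in>space M. \<bar>gap k \<omega>\<bar> \<ge> A} \<in> sets (hist k)" by (rule A1) simp
    moreover have "first k = (if {1..<k} = {} then {\<omega>\<in>space M. \<bar>gap k \<omega>\<bar> \<ge> A} else
        {\<omega>\<in>space M. \<bar>gap k \<omega>\<bar> \<ge> A} \<inter> (\<Inter>j\<in>{1..<k}. {\<omega>\<in>space M. \<bar>gap j \<omega>\<bar> < A}))"
      unfolding first_def by auto
    ultimately show ?thesis by (simp split: if_splits)
  qed
  have first_ev: "first k \<in> events" for k using first_hist hist_events by blast
  let ?Mt = "\<lambda>k. innov_sum (\<lambda>_. 1) (\<lambda>_. -1) k (grid k)"
  \<comment> \<open>First passage at \<open>k\<close>, followed by a large martingale increment up to the next grid point.\<close>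
  define bad where "bad k = first k \<inter> {\<omega>\<in>space M. \<bar>?Mt k \<omega>\<bar> \<ge> b}" for k
  have bad_ev: "bad k \<in> events" for k
    unfolding bad_def by (intro sets.Int first_ev) measurable
  let ?G = "{\<omega>\<in>space M. \<exists>i\<in>{1..q}. \<bar>gap (m i) \<omega>\<bar> \<ge> A - 2 * b}"
  let ?R = "{\<omega>\<in>space M. 2 * sqrt (real l) * Q \<omega> \<ge> b^2}"
  have G_ev: "?G \<in> events" by measurable
  have Qm [measurable]: "Q \<in> borel_measurable M" unfolding Q_def[abs_def] by measurable
  have R_ev: "?R \<in> events" by measurable
  have drift_small: "\<bar>\<Sum>j\<in>{k<..grid k}. drift1 (j - 1) \<omega> - drift2 (j - 1) \<omega>\<bar>^2 \<le> 2 * sqrt (real l) * Q \<omega>"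
    if k: "k \<in> {1..m q}" for k \<omega>
  proof -
    obtain i where i: "i \<in> {1..q}" "m (i - 1) < k" "k \<le> m i" "grid k = m i" using grid(3)[OF k] by blast
    let ?c = "{m (i - 1)<..m (i - 1) + l}" and ?S = "{k..<m i}"
    have "(\<Sum>j\<in>{k<..grid k}. drift1 (j - 1) \<omega> - drift2 (j - 1) \<omega>) = (\<Sum>j\<in>?S. d j \<omega>)"
      unfolding d_def i(4)
      by (rule sum.reindex_bij_witness[of _ Suc "\<lambda>j. j - 1"]) auto
    also have "\<bar>\<Sum>j\<in>?S. d j \<omega>\<bar>^2 = (\<Sum>j\<in>?S. real j powr (-1/4) * (real j powr (1/4) * d j \<omega>))^2"
    proof -
      have "d j \<omega> = real j powr (-1/4) * (real j powr (1/4) * d j \<omega>)" if "j \<in> ?S" for j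
        using that i(2) by (simp add: mult.assoc[symmetric] powr_add[symmetric])
      then have "(\<Sum>j\<in>?S. d j \<omega>) = (\<Sum>j\<in>?S. real j powr (-1/4) * (real j powr (1/4) * d j \<omega>))" by (rule sum.cong[OF refl])
      then show ?thesis by (simp only: power2_abs)
    qed
    also have "\<dots> \<le> (\<Sum>j\<in>?S. (real j powr (-1/4))^2) * (\<Sum>j\<in>?S. (real j powr (1/4) * d j \<omega>)^2)"
      by (rule Cauchy_Schwarz_ineq_sum)
    also have "(\<Sum>j\<in>?S. (real j powr (-1/4))^2) = (\<Sum>j\<in>?S. real j powr (-1/2))"
      by (intro sum.cong refl) (simp add: power2_eq_square powr_add[symmetric])
    also have "(\<Sum>j\<in>?S. (real j powr (1/4) * d j \<omega>)^2) = (\<Sum>j\<in>?S. real j powr (1/2) * (d j \<omega>)^2)"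
      by (intro sum.cong refl) (simp add: power_mult_distrib, simp add: power2_eq_square powr_add[symmetric])
    also have "(\<Sum>j\<in>?S. real j powr (-1/2)) * (\<Sum>j\<in>?S. real j powr (1/2) * (d j \<omega>)^2) \<le> (2 * sqrt (real l)) * Q \<omega>"
    proof (rule mult_mono)
      have "m i \<le> m (i - 1) + l" using m_gap[of "i - 1"] i(1) by simp
      then have "(\<Sum>j\<in>?S. real j powr (-1/2)) \<le> (\<Sum>j\<in>?c. real j powr (-1/2))"
        using i(2) by (intro sum_mono2) auto
      then show "(\<Sum>j\<in>?S. real j powr (-1/2)) \<le> 2 * sqrt (real l)" using sum_inverse_sqrt_shift_le[of "m (i - 1)" l] by linarith
      have "m i \<le> m q" using i(1) by (intro mm) auto
      then show "(\<Sum>j\<in>?S. real j powr (1/2) * (d j \<omega>)^2) \<le> Q \<omega>"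
        unfolding Q_def using k by (intro sum_mono2) auto
    qed (auto intro!: sum_nonneg)
    finally show ?thesis .
  qed
  have cover: "{\<omega>\<in>space M. \<exists>k\<in>{1..m q}. \<bar>gap k \<omega>\<bar> \<ge> A} \<subseteq> ?G \<union> ?R \<union> (\<Union>k\<in>{1..m q}. bad k)"
  proof
    fix \<omega> assume "\<omega> \<in> {\<omega>\<in>space M. \<exists>k\<in>{1..m q}. \<bar>gap k \<omega>\<bar> \<ge> A}"
    then have w: "\<omega> \<in> space M" and ex: "\<exists>k. 1 \<le> k \<and> k \<le> m q \<and> \<bar>gap k \<omega>\<bar> \<ge> A" by auto
    define k where "k = (LEAST k. 1 \<le> k \<and> k \<le> m q \<and> \<bar>gap k \<omega>\<bar> \<ge> A)"
    have k: "1 \<le> k \<and> k \<le> m q \<and> \<bar>gap k \<omega>\<bar> \<ge> A" unfolding k_def using ex by (rule LeastI_ex)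
    have kf: "\<omega> \<in> first k"
    proof -
      have "\<bar>gap j \<omega>\<bar> < A" if "j \<in> {1..<k}" for j
      proof (rule ccontr)
        assume "\<not> \<bar>gap j \<omega>\<bar> < A"
        then have "k \<le> j" unfolding k_def using that k by (intro Least_le) auto
        with that show False by simp
      qed
      then show ?thesis using w k by (simp add: first_def)
    qed
    have kq: "k \<in> {1..m q}" using k by simp
    show "\<omega> \<in> ?G \<union> ?R \<union> (\<Union>k\<in>{1..m q}. bad k)"
    proof (rule ccontr)
      assume "\<omega> \<notin> ?G \<union> ?R \<union> (\<Union>k\<in>{1..m q}. bad k)"
      then have nG: "\<omega> \<notin> ?G" and nR: "\<omega> \<notin> ?R" and nB: "\<omega> \<notin> bad k" using kq by auto
      have 1: "\<bar>?Mt k \<omega>\<bar> < b" using nB kf w by (auto simp: bad_def)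
      have "\<bar>\<Sum>j\<in>{k<..grid k}. drift1 (j - 1) \<omega> - drift2 (j - 1) \<omega>\<bar>^2 < b^2"
        using drift_small[OF kq, of \<omega>] nR w by simp
      then have 2: "\<bar>\<Sum>j\<in>{k<..grid k}. drift1 (j - 1) \<omega> - drift2 (j - 1) \<omega>\<bar> < b"
        by (rule power_less_imp_less_base) (use b in simp)
      have "\<bar>gap (grid k) \<omega> - gap k \<omega>\<bar> < 2 * b"
        using 1 2 gap_increment[OF _ grid(1)[OF kq], of \<omega>] k by linarith
      then have "\<bar>gap (grid k) \<omega>\<bar> \<ge> A - 2 * b" using k by linarith
      moreover obtain i where "i \<in> {1..q}" "grid k = m i" using grid(3)[OF kq] by blast
      ultimately show False using nG w by auto
    qed
  qed
  have pb: "prob (bad k) \<le> prob (first k) * (2 * real l / b^2)" if k: "k \<in> {1..m q}" for k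
  proof -
    let ?f = "\<lambda>\<omega>. indicator (first k) \<omega> * ?Mt k \<omega>"
    have fm: "?f \<in> borel_measurable M" using first_ev[of k] by measurable
    have sq: "(?f \<omega>)^2 = indicator (first k) \<omega> * (?Mt k \<omega>)^2" for \<omega> by (auto split: split_indicator)
    have "integrable M (\<lambda>\<omega>. (?Mt k \<omega>)^2 * indicator (first k) \<omega>)"
      by (rule integrable_real_mult_indicator[OF first_ev integrable_innov_sum_square])
    then have int: "integrable M (\<lambda>\<omega>. (?f \<omega>)^2)" unfolding sq by (simp add: mult.commute)
    have "bad k \<subseteq> {\<omega>\<in>space M. \<bar>?f \<omega>\<bar> \<ge> b}" by (auto simp: bad_def)
    moreover have "{\<omega>\<in>space M. \<bar>F \<omega>\<bar> \<ge> b} \<in> events" if "F \<in> borel_measurable M" for F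
      using that by measurable
    ultimately have "prob (bad k) \<le> prob {\<omega>\<in>space M. \<bar>?f \<omega>\<bar> \<ge> b}" using fm by (intro finite_measure_mono)
    also have "\<dots> \<le> (\<integral>\<omega>. (?f \<omega>)^2 \<partial>M) / b^2" by (rule markov_square[OF fm int b])
    also have "(\<integral>\<omega>. (?f \<omega>)^2 \<partial>M) \<le> prob (first k) * (\<Sum>j\<in>{k<..grid k}. 1^2 + (-1)^2)"
      unfolding sq by (rule innov_sum_second_moment[OF _ grid(1)[OF k] first_hist]) (use k in simp)
    also have "(\<Sum>j\<in>{k<..grid k}. 1^2 + (-1)^2) = 2 * real (grid k - k)" by simp
    also have "prob (first k) * (2 * real (grid k - k)) / b^2 \<le> prob (first k) * (2 * real l) / b^2"
      using grid(2)[OF k] by (intro divide_right_mono mult_left_mono) auto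
    finally show ?thesis by (simp add: divide_right_mono)
  qed
  have sum_first: "(\<Sum>k\<in>{1..m q}. prob (first k)) \<le> 1"
  proof -
    have disj: "first j \<inter> first k = {}" if "1 \<le> j" "j < k" for j k
    proof (rule equals0I)
      fix \<omega> assume "\<omega> \<in> first j \<inter> first k"
      then have "\<bar>gap j \<omega>\<bar> \<ge> A" "\<forall>i\<in>{1..<k}. \<bar>gap i \<omega>\<bar> < A" by (simp_all add: first_def)
      moreover have "j \<in> {1..<k}" using that by simp
      ultimately show False by (meson not_le)
    qed
    have "disjoint_family_on first {1..m q}"
      unfolding disjoint_family_on_def
    proof (intro ballI impI)
      fix j k assume jk: "j \<in> {1..m q}" "k \<in> {1..m q}" "j \<noteq> k"
      show "first j \<inter> first k = {}"
      proof (cases "j < k")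
        case True
        then show ?thesis using disj[of j k] jk by simp
      next
        case False
        then show ?thesis using disj[of k j] jk by (simp add: Int_commute)
      qed
    qed
    then have "(\<Sum>k\<in>{1..m q}. prob (first k)) = prob (\<Union>k\<in>{1..m q}. first k)"
      using first_ev by (intro finite_measure_finite_Union[symmetric]) auto
    then show ?thesis by simp
  qed
  have pB: "prob (\<Union>k\<in>{1..m q}. bad k) \<le> 2 * real l / b^2"
  proof -
    have "prob (\<Union>k\<in>{1..m q}. bad k) \<le> (\<Sum>k\<in>{1..m q}. prob (bad k))"
      using bad_ev by (intro finite_measure_subadditive_finite) auto
    also have "\<dots> \<le> (\<Sum>k\<in>{1..m q}. prob (first k) * (2 * real l / b^2))" by (intro sum_mono pb)
    also have "\<dots> = (\<Sum>k\<in>{1..m q}. prob (first k)) * (2 * real l / b^2)" by (rule sum_distrib_right[symmetric])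
    also have "\<dots> \<le> 1 * (2 * real l / b^2)" by (intro mult_right_mono sum_first) auto
    finally show ?thesis by simp
  qed
  have d2: "integrable M (\<lambda>\<omega>. (d j \<omega>)^2)" "(\<integral>\<omega>. (d j \<omega>)^2 \<partial>M) \<le> Cd / real j" if j: "1 \<le> j" for j
  proof -
    show i: "integrable M (\<lambda>\<omega>. (d j \<omega>)^2)"
      by (rule integrable_bounded_rv[of _ "2^2"]) (use power_mono[OF d_bound, of _ j 2] in auto)
    have "(\<integral>\<omega>. (d j \<omega>)^2 \<partial>M) = (\<integral>\<omega>. (mem1 * s2 j \<omega> - mem2 * s1 j \<omega>)^2 \<partial>M) / (real j)^2"
      by (simp add: d_def drift1_def drift2_def power_divide flip: diff_divide_distrib)
    also have "\<dots> \<le> Cd * real j / (real j)^2" by (intro divide_right_mono Cd) auto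
    also have "\<dots> = Cd / real j" using j by (simp add: power2_eq_square)
    finally show "(\<integral>\<omega>. (d j \<omega>)^2 \<partial>M) \<le> Cd / real j" .
  qed
  have Qi: "integrable M Q" unfolding Q_def[abs_def]
    by (intro Bochner_Integration.integrable_sum integrable_mult_right d2) auto
  have EQ: "(\<integral>\<omega>. Q \<omega> \<partial>M) \<le> 2 * Cd * sqrt (real (m q))"
  proof -
    have "(\<integral>\<omega>. Q \<omega> \<partial>M) = (\<Sum>j\<in>{0<..m q}. real j powr (1/2) * (\<integral>\<omega>. (d j \<omega>)^2 \<partial>M))"
      unfolding Q_def by (subst Bochner_Integration.integral_sum) (auto intro!: d2)
    also have "\<dots> \<le> (\<Sum>j\<in>{0<..m q}. Cd * real j powr (-1/2))"
    proof (rule sum_mono)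
      fix j assume j: "j \<in> {0<..m q}"
      have "real j powr (1/2) * (\<integral>\<omega>. (d j \<omega>)^2 \<partial>M) \<le> real j powr (1/2) * (Cd / real j)"
        using j by (intro mult_left_mono d2) auto
      also have "\<dots> = Cd * (real j powr (1/2) / real j powr 1)" using j by simp
      also have "real j powr (1/2) / real j powr 1 = real j powr (-1/2)" by (simp only: powr_diff[symmetric]) simp
      finally show "real j powr (1/2) * (\<integral>\<omega>. (d j \<omega>)^2 \<partial>M) \<le> Cd * real j powr (-1/2)" .
    qed
    also have "\<dots> = Cd * (\<Sum>j\<in>{0<..m q}. real j powr (-1/2))" by (simp only: sum_distrib_left)
    also have "\<dots> \<le> Cd * (2 * sqrt (real (m q)))" using sum_inverse_sqrt_shift_le[of 0 "m q"] Cd(1) by (intro mult_left_mono) auto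
    finally show ?thesis by simp
  qed
  have pR: "prob ?R \<le> 4 * Cd * sqrt (real l) * sqrt (real (m q)) / b^2"
  proof -
    have "prob ?R \<le> (\<integral>\<omega>. 2 * sqrt (real l) * Q \<omega> \<partial>M) / b^2"
      by (rule integral_Markov_inequality_measure[where A="{}"]) (use Qi Q0 b in auto)
    also have "\<dots> = 2 * sqrt (real l) * (\<integral>\<omega>. Q \<omega> \<partial>M) / b^2" by simp
    also have "\<dots> \<le> 2 * sqrt (real l) * (2 * Cd * sqrt (real (m q))) / b^2"
      by (intro divide_right_mono mult_left_mono EQ) auto
    finally show ?thesis by (simp add: mult_ac)
  qed
  have "prob {\<omega>\<in>space M. \<exists>k\<in>{1..m q}. \<bar>gap k \<omega>\<bar> \<ge> A} \<le> prob (?G \<union> ?R \<union> (\<Union>k\<in>{1..m q}. bad k))"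
    using G_ev R_ev bad_ev by (intro finite_measure_mono cover sets.Un sets.finite_UN) auto
  also have "\<dots> \<le> prob (?G \<union> ?R) + prob (\<Union>k\<in>{1..m q}. bad k)"
    using G_ev R_ev bad_ev by (intro measure_Un_le sets.Un sets.finite_UN) auto
  also have "prob (?G \<union> ?R) \<le> prob ?G + prob ?R" by (rule measure_Un_le[OF G_ev R_ev])
  finally show ?thesis using pR pB by linarith
qed

end

section \<open>Convergence in distribution on the extended half-line\<close>

text \<open>An embedding of \<open>[0, \<infinity>]\<close> into \<open>[0, 1]\<close>, which makes weak convergence of real distributions applicable.\<close>

definition squash :: "ennreal \<Rightarrow> real" where
  "squash y = (if y = \<top> then 1 else enn2real y / (1 + enn2real y))"

text \<open>The left inverse \<open>x / (1 - x)\<close>.  Truncation of negative arguments to \<open>0\<close> makes it continuous on the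
whole line, with value \<open>\<infinity>\<close> from \<open>1\<close> on.\<close>

definition unsquash :: "real \<Rightarrow> ennreal" where
  "unsquash x = ennreal x * inverse (ennreal (1 - x))"

lemma squash_ennreal: "0 \<le> r \<Longrightarrow> squash (ennreal r) = r / (1 + r)"
  by (simp add: squash_def)

lemma unsquash_squash: "unsquash (squash y) = y"
proof (cases y)
  case (real r)
  have e: "1 - r / (1 + r) = 1 / (1 + r)" using real by (simp add: field_simps)
  have "inverse (ennreal (1 / (1 + r))) = ennreal (1 + r)"
    using real by (subst inverse_ennreal) auto
  moreover have "ennreal (r / (1 + r)) * ennreal (1 + r) = ennreal r"
  proof -
    have "ennreal (r / (1 + r)) * ennreal (1 + r) = ennreal (r / (1 + r) * (1 + r))"
      using real by (intro ennreal_mult[symmetric]) auto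
    also have "r / (1 + r) * (1 + r) = r" using real by simp
    finally show ?thesis .
  qed
  moreover have "squash y = r / (1 + r)" using real by (simp add: squash_ennreal)
  ultimately show ?thesis using real by (simp only: unsquash_def e)
qed (simp add: squash_def unsquash_def)

lemma continuous_unsquash: "continuous_on UNIV unsquash"
  unfolding unsquash_def[abs_def] continuous_on_def
proof (intro ballI tendsto_mult_ennreal)
  fix x :: real
  have "continuous_on UNIV (\<lambda>x. ennreal x)" "continuous_on UNIV (\<lambda>x. inverse (ennreal (1 - x)))"
    by (intro continuous_on_inverse_ennreal continuous_on_ennreal continuous_intros)+
  then show "(ennreal \<longlongrightarrow> ennreal x) (at x within UNIV)"
    "((\<lambda>x. inverse (ennreal (1 - x))) \<longlongrightarrow> inverse (ennreal (1 - x))) (at x within UNIV)"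
    by (simp_all add: continuous_on_def)
  show "\<not> (ennreal x = 0 \<and> inverse (ennreal (1 - x)) = \<infinity> \<or> ennreal x = \<infinity> \<and> inverse (ennreal (1 - x)) = 0)"
    by (auto simp: ennreal_eq_0_iff)
qed

lemma squash_measurable [measurable]: "squash \<in> borel_measurable borel"
  unfolding squash_def[abs_def] by measurable

lemma squash_le_iff: "0 < x \<Longrightarrow> x < 1 \<Longrightarrow> squash y \<le> x \<longleftrightarrow> y \<le> ennreal (x / (1 - x))"
proof (cases y)
  case (real r)
  assume x: "0 < x" "x < 1"
  have "squash y \<le> x \<longleftrightarrow> r / (1 + r) \<le> x" using real by (simp add: squash_ennreal)
  also have "\<dots> \<longleftrightarrow> r \<le> x / (1 - x)" using real x by (simp add: field_simps)
  also have "\<dots> \<longleftrightarrow> y \<le> ennreal (x / (1 - x))" using real x by (simp add: ennreal_le_iff)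
  finally show ?thesis .
qed (simp add: squash_def top_unique)

lemma squash_le_1: "squash y \<le> 1"
  by (cases y) (auto simp: squash_def field_simps)

lemma squash_pos: "y \<noteq> 0 \<Longrightarrow> squash y > 0"
  by (cases y) (auto simp: squash_def ennreal_eq_0_iff)

text \<open>Distribution functions that are asymptotically sandwiched between values of the limiting one at
neighbouring times converge at its continuity points.  After squashing, the points \<open>x \<ge> 1\<close> are
trivial, and so are the points \<open>x \<le> 0\<close>, because neither side charges the value \<open>0\<close>.\<close>

lemma ennreal_convergence_from_cdf:
  fixes Y :: "nat \<Rightarrow> 'a \<Rightarrow> ennreal" and Z :: "'b \<Rightarrow> ennreal" and f :: "ennreal \<Rightarrow> real"
  assumes M: "prob_space M" and N: "prob_space N"
    and Y: "\<And>n. Y n \<in> borel_measurable M" and Z: "Z \<in> borel_measurable N"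
    and Y0: "\<And>n \<omega>. \<omega> \<in> space M \<Longrightarrow> Y n \<omega> \<noteq> 0" and Z0: "\<And>\<omega>. \<omega> \<in> space N \<Longrightarrow> Z \<omega> \<noteq> 0"
    and lower: "\<And>s t e. 0 < s \<Longrightarrow> s < t \<Longrightarrow> 0 < e \<Longrightarrow>
      eventually (\<lambda>n. measure N {\<omega>\<in>space N. Z \<omega> \<le> ennreal s} - e \<le> measure M {\<omega>\<in>space M. Y n \<omega> \<le> ennreal t}) sequentially"
    and upper: "\<And>t u e. 0 < t \<Longrightarrow> t < u \<Longrightarrow> 0 < e \<Longrightarrow>
      eventually (\<lambda>n. measure M {\<omega>\<in>space M. Y n \<omega> \<le> ennreal t} \<le> measure N {\<omega>\<in>space N. Z \<omega> \<le> ennreal u} + e) sequentially"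
    and f: "continuous_on UNIV f" "bounded (range f)"
  shows "(\<lambda>n. \<integral>\<omega>. f (Y n \<omega>) \<partial>M) \<longlonglongrightarrow> (\<integral>\<omega>. f (Z \<omega>) \<partial>N)"
proof -
  interpret M: prob_space M by fact
  interpret N: prob_space N by fact
  define \<mu> where "\<mu> n = distr M borel (\<lambda>\<omega>. squash (Y n \<omega>))" for n
  define \<nu> where "\<nu> = distr N borel (\<lambda>\<omega>. squash (Z \<omega>))"
  have hY: "(\<lambda>\<omega>. squash (Y n \<omega>)) \<in> borel_measurable M" for n by (rule measurable_compose[OF Y squash_measurable])
  have hZ: "(\<lambda>\<omega>. squash (Z \<omega>)) \<in> borel_measurable N" by (rule measurable_compose[OF Z squash_measurable])
  have \<mu>: "real_distribution (\<mu> n)" for n unfolding \<mu>_def by (rule M.real_distribution_distr[OF hY])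
  have \<nu>: "real_distribution \<nu>" unfolding \<nu>_def by (rule N.real_distribution_distr[OF hZ])
  have cdf\<mu>: "cdf (\<mu> n) x = measure M {\<omega>\<in>space M. squash (Y n \<omega>) \<le> x}" for n x
    unfolding cdf_def \<mu>_def by (subst measure_distr[OF hY]) (auto intro!: arg_cong[where f="measure M"])
  have cdf\<nu>: "cdf \<nu> x = measure N {\<omega>\<in>space N. squash (Z \<omega>) \<le> x}" for x
    unfolding cdf_def \<nu>_def by (subst measure_distr[OF hZ]) (auto intro!: arg_cong[where f="measure N"])
  have "weak_conv_m \<mu> \<nu>"
    unfolding weak_conv_m_def weak_conv_def
  proof (intro allI impI)
    fix x assume cont: "isCont (cdf \<nu>) x"
    consider "x \<le> 0" | "x \<ge> 1" | "0 < x" "x < 1" by linarith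
    then show "(\<lambda>n. cdf (\<mu> n) x) \<longlonglongrightarrow> cdf \<nu> x"
    proof cases
      case 1
      have "\<not> squash (Y n \<omega>) \<le> x" if "\<omega> \<in> space M" for n \<omega>
        using squash_pos[OF Y0[OF that, of n]] 1 by linarith
      then have e1: "{\<omega>\<in>space M. squash (Y n \<omega>) \<le> x} = {}" for n by blast
      have "\<not> squash (Z \<omega>) \<le> x" if "\<omega> \<in> space N" for \<omega>
        using squash_pos[OF Z0[OF that]] 1 by linarith
      then have e2: "{\<omega>\<in>space N. squash (Z \<omega>) \<le> x} = {}" by blast
      show ?thesis unfolding cdf\<mu> cdf\<nu> e1 e2 by simp
    next
      case 2
      then have "{\<omega>\<in>space M. squash (Y n \<omega>) \<le> x} = space M" for n using squash_le_1 by (auto intro: order_trans)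
      moreover have "{\<omega>\<in>space N. squash (Z \<omega>) \<le> x} = space N" using 2 squash_le_1 by (auto intro: order_trans)
      ultimately show ?thesis by (simp add: cdf\<mu> cdf\<nu> M.prob_space N.prob_space)
    next
      case 3
      have c\<mu>: "cdf (\<mu> n) y = measure M {\<omega>\<in>space M. Y n \<omega> \<le> ennreal (y / (1 - y))}" if "0 < y" "y < 1" for n y
        unfolding cdf\<mu> using squash_le_iff[OF that] by simp
      have c\<nu>: "cdf \<nu> y = measure N {\<omega>\<in>space N. Z \<omega> \<le> ennreal (y / (1 - y))}" if "0 < y" "y < 1" for y
        unfolding cdf\<nu> using squash_le_iff[OF that] by simp
      have mono: "y / (1 - y) < z / (1 - z)" if "0 < y" "y < z" "z < 1" for y z :: real
        using that by (simp add: field_simps)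
      show ?thesis
      proof (rule LIMSEQ_I)
        fix e :: real assume e: "e > 0"
        from cont[unfolded continuous_at_real_range, rule_format, of "e / 2"] e
        obtain d where d: "d > 0" "\<And>y. \<bar>y - x\<bar> < d \<Longrightarrow> \<bar>cdf \<nu> y - cdf \<nu> x\<bar> < e / 2" by auto
        \<comment> \<open>Small enough for continuity at \<open>x\<close> and for \<open>x \<plusminus> \<delta>\<close> to stay in \<open>(0, 1)\<close>.\<close>
        define \<delta> where "\<delta> = min (d / 2) (min (x / 2) ((1 - x) / 2))"
        have \<delta>0: "\<delta> > 0" using d(1) 3 by (simp add: \<delta>_def)
        have "\<delta> \<le> d / 2" unfolding \<delta>_def by (rule min.cobounded1)
        with d(1) have \<delta>d: "\<delta> < d" by simp
        have "\<delta> \<le> x / 2" unfolding \<delta>_def by (rule min.coboundedI2, rule min.cobounded1)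
        with 3(1) have \<delta>x: "\<delta> < x" by simp
        have "\<delta> \<le> (1 - x) / 2" unfolding \<delta>_def by (rule min.coboundedI2, rule min.cobounded2)
        with 3(2) have \<delta>1: "x + \<delta> < 1" by (simp add: field_simps)
        note \<delta> = \<delta>0 \<delta>d \<delta>x \<delta>1
        have s: "0 < x - \<delta>" "x - \<delta> < 1" "0 < x + \<delta>" using \<delta> 3 by auto
        have cl: "\<bar>cdf \<nu> (x - \<delta>) - cdf \<nu> x\<bar> < e / 2" "\<bar>cdf \<nu> (x + \<delta>) - cdf \<nu> x\<bar> < e / 2"
          using d(2)[of "x - \<delta>"] d(2)[of "x + \<delta>"] \<delta> by auto
        have ev: "eventually (\<lambda>n. cdf \<nu> (x - \<delta>) - e / 2 \<le> cdf (\<mu> n) x) sequentially"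
          "eventually (\<lambda>n. cdf (\<mu> n) x \<le> cdf \<nu> (x + \<delta>) + e / 2) sequentially"
          unfolding c\<mu>[OF 3] c\<nu>[OF s(1,2)] c\<nu>[OF s(3) \<delta>(4)]
          using e \<delta> 3 s by (intro lower upper mono divide_pos_pos; simp)+
        then have "eventually (\<lambda>n. norm (cdf (\<mu> n) x - cdf \<nu> x) < e) sequentially"
        proof eventually_elim
          case (elim n)
          then show ?case using cl unfolding real_norm_def by linarith
        qed
        then show "\<exists>n0. \<forall>n\<ge>n0. norm (cdf (\<mu> n) x - cdf \<nu> x) < e" by (simp add: eventually_sequentially)
      qed
    qed
  qed
  moreover obtain K where K: "\<And>y. norm (f y) \<le> K" using f(2) by (auto simp: bounded_iff)
  have fc: "continuous_on UNIV (\<lambda>x. f (unsquash x))"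
    by (rule continuous_on_compose2[OF f(1) continuous_unsquash]) auto
  then have fi: "isCont (\<lambda>x. f (unsquash x)) x" for x by (simp add: continuous_on_eq_continuous_at)
  have fm: "(\<lambda>x. f (unsquash x)) \<in> borel_measurable borel" by (rule borel_measurable_continuous_onI[OF fc])
  ultimately have "(\<lambda>n. \<integral>x. f (unsquash x) \<partial>\<mu> n) \<longlonglongrightarrow> (\<integral>x. f (unsquash x) \<partial>\<nu>)"
    by (intro weak_conv_imp_integral_bdd_continuous_conv[where B=K] \<mu> \<nu> fi K)
  moreover have "(\<integral>x. f (unsquash x) \<partial>\<mu> n) = (\<integral>\<omega>. f (Y n \<omega>) \<partial>M)" for n
    unfolding \<mu>_def by (subst integral_distr[OF hY fm]) (simp add: unsquash_squash)
  moreover have "(\<integral>x. f (unsquash x) \<partial>\<nu>) = (\<integral>\<omega>. f (Z \<omega>) \<partial>N)"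
    unfolding \<nu>_def by (subst integral_distr[OF hZ fm]) (simp add: unsquash_squash)
  ultimately show ?thesis by simp
qed

section \<open>The exit times\<close>

context interacting_erw
begin

lemma gap_walk_diff: "gap k \<omega> = real_of_int (walk_diff X1 X2 k \<omega>)"
  by (simp add: gap_def s1_def s2_def walk_diff_def)

lemma exit_index_measurable: "exit_index X1 X2 c \<in> borel_measurable M"
proof -
  have "exit_index X1 X2 c = (\<lambda>\<omega>. INF n. if 1 \<le> n \<and> \<bar>gap n \<omega>\<bar> \<ge> 2 * real c then of_nat n else \<top>)"
  proof (rule ext, rule antisym)
    fix \<omega>
    have c: "\<bar>walk_diff X1 X2 n \<omega>\<bar> \<ge> 2 * int c \<longleftrightarrow> \<bar>gap n \<omega>\<bar> \<ge> 2 * real c" for n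
      unfolding gap_walk_diff of_int_abs[symmetric] by (metis of_int_le_iff of_int_mult of_int_numeral of_int_of_nat_eq)
    show "exit_index X1 X2 c \<omega> \<le> (INF n. if 1 \<le> n \<and> \<bar>gap n \<omega>\<bar> \<ge> 2 * real c then of_nat n else \<top>)"
      unfolding exit_index_def c by (rule INF_greatest) (auto intro: Inf_lower)
    show "(INF n. if 1 \<le> n \<and> \<bar>gap n \<omega>\<bar> \<ge> 2 * real c then of_nat n else \<top>) \<le> exit_index X1 X2 c \<omega>"
      unfolding exit_index_def c
    proof (rule Inf_greatest)
      fix y :: ennreal assume "y \<in> {of_nat n | n. 1 \<le> n \<and> \<bar>gap n \<omega>\<bar> \<ge> 2 * real c}"
      then obtain n where "y = of_nat n" "1 \<le> n" "\<bar>gap n \<omega>\<bar> \<ge> 2 * real c" by auto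
      then show "(INF n. if 1 \<le> n \<and> \<bar>gap n \<omega>\<bar> \<ge> 2 * real c then of_nat n else \<top>) \<le> y"
        by (intro INF_lower2[of n]) auto
    qed
  qed
  also have "\<dots> \<in> borel_measurable M" by measurable
  finally show ?thesis .
qed

text \<open>The infimum is attained at the least admissible index; if there is none, it is \<open>\<infinity>\<close> and stays so after division.\<close>

lemma exit_index_le_iff:
  assumes c: "c \<ge> 1" and t: "t > 0"
  shows "exit_index X1 X2 c \<omega> / (of_nat c)\<^sup>2 \<le> ennreal t \<longleftrightarrow> (\<exists>k\<in>{1..nat \<lfloor>(real c)^2 * t\<rfloor>}. \<bar>gap k \<omega>\<bar> \<ge> 2 * real c)"
proof -
  have cw: "\<bar>walk_diff X1 X2 n \<omega>\<bar> \<ge> 2 * int c \<longleftrightarrow> \<bar>gap n \<omega>\<bar> \<ge> 2 * real c" for n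
    unfolding gap_walk_diff of_int_abs[symmetric] by (metis of_int_le_iff of_int_mult of_int_numeral of_int_of_nat_eq)
  define P where "P n \<longleftrightarrow> 1 \<le> n \<and> \<bar>gap n \<omega>\<bar> \<ge> 2 * real c" for n
  have E: "exit_index X1 X2 c \<omega> = Inf {of_nat n | n. P n}" unfolding exit_index_def cw P_def ..
  have c2: "(of_nat c :: ennreal)\<^sup>2 = ennreal ((real c)^2)" by (simp add: ennreal_of_nat_eq_real_of_nat ennreal_power)
  have c0: "(real c)^2 > 0" using c by simp
  show ?thesis
  proof (cases "\<exists>n. P n")
    case False
    then have "exit_index X1 X2 c \<omega> = \<top>" unfolding E by simp
    then have "exit_index X1 X2 c \<omega> / (of_nat c)\<^sup>2 = \<top>" unfolding c2 using c0 by (simp add: ennreal_top_divide)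
    moreover have "\<not> (\<exists>k\<in>{1..nat \<lfloor>(real c)^2 * t\<rfloor>}. \<bar>gap k \<omega>\<bar> \<ge> 2 * real c)" using False by (auto simp: P_def)
    ultimately show ?thesis by (simp add: top_unique)
  next
    case True
    define k where "k = (LEAST n. P n)"
    have Pk: "P k" unfolding k_def using True by (rule LeastI_ex)
    have kle: "k \<le> n" if "P n" for n unfolding k_def using that by (rule Least_le)
    have "exit_index X1 X2 c \<omega> = of_nat k" unfolding E
    proof (rule antisym)
      show "Inf {of_nat n | n. P n} \<le> (of_nat k :: ennreal)" using Pk by (intro Inf_lower) auto
      show "(of_nat k :: ennreal) \<le> Inf {of_nat n | n. P n}"
        by (rule Inf_greatest) (use kle in auto)
    qed
    then have "exit_index X1 X2 c \<omega> / (of_nat c)\<^sup>2 = ennreal (real k / (real c)^2)"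
      unfolding c2 using c0 by (simp add: ennreal_of_nat_eq_real_of_nat divide_ennreal)
    then have "exit_index X1 X2 c \<omega> / (of_nat c)\<^sup>2 \<le> ennreal t \<longleftrightarrow> real k \<le> (real c)^2 * t"
      using t c0 by (simp add: ennreal_le_iff pos_divide_le_eq mult.commute)
    also have "\<dots> \<longleftrightarrow> k \<le> nat \<lfloor>(real c)^2 * t\<rfloor>" using t by (simp add: le_nat_floor le_nat_iff le_floor_iff)
    also have "\<dots> \<longleftrightarrow> (\<exists>k\<in>{1..nat \<lfloor>(real c)^2 * t\<rfloor>}. \<bar>gap k \<omega>\<bar> \<ge> 2 * real c)"
    proof
      assume "k \<le> nat \<lfloor>(real c)^2 * t\<rfloor>"
      then show "\<exists>k\<in>{1..nat \<lfloor>(real c)^2 * t\<rfloor>}. \<bar>gap k \<omega>\<bar> \<ge> 2 * real c" using Pk by (intro bexI[of _ k]) (auto simp: P_def)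
    next
      assume "\<exists>k\<in>{1..nat \<lfloor>(real c)^2 * t\<rfloor>}. \<bar>gap k \<omega>\<bar> \<ge> 2 * real c"
      then obtain n where "P n" "n \<le> nat \<lfloor>(real c)^2 * t\<rfloor>" by (auto simp: P_def)
      with kle[of n] show "k \<le> nat \<lfloor>(real c)^2 * t\<rfloor>" by linarith
    qed
    finally show ?thesis .
  qed
qed

text \<open>Products of tents over \<open>J\<close> lie between the indicators of the absence of level crossings at level \<open>a\<close> and at
level \<open>b\<close>.  The gap between the two levels replaces continuity of the law of the maximum of \<open>|V|\<close>.\<close>

lemma finite_dimensional_limits:
  assumes L: "limit_process N mem1 mem2 V" and cs: "mem1 * mem2 < 1/4 \<or> (mem1 = mem2 \<and> mem1 \<in> {1/2..<1})"
    and J: "finite J" "J \<subseteq> {0<..}" and r: "\<And>n. r n \<ge> 1" "filterlim r at_top sequentially"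
    and ab: "0 < a" "a < b" and e: "e > 0"
  shows "eventually (\<lambda>n. measure N {\<omega>\<in>space N. \<exists>t\<in>J. \<bar>V t \<omega>\<bar> \<ge> b} - e
      \<le> prob {\<omega>\<in>space M. \<exists>t\<in>J. \<bar>gap (nat \<lfloor>(r n)^2 * t\<rfloor>) \<omega>\<bar> > a * r n}) sequentially"
    and "eventually (\<lambda>n. prob {\<omega>\<in>space M. \<exists>t\<in>J. \<bar>gap (nat \<lfloor>(r n)^2 * t\<rfloor>) \<omega>\<bar> \<ge> b * r n}
      \<le> measure N {\<omega>\<in>space N. \<exists>t\<in>J. \<bar>V t \<omega>\<bar> > a} + e) sequentially"
proof -
  interpret N: prob_space N using L by (simp add: limit_process_def)
  obtain \<rho> \<psi>1 \<psi>2 where \<rho>: "0 < \<rho>" "\<rho> < 1/2" and w: "memory_weight mem1 mem2 \<rho> \<psi>1 \<psi>2" and \<psi>: "\<psi>1 1 = 1" "\<psi>2 1 = -1"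
    and char: "\<And>J \<theta>. finite J \<Longrightarrow> J \<subseteq> {0<..} \<Longrightarrow> (\<integral>\<omega>. iexp (\<Sum>t\<in>J. \<theta> t * V t \<omega>) \<partial>N) =
       of_real (exp (- ((\<integral>s. indicator {0<..} s * ((kernel_sum J \<theta> \<psi>1 s)^2 + (kernel_sum J \<theta> \<psi>2 s)^2) \<partial>lborel) / 2)))"
    using limit_process_char[OF L cs] by blast
  have mu: "mem1 * mem2 < 1"
    using cs
  proof
    assume "mem1 = mem2 \<and> mem1 \<in> {1/2..<1}"
    then have m: "mem1 = mem2" "0 \<le> mem1" "mem1 < 1" by auto
    then have "mem1 * mem1 < 1 * 1" by (intro mult_strict_mono) auto
    then show ?thesis using m by simp
  qed simp
  have Jp: "\<And>t. t \<in> J \<Longrightarrow> t > 0" using J by auto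
  have r0: "r n > 0" for n using r(1)[of n] by linarith
  define Y where "Y n t \<omega> = gap (nat \<lfloor>(r n)^2 * t\<rfloor>) \<omega> / r n" for n t \<omega>
  \<comment> \<open>The difference of the walks is the direction \<open>\<psi>(1) = (1, -1)\<close>.\<close>
  have Ylin: "Y n t \<omega> = lin_stat \<psi>1 \<psi>2 (r n) t \<omega>" for n t \<omega>
    by (simp add: Y_def lin_stat_def \<psi> gap_def)
  have Ymeas [measurable]: "Y n t \<in> borel_measurable M" for n t unfolding Y_def[abs_def] by measurable
  have Vm: "V t \<in> borel_measurable N" if "t \<in> J" for t using L Jp[OF that] by (auto simp: limit_process_def)
  interpret char_convergence M N Y V J
  proof
    fix \<theta> :: "real \<Rightarrow> real"
    show "(\<lambda>n. \<integral>\<omega>. iexp (\<Sum>t\<in>J. \<theta> t * Y n t \<omega>) \<partial>M) \<longlonglongrightarrow> (\<integral>\<omega>. iexp (\<Sum>t\<in>J. \<theta> t * V t \<omega>) \<partial>N)"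
      unfolding char[OF J] Ylin by (rule lin_stat_char_converges[OF w \<rho> mu J(1) Jp r])
  qed (use J Vm Ymeas in auto)
  obtain C where C: "C \<ge> 0" "\<And>m. (\<integral>\<omega>. (\<psi>1 1 * s1 m \<omega> + \<psi>2 1 * s2 m \<omega>)^2 \<partial>M) \<le> C * real m"
    using diffusive_second_moment[OF w \<rho>] by blast
  \<comment> \<open>Second moments of the rescaled walks are bounded in \<open>n\<close>.\<close>
  have tight: "\<exists>L>0. \<forall>n. prob {\<omega>\<in>space M. \<bar>Y n t \<omega>\<bar> > L} \<le> \<eta>" if t: "t \<in> J" and \<eta>: "\<eta> > 0" for t \<eta>
  proof -
    define L where "L = sqrt ((C * t + 1) / \<eta>)"
    have Ct: "C * t + 1 > 0" using C(1) Jp[OF t] by (intro add_nonneg_pos mult_nonneg_nonneg) auto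
    have L0: "L > 0" unfolding L_def using Ct \<eta> by simp
    have "prob {\<omega>\<in>space M. \<bar>Y n t \<omega>\<bar> > L} \<le> \<eta>" for n
    proof -
      let ?m = "nat \<lfloor>(r n)^2 * t\<rfloor>"
      have int: "integrable M (\<lambda>\<omega>. (Y n t \<omega>)^2)"
      proof (rule integrable_bounded_rv)
        fix \<omega> assume om: "\<omega> \<in> space M"
        have "\<bar>gap ?m \<omega>\<bar> \<le> 2 * ?m" unfolding gap_def using abs_s_le[OF om, of ?m] by linarith
        then have "\<bar>Y n t \<omega>\<bar> \<le> 2 * ?m / r n" unfolding Y_def using r0[of n] by (simp add: abs_divide divide_right_mono)
        from power_mono[OF this, of 2] show "\<bar>(Y n t \<omega>)^2\<bar> \<le> (2 * ?m / r n)^2" by simp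
      qed measurable
      have "(\<integral>\<omega>. (Y n t \<omega>)^2 \<partial>M) = (\<integral>\<omega>. (\<psi>1 1 * s1 ?m \<omega> + \<psi>2 1 * s2 ?m \<omega>)^2 \<partial>M) / (r n)^2"
        by (simp add: Y_def gap_def \<psi> power_divide)
      also have "\<dots> \<le> C * real ?m / (r n)^2" by (intro divide_right_mono C) auto
      also have "\<dots> \<le> C * ((r n)^2 * t) / (r n)^2"
        using Jp[OF t] C(1) by (intro divide_right_mono mult_left_mono of_nat_floor) auto
      also have "\<dots> = C * t" using r0[of n] by simp
      finally have E: "(\<integral>\<omega>. (Y n t \<omega>)^2 \<partial>M) \<le> C * t" .
      have "prob {\<omega>\<in>space M. \<bar>Y n t \<omega>\<bar> > L} \<le> prob {\<omega>\<in>space M. \<bar>Y n t \<omega>\<bar> \<ge> L}"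
        by (intro finite_measure_mono) auto
      also have "\<dots> \<le> (\<integral>\<omega>. (Y n t \<omega>)^2 \<partial>M) / L^2" by (rule markov_square[OF Ymeas int L0])
      also have "\<dots> \<le> (C * t + 1) / L^2" using E by (intro divide_right_mono) auto
      also have "\<dots> = \<eta>" unfolding L_def using Ct \<eta> by simp
      finally show ?thesis .
    qed
    with L0 show ?thesis by blast
  qed
  have lim: "(\<lambda>n. \<integral>\<omega>. (\<Prod>t\<in>J. tent a b (Y n t \<omega>)) \<partial>M) \<longlonglongrightarrow> (\<integral>\<omega>. (\<Prod>t\<in>J. tent a b (V t \<omega>)) \<partial>N)"
    by (rule prod_even_converges[OF continuous_tent tent_bounds tent_abs tight])
  have prod01: "0 \<le> (\<Prod>t\<in>J. tent a b (y t))" "(\<Prod>t\<in>J. tent a b (y t)) \<le> 1" for y :: "real \<Rightarrow> real"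
    by (auto intro!: prod_nonneg prod_le_1 simp: tent_bounds)
  have prod_eq_1: "(\<Prod>t\<in>J. tent a b (y t)) = 1" if "\<not> (\<exists>t\<in>J. \<bar>y t\<bar> > a)" for y :: "real \<Rightarrow> real"
    by (intro prod.neutral ballI tent_eq_1 ab) (use that in force)
  have prod_eq_0: "(\<Prod>t\<in>J. tent a b (y t)) = 0" if "\<exists>t\<in>J. \<bar>y t\<bar> \<ge> b" for y :: "real \<Rightarrow> real"
    using that J(1) tent_eq_0[OF ab(2)] by (metis prod_zero)
  have YM: "(\<lambda>\<omega>. \<Prod>t\<in>J. tent a b (Y n t \<omega>)) \<in> borel_measurable M" for n
    by (rule borel_measurable_prod, rule measurable_compose[OF Ymeas tent_measurable])
  have VM: "(\<lambda>\<omega>. \<Prod>t\<in>J. tent a b (V t \<omega>)) \<in> borel_measurable N"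
    by (rule borel_measurable_prod, rule measurable_compose[OF Vm tent_measurable])
  have evY: "{\<omega>\<in>space M. \<exists>t\<in>J. \<bar>Y n t \<omega>\<bar> > x} \<in> events" "{\<omega>\<in>space M. \<exists>t\<in>J. \<bar>Y n t \<omega>\<bar> \<ge> x} \<in> events" for n x
    using J(1) by measurable
  have evV: "{\<omega>\<in>space N. \<exists>t\<in>J. \<bar>V t \<omega>\<bar> > x} \<in> N.events" "{\<omega>\<in>space N. \<exists>t\<in>J. \<bar>V t \<omega>\<bar> \<ge> x} \<in> N.events" for x
  proof -
    have "{\<omega>\<in>space N. \<exists>t\<in>J. \<bar>V t \<omega>\<bar> > x} = (\<Union>t\<in>J. {\<omega>\<in>space N. \<bar>V t \<omega>\<bar> > x})"
      "{\<omega>\<in>space N. \<exists>t\<in>J. \<bar>V t \<omega>\<bar> \<ge> x} = (\<Union>t\<in>J. {\<omega>\<in>space N. \<bar>V t \<omega>\<bar> \<ge> x})" by auto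
    moreover have "{\<omega>\<in>space N. \<bar>V t \<omega>\<bar> > x} \<in> N.events" "{\<omega>\<in>space N. \<bar>V t \<omega>\<bar> \<ge> x} \<in> N.events" if "t \<in> J" for t
      using Vm[OF that] by measurable
    ultimately show "{\<omega>\<in>space N. \<exists>t\<in>J. \<bar>V t \<omega>\<bar> > x} \<in> N.events" "{\<omega>\<in>space N. \<exists>t\<in>J. \<bar>V t \<omega>\<bar> \<ge> x} \<in> N.events"
      using J(1) by (simp_all add: sets.finite_UN)
  qed
  have sandwich: "measure P {\<omega>\<in>space P. \<exists>t\<in>J. \<bar>y t \<omega>\<bar> \<ge> b} \<le> 1 - (\<integral>\<omega>. (\<Prod>t\<in>J. tent a b (y t \<omega>)) \<partial>P) \<and>
     1 - (\<integral>\<omega>. (\<Prod>t\<in>J. tent a b (y t \<omega>)) \<partial>P) \<le> measure P {\<omega>\<in>space P. \<exists>t\<in>J. \<bar>y t \<omega>\<bar> > a}"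
    if P: "prob_space P" and m: "(\<lambda>\<omega>. \<Prod>t\<in>J. tent a b (y t \<omega>)) \<in> borel_measurable P"
      and A: "{\<omega>\<in>space P. \<exists>t\<in>J. \<bar>y t \<omega>\<bar> \<ge> b} \<in> sets P" and B: "{\<omega>\<in>space P. \<exists>t\<in>J. \<bar>y t \<omega>\<bar> > a} \<in> sets P"
    for P :: "'z measure" and y
  proof -
    interpret P: prob_space P by fact
    have i: "integrable P (\<lambda>\<omega>. \<Prod>t\<in>J. tent a b (y t \<omega>))"
      by (rule P.integrable_const_bound[where B=1, OF _ m]) (use prod01 in auto)
    have e: "1 - (\<integral>\<omega>. (\<Prod>t\<in>J. tent a b (y t \<omega>)) \<partial>P) = (\<integral>\<omega>. 1 - (\<Prod>t\<in>J. tent a b (y t \<omega>)) \<partial>P)"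
      using i by (simp add: P.prob_space)
    have iA: "integrable P (indicator {\<omega>\<in>space P. \<exists>t\<in>J. \<bar>y t \<omega>\<bar> \<ge> b} :: 'z \<Rightarrow> real)"
      "integrable P (indicator {\<omega>\<in>space P. \<exists>t\<in>J. \<bar>y t \<omega>\<bar> > a} :: 'z \<Rightarrow> real)"
      using A B by (auto simp: less_top[symmetric])
    have "measure P {\<omega>\<in>space P. \<exists>t\<in>J. \<bar>y t \<omega>\<bar> \<ge> b} = (\<integral>\<omega>. indicator {\<omega>\<in>space P. \<exists>t\<in>J. \<bar>y t \<omega>\<bar> \<ge> b} \<omega> \<partial>P)"
      using A by simp
    also have "\<dots> \<le> (\<integral>\<omega>. 1 - (\<Prod>t\<in>J. tent a b (y t \<omega>)) \<partial>P)"
    proof (rule integral_mono[OF iA(1)])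
      fix \<omega> assume "\<omega> \<in> space P"
      show "indicator {\<omega>\<in>space P. \<exists>t\<in>J. \<bar>y t \<omega>\<bar> \<ge> b} \<omega> \<le> 1 - (\<Prod>t\<in>J. tent a b (y t \<omega>))"
        using prod_eq_0[of "\<lambda>t. y t \<omega>"] prod01(2)[of "\<lambda>t. y t \<omega>"] by (auto simp: indicator_def)
    qed (use i in auto)
    finally have 1: "measure P {\<omega>\<in>space P. \<exists>t\<in>J. \<bar>y t \<omega>\<bar> \<ge> b} \<le> \<dots>" .
    have "(\<integral>\<omega>. 1 - (\<Prod>t\<in>J. tent a b (y t \<omega>)) \<partial>P) \<le> (\<integral>\<omega>. indicator {\<omega>\<in>space P. \<exists>t\<in>J. \<bar>y t \<omega>\<bar> > a} \<omega> \<partial>P)"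
    proof (rule integral_mono[OF _ iA(2)])
      fix \<omega> assume "\<omega> \<in> space P"
      then show "1 - (\<Prod>t\<in>J. tent a b (y t \<omega>)) \<le> indicator {\<omega>\<in>space P. \<exists>t\<in>J. \<bar>y t \<omega>\<bar> > a} \<omega>"
        using prod_eq_1[of "\<lambda>t. y t \<omega>"] prod01(1)[of "\<lambda>t. y t \<omega>"] by (auto simp: indicator_def)
    qed (use i in auto)
    also have "\<dots> = measure P {\<omega>\<in>space P. \<exists>t\<in>J. \<bar>y t \<omega>\<bar> > a}" using B by simp
    finally show ?thesis using 1 e by simp
  qed
  note sM = sandwich[OF prob_space_axioms YM evY(2) evY(1)] and sN = sandwich[OF N.prob_space_axioms VM evV(2) evV(1)]
  have YD: "\<bar>Y n t \<omega>\<bar> > x \<longleftrightarrow> \<bar>gap (nat \<lfloor>(r n)^2 * t\<rfloor>) \<omega>\<bar> > x * r n"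
    "\<bar>Y n t \<omega>\<bar> \<ge> x \<longleftrightarrow> \<bar>gap (nat \<lfloor>(r n)^2 * t\<rfloor>) \<omega>\<bar> \<ge> x * r n" for n t \<omega> x
    unfolding Y_def using r0[of n] by (simp_all add: abs_divide pos_less_divide_eq pos_le_divide_eq)
  have ev: "eventually (\<lambda>n. \<bar>(\<integral>\<omega>. (\<Prod>t\<in>J. tent a b (Y n t \<omega>)) \<partial>M) - (\<integral>\<omega>. (\<Prod>t\<in>J. tent a b (V t \<omega>)) \<partial>N)\<bar> < e) sequentially"
    using tendstoD[OF lim e] by (simp add: dist_real_def)
  show "eventually (\<lambda>n. measure N {\<omega>\<in>space N. \<exists>t\<in>J. \<bar>V t \<omega>\<bar> \<ge> b} - e
      \<le> prob {\<omega>\<in>space M. \<exists>t\<in>J. \<bar>gap (nat \<lfloor>(r n)^2 * t\<rfloor>) \<omega>\<bar> > a * r n}) sequentially"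
    using ev
  proof eventually_elim
    case (elim n)
    then show ?case using sM[of n] sN unfolding YD by linarith
  qed
  show "eventually (\<lambda>n. prob {\<omega>\<in>space M. \<exists>t\<in>J. \<bar>gap (nat \<lfloor>(r n)^2 * t\<rfloor>) \<omega>\<bar> \<ge> b * r n}
      \<le> measure N {\<omega>\<in>space N. \<exists>t\<in>J. \<bar>V t \<omega>\<bar> > a} + e) sequentially"
    using ev
  proof eventually_elim
    case (elim n)
    then show ?case using sM[of n] sN unfolding YD by linarith
  qed
qed

end

lemma exit_time_le_witness:
  assumes "exit_time V \<omega> \<le> ennreal s" "0 < s" "s < u"
  obtains t where "0 < t" "t < u" "\<bar>V t \<omega>\<bar> \<ge> 2"
proof -
  have "exit_time V \<omega> < ennreal u" using assms by (simp add: order.strict_trans1 ennreal_less_iff)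
  then obtain y where "y \<in> {ennreal t | t. t > 0 \<and> \<bar>V t \<omega>\<bar> \<ge> 2}" "y < ennreal u"
    unfolding exit_time_def by (auto simp: Inf_less_iff)
  then obtain t where "t > 0" "\<bar>V t \<omega>\<bar> \<ge> 2" "ennreal t < ennreal u" by auto
  then show ?thesis using that by (simp add: ennreal_less_iff)
qed

lemma exit_time_leI: "0 < t \<Longrightarrow> \<bar>V t \<omega>\<bar> \<ge> 2 \<Longrightarrow> t \<le> u \<Longrightarrow> exit_time V \<omega> \<le> ennreal u"
  unfolding exit_time_def by (rule Inf_lower2[of "ennreal t"]) (auto intro: ennreal_leI)

lemma rational_near_level_crossing:
  fixes v :: "real \<Rightarrow> real"
  assumes cont: "continuous_on {0..} v" and t: "0 < t" "t < u" and lev: "b < \<bar>v t\<bar>"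
  obtains q where "q \<in> \<rat>" "0 < q" "q < u" "b < \<bar>v q\<bar>"
proof -
  have "continuous_on {0<..<u} (\<lambda>s. \<bar>v s\<bar>)"
    by (intro continuous_on_rabs continuous_on_subset[OF cont]) auto
  then have "open ((\<lambda>s. \<bar>v s\<bar>) -` {b<..} \<inter> {0<..<u})"
    by (subst (asm) continuous_on_open_vimage) auto
  moreover have "t \<in> (\<lambda>s. \<bar>v s\<bar>) -` {b<..} \<inter> {0<..<u}" using t lev by simp
  ultimately obtain e where e: "e > 0" "\<And>s. \<bar>s - t\<bar> < e \<Longrightarrow> s \<in> (\<lambda>s. \<bar>v s\<bar>) -` {b<..} \<inter> {0<..<u}"
    unfolding open_dist dist_real_def by blast
  obtain q where q: "q \<in> \<rat>" "t < q" "q < t + e" using Rats_dense_in_real[of t "t + e"] e(1) by auto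
  have "q \<in> (\<lambda>s. \<bar>v s\<bar>) -` {b<..} \<inter> {0<..<u}" by (rule e(2)) (use q in auto)
  then show ?thesis using that q(1) by auto
qed

text \<open>By continuity \<open>\<tau> < y\<close> holds iff for some rational \<open>r < y\<close> the levels \<open>2 - 1/k\<close> are all exceeded at
rational times before \<open>r\<close>: the supremum of \<open>|V|\<close> over \<open>[0, r]\<close> is attained.\<close>

lemma exit_time_measurable:
  assumes V: "\<And>t. t \<ge> 0 \<Longrightarrow> V t \<in> borel_measurable N"
    and path: "\<And>\<omega>. \<omega> \<in> space N \<Longrightarrow> V 0 \<omega> = 0 \<and> continuous_on {0..} (\<lambda>t. V t \<omega>)"
  shows "exit_time V \<in> borel_measurable N"
proof (rule borel_measurableI_less)
  fix y :: ennreal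
  define R where "R = {r. r \<in> \<rat> \<and> 0 < r \<and> ennreal r < y}"
  define S where "S r = {q. q \<in> \<rat> \<and> 0 < q \<and> q < r}" for r :: real
  have cR: "countable R" "countable (S r)" for r
    unfolding R_def S_def by (rule countable_subset[OF _ countable_rat]; auto)+
  have iff: "exit_time V \<omega> < y \<longleftrightarrow> (\<exists>r\<in>R. \<forall>k::nat. \<exists>q\<in>S r. \<bar>V q \<omega>\<bar> > 2 - 1 / real (Suc k))" if w: "\<omega> \<in> space N" for \<omega>
  proof
    assume "exit_time V \<omega> < y"
    then obtain t where t: "t > 0" "\<bar>V t \<omega>\<bar> \<ge> 2" "ennreal t < y"
      unfolding exit_time_def by (auto simp: Inf_less_iff)
    obtain r where r: "r \<in> \<rat>" "t < r" "ennreal r < y"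
    proof (cases y)
      case (real y')
      then have "t < y'" using t by (simp add: ennreal_less_iff)
      then obtain r where "r \<in> \<rat>" "t < r" "r < y'" using Rats_dense_in_real by blast
      then show ?thesis using that real t by (simp add: ennreal_less_iff)
    next
      case top
      obtain r where "r \<in> \<rat>" "t < r" using Rats_dense_in_real[of t "t + 1"] by auto
      then show ?thesis using that top by simp
    qed
    have "\<exists>q\<in>S r. \<bar>V q \<omega>\<bar> > 2 - 1 / real (Suc k)" for k
    proof -
      have "2 - 1 / real (Suc k) < \<bar>V t \<omega>\<bar>" using t(2) by (rule less_le_trans[rotated]) simp
      from rational_near_level_crossing[OF conjunct2[OF path[OF w]] t(1) r(2) this]
      show ?thesis by (auto simp: S_def)
    qed
    then show "\<exists>r\<in>R. \<forall>k::nat. \<exists>q\<in>S r. \<bar>V q \<omega>\<bar> > 2 - 1 / real (Suc k)"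
      using r t(1) by (intro bexI[of _ r]) (auto simp: R_def)
  next
    assume "\<exists>r\<in>R. \<forall>k::nat. \<exists>q\<in>S r. \<bar>V q \<omega>\<bar> > 2 - 1 / real (Suc k)"
    then obtain r where r: "r > 0" "ennreal r < y" "\<And>k::nat. \<exists>q\<in>S r. \<bar>V q \<omega>\<bar> > 2 - 1 / real (Suc k)" by (auto simp: R_def)
    have "continuous_on {0..r} (\<lambda>t. \<bar>V t \<omega>\<bar>)"
      using path[OF w] by (intro continuous_on_rabs) (auto intro: continuous_on_subset)
    from continuous_attains_sup[OF compact_Icc _ this] r(1)
    obtain t where t: "t \<in> {0..r}" "\<And>s. s \<in> {0..r} \<Longrightarrow> \<bar>V s \<omega>\<bar> \<le> \<bar>V t \<omega>\<bar>" by auto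
    have "2 - 1 / real (Suc k) \<le> \<bar>V t \<omega>\<bar>" for k
    proof -
      obtain q where "q \<in> S r" "\<bar>V q \<omega>\<bar> > 2 - 1 / real (Suc k)" using r(3) by blast
      then show ?thesis using t(2)[of q] by (auto simp: S_def)
    qed
    moreover have "(\<lambda>k. 2 - 1 / real (Suc k)) \<longlonglongrightarrow> 2 - 0"
      by (intro tendsto_diff tendsto_const LIMSEQ_Suc lim_1_over_n)
    ultimately have "2 - 0 \<le> \<bar>V t \<omega>\<bar>" by (intro LIMSEQ_le_const2) auto
    moreover then have "t \<noteq> 0" using path[OF w] by auto
    ultimately have "exit_time V \<omega> \<le> ennreal r" using t(1) by (intro exit_time_leI[of t]) auto
    then show "exit_time V \<omega> < y" using r(2) by (rule order.strict_trans1)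
  qed
  have "{\<omega>\<in>space N. exit_time V \<omega> < y} = {\<omega>\<in>space N. \<exists>r\<in>R. \<forall>k::nat. \<exists>q\<in>S r. \<bar>V q \<omega>\<bar> > 2 - 1 / real (Suc k)}"
    using iff by blast
  also have "\<dots> \<in> sets N"
  proof (rule sets.sets_Collect_countable_Ex'[OF _ cR(1)], rule sets.sets_Collect_countable_All, rule sets.sets_Collect_countable_Ex'[OF _ cR(2)])
    fix r q k assume "q \<in> S r"
    then have "V q \<in> borel_measurable N" by (intro V) (simp add: S_def)
    then show "{\<omega>\<in>space N. \<bar>V q \<omega>\<bar> > 2 - 1 / real (Suc k)} \<in> sets N" by measurable
  qed
  finally show "{\<omega>\<in>space N. exit_time V \<omega> < y} \<in> sets N" .
qed

lemma exit_time_pos: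
  assumes "V 0 \<omega> = 0" "continuous_on {0..} (\<lambda>t. V t \<omega>)"
  shows "exit_time V \<omega> \<noteq> 0"
proof -
  have "((\<lambda>t. V t \<omega>) \<longlongrightarrow> V 0 \<omega>) (at 0 within {0..})" using assms(2) by (auto simp: continuous_on_def)
  from tendstoD[OF this, of 2] obtain d where d: "d > 0" "\<And>t. 0 \<le> t \<Longrightarrow> t < d \<Longrightarrow> t \<noteq> 0 \<Longrightarrow> \<bar>V t \<omega>\<bar> < 2"
    unfolding eventually_at by (auto simp: dist_real_def assms(1))
  have "ennreal d \<le> exit_time V \<omega>" unfolding exit_time_def
  proof (rule Inf_greatest)
    fix y assume "y \<in> {ennreal t | t. t > 0 \<and> \<bar>V t \<omega>\<bar> \<ge> 2}"
    then obtain t where t: "y = ennreal t" "t > 0" "\<bar>V t \<omega>\<bar> \<ge> 2" by auto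
    then have "d \<le> t" using d(2)[of t] by fastforce
    then show "ennreal d \<le> y" using t by (simp add: ennreal_leI)
  qed
  then show ?thesis using d(1) by auto
qed

context interacting_erw
begin

text \<open>The limit theorem is applied along \<open>r = \<kappa> c\<close>; the shift by \<open>c0\<close> makes \<open>r \<ge> 1\<close> from the start.\<close>

lemma scaled_sequence:
  assumes "\<kappa> > 0"
  obtains c0 :: nat where "c0 \<ge> 1" "\<And>n. \<kappa> * real (n + c0) \<ge> 1" "filterlim (\<lambda>n. \<kappa> * real (n + c0)) at_top sequentially"
proof -
  define c0 where "c0 = Suc (nat \<lceil>1 / \<kappa>\<rceil>)"
  have c: "real c0 \<ge> 1 / \<kappa>" unfolding c0_def using real_nat_ceiling_ge[of "1 / \<kappa>"] by linarith
  show ?thesis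
  proof (rule that[of c0])
    show "c0 \<ge> 1" by (simp add: c0_def)
    fix n
    have "1 / \<kappa> \<le> real (n + c0)" using c by simp
    then show "\<kappa> * real (n + c0) \<ge> 1" using assms by (simp add: field_simps)
  next
    have "filterlim (\<lambda>n. real (n + c0)) at_top sequentially"
      by (rule filterlim_compose[OF filterlim_real_sequentially filterlim_add_const_nat_at_top])
    then show "filterlim (\<lambda>n. \<kappa> * real (n + c0)) at_top sequentially"
      using assms by (intro filterlim_tendsto_pos_mult_at_top[OF tendsto_const])
  qed
qed

text \<open>If \<open>V\<close> exits before \<open>s < u\<close> then by continuity it exceeds any level \<open>b < 2\<close> at a rational time before \<open>u\<close>, hence
with almost the same probability at one of finitely many such times.  At scale \<open>r = \<kappa> c\<close>,
\<open>\<kappa>\<^sup>2 = t/u > 1\<close>, the time \<open>u\<close> corresponds to \<open>c\<^sup>2 t\<close> and the level \<open>2 c\<close> to \<open>2/\<kappa>\<close>, which is below \<open>2\<close> and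
leaves room for \<open>b\<close>.\<close>

lemma passage_lower:
  assumes L: "limit_process N mem1 mem2 V" and cs: "mem1 * mem2 < 1/4 \<or> (mem1 = mem2 \<and> mem1 \<in> {1/2..<1})"
    and s: "0 < s" "s < t" and e: "e > 0"
  shows "eventually (\<lambda>c. measure N {\<omega>\<in>space N. exit_time V \<omega> \<le> ennreal s} - e
      \<le> prob {\<omega>\<in>space M. exit_index X1 X2 c \<omega> / (of_nat c)\<^sup>2 \<le> ennreal t}) sequentially"
proof -
  interpret N: prob_space N using L by (simp add: limit_process_def)
  have Vm: "V t \<in> borel_measurable N" if "t \<ge> 0" for t using L that by (simp add: limit_process_def)
  have path: "V 0 \<omega> = 0 \<and> continuous_on {0..} (\<lambda>t. V t \<omega>)" if "\<omega> \<in> space N" for \<omega> using L that by (simp add: limit_process_def)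
  define u where "u = (s + t) / 2"
  have u: "s < u" "u < t" "0 < u" using s by (auto simp: u_def)
  define \<kappa> where "\<kappa> = sqrt (t / u)"
  have \<kappa>2: "\<kappa>^2 = t / u" using u s by (simp add: \<kappa>_def)
  have \<kappa>1: "\<kappa> > 1" unfolding \<kappa>_def using u by simp
  \<comment> \<open>The midpoint of \<open>2/\<kappa>\<close> and \<open>2\<close>.\<close>
  define b where "b = 1 + 1 / \<kappa>"
  have b: "0 < 2 / \<kappa>" "2 / \<kappa> < b" "b < 2" using \<kappa>1 by (auto simp: b_def field_simps)
  obtain c0 where c0: "c0 \<ge> 1" "\<And>n. \<kappa> * real (n + c0) \<ge> 1" "filterlim (\<lambda>n. \<kappa> * real (n + c0)) at_top sequentially"
    using scaled_sequence[of \<kappa>] \<kappa>1 by auto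
  define S where "S = {q. q \<in> \<rat> \<and> 0 < q \<and> q < u}"
  have cS: "countable S" unfolding S_def by (rule countable_subset[OF _ countable_rat]) auto
  obtain q0 where "q0 \<in> S" using Rats_dense_in_real[OF u(3)] by (auto simp: S_def)
  then have S0: "S \<noteq> {}" by auto
  \<comment> \<open>Finite sets increasing to the rational times before \<open>u\<close>.\<close>
  define Js where "Js i = from_nat_into S ` {..i}" for i :: nat
  have JsS: "Js i \<subseteq> S" for i unfolding Js_def using from_nat_into[OF S0] by auto
  have SJs: "(\<Union>i. Js i) = S"
  proof
    show "(\<Union>i. Js i) \<subseteq> S" using JsS by auto
    show "S \<subseteq> (\<Union>i. Js i)"
    proof
      fix q assume "q \<in> S"
      then obtain i where "from_nat_into S i = q" using from_nat_into_surj[OF cS] by blast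
      then show "q \<in> (\<Union>i. Js i)" by (auto simp: Js_def)
    qed
  qed
  let ?E = "\<lambda>i. {\<omega>\<in>space N. \<exists>t\<in>Js i. \<bar>V t \<omega>\<bar> \<ge> b}"
  have Eev: "?E i \<in> N.events" for i
  proof -
    have "?E i = (\<Union>t\<in>Js i. {\<omega>\<in>space N. \<bar>V t \<omega>\<bar> \<ge> b})" by auto
    moreover have "{\<omega>\<in>space N. \<bar>V t \<omega>\<bar> \<ge> b} \<in> N.events" if "t \<in> Js i" for t
    proof -
      have [measurable]: "V t \<in> borel_measurable N" by (rule Vm) (use that JsS[of i] in \<open>auto simp: S_def\<close>)
      show ?thesis by measurable
    qed
    ultimately show ?thesis by (simp add: sets.finite_UN Js_def)
  qed
  have "(\<lambda>i. N.prob (?E i)) \<longlonglongrightarrow> N.prob (\<Union>i. ?E i)"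
    by (rule N.finite_Lim_measure_incseq) (use Eev in \<open>auto simp: incseq_def Js_def intro: order_trans\<close>)
  moreover have sub: "{\<omega>\<in>space N. exit_time V \<omega> \<le> ennreal s} \<subseteq> (\<Union>i. ?E i)"
  proof
    fix \<omega> assume "\<omega> \<in> {\<omega>\<in>space N. exit_time V \<omega> \<le> ennreal s}"
    then have w: "\<omega> \<in> space N" "exit_time V \<omega> \<le> ennreal s" by auto
    obtain t where t: "0 < t" "t < u" "\<bar>V t \<omega>\<bar> \<ge> 2" using exit_time_le_witness[OF w(2) s(1) u(1)] by blast
    then have "b < \<bar>V t \<omega>\<bar>" using b by linarith
    from rational_near_level_crossing[OF conjunct2[OF path[OF w(1)]] t(1,2) this]
    obtain q where q: "q \<in> S" "b < \<bar>V q \<omega>\<bar>" by (auto simp: S_def)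
    then obtain i where "q \<in> Js i" using SJs by blast
    then show "\<omega> \<in> (\<Union>i. ?E i)" using w q by (auto intro: less_imp_le)
  qed
  moreover have "N.prob {\<omega>\<in>space N. exit_time V \<omega> \<le> ennreal s} \<le> N.prob (\<Union>i. ?E i)"
    using Eev by (intro N.finite_measure_mono sub) auto
  ultimately have "eventually (\<lambda>i. N.prob {\<omega>\<in>space N. exit_time V \<omega> \<le> ennreal s} - e / 2 < N.prob (?E i)) sequentially"
    using e by (intro order_tendstoD(1)) auto
  then obtain i where i: "N.prob {\<omega>\<in>space N. exit_time V \<omega> \<le> ennreal s} - e / 2 < N.prob (?E i)"
    by (auto simp: eventually_sequentially)
  have J: "finite (Js i)" "Js i \<subseteq> {0<..}" using JsS[of i] by (auto simp: Js_def S_def)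
  define r where "r n = \<kappa> * real (n + c0)" for n
  have "eventually (\<lambda>n. N.prob (?E i) - e / 2 \<le> prob {\<omega>\<in>space M. \<exists>t\<in>Js i. \<bar>gap (nat \<lfloor>(r n)^2 * t\<rfloor>) \<omega>\<bar> > 2 / \<kappa> * r n}) sequentially"
    by (rule finite_dimensional_limits(1)[OF L cs J _ _ b(1,2)]) (use c0 e in \<open>auto simp: r_def\<close>)
  then have "eventually (\<lambda>n. N.prob {\<omega>\<in>space N. exit_time V \<omega> \<le> ennreal s} - e
      \<le> prob {\<omega>\<in>space M. exit_index X1 X2 (n + c0) \<omega> / (of_nat (n + c0))\<^sup>2 \<le> ennreal t}) sequentially"
  proof eventually_elim
    case (elim n)
    have c1: "n + c0 \<ge> 1" using c0(1) by simp
    have t0: "0 < t" using s by simp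
    have lev: "2 / \<kappa> * r n = 2 * real (n + c0)" using \<kappa>1 by (simp add: r_def)
    have time: "(r n)^2 * q \<le> (real (n + c0))^2 * t" if "q \<in> Js i" for q
    proof -
      have "(r n)^2 * q \<le> (r n)^2 * u" using that JsS[of i] by (intro mult_left_mono) (auto simp: S_def)
      also have "\<dots> = (real (n + c0))^2 * t" using u by (simp add: r_def power_mult_distrib \<kappa>2)
      finally show ?thesis .
    qed
    have "{\<omega>\<in>space M. \<exists>t\<in>Js i. \<bar>gap (nat \<lfloor>(r n)^2 * t\<rfloor>) \<omega>\<bar> > 2 / \<kappa> * r n}
      \<subseteq> {\<omega>\<in>space M. exit_index X1 X2 (n + c0) \<omega> / (of_nat (n + c0))\<^sup>2 \<le> ennreal t}"
    proof
      fix \<omega> assume "\<omega> \<in> {\<omega>\<in>space M. \<exists>t\<in>Js i. \<bar>gap (nat \<lfloor>(r n)^2 * t\<rfloor>) \<omega>\<bar> > 2 / \<kappa> * r n}"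
      then obtain q where w: "\<omega> \<in> space M" and q: "q \<in> Js i" "\<bar>gap (nat \<lfloor>(r n)^2 * q\<rfloor>) \<omega>\<bar> > 2 * real (n + c0)"
        unfolding lev by auto
      let ?k = "nat \<lfloor>(r n)^2 * q\<rfloor>"
      have "1 \<le> ?k"
      proof (rule ccontr)
        assume "\<not> 1 \<le> ?k"
        then have "?k = 0" by linarith
        then have "gap ?k \<omega> = 0" by (simp only: gap_def s1_def s2_def walk_def) simp
        then show False using q(2) by simp
      qed
      moreover have "?k \<le> nat \<lfloor>(real (n + c0))^2 * t\<rfloor>" using time[OF q(1)] by (intro nat_mono floor_mono)
      ultimately have "\<exists>k\<in>{1..nat \<lfloor>(real (n + c0))^2 * t\<rfloor>}. \<bar>gap k \<omega>\<bar> \<ge> 2 * real (n + c0)"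
        using q(2) by (intro bexI[of _ ?k]) (linarith | simp only: atLeastAtMost_iff simp_thms)+
      then show "\<omega> \<in> {\<omega>\<in>space M. exit_index X1 X2 (n + c0) \<omega> / (of_nat (n + c0))\<^sup>2 \<le> ennreal t}"
        using w exit_index_le_iff[OF c1 t0, of \<omega>] by blast
    qed
    moreover have "{\<omega>\<in>space M. exit_index X1 X2 (n + c0) \<omega> / (of_nat (n + c0))\<^sup>2 \<le> ennreal t} \<in> events"
      using exit_index_measurable[of "n + c0"] by measurable
    ultimately have "prob {\<omega>\<in>space M. \<exists>t\<in>Js i. \<bar>gap (nat \<lfloor>(r n)^2 * t\<rfloor>) \<omega>\<bar> > 2 / \<kappa> * r n}
      \<le> prob {\<omega>\<in>space M. exit_index X1 X2 (n + c0) \<omega> / (of_nat (n + c0))\<^sup>2 \<le> ennreal t}"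
      by (rule finite_measure_mono)
    then show ?case using elim i by linarith
  qed
  then show ?thesis by (rule eventually_sequentially_seg[THEN iffD1])
qed

text \<open>At scale \<open>r = \<kappa> c\<close>, \<open>\<kappa>\<^sup>2 = t/u < 1\<close>, the time \<open>c\<^sup>2 t\<close> corresponds to \<open>u\<close> and the level \<open>2 c\<close> to \<open>2/\<kappa> > 2\<close>.  So a
level still above \<open>2\<close> is left after the loss at the next grid point, and the mesh \<open>h\<close> of the grid can be
chosen so small that the error does not exceed \<open>e/2\<close>.\<close>

lemma passage_upper:
  assumes L: "limit_process N mem1 mem2 V" and cs: "mem1 * mem2 < 1/4 \<or> (mem1 = mem2 \<and> mem1 \<in> {1/2..<1})"
    and t: "0 < t" "t < u" and e: "e > 0"
  shows "eventually (\<lambda>c. prob {\<omega>\<in>space M. exit_index X1 X2 c \<omega> / (of_nat c)\<^sup>2 \<le> ennreal t}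
      \<le> measure N {\<omega>\<in>space N. exit_time V \<omega> \<le> ennreal u} + e) sequentially"
proof -
  interpret N: prob_space N using L by (simp add: limit_process_def)
  have Vm: "V t \<in> borel_measurable N" if "t \<ge> 0" for t using L that by (simp add: limit_process_def)
  have path: "V 0 \<omega> = 0 \<and> continuous_on {0..} (\<lambda>t. V t \<omega>)" if "\<omega> \<in> space N" for \<omega> using L that by (simp add: limit_process_def)
  have tau [measurable]: "exit_time V \<in> borel_measurable N" by (rule exit_time_measurable[OF Vm path])
  obtain \<rho> \<psi>1 \<psi>2 where \<rho>: "0 < \<rho>" "\<rho> < 1/2" and w: "memory_weight mem1 mem2 \<rho> \<psi>1 \<psi>2" and \<psi>: "\<psi>1 1 = 1" "\<psi>2 1 = -1"
    using limit_process_char[OF L cs] by metis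
  \<comment> \<open>The drift of the difference of the walks is the weight \<open>\<psi> A\<close>, hence diffusive as well, even where the walks themselves are not.\<close>
  obtain Cd where Cd: "Cd \<ge> 0" "\<And>m. (\<integral>\<omega>. (mem1 * s2 m \<omega> - mem2 * s1 m \<omega>)^2 \<partial>M) \<le> Cd * real m"
  proof -
    obtain C where C: "C \<ge> 0" "\<And>m. (\<integral>\<omega>. ((mem2 * \<psi>2 1) * s1 m \<omega> + (mem1 * \<psi>1 1) * s2 m \<omega>)^2 \<partial>M) \<le> C * real m"
      using diffusive_second_moment[OF memory_weight_drift[OF w] \<rho>] by blast
    have "(mem2 * \<psi>2 1) * s1 m \<omega> + (mem1 * \<psi>1 1) * s2 m \<omega> = mem1 * s2 m \<omega> - mem2 * s1 m \<omega>" for m \<omega>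
      by (simp add: \<psi>)
    with C show ?thesis using that by simp
  qed
  define \<kappa> where "\<kappa> = sqrt (t / u)"
  have u0: "u > 0" using t by simp
  have \<kappa>2: "\<kappa>^2 = t / u" using u0 t by (simp add: \<kappa>_def)
  have \<kappa>0: "\<kappa> > 0" unfolding \<kappa>_def using t u0 by simp
  have \<kappa>1: "\<kappa> < 1" unfolding \<kappa>_def using t by simp
  \<comment> \<open>Half of the gap between \<open>2/\<kappa>\<close> and \<open>2\<close> is given up at the next grid point.\<close>
  define \<beta> where "\<beta> = (2 / \<kappa> - 2) / 4"
  have "2 / \<kappa> > 2" using \<kappa>0 \<kappa>1 by (simp add: field_simps)
  then have \<beta>: "\<beta> > 0" "2 < 2 / \<kappa> - 2 * \<beta>" by (auto simp: \<beta>_def field_simps)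
  obtain c0 where c0: "c0 \<ge> 1" "\<And>n. \<kappa> * real (n + c0) \<ge> 1" "filterlim (\<lambda>n. \<kappa> * real (n + c0)) at_top sequentially"
    using scaled_sequence[OF \<kappa>0] by auto
  \<comment> \<open>The error of the grid estimate at mesh \<open>h\<close>, uniform in the scale \<open>r\<close>.\<close>
  define err where "err h = 4 * h / \<beta>^2 + 4 * Cd * sqrt (2 * h * u) / \<beta>^2" for h
  have "(\<lambda>q. err (u / real q)) \<longlonglongrightarrow> 4 * 0 / \<beta>^2 + 4 * Cd * sqrt (2 * 0 * u) / \<beta>^2"
    unfolding err_def using \<beta> by (intro tendsto_intros lim_const_over_n) auto
  then have "(\<lambda>q. err (u / real q)) \<longlonglongrightarrow> 0" by simp
  then have "eventually (\<lambda>q. err (u / real q) < e / 2) sequentially" using e by (intro order_tendstoD(2)) auto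
  then have "eventually (\<lambda>q. err (u / real q) < e / 2 \<and> q \<ge> 1) sequentially" using eventually_ge_at_top[of 1] by (rule eventually_conj)
  then obtain q where q: "err (u / real q) < e / 2" "q \<ge> 1" by (auto simp: eventually_sequentially)
  define h where "h = u / real q"
  have h: "h > 0" "h * real q = u" "err h < e / 2" using q u0 by (auto simp: h_def)
  define J where "J = (\<lambda>i. h * real i) ` {1..q}"
  have J: "finite J" "J \<subseteq> {0<..}" "\<And>x. x \<in> J \<Longrightarrow> 0 < x \<and> x \<le> u"
  proof -
    show "finite J" "J \<subseteq> {0<..}" using h(1) by (auto simp: J_def)
    fix x assume "x \<in> J"
    then obtain i where i: "i \<in> {1..q}" "x = h * real i" by (auto simp: J_def)
    then have "h * real i \<le> h * real q" using h(1) by (intro mult_left_mono) auto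
    then show "0 < x \<and> x \<le> u" using i h by simp
  qed
  define r where "r n = \<kappa> * real (n + c0)" for n
  have r1: "r n \<ge> 1" for n unfolding r_def by (rule c0(2))
  have rinf: "filterlim r at_top sequentially" unfolding r_def[abs_def] by (rule c0(3))
  have r2inf: "filterlim (\<lambda>n. (r n)^2) at_top sequentially" using rinf by (intro filterlim_pow_at_top) auto
  have ev1: "eventually (\<lambda>n. prob {\<omega>\<in>space M. \<exists>t\<in>J. \<bar>gap (nat \<lfloor>(r n)^2 * t\<rfloor>) \<omega>\<bar> \<ge> (2 / \<kappa> - 2 * \<beta>) * r n}
      \<le> N.prob {\<omega>\<in>space N. \<exists>t\<in>J. \<bar>V t \<omega>\<bar> > 2} + e / 2) sequentially"
    by (rule finite_dimensional_limits(2)[OF L cs J(1,2) r1 rinf _ \<beta>(2)]) (use e in auto)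
  \<comment> \<open>Rounding the mesh to an integer at most doubles it from here on.\<close>
  have ev2: "eventually (\<lambda>n. (r n)^2 * h \<ge> 1) sequentially"
    using filterlim_at_top_mult_tendsto_pos[OF tendsto_const h(1) r2inf] by (simp add: filterlim_at_top mult.commute)
  have Nle: "N.prob {\<omega>\<in>space N. \<exists>t\<in>J. \<bar>V t \<omega>\<bar> > 2} \<le> N.prob {\<omega>\<in>space N. exit_time V \<omega> \<le> ennreal u}"
  proof (rule N.finite_measure_mono)
    show "{\<omega>\<in>space N. \<exists>t\<in>J. \<bar>V t \<omega>\<bar> > 2} \<subseteq> {\<omega>\<in>space N. exit_time V \<omega> \<le> ennreal u}"
      using J(3) by (auto intro: exit_time_leI less_imp_le)
  qed measurable
  from ev1 ev2 have "eventually (\<lambda>n. prob {\<omega>\<in>space M. exit_index X1 X2 (n + c0) \<omega> / (of_nat (n + c0))\<^sup>2 \<le> ennreal t}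
      \<le> N.prob {\<omega>\<in>space N. exit_time V \<omega> \<le> ennreal u} + e) sequentially"
  proof eventually_elim
    case (elim n)
    have c1: "n + c0 \<ge> 1" using c0(1) by simp
    have r0: "r n > 0" using r1[of n] by linarith
    have lev: "2 / \<kappa> * r n = 2 * real (n + c0)" using \<kappa>0 by (simp add: r_def)
    have time: "(real (n + c0))^2 * t = (r n)^2 * u" using u0 by (simp add: r_def power_mult_distrib \<kappa>2)
    define m where "m i = nat \<lfloor>(r n)^2 * (h * real i)\<rfloor>" for i
    define l where "l = nat \<lceil>(r n)^2 * h\<rceil>"
    have m0: "m 0 = 0" by (simp add: m_def)
    have hq: "h * real q = u" by (rule h(2))
    have mq: "m q = nat \<lfloor>(real (n + c0))^2 * t\<rfloor>" unfolding m_def hq time ..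
    have m_mono: "m i \<le> m (Suc i)" for i
      unfolding m_def using h(1) by (intro nat_mono floor_mono mult_left_mono) auto
    have m_gap: "m (Suc i) \<le> m i + l" for i
    proof -
      have eq: "(r n)^2 * (h * real (Suc i)) = (r n)^2 * (h * real i) + (r n)^2 * h" by (simp add: algebra_simps)
      have "\<lfloor>(r n)^2 * (h * real (Suc i))\<rfloor> \<le> \<lfloor>(r n)^2 * (h * real i)\<rfloor> + \<lceil>(r n)^2 * h\<rceil>"
        unfolding eq by linarith
      moreover have "0 \<le> \<lfloor>(r n)^2 * (h * real i)\<rfloor>" "0 \<le> \<lceil>(r n)^2 * h\<rceil>"
        using h(1) by (simp_all add: less_le_trans[of "-1" 0])
      ultimately show ?thesis unfolding m_def l_def by linarith
    qed
    have l_le: "real l \<le> 2 * ((r n)^2 * h)"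
    proof -
      have "real l = of_int \<lceil>(r n)^2 * h\<rceil>" unfolding l_def using h(1) by simp
      also have "\<dots> \<le> (r n)^2 * h + 1" by linarith
      finally show ?thesis using elim(2) by linarith
    qed
    have mq_le: "real (m q) \<le> (r n)^2 * u" unfolding m_def hq using u0 by (intro of_nat_floor) auto
    have br: "\<beta> * r n > 0" using \<beta> r0 by simp
    have "prob {\<omega>\<in>space M. \<exists>k\<in>{1..m q}. \<bar>gap k \<omega>\<bar> \<ge> 2 / \<kappa> * r n} \<le>
       prob {\<omega>\<in>space M. \<exists>i\<in>{1..q}. \<bar>gap (m i) \<omega>\<bar> \<ge> 2 / \<kappa> * r n - 2 * (\<beta> * r n)} + 2 * real l / (\<beta> * r n)^2
       + 4 * Cd * sqrt (real l) * sqrt (real (m q)) / (\<beta> * r n)^2"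
      by (rule grid_detects_passage[where l=l, OF Cd m0 m_mono m_gap br])
    also have "2 * real l / (\<beta> * r n)^2 \<le> 4 * h / \<beta>^2"
    proof -
      have "2 * real l / (\<beta> * r n)^2 \<le> 2 * (2 * ((r n)^2 * h)) / (\<beta> * r n)^2"
        using l_le by (intro divide_right_mono mult_left_mono) simp_all
      also have "\<dots> = 4 * h / \<beta>^2" using r0 by (simp add: power_mult_distrib)
      finally show ?thesis .
    qed
    also have "4 * Cd * sqrt (real l) * sqrt (real (m q)) / (\<beta> * r n)^2 \<le> 4 * Cd * sqrt (2 * h * u) / \<beta>^2"
    proof -
      have "sqrt (real l) * sqrt (real (m q)) \<le> sqrt (2 * ((r n)^2 * h)) * sqrt ((r n)^2 * u)"
        using l_le mq_le by (intro mult_mono real_sqrt_le_mono) auto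
      also have "\<dots> = sqrt (2 * h * u * ((r n)^2)^2)"
        by (simp add: real_sqrt_mult[symmetric] power2_eq_square mult_ac)
      also have "\<dots> = sqrt (2 * h * u) * (r n)^2"
        by (simp only: real_sqrt_mult[of "2 * h * u"] real_sqrt_abs abs_power2)
      finally have "4 * Cd * (sqrt (real l) * sqrt (real (m q))) / (\<beta> * r n)^2 \<le> 4 * Cd * (sqrt (2 * h * u) * (r n)^2) / (\<beta> * r n)^2"
        using Cd(1) by (intro divide_right_mono mult_left_mono) auto
      also have "\<dots> = 4 * Cd * sqrt (2 * h * u) / \<beta>^2" using r0 by (simp add: power_mult_distrib)
      finally show ?thesis by (simp add: mult.assoc)
    qed
    finally have main: "prob {\<omega>\<in>space M. \<exists>k\<in>{1..m q}. \<bar>gap k \<omega>\<bar> \<ge> 2 / \<kappa> * r n} \<le>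
       prob {\<omega>\<in>space M. \<exists>i\<in>{1..q}. \<bar>gap (m i) \<omega>\<bar> \<ge> 2 / \<kappa> * r n - 2 * (\<beta> * r n)} + err h"
      by (simp add: err_def)
    have e1: "{\<omega>\<in>space M. \<exists>i\<in>{1..q}. \<bar>gap (m i) \<omega>\<bar> \<ge> 2 / \<kappa> * r n - 2 * (\<beta> * r n)}
       = {\<omega>\<in>space M. \<exists>t\<in>J. \<bar>gap (nat \<lfloor>(r n)^2 * t\<rfloor>) \<omega>\<bar> \<ge> (2 / \<kappa> - 2 * \<beta>) * r n}"
      unfolding J_def m_def by (simp add: left_diff_distrib mult.assoc)
    have e2: "{\<omega>\<in>space M. exit_index X1 X2 (n + c0) \<omega> / (of_nat (n + c0))\<^sup>2 \<le> ennreal t}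
       = {\<omega>\<in>space M. \<exists>k\<in>{1..m q}. \<bar>gap k \<omega>\<bar> \<ge> 2 / \<kappa> * r n}"
      unfolding exit_index_le_iff[OF c1 t(1)] mq lev ..
    show ?case using main elim(1) Nle h(3) unfolding e1 e2 by linarith
  qed
  then show ?thesis by (rule eventually_sequentially_seg[THEN iffD1])
qed

end

theorem proposition6p1:
  fixes M :: "'a measure" and N :: "'b measure"
    and p1 p2 \<alpha>1 \<alpha>2 :: real
    and \<xi>1 \<xi>2 X1 X2 :: "nat \<Rightarrow> 'a \<Rightarrow> int"
    and U1 U2 :: "nat \<Rightarrow> 'a \<Rightarrow> nat"
    and V :: "real \<Rightarrow> 'b \<Rightarrow> real"
  assumes "interacting_erw M p1 p2 \<xi>1 \<xi>2 U1 U2 X1 X2"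
    and "\<alpha>1 = 2 * p1 - 1" and "\<alpha>2 = 2 * p2 - 1"
    and "\<alpha>1 * \<alpha>2 < 1/4 \<or> (\<alpha>1 = \<alpha>2 \<and> \<alpha>1 \<in> {1/2..<1})"
    and "limit_process N \<alpha>1 \<alpha>2 V"
  shows "converges_in_distribution M
           (\<lambda>c \<omega>. exit_index X1 X2 c \<omega> / (of_nat c)\<^sup>2) N (exit_time V)"
proof -
  interpret interacting_erw M p1 p2 \<xi>1 \<xi>2 U1 U2 X1 X2 by fact
  have a: "\<alpha>1 = mem1" "\<alpha>2 = mem2" using assms(2,3) by (simp_all add: mem1_def mem2_def)
  note cs = assms(4)[unfolded a] and L = assms(5)[unfolded a]
  have N: "prob_space N" using L by (simp add: limit_process_def)
  have path: "V 0 \<omega> = 0 \<and> continuous_on {0..} (\<lambda>t. V t \<omega>)" if "\<omega> \<in> space N" for \<omega> using L that by (simp add: limit_process_def)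
  have Z: "exit_time V \<in> borel_measurable N"
    by (rule exit_time_measurable) (use L in \<open>simp_all add: limit_process_def\<close>)
  have Y: "(\<lambda>\<omega>. exit_index X1 X2 c \<omega> / (of_nat c)\<^sup>2) \<in> borel_measurable M" for c
    using exit_index_measurable[of c] by measurable
  have Y0: "exit_index X1 X2 c \<omega> / (of_nat c)\<^sup>2 \<noteq> 0" for c \<omega>
  proof -
    have "1 \<le> exit_index X1 X2 c \<omega>"
      unfolding exit_index_def by (rule Inf_greatest) auto
    then have "exit_index X1 X2 c \<omega> \<noteq> 0" by auto
    moreover have "(of_nat c :: ennreal)\<^sup>2 \<noteq> \<top>" by (simp add: ennreal_of_nat_eq_real_of_nat ennreal_power)
    ultimately show ?thesis by (simp add: ennreal_divide_eq_0_iff)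
  qed
  show ?thesis
    unfolding converges_in_distribution_def
  proof (intro conjI allI impI Y Z)
    fix f :: "ennreal \<Rightarrow> real" assume "continuous_on UNIV f \<and> bounded (range f)"
    then show "(\<lambda>c. \<integral>\<omega>. f (exit_index X1 X2 c \<omega> / (of_nat c)\<^sup>2) \<partial>M) \<longlonglongrightarrow> (\<integral>\<omega>. f (exit_time V \<omega>) \<partial>N)"
      by (intro ennreal_convergence_from_cdf[OF prob_space_axioms N Y Z Y0 _ passage_lower[OF L cs] passage_upper[OF L cs]] exit_time_pos)
         (use path in auto)
  qed
qed

end
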